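(* Let $F:C[0,\infty)\to[0,\infty]$ be a time-superinvariant functional that is measurable with respect to the $\sigma$-algebra on $C[0,\infty)$ generated by the evaluation maps, and let $X$ be a continuous martingale. Then $$\overline{\mathbb E}(F(X))\le\int F\,dW_{X_0},$$ where $F(X)$ denotes the functional $\omega\mapsto F(X(\omega))$, with $F(X(\omega)):=\infty$ when the path $X(\omega):t\mapsto X_t(\omega)$ is not in $C[0,\infty)$ (i.e., takes the value $\partial$), $X_0$ is the (constant) initial value of $X$, and $W_{X_0}$ is the law of Brownian motion started at $X_0$ (Wiener measure on $C[0,\infty)$).
   Context: Setup. Fix integers $1\le J^*\le J$; sample space $\Omega:=C[0,\infty)^J$ with elements $\omega=(S_1,\dots,S_J)$ of continuous functions $[0,\infty)\to\mathbb{R}$, the first $J^*$ being price paths of traded securities and the rest information paths; $\omega^*:=(S_1,\dots,S_{J^*})$; $\mathcal F$ is the $\sigma$-algebra generated by $\omega\mapsto\omega(t)$. A stopping time is an $\mathcal F$-measurable $\tau:\Omega\to[0,\infty]$ with $\omega|_{[0,\tau(\omega)]}=\omega'|_{[0,\tau(\omega)]}\Rightarrow\tau(\omega)=\tau(\omega')$; $h$ is $\tau$-measurable if that restriction equality implies $h(\omega)=h(\omega')$. A process is adapted if $\omega|_{[0,t]}=\omega'|_{[0,t]}\Rightarrow X_t(\omega)=X_t(\omega')$. A simple capital process is $\mathcal K_t(\omega)=c+\sum_{n\ge1}h_n(\omega)\cdot(\omega^*(\tau_{n+1}\wedge t)-\omega^*(\tau_n\wedge t))$ with $c\in\mathbb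 R$, stopping times $\tau_1\le\tau_2\le\cdots$, $\tau_n(\omega)\to\infty$ for all $\omega$, and bounded $\tau_n$-measurable $h_n:\Omega\to\mathbb R^{J^*}$. Nonnegative supermartingales: the smallest class of nonnegative processes containing all nonnegative simple capital processes and closed under pointwise $\liminf_k$ of sequences; their initial values $X_0$ are constants. A set $E\subseteq[0,\infty)\times\Omega$ holds quasi-always (q.a.) if some nonnegative supermartingale $X$ with $X_0=1$ has $X_t(\omega)=\infty$ for all $(t,\omega)\notin E$. With a cemetery symbol $\partial\notin\mathbb R$, a continuous process is an adapted $X:[0,\infty)\times\Omega\to\mathbb R\cup\{\partial\}$ such that $\mathrm{dom}\,X:=\{(t,\omega):X_t(\omega)\in\mathbb R\}$ holds q.a. and for each $\omega$ the set $\{t:X_t(\omega)\in\mathbb R\}$ contains $0$, is connected, and $X(\omega)$ is continuous on it. Continuous martingales: the smallest class $\mathcal C$ of continuous processes containing all simple capital processes and containing every continuous process $X$ for which there are $X^k\in\mathcal C$ with $\mathrm{dom}\,X\subseteq\mathrm{dom}\,X^k$ and $\sup_{s\in[0,t]}|X^k_s(\omega)-X_s(\omega)|\to0$ for all $(t,\omega)\in\mathrm{dom}\,X$. The upper expectation of $G:\Omega\to[0,\infty]$ is $\overline{\mathbb E}(G):=\inf\{X_0:\ X$ a nonnegative supermartingale with $\liminf_{t\to\infty}X_t(\omega)\ge G(\omega)$ for all $\omega\in\Omega\}$. A time transformation is a continuous increasing (not necessarily strictly) $f:[0,\infty)\to[0,\infty)$ with $f(0)=0$; $F$ is time-superinvariant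 if $F(\psi\circ f)\le F(\psi)$ for every path $\psi$ and every time transformation $f$. *)

theory Defs
  imports "HOL-Probability.Probability"
begin

text \<open>Paths: a function real => real that is continuous and constant on (-inf,0];
  this canonically represents an element of C[0,inf).\<close>
definition Cpaths :: "(real \<Rightarrow> real) set" where
  "Cpaths = {\<psi>. continuous_on UNIV \<psi> \<and> (\<forall>t\<le>0. \<psi> t = \<psi> 0)}"

definition Cspace :: "(real \<Rightarrow> real) measure" where
  "Cspace = sigma Cpaths {{\<psi>\<in>Cpaths. \<psi> t \<in> B} | t B. 0 \<le> t \<and> B \<in> sets borel}"

text \<open>Sample space Omega = C[0,inf)^J; components j >= J are fixed to 0 (normalisation).\<close>
definition Omega :: "nat \<Rightarrow> (nat \<Rightarrow> real \<Rightarrow> real) set" where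
  "Omega J = {\<omega>. (\<forall>j<J. \<omega> j \<in> Cpaths) \<and> (\<forall>j\<ge>J. \<omega> j = (\<lambda>_. 0))}"

definition Fsa :: "nat \<Rightarrow> (nat \<Rightarrow> real \<Rightarrow> real) measure" where
  "Fsa J = sigma (Omega J)
     {{\<omega>\<in>Omega J. \<omega> j t \<in> B} | j t B. j < J \<and> 0 \<le> t \<and> B \<in> sets borel}"

definition agree :: "nat \<Rightarrow> (nat \<Rightarrow> real \<Rightarrow> real) \<Rightarrow> (nat \<Rightarrow> real \<Rightarrow> real) \<Rightarrow> ennreal \<Rightarrow> bool" where
  "agree J \<omega> \<omega>' T \<longleftrightarrow> (\<forall>j<J. \<forall>s. 0 \<le> s \<and> ennreal s \<le> T \<longrightarrow> \<omega> j s = \<omega>' j s)"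

definition stopping_time :: "nat \<Rightarrow> ((nat \<Rightarrow> real \<Rightarrow> real) \<Rightarrow> ennreal) \<Rightarrow> bool" where
  "stopping_time J \<tau> \<longleftrightarrow> \<tau> \<in> borel_measurable (Fsa J) \<and>
     (\<forall>\<omega>\<in>Omega J. \<forall>\<omega>'\<in>Omega J. agree J \<omega> \<omega>' (\<tau> \<omega>) \<longrightarrow> \<tau> \<omega> = \<tau> \<omega>')"

definition tau_measurable :: "nat \<Rightarrow> ((nat \<Rightarrow> real \<Rightarrow> real) \<Rightarrow> ennreal) \<Rightarrow> ((nat \<Rightarrow> real \<Rightarrow> real) \<Rightarrow> 'b) \<Rightarrow> bool" where
  "tau_measurable J \<tau> h \<longleftrightarrow>
     (\<forall>\<omega>\<in>Omega J. \<forall>\<omega>'\<in>Omega J. agree J \<omega> \<omega>' (\<tau> \<omega>) \<longrightarrow> h \<omega> = h \<omega>')"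

definition stopt :: "((nat \<Rightarrow> real \<Rightarrow> real) \<Rightarrow> ennreal) \<Rightarrow> real \<Rightarrow> (nat \<Rightarrow> real \<Rightarrow> real) \<Rightarrow> real" where
  "stopt \<tau> t \<omega> = enn2real (min (\<tau> \<omega>) (ennreal t))"

text \<open>Simple capital processes; the sum over n >= 1 of the paper is indexed here from 0;
  h n omega is a vector in R^{J*} given by its coordinates j < Jstar.\<close>
definition simple_capital :: "nat \<Rightarrow> nat \<Rightarrow> (real \<Rightarrow> (nat \<Rightarrow> real \<Rightarrow> real) \<Rightarrow> real) \<Rightarrow> bool" where
  "simple_capital J Jstar K \<longleftrightarrow>
    (\<exists>(c::real) (\<tau>::nat \<Rightarrow> (nat \<Rightarrow> real \<Rightarrow> real) \<Rightarrow> ennreal)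
        (h::nat \<Rightarrow> (nat \<Rightarrow> real \<Rightarrow> real) \<Rightarrow> nat \<Rightarrow> real).
       (\<forall>n. stopping_time J (\<tau> n)) \<and>
       (\<forall>n. \<forall>\<omega>\<in>Omega J. \<tau> n \<omega> \<le> \<tau> (Suc n) \<omega>) \<and>
       (\<forall>\<omega>\<in>Omega J. ((\<lambda>n. \<tau> n \<omega>) \<longlongrightarrow> \<infinity>) sequentially) \<and>
       (\<forall>n. tau_measurable J (\<tau> n) (h n)) \<and>
       (\<forall>n. \<exists>B. \<forall>\<omega>\<in>Omega J. \<forall>j<Jstar. \<bar>h n \<omega> j\<bar> \<le> B) \<and>
       K = (\<lambda>t \<omega>. c + (\<Sum>n. \<Sum>j<Jstar.
              h n \<omega> j * (\<omega> j (stopt (\<tau> (Suc n)) t \<omega>) - \<omega> j (stopt (\<tau> n) t \<omega>)))))"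

text \<open>Nonnegative supermartingales (values in [0,inf]); only values for t >= 0 and
  omega in Omega J are meaningful.\<close>
inductive_set nn_supermart :: "nat \<Rightarrow> nat \<Rightarrow> (real \<Rightarrow> (nat \<Rightarrow> real \<Rightarrow> real) \<Rightarrow> ennreal) set"
  for J Jstar where
  simple: "simple_capital J Jstar K \<Longrightarrow> (\<forall>t\<ge>0. \<forall>\<omega>\<in>Omega J. 0 \<le> K t \<omega>) \<Longrightarrow>
             (\<lambda>t \<omega>. ennreal (K t \<omega>)) \<in> nn_supermart J Jstar"
| liminf: "(\<And>k. Xs k \<in> nn_supermart J Jstar) \<Longrightarrow>
             (\<lambda>t \<omega>. liminf (\<lambda>k. Xs k t \<omega>)) \<in> nn_supermart J Jstar"

definition quasi_always :: "nat \<Rightarrow> nat \<Rightarrow> (real \<times> (nat \<Rightarrow> real \<Rightarrow> real)) set \<Rightarrow> bool" where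
  "quasi_always J Jstar E \<longleftrightarrow>
     (\<exists>X\<in>nn_supermart J Jstar. (\<forall>\<omega>\<in>Omega J. X 0 \<omega> = 1) \<and>
        (\<forall>t\<ge>0. \<forall>\<omega>\<in>Omega J. (t, \<omega>) \<notin> E \<longrightarrow> X t \<omega> = \<infinity>))"

text \<open>Processes with values in R \<union> {cemetery}: None plays the role of the cemetery.\<close>
definition pdom :: "nat \<Rightarrow> (real \<Rightarrow> (nat \<Rightarrow> real \<Rightarrow> real) \<Rightarrow> real option) \<Rightarrow> (real \<times> (nat \<Rightarrow> real \<Rightarrow> real)) set" where
  "pdom J X = {(t, \<omega>). 0 \<le> t \<and> \<omega> \<in> Omega J \<and> X t \<omega> \<noteq> None}"

definition cont_process :: "nat \<Rightarrow> nat \<Rightarrow> (real \<Rightarrow> (nat \<Rightarrow> real \<Rightarrow> real) \<Rightarrow> real option) \<Rightarrow> bool" where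
  "cont_process J Jstar X \<longleftrightarrow>
     (\<forall>t\<ge>0. \<forall>\<omega>\<in>Omega J. \<forall>\<omega>'\<in>Omega J. agree J \<omega> \<omega>' (ennreal t) \<longrightarrow> X t \<omega> = X t \<omega>') \<and>
     quasi_always J Jstar (pdom J X) \<and>
     (\<forall>\<omega>\<in>Omega J. 0 \<in> {t. 0 \<le> t \<and> X t \<omega> \<noteq> None} \<and>
        connected {t. 0 \<le> t \<and> X t \<omega> \<noteq> None} \<and>
        continuous_on {t. 0 \<le> t \<and> X t \<omega> \<noteq> None} (\<lambda>t. the (X t \<omega>)))"

inductive_set cont_martingales :: "nat \<Rightarrow> nat \<Rightarrow> (real \<Rightarrow> (nat \<Rightarrow> real \<Rightarrow> real) \<Rightarrow> real option) set"
  for J Jstar where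
  simple: "simple_capital J Jstar K \<Longrightarrow> (\<lambda>t \<omega>. Some (K t \<omega>)) \<in> cont_martingales J Jstar"
| limit: "cont_process J Jstar X \<Longrightarrow> (\<And>k. Xs k \<in> cont_martingales J Jstar) \<Longrightarrow>
           (\<And>k. pdom J X \<subseteq> pdom J (Xs k)) \<Longrightarrow>
           (\<And>t \<omega>. (t, \<omega>) \<in> pdom J X \<Longrightarrow>
              ((\<lambda>k. Sup ((\<lambda>s. \<bar>the (Xs k s \<omega>) - the (X s \<omega>)\<bar>) ` {0..t})) \<longlongrightarrow> 0) sequentially) \<Longrightarrow>
           X \<in> cont_martingales J Jstar"

definition upper_expectation :: "nat \<Rightarrow> nat \<Rightarrow> ((nat \<Rightarrow> real \<Rightarrow> real) \<Rightarrow> ennreal) \<Rightarrow> ennreal" where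
  "upper_expectation J Jstar G =
     Inf {c. \<exists>X\<in>nn_supermart J Jstar. (\<forall>\<omega>\<in>Omega J. X 0 \<omega> = c) \<and>
              (\<forall>\<omega>\<in>Omega J. G \<omega> \<le> Liminf at_top (\<lambda>t::real. X t \<omega>))}"

definition time_transformation :: "(real \<Rightarrow> real) \<Rightarrow> bool" where
  "time_transformation f \<longleftrightarrow> continuous_on {0..} f \<and> mono_on {0..} f \<and> f 0 = 0 \<and>
     (\<forall>t\<ge>0. 0 \<le> f t)"

text \<open>psi o f, as an element of Cpaths (time transformation extended by 0 on negative times).\<close>
definition time_change :: "(real \<Rightarrow> real) \<Rightarrow> (real \<Rightarrow> real) \<Rightarrow> (real \<Rightarrow> real)" where
  "time_change \<psi> f = (\<lambda>t. \<psi> (f (max t 0)))"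

definition time_superinvariant :: "((real \<Rightarrow> real) \<Rightarrow> ennreal) \<Rightarrow> bool" where
  "time_superinvariant F \<longleftrightarrow>
     (\<forall>\<psi>\<in>Cpaths. \<forall>f. time_transformation f \<longrightarrow> F (time_change \<psi> f) \<le> F \<psi>)"

definition wiener_measure :: "real \<Rightarrow> (real \<Rightarrow> real) measure \<Rightarrow> bool" where
  "wiener_measure x W \<longleftrightarrow> prob_space W \<and> sets W = sets Cspace \<and>
     (AE \<psi> in W. \<psi> 0 = x) \<and>
     (\<forall>s t. 0 \<le> s \<and> s < t \<longrightarrow>
        distributed W lborel (\<lambda>\<psi>. \<psi> t - \<psi> s) (\<lambda>y. ennreal (normal_density 0 (sqrt (t - s)) y))) \<and>
     (\<forall>(tt::nat \<Rightarrow> real) n. 0 \<le> tt 0 \<and> (\<forall>i<n. tt i < tt (Suc i)) \<longrightarrow>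
        prob_space.indep_vars W (\<lambda>_. borel) (\<lambda>i \<psi>. \<psi> (tt (Suc i)) - \<psi> (tt i)) {..<n})"

text \<open>Path omega |-> X(omega) as an element of Cpaths (if it never hits the cemetery).\<close>
definition path_of :: "(real \<Rightarrow> (nat \<Rightarrow> real \<Rightarrow> real) \<Rightarrow> real option) \<Rightarrow> (nat \<Rightarrow> real \<Rightarrow> real) \<Rightarrow> real \<Rightarrow> real" where
  "path_of X \<omega> = (\<lambda>t. the (X (max t 0) \<omega>))"

definition apply_functional :: "((real \<Rightarrow> real) \<Rightarrow> ennreal) \<Rightarrow> (real \<Rightarrow> (nat \<Rightarrow> real \<Rightarrow> real) \<Rightarrow> real option) \<Rightarrow> (nat \<Rightarrow> real \<Rightarrow> real) \<Rightarrow> ennreal" where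
  "apply_functional F X \<omega> = (if \<forall>t\<ge>0. X t \<omega> \<noteq> None then F (path_of X \<omega>) else \<infinity>)"

text \<open>Initial value X_0 (a constant for continuous martingales).\<close>
definition init_value :: "nat \<Rightarrow> (real \<Rightarrow> (nat \<Rightarrow> real \<Rightarrow> real) \<Rightarrow> real option) \<Rightarrow> real" where
  "init_value J X = the (X 0 (SOME \<omega>. \<omega> \<in> Omega J))"

end

theory Submission
  imports Defs
begin

text \<open>The whole argument trades on the successive times at which X has moved by a dyadic mesh. A bet
  on a finite pattern of up and down moves of X has initial value 2 to the minus its length, doubles at every
  correctly predicted move and is lost at the first wrong one; Brownian motion realises the
  pattern with exactly that probability. Since hedges of X need not have measurable positions,
  they are discretised along a fine crossing grid of the price paths, which supplies genuine
  stopping times and locally constant positions, and halted before ruin; the resulting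
  superhedging property passes to limits of martingales by superadditivity of the lower limit.

  For unbounded paths, Morse's order-free length serves as a clock, and running a path by it
  yields a time-invariant normal form N(phi) that depends continuously on the crossing pattern.
  By superinvariance F(phi) is at most F(N(phi)), with equality for Brownian paths, so outer
  regularity covers the level sets of F o N by pattern bets whose total price exceeds the Wiener integral of F
  by arbitrarily little. Bounded paths that cross some mesh infinitely often are covered at no
  cost. Any other total path converges; squeezed into the time interval [0,1) it can be
  continued by a Brownian motion, and averaging the bets over the continuation gives their value
  on the path itself. Explosions are paid for by the process witnessing that X is quasi-always
  finite.\<close>

section \<open>Crossing times\<close>

text \<open>The class \<open>nn_supermart\<close> is known only through its generators, and closure
  under addition is not evident, as a lower limit of sums may exceed the sum of lower limits. Hence
  every hedge is stated together with an arbitrary supermartingale \<open>Y\<close> that it must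
  carry along. Processes are really added at one place only, on a common price grid, where both
  summands share their stopping times.

  \<open>F\<close> is merely measurable, and it sees the speed of a path, whereas a countable
  portfolio of bets pays on unions of code cells and is blind to speed. Passing to F o N removes
  this mismatch: N is continuous in the codes, so level sets of F o N lie in the sigma-algebra
  generated by the cells. A code at level n has mesh 2^-n and ends at distance n from the start;
  this makes it a finite word, hence one bet, and the horizon grows by 1 per level since a mesh of
  at most 1 could otherwise spoil the nesting of cells.

  Wiener measure enters the pricing through one quantity, the probability that a given path
  continued by Brownian increments wins a bet: continued from time 0 it is the price of the bet,
  continued from time 1 it is the value reached along a squeezed convergent path.\<close>

primrec cross :: "real set \<Rightarrow> real \<Rightarrow> (real \<Rightarrow> real \<Rightarrow> real) \<Rightarrow> nat \<Rightarrow> ennreal" where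
  "cross D \<delta> q 0 = 0"
| "cross D \<delta> q (Suc k) = (if cross D \<delta> q k = \<infinity> then \<infinity> else
     Inf (ennreal ` {t\<in>D. enn2real (cross D \<delta> q k) \<le> t \<and> \<delta> \<le> q (enn2real (cross D \<delta> q k)) t}))"

declare cross.simps(2) [simp del]

lemma cross_SucI:
  assumes "cross D \<delta> q k = ennreal r" "0 \<le> r" "t \<in> D" "r \<le> t" "\<delta> \<le> q r t"
    "\<And>s. r \<le> s \<Longrightarrow> s < t \<Longrightarrow> q r s < \<delta>"
  shows "cross D \<delta> q (Suc k) = ennreal t"
proof -
  have "Inf (ennreal ` {t\<in>D. r \<le> t \<and> \<delta> \<le> q r t}) = ennreal t"
  proof (rule antisym)
    show "Inf (ennreal ` {t\<in>D. r \<le> t \<and> \<delta> \<le> q r t}) \<le> ennreal t"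
      using assms by (intro Inf_lower) auto
    show "ennreal t \<le> Inf (ennreal ` {t\<in>D. r \<le> t \<and> \<delta> \<le> q r t})"
    proof (rule Inf_greatest, clarsimp)
      fix u assume u: "u \<in> D" "r \<le> u" "\<delta> \<le> q r u"
      then have "t \<le> u" using assms(6)[of u] by force
      then show "ennreal t \<le> ennreal u" by (rule ennreal_leI)
    qed
  qed
  then show ?thesis using assms(1,2) by (simp add: cross.simps(2))
qed

text \<open>A sequence that meets the first-passage conditions step by step can only be the sequence
  of crossing times. Crossing times are identified in this way whenever the path or its time scale
  is changed.\<close>

lemma cross_eqI:
  fixes t :: "nat \<Rightarrow> real"
  assumes "t 0 = 0"
    and "\<And>i. i < k \<Longrightarrow> t (Suc i) \<in> D \<and> t i \<le> t (Suc i) \<and> \<delta> \<le> q (t i) (t (Suc i))"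
    and "\<And>i s. i < k \<Longrightarrow> t i \<le> s \<Longrightarrow> s < t (Suc i) \<Longrightarrow> q (t i) s < \<delta>"
  shows "i \<le> k \<Longrightarrow> cross D \<delta> q i = ennreal (t i) \<and> 0 \<le> t i"
proof (induction i)
  case 0 then show ?case using assms(1) by simp
next
  case (Suc i)
  then have "cross D \<delta> q i = ennreal (t i)" "0 \<le> t i" by auto
  moreover have "i < k" using Suc.prems by simp
  note assms(2)[OF this] assms(3)[OF this]
  ultimately show ?case using cross_SucI[of D \<delta> q i "t i" "t (Suc i)"] by auto
qed

text \<open>The displacement \<open>q r t\<close> from a reference time \<open>r\<close> stays
  abstract because it is used both for the summed increments of several price paths and for the
  absolute increment of a single path. \<open>D\<close> is an initial piece of the half-line and may
  be a proper one, since a martingale can explode.\<close>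

locale crossing =
  fixes D :: "real set" and \<delta> :: real and q :: "real \<Rightarrow> real \<Rightarrow> real"
  assumes pos: "0 < \<delta>" and D0: "0 \<in> D" and Dpos: "\<And>t. t \<in> D \<Longrightarrow> 0 \<le> t"
    and Ddown: "\<And>s t. t \<in> D \<Longrightarrow> 0 \<le> s \<Longrightarrow> s \<le> t \<Longrightarrow> s \<in> D"
    and qdiag: "\<And>r. q r r = 0" and qcont: "\<And>r. r \<in> D \<Longrightarrow> continuous_on D (q r)"
begin

abbreviation "T \<equiv> cross D \<delta> q"
abbreviation "\<tau> k \<equiv> enn2real (T k)"

text \<open>The set of times at which the displacement is at least \<open>\<delta>\<close> is closed
  on a compact initial piece, so the infimum in \<open>cross\<close> is attained.\<close>

lemma step:
  assumes r: "T k = ennreal r" "r \<in> D"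
  shows "(T (Suc k) = \<infinity> \<and> (\<forall>t\<in>D. r \<le> t \<longrightarrow> q r t < \<delta>)) \<or>
    (\<exists>t\<in>D. r < t \<and> T (Suc k) = ennreal t \<and> q r t = \<delta> \<and> (\<forall>s. r \<le> s \<and> s < t \<longrightarrow> q r s < \<delta>))"
proof -
  define A where "A = {t\<in>D. r \<le> t \<and> \<delta> \<le> q r t}"
  have r0: "0 \<le> r" using Dpos r(2) .
  show ?thesis
  proof (cases "A = {}")
    case True
    then have "T (Suc k) = \<infinity>" using r r0 unfolding A_def by (simp add: cross.simps(2))
    with True show ?thesis unfolding A_def by force
  next
    case False
    then obtain t0 where t0: "t0 \<in> A" by auto
    have I: "{r..t0} \<subseteq> D" using t0 r0 Ddown unfolding A_def by auto
    have c: "continuous_on {r..t0} (q r)" using qcont[OF r(2)] I continuous_on_subset by blast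
    define A' where "A' = {t\<in>{r..t0}. q r t \<in> {\<delta>..}}"
    have "closed A'" unfolding A'_def
      using continuous_closed_preimage[OF c, of "{\<delta>..}"] by (simp add: vimage_def Int_def)
    moreover have "A' \<noteq> {}" "bdd_below A'" using t0 unfolding A'_def A_def by auto
    ultimately have inA: "Inf A' \<in> A'" by (intro closed_contains_Inf)
    define t where "t = Inf A'"
    have t: "r \<le> t" "t \<le> t0" "\<delta> \<le> q r t" "t \<in> D" using inA I unfolding t_def A'_def by auto
    have lt: "q r s < \<delta>" if "r \<le> s" "s < t" for s
    proof (rule ccontr)
      assume "\<not> q r s < \<delta>"
      then have "s \<in> A'" using that t unfolding A'_def by auto
      then have "t \<le> s" unfolding t_def using \<open>bdd_below A'\<close> by (intro cInf_lower)
      with that show False by simp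
    qed
    have rt: "r < t" using t qdiag[of r] pos by (cases "r = t") auto
    \<comment> \<open>No overshoot: the displacement starts at 0, so by the intermediate value
      theorem a value above \<open>\<delta>\<close> would be preceded by the value
      \<open>\<delta>\<close>.\<close>
    have "q r t \<le> \<delta>"
    proof (rule ccontr)
      assume n: "\<not> q r t \<le> \<delta>"
      have "continuous_on {r..t} (q r)" using c t by (meson continuous_on_subset atLeastatMost_subset_iff order_refl)
      from IVT'[of "q r" r \<delta> t, OF _ _ _ this] n qdiag[of r] pos t obtain s where "r \<le> s" "s \<le> t" "q r s = \<delta>" by auto
      then show False using lt[of s] n by (cases "s = t") auto
    qed
    then have "q r t = \<delta>" using t by simp
    moreover have "T (Suc k) = ennreal t" using cross_SucI[of D \<delta> q k r t] r r0 t lt by auto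
    ultimately show ?thesis using t rt lt by blast
  qed
qed

lemma finite_cases: "T k = \<infinity> \<or> (\<exists>t\<in>D. T k = ennreal t)"
proof (induction k)
  case 0 then show ?case using D0 by (auto intro: bexI[of _ 0])
next
  case (Suc k) then show ?case
  proof
    assume "T k = \<infinity>" then show ?thesis by (simp add: cross.simps(2))
  next
    assume "\<exists>t\<in>D. T k = ennreal t"
    then obtain t where "t \<in> D" "T k = ennreal t" by auto
    from step[OF this(2,1)] show ?thesis by blast
  qed
qed

lemma fin: assumes "T k \<noteq> \<infinity>" shows "\<tau> k \<in> D" "T k = ennreal (\<tau> k)" "0 \<le> \<tau> k"
proof -
  obtain t where "t \<in> D" "T k = ennreal t" using finite_cases[of k] assms by auto
  with Dpos[of t] show "\<tau> k \<in> D" "T k = ennreal (\<tau> k)" "0 \<le> \<tau> k" by auto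
qed

lemma mono_Suc: "T k \<le> T (Suc k)"
proof (cases "T k = \<infinity>")
  case True then show ?thesis by (simp add: cross.simps(2))
next
  case False
  then show ?thesis using step[OF fin(2,1), of k]
    by (metis fin(2) ennreal_leI less_imp_le top_greatest infinity_ennreal_def)
qed

lemma mono: "i \<le> k \<Longrightarrow> T i \<le> T k"
  by (rule lift_Suc_mono_le[of T, OF mono_Suc])

lemma fin_le: "T k \<noteq> \<infinity> \<Longrightarrow> i \<le> k \<Longrightarrow> T i \<noteq> \<infinity>"
  using mono[of i k] by (metis infinity_ennreal_def neq_top_trans)

lemma \<tau>_step:
  assumes "T (Suc k) \<noteq> \<infinity>"
  shows "\<tau> k < \<tau> (Suc k)" "q (\<tau> k) (\<tau> (Suc k)) = \<delta>"
    "\<And>s. \<tau> k \<le> s \<Longrightarrow> s < \<tau> (Suc k) \<Longrightarrow> q (\<tau> k) s < \<delta>"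
proof -
  have f: "T k \<noteq> \<infinity>" using assms fin_le[of "Suc k" k] by simp
  have "\<tau> k < \<tau> (Suc k) \<and> q (\<tau> k) (\<tau> (Suc k)) = \<delta> \<and> (\<forall>s. \<tau> k \<le> s \<and> s < \<tau> (Suc k) \<longrightarrow> q (\<tau> k) s < \<delta>)"
    using step[OF fin(2,1)[OF f]] assms Dpos by (auto)
  then show "\<tau> k < \<tau> (Suc k)" "q (\<tau> k) (\<tau> (Suc k)) = \<delta>"
    "\<And>s. \<tau> k \<le> s \<Longrightarrow> s < \<tau> (Suc k) \<Longrightarrow> q (\<tau> k) s < \<delta>" by auto
qed

lemma \<tau>_last:
  assumes "T k \<noteq> \<infinity>" "s \<in> D" "\<tau> k \<le> s" "ennreal s < T (Suc k)"
  shows "q (\<tau> k) s < \<delta>"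
proof (cases "T (Suc k) = \<infinity>")
  case True then show ?thesis using step[OF fin(2,1)[OF assms(1)]] assms by (auto)
next
  case False
  then have "s < \<tau> (Suc k)" using assms(4) fin[OF False] Dpos[OF assms(2)]
    by (metis ennreal_less_iff)
  then show ?thesis using \<tau>_step(3)[OF False assms(3)] by simp
qed

lemma osc_le:
  assumes "T k \<noteq> \<infinity>" "s \<in> D" "\<tau> k \<le> s" "ennreal s \<le> T (Suc k)"
  shows "q (\<tau> k) s \<le> \<delta>"
proof (cases "ennreal s < T (Suc k)")
  case True then show ?thesis using \<tau>_last[OF assms(1-3)] by simp
next
  case False
  then have e: "T (Suc k) = ennreal s" using assms(4) by simp
  then have "\<tau> (Suc k) = s" using Dpos[OF assms(2)] by simp
  then show ?thesis using \<tau>_step(2)[of k] e by simp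
qed

lemma le_iff: "t \<in> D \<Longrightarrow> T k \<le> ennreal t \<longleftrightarrow> T k \<noteq> \<infinity> \<and> \<tau> k \<le> t"
  using fin[of k] Dpos[of t]
  by (metis ennreal_le_iff infinity_ennreal_def ennreal_neq_top neq_top_trans)

text \<open>A crossing time reads the path only up to itself, which is why it is nonanticipating. An
  infinite crossing time has read everything, so in that case agreement on the whole domain is
  demanded.\<close>

lemma cross_local:
  assumes "T k = \<infinity> \<longrightarrow> (D' = D \<and> (\<forall>r\<in>D. \<forall>t\<in>D. q' r t = q r t))"
    and "\<And>t. 0 \<le> t \<Longrightarrow> T k = ennreal t \<Longrightarrow> t \<in> D' \<and> (\<forall>s. 0 \<le> s \<and> s \<le> t \<longrightarrow> (s \<in> D' \<longleftrightarrow> s \<in> D)) \<and> (\<forall>r s. 0 \<le> r \<and> r \<le> s \<and> s \<le> t \<longrightarrow> q' r s = q r s)"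
  shows "cross D' \<delta> q' k = T k"
proof (cases "T k = \<infinity>")
  case True
  then have e: "D' = D" "\<forall>r\<in>D. \<forall>t\<in>D. q' r t = q r t" using assms(1) by auto
  show ?thesis unfolding e(1)
  proof (induction k)
    case 0 show ?case by simp
  next
    case (Suc k)
    show ?case
    proof (cases "T k = \<infinity>")
      case True with Suc show ?thesis by (simp add: cross.simps(2))
    next
      case False
      have "{t\<in>D. \<tau> k \<le> t \<and> \<delta> \<le> q' (\<tau> k) t} = {t\<in>D. \<tau> k \<le> t \<and> \<delta> \<le> q (\<tau> k) t}"
        using e(2) fin[OF False] by auto
      with Suc show ?thesis by (simp add: cross.simps(2))
    qed
  qed
next
  case False
  define u where "u = \<tau> k"
  have u: "T k = ennreal u" "u \<in> D" "0 \<le> u" using fin[OF False] unfolding u_def by auto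
  note a = assms(2)[OF u(3,1)]
  have le: "\<tau> i \<le> u" if "i \<le> k" for i
    using mono[OF that] fin[OF fin_le[OF False that]] u le_iff by simp
  have "cross D' \<delta> q' k = ennreal (\<tau> k) \<and> 0 \<le> \<tau> k"
  proof (rule cross_eqI[where t = \<tau> and k = k])
    fix i assume i: "i < k"
    have fi: "T (Suc i) \<noteq> \<infinity>" using fin_le[OF False, of "Suc i"] i by simp
    have l: "\<tau> (Suc i) \<le> u" "\<tau> i \<le> u" using le i by auto
    have p: "0 \<le> \<tau> i" "0 \<le> \<tau> (Suc i)" by simp_all
    show "\<tau> (Suc i) \<in> D' \<and> \<tau> i \<le> \<tau> (Suc i) \<and> \<delta> \<le> q' (\<tau> i) (\<tau> (Suc i))"
      using \<tau>_step[OF fi] fin(1)[OF fi] a l p by (auto)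
    fix s assume s: "\<tau> i \<le> s" "s < \<tau> (Suc i)"
    then show "q' (\<tau> i) s < \<delta>" using \<tau>_step(3)[OF fi s] a l p by (auto)
  qed simp_all
  then show ?thesis using fin(2)[OF False] by simp
qed

text \<open>Every crossing takes at least the modulus \<open>e\<close>, so \<open>k\<close>
  crossings need time \<open>k * e\<close>.\<close>

lemma unbounded:
  assumes unif: "\<exists>e>0. \<forall>r t. 0 \<le> r \<and> r \<le> t \<and> t \<le> u \<and> t - r < e \<longrightarrow> q r t < \<delta>"
  shows "\<exists>k. ennreal u < T k"
proof (rule ccontr)
  assume n: "\<not> ?thesis"
  then have le: "T k \<le> ennreal u" for k by (simp add: not_less)
  then have f: "T k \<noteq> \<infinity>" for k by (metis ennreal_neq_top infinity_ennreal_def neq_top_trans)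
  have u0: "0 \<le> u" if "0 < T 1" using le[of 1] that by (metis ennreal_neg leD linear)
  have u0: "0 \<le> u" using \<tau>_step(1)[of 0] f[of 1] le[of 1] u0 fin(2)[OF f, of 1]
    by (metis One_nat_def cross.simps(1) enn2real_0 ennreal_less_zero_iff gr_zeroI less_numeral_extra(3))
  have lt: "\<tau> k \<le> u" for k using le[of k] fin[OF f, of k] u0 by (metis ennreal_le_iff)
  obtain e where e: "e > 0" "\<And>r t. 0 \<le> r \<Longrightarrow> r \<le> t \<Longrightarrow> t \<le> u \<Longrightarrow> t - r < e \<Longrightarrow> q r t < \<delta>"
    using unif by auto
  have "real k * e \<le> \<tau> k" for k
  proof (induction k)
    case (Suc k)
    have "e \<le> \<tau> (Suc k) - \<tau> k"
      using e(2)[of "\<tau> k" "\<tau> (Suc k)"] \<tau>_step[OF f, of k] lt[of "Suc k"] fin(3)[OF f, of k]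
      by fastforce
    with Suc show ?case by (simp add: algebra_simps)
  qed simp
  moreover obtain k where "u < real k * e" using e(1) by (metis reals_Archimedean3)
  ultimately show False using lt[of k] by (meson leD le_less_trans)
qed

end

text \<open>The cells whose left end lies in [a,b) telescope between the first grid points at or
  after \<open>a\<close> and \<open>b\<close>. Such a grid point shares a cell with the true end
  point, so the two values of \<open>f\<close> differ by at most 2 \<open>\<eta>\<close>; two end
  points give the constant 4. The same estimate serves the discretisation of strategies and the
  Riemann sums of bets.\<close>

lemma grid_sum:
  fixes r :: "nat \<Rightarrow> real" and f :: "real \<Rightarrow> real"
  assumes mono: "\<And>i. i < n \<Longrightarrow> r i \<le> r (Suc i)" and ab: "r 0 \<le> a" "a \<le> b" "b \<le> r n" and \<eta>: "0 \<le> \<eta>"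
    and osc: "\<And>i s. i < n \<Longrightarrow> r i \<le> s \<Longrightarrow> s \<le> r (Suc i) \<Longrightarrow> \<bar>f s - f (r i)\<bar> \<le> \<eta>"
  shows "\<bar>(\<Sum>i<n. if a \<le> r i \<and> r i < b then f (r (Suc i)) - f (r i) else 0) - (f b - f a)\<bar> \<le> 4 * \<eta>"
proof -
  have rm: "r i \<le> r j" if "i \<le> j" "j \<le> n" for i j
    using that
  proof (induction j)
    case (Suc j)
    show ?case
    proof (cases "i = Suc j")
      case False
      then have "r i \<le> r j" using Suc by simp
      also have "\<dots> \<le> r (Suc j)" using mono[of j] Suc.prems by simp
      finally show ?thesis .
    qed simp
  qed simp
  define L where "L c = (LEAST i. c \<le> r i)" for c
  have L: "L c \<le> n" "c \<le> r (L c)" "\<And>i. i < L c \<Longrightarrow> r i < c" if "c \<le> r n" for c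
  proof -
    show "L c \<le> n" "c \<le> r (L c)" using that unfolding L_def by (auto intro: Least_le LeastI)
    show "r i < c" if "i < L c" for i using that not_less_Least[of i "\<lambda>i. c \<le> r i"] unfolding L_def by (simp add: not_le)
  qed
  have Lf: "\<bar>f (r (L c)) - f c\<bar> \<le> 2 * \<eta>" if "r 0 \<le> c" "c \<le> r n" for c
  proof (cases "L c")
    case 0 then show ?thesis using L(2)[OF that(2)] that(1) \<eta> by simp
  next
    case (Suc i)
    have i: "i < n" "r i < c" "c \<le> r (Suc i)" using L[OF that(2)] Suc by auto
    have "\<bar>f (r (Suc i)) - f (r i)\<bar> \<le> \<eta>" "\<bar>f c - f (r i)\<bar> \<le> \<eta>"
      using osc[OF i(1), of "r (Suc i)"] osc[OF i(1), of c] i mono[OF i(1)] by auto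
    then show ?thesis unfolding Suc by linarith
  qed
  have a: "a \<le> r n" using ab by simp
  have LL: "L a \<le> L b" using L[OF a] L[OF ab(3)] ab by (meson leI le_less_trans less_le_not_le)
  have "(\<Sum>i<n. if a \<le> r i \<and> r i < b then f (r (Suc i)) - f (r i) else 0)
      = (\<Sum>i\<in>{..<n}. if i \<in> {L a..<L b} then f (r (Suc i)) - f (r i) else 0)"
  proof (rule sum.cong[OF refl])
    fix i assume i: "i \<in> {..<n}"
    have "a \<le> r i \<longleftrightarrow> L a \<le> i" using L[OF a] rm[of "L a" i] i by (metis lessThan_iff less_imp_le_nat linorder_not_le order_trans)
    moreover have "b \<le> r i \<longleftrightarrow> L b \<le> i" using L[OF ab(3)] rm[of "L b" i] i by (metis lessThan_iff less_imp_le_nat linorder_not_le order_trans)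
    ultimately show "(if a \<le> r i \<and> r i < b then f (r (Suc i)) - f (r i) else 0) = (if i \<in> {L a..<L b} then f (r (Suc i)) - f (r i) else 0)"
      by (auto simp: not_le[symmetric])
  qed
  also have "\<dots> = (\<Sum>i\<in>{L a..<L b}. f (r (Suc i)) - f (r i))"
    using L(1)[OF ab(3)] by (subst sum.inter_restrict[symmetric]) (auto intro!: sum.cong)
  also have "\<dots> = f (r (L b)) - f (r (L a))" using sum_Suc_diff'[OF LL, of "\<lambda>i. f (r i)"] by simp
  finally show ?thesis using Lf[of a] Lf[of b] ab a by simp
qed

section \<open>Measurability of crossing times\<close>

text \<open>The random time is rounded up to a multiple of 1/(n+1). With countably many values the
  evaluation is measurable piece by piece, and continuity of the path passes it to the
  limit.\<close>

lemma eval_measurable: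
  fixes Y :: "'a \<Rightarrow> real \<Rightarrow> real"
  assumes m: "\<And>t. 0 \<le> t \<Longrightarrow> (\<lambda>x. Y x t) \<in> borel_measurable M"
    and c: "\<And>x. x \<in> space M \<Longrightarrow> continuous_on {0..} (Y x)"
    and r: "r \<in> borel_measurable M" "\<And>x. x \<in> space M \<Longrightarrow> 0 \<le> r x"
  shows "(\<lambda>x. Y x (r x)) \<in> borel_measurable M"
proof -
  define u where "u n x = real (nat \<lceil>r x * real (Suc n)\<rceil>) / real (Suc n)" for n x
  have u: "(\<lambda>n. u n x) \<longlonglongrightarrow> r x" if "x \<in> space M" for x
  proof (rule real_tendsto_sandwich[OF _ _ tendsto_const])
    have *: "r x * real (Suc n) \<le> real (nat \<lceil>r x * real (Suc n)\<rceil>)" 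
       "real (nat \<lceil>r x * real (Suc n)\<rceil>) \<le> r x * real (Suc n) + 1" for n
      using r(2)[OF that] by (auto simp: of_nat_ceiling)
    show "\<forall>\<^sub>F n in sequentially. r x \<le> u n x" unfolding u_def
      using *(1) by (intro always_eventually allI) (simp add: pos_le_divide_eq del: of_nat_Suc)
    show "\<forall>\<^sub>F n in sequentially. u n x \<le> r x + inverse (real (Suc n))" unfolding u_def
      using *(2) by (intro always_eventually allI) (simp add: pos_divide_le_eq distrib_right del: of_nat_Suc)
    show "(\<lambda>n. r x + inverse (real (Suc n))) \<longlonglongrightarrow> r x"
      using tendsto_add[OF tendsto_const[of "r x"] LIMSEQ_inverse_real_of_nat] by simp
  qed
  have "(\<lambda>x. Y x (u n x)) \<in> borel_measurable M" for n
    unfolding u_def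
    by (rule measurable_compose_countable[where f = "\<lambda>i x. Y x (real i / real (Suc n))"])
       (use m r in auto)
  then show ?thesis
  proof (rule borel_measurable_LIMSEQ_real[rotated])
    fix x assume x: "x \<in> space M"
    have u0: "u n x \<in> {0..}" for n unfolding u_def atLeast_iff by (intro divide_nonneg_nonneg of_nat_0_le_iff)
    have "((\<lambda>n. Y x (u n x)) \<longlongrightarrow> Y x (r x)) sequentially"
      using c[OF x] u[OF x] r(2)[OF x]
      by (intro continuous_on_tendsto_compose[of "{0..}" "Y x"] always_eventually allI u0) auto
    then show "(\<lambda>n. Y x (u n x)) \<longlonglongrightarrow> Y x (r x)" .
  qed
qed

lemma borel_measurable_ennrealI:
  assumes "\<And>t. 0 \<le> t \<Longrightarrow> {x\<in>space M. f x \<le> ennreal t} \<in> sets M"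
  shows "f \<in> borel_measurable M"
proof (rule borel_measurableI_le)
  fix y :: ennreal
  show "{x \<in> space M. f x \<le> y} \<in> sets M" using assms by (cases y) auto
qed

text \<open>An uncountable existential quantifier is turned into countable ones. Clamping the
  rational to [0,t] keeps the end point \<open>t\<close> reachable even if it is irrational.\<close>

lemma sup_condition:
  fixes g :: "real \<Rightarrow> real"
  assumes "0 \<le> t" and g: "continuous_on {0..t} g"
  shows "(\<exists>s\<in>{0..t}. \<delta> \<le> g s) \<longleftrightarrow> (\<forall>l::nat. \<exists>p::rat. \<delta> - inverse (real (Suc l)) < g (min t (max 0 (of_rat p))))"
proof
  assume "\<exists>s\<in>{0..t}. \<delta> \<le> g s"
  then obtain s where s: "s \<in> {0..t}" "\<delta> \<le> g s" by auto
  show "\<forall>l::nat. \<exists>p::rat. \<delta> - inverse (real (Suc l)) < g (min t (max 0 (of_rat p)))"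
  proof
    fix l
    have c: "continuous_on UNIV (\<lambda>p. g (min t (max 0 p)))"
      by (rule continuous_on_compose2[OF g]) (use assms(1) in \<open>auto intro!: continuous_intros\<close>)
    have "open ((\<lambda>p. g (min t (max 0 p))) -` {\<delta> - inverse (real (Suc l))<..})"
      using continuous_on_open_vimage[OF open_UNIV, of "\<lambda>p. g (min t (max 0 p))"] c by auto
    moreover have "s \<in> (\<lambda>p. g (min t (max 0 p))) -` {\<delta> - inverse (real (Suc l))<..}"
      using s by (auto simp: min_def max_def intro: less_le_trans[of _ \<delta>])
    ultimately obtain e where "e > 0" "ball s e \<subseteq> (\<lambda>p. g (min t (max 0 p))) -` {\<delta> - inverse (real (Suc l))<..}"
      by (meson open_contains_ball)
    moreover obtain p where "s < of_rat p" "of_rat p < s + e" using of_rat_dense[of s "s + e"] \<open>e > 0\<close> by auto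
    then have "of_rat p \<in> ball s e" by (simp add: dist_real_def)
    ultimately show "\<exists>p::rat. \<delta> - inverse (real (Suc l)) < g (min t (max 0 (of_rat p)))" by blast
  qed
next
  assume *: "\<forall>l::nat. \<exists>p::rat. \<delta> - inverse (real (Suc l)) < g (min t (max 0 (of_rat p)))"
  obtain s where s: "s \<in> {0..t}" "\<And>u. u \<in> {0..t} \<Longrightarrow> g u \<le> g s"
    using continuous_attains_sup[OF _ _ g] assms(1) by auto
  have "\<delta> - inverse (real (Suc l)) \<le> g s" for l
  proof -
    obtain p :: rat where p: "\<delta> - inverse (real (Suc l)) < g (min t (max 0 (of_rat p)))" using * by auto
    with s(2)[of "min t (max 0 (of_rat p))"] assms(1) show ?thesis by auto
  qed
  moreover have "(\<lambda>l. \<delta> - inverse (real (Suc l))) \<longlonglongrightarrow> \<delta> - 0"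
    by (intro tendsto_intros LIMSEQ_inverse_real_of_nat)
  ultimately have "\<delta> \<le> g s" by (auto intro: LIMSEQ_le_const2)
  then show "\<exists>s\<in>{0..t}. \<delta> \<le> g s" using s by auto
qed

lemma continuous_on_sumdist:
  fixes f :: "nat \<Rightarrow> real \<Rightarrow> real"
  assumes "\<And>j. j < d \<Longrightarrow> continuous_on D (f j)"
  shows "continuous_on D (\<lambda>t. \<Sum>j<d. \<bar>f j t - f j r\<bar>)"
  using assms by (intro continuous_intros) auto

lemma crossing_sumdist:
  fixes f :: "nat \<Rightarrow> real \<Rightarrow> real"
  assumes "0 < \<delta>" "\<And>j. j < d \<Longrightarrow> continuous_on {0..} (f j)"
  shows "crossing {0..} \<delta> (\<lambda>r t. \<Sum>j<d. \<bar>f j t - f j r\<bar>)"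
  using assms by unfold_locales (auto intro!: continuous_on_sumdist)

lemma sumdist_uniform:
  fixes f :: "nat \<Rightarrow> real \<Rightarrow> real"
  assumes "0 < \<delta>" "\<And>j. j < d \<Longrightarrow> continuous_on {0..} (f j)"
  shows "\<exists>e>0. \<forall>r t. 0 \<le> r \<and> r \<le> t \<and> t \<le> u \<and> t - r < e \<longrightarrow> (\<Sum>j<d. \<bar>f j t - f j r\<bar>) < \<delta>"
proof -
  \<comment> \<open>The divisor \<open>real d + 1\<close> keeps the sum of the \<open>d\<close>
    bounds strictly below \<open>\<delta>\<close> and avoids division by 0.\<close>
  have "\<exists>e>0. \<forall>r t. 0 \<le> r \<and> r \<le> t \<and> t \<le> u \<and> t - r < e \<longrightarrow> \<bar>f j t - f j r\<bar> < \<delta> / (real d + 1)" if j: "j < d" for j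
  proof -
    have "uniformly_continuous_on {0..u} (f j)"
      using continuous_on_subset[OF assms(2)[OF j], of "{0..u}"] by (intro compact_uniformly_continuous) auto
    then obtain e where e: "e > 0" "\<And>x x'. x \<in> {0..u} \<Longrightarrow> x' \<in> {0..u} \<Longrightarrow> dist x' x < e \<Longrightarrow> dist (f j x') (f j x) < \<delta> / (real d + 1)"
      unfolding uniformly_continuous_on_def using assms(1) by (metis add_nonneg_pos divide_pos_pos of_nat_0_le_iff zero_less_one)
    have "\<bar>f j t - f j r\<bar> < \<delta> / (real d + 1)" if "0 \<le> r \<and> r \<le> t \<and> t \<le> u \<and> t - r < e" for r t
      using e(2)[of r t] that by (simp add: dist_real_def)
    then show ?thesis using e(1) by blast
  qed
  then obtain e where e: "\<And>j. j < d \<Longrightarrow> e j > 0"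
    "\<And>j r t. j < d \<Longrightarrow> 0 \<le> r \<and> r \<le> t \<and> t \<le> u \<and> t - r < e j \<Longrightarrow> \<bar>f j t - f j r\<bar> < \<delta> / (real d + 1)"
    by metis
  define E where "E = Min (insert 1 (e ` {..<d}))"
  have E: "E > 0" "\<And>j. j < d \<Longrightarrow> E \<le> e j" unfolding E_def using e(1) by auto
  have "(\<Sum>j<d. \<bar>f j t - f j r\<bar>) < \<delta>" if "0 \<le> r \<and> r \<le> t \<and> t \<le> u \<and> t - r < E" for r t
  proof -
    have "(\<Sum>j<d. \<bar>f j t - f j r\<bar>) \<le> (\<Sum>j<d. \<delta> / (real d + 1))"
      using that E(2) by (intro sum_mono less_imp_le e(2)) (auto intro: less_le_trans)
    also have "\<dots> < \<delta>" using assms(1) by (simp add: field_simps)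
    finally show ?thesis .
  qed
  then show ?thesis using E(1) by blast
qed

text \<open>The next crossing has occurred by time \<open>t\<close> exactly if the previous one has
  and the displacement from it reaches \<open>\<delta>\<close> within [0,t]; by
  \<open>sup_condition\<close> this is a countable condition.\<close>

lemma cross_measurable:
  fixes Y :: "nat \<Rightarrow> 'a \<Rightarrow> real \<Rightarrow> real"
  assumes m: "\<And>j t. j < d \<Longrightarrow> 0 \<le> t \<Longrightarrow> (\<lambda>x. Y j x t) \<in> borel_measurable M"
    and c: "\<And>j x. j < d \<Longrightarrow> x \<in> space M \<Longrightarrow> continuous_on {0..} (Y j x)" and \<delta>: "0 < \<delta>"
  shows "(\<lambda>x. cross {0..} \<delta> (\<lambda>r t. \<Sum>j<d. \<bar>Y j x t - Y j x r\<bar>) k) \<in> borel_measurable M"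
proof (induction k)
  case 0 show ?case by simp
next
  case (Suc k)
  let ?q = "\<lambda>x r t. \<Sum>j<d. \<bar>Y j x t - Y j x r\<bar>"
  let ?T = "\<lambda>k x. cross {0..} \<delta> (?q x) k"
  note [measurable] = Suc
  show ?case
  proof (rule borel_measurable_ennrealI)
    fix t :: real assume t: "0 \<le> t"
    \<comment> \<open>The previous crossing is capped at \<open>t\<close>, so that the reference
      time is a real number on all of the space. In \<open>g\<close> the argument is raised to
      \<open>r x\<close>, which makes the displacement 0 before the reference time.\<close>
    define r where "r x = enn2real (min (?T k x) (ennreal t))" for x
    have r: "0 \<le> r x" "r x \<le> t" for x unfolding r_def using t
      by (auto intro!: enn2real_leI simp: min_def)
    have rm[measurable]: "r \<in> borel_measurable M" unfolding r_def by measurable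
    define g where "g x s = ?q x (r x) (max s (r x))" for x s
    have gc: "continuous_on {0..t} (g x)" if "x \<in> space M" for x unfolding g_def
      by (rule continuous_on_compose2[OF continuous_on_sumdist[where D = "{0..}"]])
         (use c that r in \<open>auto intro!: continuous_intros\<close>)
    have gm: "(\<lambda>x. g x s) \<in> borel_measurable M" for s unfolding g_def
    proof (intro borel_measurable_sum borel_measurable_abs borel_measurable_diff)
      fix j assume j: "j \<in> {..<d}"
      show "(\<lambda>x. Y j x (r x)) \<in> borel_measurable M"
        by (rule eval_measurable) (use j m c r in auto)
      show "(\<lambda>x. Y j x (max s (r x))) \<in> borel_measurable M"
        by (rule eval_measurable[where r = "\<lambda>x. max s (r x)" and Y = "Y j"])
           (use j m c r in \<open>auto simp: le_max_iff_disj\<close>)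
    qed
    have "?T (Suc k) x \<le> ennreal t \<longleftrightarrow> ?T k x \<le> ennreal t \<and> (\<exists>s\<in>{0..t}. \<delta> \<le> g x s)" if x: "x \<in> space M" for x
    proof -
      interpret crossing "{0..}" \<delta> "?q x" using c x \<delta> by (intro crossing_sumdist) auto
      show ?thesis
      proof
        assume a: "?T (Suc k) x \<le> ennreal t"
        then have f: "?T (Suc k) x \<noteq> \<infinity>" and le: "enn2real (?T (Suc k) x) \<le> t" using le_iff[of t "Suc k"] t by auto
        have a': "?T k x \<le> ennreal t" using mono_Suc[of k] a by simp
        then have rx: "r x = enn2real (?T k x)" unfolding r_def by (simp add: min_def)
        then have "g x (enn2real (?T (Suc k) x)) = \<delta>" unfolding g_def using \<tau>_step[OF f] by simp
        then show "?T k x \<le> ennreal t \<and> (\<exists>s\<in>{0..t}. \<delta> \<le> g x s)" using a' le by (auto intro!: bexI[of _ "enn2real (?T (Suc k) x)"])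
      next
        assume a: "?T k x \<le> ennreal t \<and> (\<exists>s\<in>{0..t}. \<delta> \<le> g x s)"
        then obtain s where s: "s \<in> {0..t}" "\<delta> \<le> g x s" by auto
        have f: "?T k x \<noteq> \<infinity>" using a le_iff[of t k] t by auto
        have rx: "r x = enn2real (?T k x)" unfolding r_def using a by (simp add: min_def)
        show "?T (Suc k) x \<le> ennreal t"
        proof (rule ccontr)
          assume "\<not> ?T (Suc k) x \<le> ennreal t"
          then have "ennreal (max s (r x)) < ?T (Suc k) x"
            using s r[of x] t by (auto simp: max_def not_le intro: le_less_trans[OF ennreal_leI])
          then have "g x s < \<delta>" unfolding g_def rx using s f by (intro \<tau>_last) (auto simp: rx)
          with s show False by simp
        qed
      qed
    qed
    then have "{x\<in>space M. ?T (Suc k) x \<le> ennreal t} = {x\<in>space M. ?T k x \<le> ennreal t \<and>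
        (\<forall>l::nat. \<exists>p::rat. \<delta> - inverse (real (Suc l)) < g x (min t (max 0 (of_rat p))))}"
      using sup_condition[OF t gc] by auto
    also have "\<dots> \<in> sets M" using gm by measurable
    finally show "{x\<in>space M. ?T (Suc k) x \<le> ennreal t} \<in> sets M" .
  qed
qed

section \<open>Discretising nonanticipating strategies\<close>

text \<open>Summing over the coordinates makes a single grid control the oscillation of all of them
  within one cell.\<close>

definition grid :: "nat \<Rightarrow> real \<Rightarrow> nat \<Rightarrow> (nat \<Rightarrow> real \<Rightarrow> real) \<Rightarrow> ennreal" where
  "grid d \<eta> k \<omega> = cross {0..} \<eta> (\<lambda>r t. \<Sum>j<d. \<bar>\<omega> j t - \<omega> j r\<bar>) k"

lemma Cpaths_cont: "\<psi> \<in> Cpaths \<Longrightarrow> continuous_on A \<psi>"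
  unfolding Cpaths_def using continuous_on_subset by blast

lemma Omega_cont: "\<omega> \<in> Omega J \<Longrightarrow> continuous_on A (\<omega> j)"
  unfolding Omega_def using Cpaths_cont by (cases "j < J") auto

lemma space_Fsa: "space (Fsa J) = Omega J"
  unfolding Fsa_def by (intro space_measure_of) auto

lemma Fsa_eval: "j < J \<Longrightarrow> 0 \<le> t \<Longrightarrow> (\<lambda>\<omega>. \<omega> j t) \<in> borel_measurable (Fsa J)"
proof (rule measurableI)
  fix A :: "real set" assume "j < J" "0 \<le> t" "A \<in> sets borel"
  then have "{\<omega>\<in>Omega J. \<omega> j t \<in> A} \<in> sets (Fsa J)"
    unfolding Fsa_def by (subst sets_measure_of) (auto intro!: sigma_sets.Basic)
  then show "(\<lambda>\<omega>. \<omega> j t) -` A \<inter> space (Fsa J) \<in> sets (Fsa J)"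
    by (simp add: space_Fsa vimage_def Int_def conj_commute)
qed simp

lemma grid_crossing: "0 < \<eta> \<Longrightarrow> \<omega> \<in> Omega J \<Longrightarrow> crossing {0..} \<eta> (\<lambda>r t. \<Sum>j<d. \<bar>\<omega> j t - \<omega> j r\<bar>)"
  by (intro crossing_sumdist Omega_cont)

lemma grid_stopping_time:
  assumes "0 < \<eta>" "d \<le> J"
  shows "stopping_time J (grid d \<eta> k)"
  unfolding stopping_time_def
proof (intro conjI ballI impI)
  have "grid d \<eta> k = (\<lambda>\<omega>. cross {0..} \<eta> (\<lambda>r t. \<Sum>j<d. \<bar>\<omega> j t - \<omega> j r\<bar>) k)"
    unfolding grid_def by simp
  also have "\<dots> \<in> borel_measurable (Fsa J)"
  proof (rule cross_measurable[where Y = "\<lambda>j \<omega>. \<omega> j" and d = d and \<delta> = \<eta> and k = k])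
    show "(\<lambda>\<omega>. \<omega> j t) \<in> borel_measurable (Fsa J)" if "j < d" "0 \<le> t" for j t
      using that assms by (intro Fsa_eval) auto
    show "continuous_on {0..} (\<omega> j)" if "\<omega> \<in> space (Fsa J)" for j \<omega>
      using that by (intro Omega_cont[of _ J]) (simp add: space_Fsa)
    show "0 < \<eta>" by fact
  qed
  finally show "grid d \<eta> k \<in> borel_measurable (Fsa J)" .
  fix \<omega> \<omega>' assume \<omega>: "\<omega> \<in> Omega J" "\<omega>' \<in> Omega J" and ag: "agree J \<omega> \<omega>' (grid d \<eta> k \<omega>)"
  interpret crossing "{0..}" \<eta> "\<lambda>r t. \<Sum>j<d. \<bar>\<omega> j t - \<omega> j r\<bar>" using grid_crossing[OF assms(1) \<omega>(1)] .
  have e: "\<omega>' j s = \<omega> j s" if "j < d" "0 \<le> s" "ennreal s \<le> T k" for j s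
  proof -
    have "\<And>j s. j < J \<Longrightarrow> 0 \<le> s \<Longrightarrow> ennreal s \<le> T k \<Longrightarrow> \<omega> j s = \<omega>' j s"
      using ag unfolding agree_def grid_def by blast
    from this[of j s] that assms(2) show ?thesis by simp
  qed
  have "cross {0..} \<eta> (\<lambda>r t. \<Sum>j<d. \<bar>\<omega>' j t - \<omega>' j r\<bar>) k = T k"
  proof (rule cross_local)
    fix t assume t: "0 \<le> t" "T k = ennreal t"
    then have "(\<Sum>j<d. \<bar>\<omega>' j s - \<omega>' j r\<bar>) = (\<Sum>j<d. \<bar>\<omega> j s - \<omega> j r\<bar>)" if "0 \<le> r \<and> r \<le> s \<and> s \<le> t" for r s
      using that by (intro sum.cong refl) (simp add: e ennreal_leI)
    then show "t \<in> {0..} \<and> (\<forall>s. 0 \<le> s \<and> s \<le> t \<longrightarrow> (s \<in> {0..}) = (s \<in> {0..})) \<and>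
       (\<forall>r s. 0 \<le> r \<and> r \<le> s \<and> s \<le> t \<longrightarrow> (\<Sum>j<d. \<bar>\<omega>' j s - \<omega>' j r\<bar>) = (\<Sum>j<d. \<bar>\<omega> j s - \<omega> j r\<bar>))"
      using t by auto
  next
    show "T k = \<infinity> \<longrightarrow> ({0::real..} = {0..} \<and> (\<forall>r\<in>{0..}. \<forall>t\<in>{0..}. (\<Sum>j<d. \<bar>\<omega>' j t - \<omega>' j r\<bar>) = (\<Sum>j<d. \<bar>\<omega> j t - \<omega> j r\<bar>)))"
    proof (intro impI conjI ballI refl sum.cong)
      fix r t :: real and j assume "T k = \<infinity>" "r \<in> {0..}" "t \<in> {0..}" "j \<in> {..<d}"
      then have "\<omega>' j t = \<omega> j t" "\<omega>' j r = \<omega> j r" using e[of j t] e[of j r] by auto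
      then show "\<bar>\<omega>' j t - \<omega>' j r\<bar> = \<bar>\<omega> j t - \<omega> j r\<bar>" by simp
    qed
  qed
  then show "grid d \<eta> k \<omega> = grid d \<eta> k \<omega>'" unfolding grid_def by simp
qed

lemma grid_tendsto:
  assumes "0 < \<eta>" "\<omega> \<in> Omega J"
  shows "((\<lambda>k. grid d \<eta> k \<omega>) \<longlongrightarrow> \<infinity>) sequentially" "\<exists>k. ennreal u < grid d \<eta> k \<omega>"
proof -
  interpret crossing "{0..}" \<eta> "\<lambda>r t. \<Sum>j<d. \<bar>\<omega> j t - \<omega> j r\<bar>" using grid_crossing[OF assms] .
  have ex: "\<exists>k. ennreal u < T k" for u
    by (rule unbounded) (use assms in \<open>auto intro!: sumdist_uniform Omega_cont\<close>)
  then show "\<exists>k. ennreal u < grid d \<eta> k \<omega>" unfolding grid_def by simp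
  show "((\<lambda>k. grid d \<eta> k \<omega>) \<longlongrightarrow> \<infinity>) sequentially" unfolding grid_def infinity_ennreal_def tendsto_top_iff_ennreal
  proof (intro allI impI)
    fix l :: real assume "0 \<le> l"
    obtain k where "ennreal l < T k" using ex by auto
    then show "\<forall>\<^sub>F x in sequentially. ennreal l < T x"
      unfolding eventually_sequentially using mono by (meson less_le_trans)
  qed
qed

section \<open>Strategies with nonanticipating times and their gains\<close>

definition nonanticipating :: "nat \<Rightarrow> ((nat \<Rightarrow> real \<Rightarrow> real) \<Rightarrow> ennreal) \<Rightarrow> bool" where
  "nonanticipating J \<tau> \<longleftrightarrow> (\<forall>\<omega>\<in>Omega J. \<forall>\<omega>'\<in>Omega J. agree J \<omega> \<omega>' (\<tau> \<omega>) \<longrightarrow> \<tau> \<omega> = \<tau> \<omega>')"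

text \<open>Measurability of the times is not required: crossing times of the martingale need not be
  measurable with respect to the sample space.\<close>

definition strategy where
  "strategy J I a b (k :: 'i \<Rightarrow> (nat \<Rightarrow> real \<Rightarrow> real) \<Rightarrow> real) \<longleftrightarrow> finite I \<and> (\<forall>r\<in>I. nonanticipating J (a r) \<and> nonanticipating J (b r) \<and>
     (\<forall>\<omega>\<in>Omega J. a r \<omega> \<le> b r \<omega>) \<and> tau_measurable J (a r) (k r) \<and>
     (\<exists>B. \<forall>\<omega>\<in>Omega J. \<bar>k r \<omega>\<bar> \<le> B))"

text \<open>The process may depend on the index: with coordinate \<open>jj r\<close> at index
  \<open>r\<close> this is a gain from trading the securities themselves, with a constant
  \<open>x\<close> it is a gain from trading one martingale.\<close>

definition gains :: "'i set \<Rightarrow> ('i \<Rightarrow> real \<Rightarrow> (nat \<Rightarrow> real \<Rightarrow> real) \<Rightarrow> real) \<Rightarrow> ('i \<Rightarrow> (nat \<Rightarrow> real \<Rightarrow> real) \<Rightarrow> ennreal) \<Rightarrow>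
    ('i \<Rightarrow> (nat \<Rightarrow> real \<Rightarrow> real) \<Rightarrow> ennreal) \<Rightarrow> ('i \<Rightarrow> (nat \<Rightarrow> real \<Rightarrow> real) \<Rightarrow> real) \<Rightarrow> real \<Rightarrow> (nat \<Rightarrow> real \<Rightarrow> real) \<Rightarrow> real" where
  "gains I x a b k t \<omega> = (\<Sum>r\<in>I. k r \<omega> * (x r (stopt (b r) t \<omega>) \<omega> - x r (stopt (a r) t \<omega>) \<omega>))"

lemma agree_sym: "agree J \<omega> \<omega>' T \<Longrightarrow> agree J \<omega>' \<omega> T"
  unfolding agree_def by auto

lemma agree_mono: "agree J \<omega> \<omega>' T \<Longrightarrow> S \<le> T \<Longrightarrow> agree J \<omega> \<omega>' S"
  unfolding agree_def by (meson order_trans)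

text \<open>Galmarino's test: whether a nonanticipating time has occurred by \<open>T\<close>, and
  its value if so, can be read off the path up to \<open>T\<close>.\<close>

lemma nonanticipating_agree:
  assumes "nonanticipating J \<tau>" "\<omega> \<in> Omega J" "\<omega>' \<in> Omega J" "agree J \<omega> \<omega>' T"
  shows "\<tau> \<omega> \<le> T \<longleftrightarrow> \<tau> \<omega>' \<le> T" "\<tau> \<omega> \<le> T \<Longrightarrow> \<tau> \<omega>' = \<tau> \<omega>"
proof -
  have 1: "\<tau> \<omega>' = \<tau> \<omega>" if "\<tau> \<omega> \<le> T"
    using assms that agree_mono[OF assms(4) that] unfolding nonanticipating_def by metis
  have 2: "\<tau> \<omega>' = \<tau> \<omega>" if "\<tau> \<omega>' \<le> T"
    using assms that agree_mono[OF agree_sym[OF assms(4)] that] unfolding nonanticipating_def by metis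
  show "\<tau> \<omega> \<le> T \<longleftrightarrow> \<tau> \<omega>' \<le> T" using 1 2 by auto
  show "\<tau> \<omega> \<le> T \<Longrightarrow> \<tau> \<omega>' = \<tau> \<omega>" by fact
qed

lemma stopping_nonanticipating: "stopping_time J \<tau> \<Longrightarrow> nonanticipating J \<tau>"
  unfolding stopping_time_def nonanticipating_def by blast

lemma ennreal_stopt: "ennreal (stopt \<tau> t \<omega>) = min (\<tau> \<omega>) (ennreal t)"
  unfolding stopt_def by (cases "\<tau> \<omega>") (auto simp: min_def top_unique)

lemma stopt_nonneg [simp]: "0 \<le> stopt \<tau> t \<omega>"
  unfolding stopt_def by simp

lemma stopt_le: "0 \<le> t \<Longrightarrow> stopt \<tau> t \<omega> \<le> t"
  using ennreal_stopt[of \<tau> t \<omega>] by (metis ennreal_le_iff min.cobounded2)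

lemma stopt_eq: "0 \<le> t \<Longrightarrow> ennreal t \<le> \<tau> \<omega> \<Longrightarrow> stopt \<tau> t \<omega> = t"
  unfolding stopt_def by (simp add: min_def)

lemma stopt_eq_enn2real: "\<tau> \<omega> \<le> ennreal t \<Longrightarrow> stopt \<tau> t \<omega> = enn2real (\<tau> \<omega>)"
  unfolding stopt_def by (simp add: min_def)

lemma stopt_mono: "\<tau> \<omega> \<le> \<tau>' \<omega> \<Longrightarrow> stopt \<tau> t \<omega> \<le> stopt \<tau>' t \<omega>"
proof -
  assume "\<tau> \<omega> \<le> \<tau>' \<omega>"
  then have "ennreal (stopt \<tau> t \<omega>) \<le> ennreal (stopt \<tau>' t \<omega>)"
    unfolding ennreal_stopt by (intro min.mono order_refl)
  then show ?thesis by simp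
qed

lemma sum_stop:
  assumes mono: "\<And>n. \<tau> n \<omega> \<le> \<tau> (Suc n) \<omega>" and t: "0 \<le> t" "ennreal t \<le> \<tau> N \<omega>"
  shows "(\<Sum>n. \<Sum>j<d. h n \<omega> j * (\<omega> j (stopt (\<tau> (Suc n)) t \<omega>) - \<omega> j (stopt (\<tau> n) t \<omega>)))
    = (\<Sum>n<N. \<Sum>j<d. h n \<omega> j * (\<omega> j (stopt (\<tau> (Suc n)) t \<omega>) - \<omega> j (stopt (\<tau> n) t \<omega>)))"
proof (rule suminf_finite)
  fix n assume "n \<notin> {..<N}"
  then have "N \<le> n" by simp
  then have "\<tau> N \<omega> \<le> \<tau> n \<omega>" by (rule lift_Suc_mono_le[of "\<lambda>n. \<tau> n \<omega>", OF mono])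
  then have "ennreal t \<le> \<tau> n \<omega>" "ennreal t \<le> \<tau> (Suc n) \<omega>" using order_trans[OF t(2)] mono[of n] by (auto intro: order_trans)
  then show "(\<Sum>j<d. h n \<omega> j * (\<omega> j (stopt (\<tau> (Suc n)) t \<omega>) - \<omega> j (stopt (\<tau> n) t \<omega>))) = 0"
    using t(1) by (simp add: stopt_eq)
qed simp

text \<open>With the grid fixed, two such processes are added by adding their positions, and no
  stopping times have to be merged.\<close>

definition grid_capital :: "nat \<Rightarrow> nat \<Rightarrow> real \<Rightarrow> (real \<Rightarrow> (nat \<Rightarrow> real \<Rightarrow> real) \<Rightarrow> real) \<Rightarrow> bool" where
  "grid_capital J d \<eta> K \<longleftrightarrow> (\<exists>c h. (\<forall>n. tau_measurable J (grid d \<eta> n) (h n)) \<and>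
     (\<forall>n. \<exists>B. \<forall>\<omega>\<in>Omega J. \<forall>j<d. \<bar>h n \<omega> j\<bar> \<le> B) \<and>
     K = (\<lambda>t \<omega>. c + (\<Sum>n. \<Sum>j<d. h n \<omega> j * (\<omega> j (stopt (grid d \<eta> (Suc n)) t \<omega>) - \<omega> j (stopt (grid d \<eta> n) t \<omega>)))))"

lemma grid_mono: "0 < \<eta> \<Longrightarrow> \<omega> \<in> Omega J \<Longrightarrow> grid d \<eta> n \<omega> \<le> grid d \<eta> (Suc n) \<omega>"
  unfolding grid_def by (rule crossing.mono_Suc[OF grid_crossing])

lemma grid_capital_simple:
  assumes "grid_capital J d \<eta> K" "0 < \<eta>" "d \<le> J"
  shows "simple_capital J d K"
proof -
  obtain c h where h: "\<forall>n. tau_measurable J (grid d \<eta> n) (h n)" "\<forall>n. \<exists>B. \<forall>\<omega>\<in>Omega J. \<forall>j<d. \<bar>h n \<omega> j\<bar> \<le> B"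
     "K = (\<lambda>t \<omega>. c + (\<Sum>n. \<Sum>j<d. h n \<omega> j * (\<omega> j (stopt (grid d \<eta> (Suc n)) t \<omega>) - \<omega> j (stopt (grid d \<eta> n) t \<omega>))))"
    using assms(1) unfolding grid_capital_def by blast
  show ?thesis unfolding simple_capital_def
    by (rule exI[of _ c], rule exI[of _ "grid d \<eta>"], rule exI[of _ h])
       (use h assms grid_stopping_time grid_mono grid_tendsto(1) in blast)
qed

lemma grid_capital_add:
  assumes "grid_capital J d \<eta> K" "grid_capital J d \<eta> K'" "0 < \<eta>"
  shows "\<exists>L. grid_capital J d \<eta> L \<and> (\<forall>t\<ge>0. \<forall>\<omega>\<in>Omega J. L t \<omega> = K t \<omega> + K' t \<omega>)"
proof -
  let ?G = "\<lambda>c h t \<omega>. c + (\<Sum>n. \<Sum>j<d. h n \<omega> j * (\<omega> j (stopt (grid d \<eta> (Suc n)) t \<omega>) - \<omega> j (stopt (grid d \<eta> n) t \<omega>)))"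
  obtain c h where h: "\<forall>n. tau_measurable J (grid d \<eta> n) (h n)" "\<forall>n. \<exists>B. \<forall>\<omega>\<in>Omega J. \<forall>j<d. \<bar>h n \<omega> j\<bar> \<le> B" "K = ?G c h"
    using assms(1) unfolding grid_capital_def by blast
  obtain c' h' where h': "\<forall>n. tau_measurable J (grid d \<eta> n) (h' n)" "\<forall>n. \<exists>B. \<forall>\<omega>\<in>Omega J. \<forall>j<d. \<bar>h' n \<omega> j\<bar> \<le> B" "K' = ?G c' h'"
    using assms(2) unfolding grid_capital_def by blast
  define H where "H n \<omega> j = h n \<omega> j + h' n \<omega> j" for n \<omega> and j :: nat
  have tm: "tau_measurable J (grid d \<eta> n) (H n)" for n
    using h(1) h'(1) unfolding tau_measurable_def H_def by (metis (no_types, lifting))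
  have bd: "\<exists>B. \<forall>\<omega>\<in>Omega J. \<forall>j<d. \<bar>H n \<omega> j\<bar> \<le> B" for n
  proof -
    obtain B B' where "\<forall>\<omega>\<in>Omega J. \<forall>j<d. \<bar>h n \<omega> j\<bar> \<le> B" "\<forall>\<omega>\<in>Omega J. \<forall>j<d. \<bar>h' n \<omega> j\<bar> \<le> B'" using h(2) h'(2) by metis
    then show ?thesis unfolding H_def by (intro exI[of _ "B + B'"]) (force intro: order_trans[OF abs_triangle_ineq add_mono])
  qed
  have "?G (c + c') H t \<omega> = K t \<omega> + K' t \<omega>" if t: "0 \<le> t" and \<omega>: "\<omega> \<in> Omega J" for t \<omega>
  proof -
    obtain N where N: "ennreal t \<le> grid d \<eta> N \<omega>" using grid_tendsto(2)[OF assms(3) \<omega>] less_imp_le by blast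
    have S: "(\<Sum>n. \<Sum>j<d. f n \<omega> j * (\<omega> j (stopt (grid d \<eta> (Suc n)) t \<omega>) - \<omega> j (stopt (grid d \<eta> n) t \<omega>)))
     = (\<Sum>n<N. \<Sum>j<d. f n \<omega> j * (\<omega> j (stopt (grid d \<eta> (Suc n)) t \<omega>) - \<omega> j (stopt (grid d \<eta> n) t \<omega>)))" for f
      using grid_mono[OF assms(3) \<omega>] t N by (intro sum_stop) auto
    show ?thesis unfolding h(3) h'(3) S unfolding H_def by (simp add: distrib_right sum.distrib)
  qed
  moreover have "grid_capital J d \<eta> (?G (c + c') H)" unfolding grid_capital_def
    by (rule exI[of _ "c + c'"], rule exI[of _ H]) (use tm bd in blast)
  ultimately show ?thesis by blast
qed

text \<open>Trading stops once the capital falls below \<open>\<kappa>\<close>, the most that one grid step can lose; this keeps it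
  nonnegative.\<close>

primrec halted :: "real \<Rightarrow> real \<Rightarrow> (nat \<Rightarrow> real) \<Rightarrow> nat \<Rightarrow> real" where
  "halted \<kappa> c u 0 = c"
| "halted \<kappa> c u (Suc i) = halted \<kappa> c u i + (if \<kappa> \<le> halted \<kappa> c u i then u i else 0)"

lemma halted_cong: "(\<And>i. i < n \<Longrightarrow> u i = u' i) \<Longrightarrow> halted \<kappa> c u n = halted \<kappa> c u' n"
  by (induction n) auto

lemma halted_sum: "halted \<kappa> c u n = c + (\<Sum>i<n. if \<kappa> \<le> halted \<kappa> c u i then u i else 0)"
  by (induction n) auto

lemma strategy_discretise:
  fixes I :: "'i set"
  assumes s: "strategy J I a b k" and jjd: "\<forall>r\<in>I. jj r < d" and dJ: "d \<le> J" and c: "0 \<le> c"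
  shows "\<exists>C\<ge>0. \<forall>\<eta>>0. \<exists>K. grid_capital J d \<eta> K \<and> (\<forall>t\<ge>0. \<forall>\<omega>\<in>Omega J. 0 \<le> K t \<omega>) \<and> (\<forall>\<omega>\<in>Omega J. K 0 \<omega> = c + C * \<eta>) \<and>
    (\<forall>t\<ge>0. \<forall>\<omega>\<in>Omega J. (\<forall>s\<in>{0..t}. 0 \<le> c + gains I (\<lambda>r t \<omega>. \<omega> (jj r) t) a b k s \<omega>) \<longrightarrow>
        c + gains I (\<lambda>r t \<omega>. \<omega> (jj r) t) a b k t \<omega> \<le> K t \<omega>)"
proof -
  have jj: "\<And>r. r \<in> I \<Longrightarrow> jj r < d" using jjd by blast
  have fin: "finite I" using s unfolding strategy_def by auto
  obtain Br where Br: "\<And>r \<omega>. r \<in> I \<Longrightarrow> \<omega> \<in> Omega J \<Longrightarrow> \<bar>k r \<omega>\<bar> \<le> Br r"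
    using s unfolding strategy_def by metis
  define B where "B = (\<Sum>r\<in>I. \<bar>Br r\<bar>)"
  have B0: "0 \<le> B" unfolding B_def by (simp add: sum_nonneg)
  have Bk: "(\<Sum>r\<in>I. \<bar>k r \<omega>\<bar>) \<le> B" if "\<omega> \<in> Omega J" for \<omega>
    unfolding B_def using Br[OF _ that] by (intro sum_mono) force
  let ?V = "gains I (\<lambda>r t \<omega>. \<omega> (jj r) t) a b k"
  have main: "\<exists>K. grid_capital J d \<eta> K \<and> (\<forall>t\<ge>0. \<forall>\<omega>\<in>Omega J. 0 \<le> K t \<omega>) \<and> (\<forall>\<omega>\<in>Omega J. K 0 \<omega> = c + (5 * B) * \<eta>) \<and>
    (\<forall>t\<ge>0. \<forall>\<omega>\<in>Omega J. (\<forall>s\<in>{0..t}. 0 \<le> c + ?V s \<omega>) \<longrightarrow> c + ?V t \<omega> \<le> K t \<omega>)" if \<eta>: "0 < \<eta>" for \<eta>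
  proof -
    define \<kappa> where "\<kappa> = B * \<eta>"
    have \<kappa>0: "0 \<le> \<kappa>" unfolding \<kappa>_def using B0 \<eta> by simp
    define c0 where "c0 = c + (5 * B) * \<eta>"
    define \<rho> where "\<rho> = grid d \<eta>"
    \<comment> \<open>An index counts in a cell if it is active at the left end
      \<open>\<rho> i\<close>; whether this is so, and with which position, depends on the path up
      to \<open>\<rho> i\<close> only.\<close>
    define G where "G i \<omega> j = (\<Sum>r\<in>I. if jj r = j \<and> a r \<omega> \<le> \<rho> i \<omega> \<and> \<rho> i \<omega> < b r \<omega> then k r \<omega> else 0)" for i \<omega> j
    define u where "u \<omega> i = (\<Sum>j<d. G i \<omega> j * (\<omega> j (enn2real (\<rho> (Suc i) \<omega>)) - \<omega> j (enn2real (\<rho> i \<omega>))))" for \<omega> i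
    define z where "z i \<omega> = halted \<kappa> c0 (u \<omega>) i" for i \<omega>
    define H where "H i \<omega> j = (if \<kappa> \<le> z i \<omega> then G i \<omega> j else 0)" for i \<omega> j
    define K where "K t \<omega> = c0 + (\<Sum>n. \<Sum>j<d. H n \<omega> j * (\<omega> j (stopt (grid d \<eta> (Suc n)) t \<omega>) - \<omega> j (stopt (grid d \<eta> n) t \<omega>)))" for t \<omega>
    have st: "nonanticipating J (\<rho> i)" for i unfolding \<rho>_def using grid_stopping_time[OF \<eta> dJ] stopping_nonanticipating by blast
    have rmono: "\<rho> i \<omega> \<le> \<rho> (Suc i) \<omega>" if "\<omega> \<in> Omega J" for i \<omega>
      unfolding \<rho>_def using grid_mono[OF \<eta> that] .
    have Gb: "\<bar>G i \<omega> j\<bar> \<le> B" if "\<omega> \<in> Omega J" for i \<omega> j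
    proof -
      have "\<bar>G i \<omega> j\<bar> \<le> (\<Sum>r\<in>I. \<bar>k r \<omega>\<bar>)" unfolding G_def
        by (rule order_trans[OF sum_abs]) (auto intro: sum_mono)
      then show ?thesis using Bk[OF that] by simp
    qed
    have Gm: "tau_measurable J (\<rho> i) (G i)" for i
      unfolding tau_measurable_def
    proof (intro ballI impI)
      fix \<omega> \<omega>' assume \<omega>: "\<omega> \<in> Omega J" "\<omega>' \<in> Omega J" and ag: "agree J \<omega> \<omega>' (\<rho> i \<omega>)"
      have r: "\<rho> i \<omega>' = \<rho> i \<omega>" using nonanticipating_agree(2)[OF st \<omega> ag] by simp
      show "G i \<omega> = G i \<omega>'"
      proof
        fix j show "G i \<omega> j = G i \<omega>' j" unfolding G_def
        proof (rule sum.cong[OF refl])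
          fix q assume q: "q \<in> I"
          have qa: "nonanticipating J (a q)" "nonanticipating J (b q)" "tau_measurable J (a q) (k q)" using s q unfolding strategy_def by auto
          have "a q \<omega> \<le> \<rho> i \<omega> \<Longrightarrow> k q \<omega> = k q \<omega>'"
            using qa(3) agree_mono[OF ag] \<omega> unfolding tau_measurable_def by blast
          then show "(if jj q = j \<and> a q \<omega> \<le> \<rho> i \<omega> \<and> \<rho> i \<omega> < b q \<omega> then k q \<omega> else 0) =
             (if jj q = j \<and> a q \<omega>' \<le> \<rho> i \<omega>' \<and> \<rho> i \<omega>' < b q \<omega>' then k q \<omega>' else 0)"
            using nonanticipating_agree(1)[OF qa(1) \<omega> ag] nonanticipating_agree(1)[OF qa(2) \<omega> ag] r by (auto simp: not_le[symmetric])
        qed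
      qed
    qed
    have agm: "agree J \<omega> \<omega>' (\<rho> m \<omega>)" if "\<omega> \<in> Omega J" "agree J \<omega> \<omega>' (\<rho> i \<omega>)" "m \<le> i" for \<omega> \<omega>' m i
      using agree_mono[OF that(2)] lift_Suc_mono_le[of "\<lambda>n. \<rho> n \<omega>" m i, OF rmono[OF that(1)] that(3)] by blast
    have zm: "z i \<omega> = z i \<omega>'" if \<omega>: "\<omega> \<in> Omega J" "\<omega>' \<in> Omega J" and ag: "agree J \<omega> \<omega>' (\<rho> i \<omega>)" for i \<omega> \<omega>'
      unfolding z_def
    proof (rule halted_cong)
      fix m assume "m < i"
      then have ag': "agree J \<omega> \<omega>' (\<rho> m \<omega>)" "agree J \<omega> \<omega>' (\<rho> (Suc m) \<omega>)" using agm[OF \<omega>(1) ag] by auto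
      have r: "\<rho> m \<omega>' = \<rho> m \<omega>" "\<rho> (Suc m) \<omega>' = \<rho> (Suc m) \<omega>"
        using nonanticipating_agree(2)[OF st \<omega> ag'(1)] nonanticipating_agree(2)[OF st \<omega> ag'(2)] by auto
      have e: "ennreal (enn2real T) \<le> T" for T :: ennreal by (cases T) auto
      have "\<omega> j (enn2real (\<rho> m \<omega>)) = \<omega>' j (enn2real (\<rho> m \<omega>))" "\<omega> j (enn2real (\<rho> (Suc m) \<omega>)) = \<omega>' j (enn2real (\<rho> (Suc m) \<omega>))" if "j < d" for j
        using ag' e that dJ unfolding agree_def by auto
      moreover have "G m \<omega> = G m \<omega>'" using Gm ag'(1) \<omega> unfolding tau_measurable_def by blast
      ultimately show "u \<omega> m = u \<omega>' m" unfolding u_def r by (intro sum.cong) auto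
    qed
    have gc: "grid_capital J d \<eta> K" unfolding grid_capital_def
    proof (rule exI[of _ c0], rule exI[of _ H], intro conjI allI)
      show "tau_measurable J (grid d \<eta> n) (H n)" for n
        using Gm[of n] zm[of _ _ n] unfolding tau_measurable_def H_def \<rho>_def by metis
      show "\<exists>B. \<forall>\<omega>\<in>Omega J. \<forall>j<d. \<bar>H n \<omega> j\<bar> \<le> B" for n
        using Gb B0 unfolding H_def by (intro exI[of _ B]) auto
      show "K = (\<lambda>t \<omega>. c0 + (\<Sum>n. \<Sum>j<d. H n \<omega> j * (\<omega> j (stopt (grid d \<eta> (Suc n)) t \<omega>) - \<omega> j (stopt (grid d \<eta> n) t \<omega>))))"
        by (intro ext) (rule K_def)
    qed
    have path: "0 \<le> K t \<omega> \<and> ((\<forall>s\<in>{0..t}. 0 \<le> c + ?V s \<omega>) \<longrightarrow> c + ?V t \<omega> \<le> K t \<omega>)" if t: "0 \<le> t" and \<omega>: "\<omega> \<in> Omega J" for t \<omega>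
    proof -
      interpret crossing "{0..}" \<eta> "\<lambda>r t. \<Sum>j<d. \<bar>\<omega> j t - \<omega> j r\<bar>" using grid_crossing[OF \<eta> \<omega>] .
      have \<rho>T: "\<rho> i \<omega> = T i" for i unfolding \<rho>_def grid_def by simp
      \<comment> \<open>The index of the grid cell that contains \<open>t\<close>.\<close>
      define n where "n = (LEAST i. ennreal t < T (Suc i))"
      obtain m where m: "ennreal t < T m" using grid_tendsto(2)[OF \<eta> \<omega>] unfolding grid_def by blast
      then obtain m' where "m = Suc m'" by (cases m) auto
      then have n1: "ennreal t < T (Suc n)" unfolding n_def using m by (metis (mono_tags) LeastI)
      have n2: "T n \<le> ennreal t"
      proof (cases n)
        case (Suc n')
        then show ?thesis using not_less_Least[of n' "\<lambda>i. ennreal t < T (Suc i)"] unfolding n_def by (auto simp: not_less)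
      qed simp
      have Tf: "T i \<noteq> \<infinity> \<and> \<tau> i \<le> t" if "i \<le> n" for i
        using mono[OF that] n2 le_iff[of t i] t by auto
      define g where "g i s = (\<Sum>j<d. G i \<omega> j * (\<omega> j (stopt (\<rho> (Suc i)) s \<omega>) - \<omega> j (stopt (\<rho> i) s \<omega>)))" for i s
      have gb: "\<bar>g i s\<bar> \<le> \<kappa>" if i: "i \<le> n" and s: "0 \<le> s" "T i \<le> ennreal s" for i s
      proof -
        have e: "stopt (\<rho> i) s \<omega> = \<tau> i" using stopt_eq_enn2real[of "\<rho> i" \<omega> s] s \<rho>T by simp
        let ?x = "stopt (\<rho> (Suc i)) s \<omega>"
        have "ennreal ?x \<le> T (Suc i)" unfolding ennreal_stopt \<rho>T by simp
        moreover have "\<tau> i \<le> ?x" unfolding e[symmetric] by (rule stopt_mono) (simp add: \<rho>T mono_Suc)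
        ultimately have q: "(\<Sum>j<d. \<bar>\<omega> j ?x - \<omega> j (\<tau> i)\<bar>) \<le> \<eta>" using osc_le[of i ?x] Tf[OF i] by simp
        have "\<bar>g i s\<bar> \<le> (\<Sum>j<d. B * \<bar>\<omega> j ?x - \<omega> j (\<tau> i)\<bar>)" unfolding g_def e
          by (rule order_trans[OF sum_abs]) (auto intro!: sum_mono mult_right_mono Gb[OF \<omega>] simp: abs_mult)
        also have "\<dots> \<le> \<kappa>" unfolding \<kappa>_def sum_distrib_left[symmetric] using q B0 by (rule mult_left_mono)
        finally show ?thesis .
      qed
      have gu: "g i s = u \<omega> i" if "T (Suc i) \<le> ennreal s" for i s
        unfolding g_def u_def using that mono_Suc[of i] stopt_eq_enn2real[of "\<rho> i" \<omega> s] stopt_eq_enn2real[of "\<rho> (Suc i)" \<omega> s]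
        by (simp add: \<rho>T)
      have g0: "g i s = 0" if "0 \<le> s" "ennreal s \<le> T i" for i s
        unfolding g_def using that mono_Suc[of i] stopt_eq[of s "\<rho> i" \<omega>] stopt_eq[of s "\<rho> (Suc i)" \<omega>]
        by (simp add: \<rho>T)
      have gut: "g i t = u \<omega> i" if "i < n" for i using that mono[of "Suc i" n] n2 by (intro gu) auto
      have "K t \<omega> = c0 + (\<Sum>i<Suc n. \<Sum>j<d. H i \<omega> j * (\<omega> j (stopt (\<rho> (Suc i)) t \<omega>) - \<omega> j (stopt (\<rho> i) t \<omega>)))"
        unfolding K_def \<rho>_def using grid_mono[OF \<eta> \<omega>] t n1 by (subst sum_stop[where N = "Suc n"]) (auto simp: grid_def)
      also have "\<dots> = c0 + (\<Sum>i<Suc n. if \<kappa> \<le> z i \<omega> then g i t else 0)"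
        unfolding H_def g_def by (auto intro!: sum.cong)
      also have "\<dots> = c0 + (\<Sum>i<n. if \<kappa> \<le> z i \<omega> then u \<omega> i else 0) + (if \<kappa> \<le> z n \<omega> then g n t else 0)"
        using gut by (auto intro!: sum.cong)
      also have "c0 + (\<Sum>i<n. if \<kappa> \<le> z i \<omega> then u \<omega> i else 0) = z n \<omega>"
        unfolding z_def halted_sum[of _ _ _ n] ..
      finally have Kz: "K t \<omega> = z n \<omega> + (if \<kappa> \<le> z n \<omega> then g n t else 0)" .
      have z0: "0 \<le> z i \<omega>" if "i \<le> n" for i using that
      proof (induction i)
        case 0 show ?case unfolding z_def c0_def using c B0 \<eta> by simp
      next
        case (Suc i)
        have "\<bar>u \<omega> i\<bar> \<le> \<kappa>" using gb[of i t] gut[of i] Suc.prems t mono[of i n] n2 by auto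
        then show ?case using Suc unfolding z_def by auto
      qed
      have 1: "0 \<le> K t \<omega>" unfolding Kz using z0[of n] gb[of n t] t n2 by auto
      have Vg: "\<bar>(\<Sum>i<Suc n. g i s) - ?V s \<omega>\<bar> \<le> 4 * \<kappa>" if s: "0 \<le> s" "s \<le> t" for s
      proof -
        define f where "f r i = (if a r \<omega> \<le> \<rho> i \<omega> \<and> \<rho> i \<omega> < b r \<omega> then \<omega> (jj r) (stopt (\<rho> (Suc i)) s \<omega>) - \<omega> (jj r) (stopt (\<rho> i) s \<omega>) else 0)" for r i
        have "g i s = (\<Sum>r\<in>I. k r \<omega> * f r i)" for i
        proof -
          have "g i s = (\<Sum>j<d. \<Sum>r\<in>I. (if jj r = j then k r \<omega> * f r i else 0))"
            unfolding g_def G_def sum_distrib_right f_def by (intro sum.cong refl) auto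
          also have "\<dots> = (\<Sum>r\<in>I. \<Sum>j<d. (if jj r = j then k r \<omega> * f r i else 0))" by (rule sum.swap)
          also have "\<dots> = (\<Sum>r\<in>I. k r \<omega> * f r i)" using jj by (intro sum.cong refl) (simp add: sum.delta)
          finally show ?thesis .
        qed
        then have "(\<Sum>i<Suc n. g i s) = (\<Sum>r\<in>I. k r \<omega> * (\<Sum>i<Suc n. f r i))"
          by (simp only: sum_distrib_left sum.swap[of _ I])
        then have "(\<Sum>i<Suc n. g i s) - ?V s \<omega> = (\<Sum>r\<in>I. k r \<omega> * ((\<Sum>i<Suc n. f r i) - (\<omega> (jj r) (stopt (b r) s \<omega>) - \<omega> (jj r) (stopt (a r) s \<omega>))))"
          unfolding gains_def by (simp add: sum_subtractf[symmetric] right_diff_distrib)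
        also have "\<bar>\<dots>\<bar> \<le> (\<Sum>r\<in>I. \<bar>k r \<omega>\<bar> * (4 * \<eta>))"
        proof (rule order_trans[OF sum_abs], rule sum_mono)
          fix r assume r: "r \<in> I"
          let ?x = "\<lambda>i. stopt (\<rho> i) s \<omega>" and ?a = "stopt (a r) s \<omega>" and ?b = "stopt (b r) s \<omega>"
          \<comment> \<open>To apply \<open>grid_sum\<close>, the conditions on the times must
            become conditions on the times stopped at \<open>s\<close>. They are equivalent while
            the grid time is before \<open>s\<close>; afterwards the increment vanishes and the
            conditions are irrelevant.\<close>
          have f': "f r i = (if ?a \<le> ?x i \<and> ?x i < ?b then \<omega> (jj r) (?x (Suc i)) - \<omega> (jj r) (?x i) else 0)" for i
          proof (cases "ennreal s \<le> T i")
            case True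
            then show ?thesis unfolding f_def using s mono_Suc[of i] stopt_eq[of s "\<rho> i" \<omega>] stopt_eq[of s "\<rho> (Suc i)" \<omega>] by (simp add: \<rho>T)
          next
            case False
            have "?a \<le> ?x i \<longleftrightarrow> min (a r \<omega>) (ennreal s) \<le> min (\<rho> i \<omega>) (ennreal s)"
              unfolding ennreal_stopt[symmetric] by simp
            also have "\<dots> \<longleftrightarrow> a r \<omega> \<le> \<rho> i \<omega>" using False unfolding \<rho>T by (auto simp: min_def)
            finally have A: "?a \<le> ?x i \<longleftrightarrow> a r \<omega> \<le> \<rho> i \<omega>" .
            have "?x i < ?b \<longleftrightarrow> min (\<rho> i \<omega>) (ennreal s) < min (b r \<omega>) (ennreal s)"
              unfolding ennreal_stopt[symmetric] by (simp add: ennreal_less_iff)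
            also have "\<dots> \<longleftrightarrow> \<rho> i \<omega> < b r \<omega>" using False unfolding \<rho>T by (auto simp: min_def)
            finally show ?thesis unfolding f_def using A by simp
          qed
          have "\<bar>(\<Sum>i<Suc n. f r i) - (\<omega> (jj r) ?b - \<omega> (jj r) ?a)\<bar> \<le> 4 * \<eta>" unfolding f'
          proof (rule grid_sum)
            show "?x i \<le> ?x (Suc i)" for i by (rule stopt_mono) (simp add: \<rho>T mono_Suc)
            show "?x 0 \<le> ?a" by (simp add: stopt_eq_enn2real[of "\<rho> 0"] \<rho>T)
            show "?a \<le> ?b" using s \<omega> r \<open>strategy J I a b k\<close> unfolding strategy_def by (intro stopt_mono) auto
            have "?x (Suc n) = s" using s n1 by (intro stopt_eq) (auto simp: \<rho>T intro: order_trans[OF ennreal_leI])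
            then show "?b \<le> ?x (Suc n)" using stopt_le[OF s(1)] by simp
            show "0 \<le> \<eta>" using \<eta> by simp
            fix i y assume i: "i < Suc n" and y: "?x i \<le> y" "y \<le> ?x (Suc i)"
            show "\<bar>\<omega> (jj r) y - \<omega> (jj r) (?x i)\<bar> \<le> \<eta>"
            proof (cases "ennreal s \<le> T i")
              case True
              then have "?x i = s" "?x (Suc i) = s" using s mono_Suc[of i] stopt_eq[of s "\<rho> i" \<omega>] stopt_eq[of s "\<rho> (Suc i)" \<omega>] by (simp_all add: \<rho>T)
              then show ?thesis using y \<eta> by simp
            next
              case False
              then have e: "?x i = \<tau> i" using stopt_eq_enn2real[of "\<rho> i" \<omega> s] by (simp add: \<rho>T)
              have "ennreal y \<le> ennreal (?x (Suc i))" using y by (intro ennreal_leI)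
              also have "\<dots> \<le> T (Suc i)" unfolding ennreal_stopt \<rho>T by simp
              finally have "(\<Sum>j<d. \<bar>\<omega> j y - \<omega> j (\<tau> i)\<bar>) \<le> \<eta>"
                using osc_le[of i y] Tf[of i] i y e by (simp add: order_trans[OF enn2real_nonneg])
              moreover have "\<bar>\<omega> (jj r) y - \<omega> (jj r) (\<tau> i)\<bar> \<le> (\<Sum>j<d. \<bar>\<omega> j y - \<omega> j (\<tau> i)\<bar>)"
                using jj[OF r] by (intro member_le_sum[of "jj r" _ "\<lambda>j. \<bar>\<omega> j y - \<omega> j (\<tau> i)\<bar>"]) auto
              ultimately show ?thesis unfolding e by simp
            qed
          qed
          then show "\<bar>k r \<omega> * ((\<Sum>i<Suc n. f r i) - (\<omega> (jj r) ?b - \<omega> (jj r) ?a))\<bar> \<le> \<bar>k r \<omega>\<bar> * (4 * \<eta>)"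
            unfolding abs_mult by (intro mult_left_mono) auto
        qed
        also have "\<dots> \<le> 4 * \<kappa>" unfolding sum_distrib_right[symmetric] \<kappa>_def using Bk[OF \<omega>] \<eta> by (simp add: mult_right_mono)
        finally show ?thesis .
      qed
      have 2: "c + ?V t \<omega> \<le> K t \<omega>" if V: "\<forall>s\<in>{0..t}. 0 \<le> c + ?V s \<omega>"
      proof -
        have c0: "c0 = c + 5 * \<kappa>" unfolding c0_def \<kappa>_def by simp
        have zz: "z i \<omega> = c0 + (\<Sum>m<i. u \<omega> m) \<and> \<kappa> \<le> z i \<omega>" if "i \<le> n" for i using that
        proof (induction i)
          case 0 show ?case unfolding z_def using c0 c \<kappa>0 by simp
        next
          case (Suc i)
          have e: "z (Suc i) \<omega> = c0 + (\<Sum>m<Suc i. u \<omega> m)" using Suc unfolding z_def by auto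
          have Ts: "T (Suc i) = ennreal (\<tau> (Suc i))" "0 \<le> \<tau> (Suc i)" "\<tau> (Suc i) \<le> t" using fin[of "Suc i"] Tf[OF Suc.prems] by auto
          have "(\<Sum>m<Suc n. g m (\<tau> (Suc i))) = (\<Sum>m<Suc i. g m (\<tau> (Suc i)))"
            using Suc.prems Ts mono[of "Suc i"] by (intro sum.mono_neutral_right) (auto intro!: g0)
          also have "\<dots> = (\<Sum>m<Suc i. u \<omega> m)"
          proof (intro sum.cong refl gu)
            fix m assume "m \<in> {..<Suc i}"
            then have "T (Suc m) \<le> T (Suc i)" by (intro mono) simp
            then show "T (Suc m) \<le> ennreal (\<tau> (Suc i))" using Ts(1) by simp
          qed
          finally have "\<bar>(\<Sum>m<Suc i. u \<omega> m) - ?V (\<tau> (Suc i)) \<omega>\<bar> \<le> 4 * \<kappa>" using Vg[OF Ts(2,3)] by simp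
          moreover have "0 \<le> c + ?V (\<tau> (Suc i)) \<omega>" using V Ts by auto
          ultimately show ?case using e c0 by linarith
        qed
        have "K t \<omega> = c0 + (\<Sum>i<Suc n. g i t)" unfolding Kz using zz[of n] gut by simp
        then show ?thesis using Vg[of t] t c0 \<kappa>0 by linarith
      qed
      show ?thesis using 1 2 by blast
    qed
    have "K 0 \<omega> = c + (5 * B) * \<eta>" if "\<omega> \<in> Omega J" for \<omega>
      unfolding K_def using grid_mono[OF \<eta> that] by (subst sum_stop[where N = 0]) (auto simp: c0_def)
    then show ?thesis using gc path by blast
  qed
  then show ?thesis using B0 by (intro exI[of _ "5 * B"]) auto
qed

section \<open>Tradability of continuous martingales\<close>

lemma liminf_superadd_ennreal:
  fixes a b :: "nat \<Rightarrow> ennreal"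
  shows "liminf a + liminf b \<le> liminf (\<lambda>n. a n + b n)"
proof -
  have i: "incseq (\<lambda>n. INF m\<in>{n..}. a m)" "incseq (\<lambda>n. INF m\<in>{n..}. b m)"
    by (auto simp: incseq_def intro!: INF_superset_mono)
  have "liminf a + liminf b = (SUP n. (INF m\<in>{n..}. a m) + (INF m\<in>{n..}. b m))"
    unfolding liminf_SUP_INF using ennreal_SUP_add[OF i] by simp
  also have "\<dots> \<le> (SUP n. INF m\<in>{n..}. a m + b m)"
    by (intro SUP_mono bexI INF_greatest add_mono INF_lower) auto
  finally show ?thesis unfolding liminf_SUP_INF .
qed

text \<open>\<open>V\<close> is only covered on \<open>E\<close>; the supermartingale \<open>Y\<close>, carried along, pays for the complement.\<close>

definition superhedges where
  "superhedges J Jstar c E V Y Z \<longleftrightarrow> Z \<in> nn_supermart J Jstar \<and> (\<forall>\<omega>\<in>Omega J. Z 0 \<omega> = ennreal c + Y 0 \<omega>) \<and>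
    (\<forall>t\<ge>0. \<forall>\<omega>\<in>Omega J. Y t \<omega> \<le> Z t \<omega> \<and>
      ((t, \<omega>) \<in> E \<longrightarrow> (\<forall>s\<in>{0..t}. 0 \<le> V s \<omega>) \<longrightarrow> ennreal (V t \<omega>) + Y t \<omega> \<le> Z t \<omega>))"

text \<open>All limit passages for hedges go through this rule. Nonnegativity of the approximants is
  required only eventually and only at the point in question, and the limit \<open>v\<close> may
  exceed \<open>V'\<close>, so that a vanishing surplus can be absorbed.\<close>

lemma superhedges_liminf:
  assumes Z: "\<And>k. superhedges J Jstar (c k) (E k) (V k) (Y k) (Z k)"
    and c: "\<And>\<omega>. \<omega> \<in> Omega J \<Longrightarrow> liminf (\<lambda>k. ennreal (c k) + Y k 0 \<omega>) = ennreal c' + Y' 0 \<omega>"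
    and Y: "\<And>t \<omega>. 0 \<le> t \<Longrightarrow> \<omega> \<in> Omega J \<Longrightarrow> Y' t \<omega> \<le> liminf (\<lambda>k. Y k t \<omega>)"
    and E: "\<And>t \<omega>. 0 \<le> t \<Longrightarrow> \<omega> \<in> Omega J \<Longrightarrow> (t, \<omega>) \<in> E' \<Longrightarrow> \<forall>s\<in>{0..t}. 0 \<le> V' s \<omega> \<Longrightarrow>
       (\<forall>\<^sub>F k in sequentially. (t, \<omega>) \<in> E k \<and> (\<forall>s\<in>{0..t}. 0 \<le> V k s \<omega>)) \<and> (\<exists>v. (\<lambda>k. V k t \<omega>) \<longlonglongrightarrow> v \<and> V' t \<omega> \<le> v)"
  shows "superhedges J Jstar c' E' V' Y' (\<lambda>t \<omega>. liminf (\<lambda>k. Z k t \<omega>))"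
  unfolding superhedges_def
proof (intro conjI ballI allI impI)
  show "(\<lambda>t \<omega>. liminf (\<lambda>k. Z k t \<omega>)) \<in> nn_supermart J Jstar"
    using Z unfolding superhedges_def by (intro nn_supermart.liminf) blast
  fix \<omega> assume \<omega>: "\<omega> \<in> Omega J"
  have "Z k 0 \<omega> = ennreal (c k) + Y k 0 \<omega>" for k using Z[of k] \<omega> unfolding superhedges_def by blast
  then show "liminf (\<lambda>k. Z k 0 \<omega>) = ennreal c' + Y' 0 \<omega>" using c[OF \<omega>] by simp
next
  fix t :: real and \<omega> assume t: "0 \<le> t" and \<omega>: "\<omega> \<in> Omega J"
  have "Y k t \<omega> \<le> Z k t \<omega>" for k using Z[of k] t \<omega> unfolding superhedges_def by blast
  then have "liminf (\<lambda>k. Y k t \<omega>) \<le> liminf (\<lambda>k. Z k t \<omega>)" by (intro Liminf_mono always_eventually) auto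
  then show "Y' t \<omega> \<le> liminf (\<lambda>k. Z k t \<omega>)" using Y[OF t \<omega>] by simp
  assume e: "(t, \<omega>) \<in> E'" "\<forall>s\<in>{0..t}. 0 \<le> V' s \<omega>"
  from E[OF t \<omega> e] obtain v where v: "\<forall>\<^sub>F k in sequentially. (t, \<omega>) \<in> E k \<and> (\<forall>s\<in>{0..t}. 0 \<le> V k s \<omega>)"
    "(\<lambda>k. V k t \<omega>) \<longlonglongrightarrow> v" "V' t \<omega> \<le> v" by blast
  have "ennreal (V' t \<omega>) + Y' t \<omega> \<le> ennreal v + liminf (\<lambda>k. Y k t \<omega>)"
    using Y[OF t \<omega>] v(3) by (intro add_mono ennreal_leI)
  also have "ennreal v = liminf (\<lambda>k. ennreal (V k t \<omega>))"
    using v(2) by (intro lim_imp_Liminf[symmetric] tendsto_ennrealI) auto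
  also have "\<dots> + liminf (\<lambda>k. Y k t \<omega>) \<le> liminf (\<lambda>k. ennreal (V k t \<omega>) + Y k t \<omega>)" by (rule liminf_superadd_ennreal)
  also have "\<dots> \<le> liminf (\<lambda>k. Z k t \<omega>)"
  proof (rule Liminf_mono)
    show "\<forall>\<^sub>F k in sequentially. ennreal (V k t \<omega>) + Y k t \<omega> \<le> Z k t \<omega>" using v(1)
    proof eventually_elim
      case (elim k)
      then show ?case using Z[of k] t \<omega> unfolding superhedges_def by blast
    qed
  qed
  finally show "ennreal (V' t \<omega>) + Y' t \<omega> \<le> liminf (\<lambda>k. Z k t \<omega>)" .
qed

lemma stopt_0 [simp]: "stopt \<tau> 0 \<omega> = 0"
  unfolding stopt_def by simp

lemma stopt_stopt: "\<tau> \<omega> \<le> \<tau>' \<omega> \<Longrightarrow> stopt \<tau> (stopt \<tau>' t \<omega>) \<omega> = stopt \<tau> t \<omega>"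
  unfolding stopt_def[of \<tau>] ennreal_stopt by (simp add: min.assoc[symmetric] min.absorb1)

lemma simple_capital_cases:
  assumes "simple_capital J Jstar K"
  obtains \<tau> h c where "\<And>n. nonanticipating J (\<tau> n)" "\<And>n \<omega>. \<omega> \<in> Omega J \<Longrightarrow> \<tau> n \<omega> \<le> \<tau> (Suc n) \<omega>"
    "\<And>\<omega> u. \<omega> \<in> Omega J \<Longrightarrow> \<exists>N. \<forall>n\<ge>N. ennreal u \<le> \<tau> n \<omega>" "\<And>n. tau_measurable J (\<tau> n) (h n)"
    "\<And>n. \<exists>B. \<forall>\<omega>\<in>Omega J. \<forall>j<Jstar. \<bar>h n \<omega> j\<bar> \<le> B"
    "\<And>t \<omega>. K t \<omega> = c + (\<Sum>n. \<Sum>j<Jstar. h n \<omega> j * (\<omega> j (stopt (\<tau> (Suc n)) t \<omega>) - \<omega> j (stopt (\<tau> n) t \<omega>)))"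
    "\<And>\<omega>. K 0 \<omega> = c"
proof -
  obtain c \<tau> h where h: "\<forall>n. stopping_time J (\<tau> n)" "\<forall>n. \<forall>\<omega>\<in>Omega J. \<tau> n \<omega> \<le> \<tau> (Suc n) \<omega>"
    "\<forall>\<omega>\<in>Omega J. ((\<lambda>n. \<tau> n \<omega>) \<longlongrightarrow> \<infinity>) sequentially" "\<forall>n. tau_measurable J (\<tau> n) (h n)"
    "\<forall>n. \<exists>B. \<forall>\<omega>\<in>Omega J. \<forall>j<Jstar. \<bar>h n \<omega> j\<bar> \<le> B"
    "K = (\<lambda>t \<omega>. c + (\<Sum>n. \<Sum>j<Jstar. h n \<omega> j * (\<omega> j (stopt (\<tau> (Suc n)) t \<omega>) - \<omega> j (stopt (\<tau> n) t \<omega>))))"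
    using assms unfolding simple_capital_def by blast
  have "\<exists>N. \<forall>n\<ge>N. ennreal u \<le> \<tau> n \<omega>" if "\<omega> \<in> Omega J" for \<omega> u
  proof -
    have "\<forall>\<^sub>F n in sequentially. ennreal (max u 0) < \<tau> n \<omega>"
      using h(3) that unfolding infinity_ennreal_def tendsto_top_iff_ennreal by (meson max.cobounded2)
    then obtain N where N: "\<And>n. n \<ge> N \<Longrightarrow> ennreal (max u 0) < \<tau> n \<omega>" unfolding eventually_sequentially by blast
    have "ennreal u \<le> ennreal (max u 0)" by (intro ennreal_leI) simp
    then show ?thesis using N by (meson le_less_trans less_imp_le)
  qed
  then show ?thesis using h stopping_nonanticipating by (intro that[of \<tau> h c]) (auto simp: h(6))
qed

text \<open>This makes the process that witnesses a quasi-always statement as cheap as desired.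
  Multiplication by a constant is continuous and monotone, hence it commutes with the lower
  limit.\<close>

lemma nn_supermart_scale:
  assumes "Y \<in> nn_supermart J Jstar" "0 \<le> e"
  shows "\<exists>Z\<in>nn_supermart J Jstar. \<forall>t\<ge>0. \<forall>\<omega>\<in>Omega J. Z t \<omega> = ennreal e * Y t \<omega>"
  using assms(1)
proof induction
  case (simple K)
  obtain c \<tau> h where h: "\<forall>n. stopping_time J (\<tau> n)" "\<forall>n. \<forall>\<omega>\<in>Omega J. \<tau> n \<omega> \<le> \<tau> (Suc n) \<omega>"
    "\<forall>\<omega>\<in>Omega J. ((\<lambda>n. \<tau> n \<omega>) \<longlongrightarrow> \<infinity>) sequentially" "\<forall>n. tau_measurable J (\<tau> n) (h n)"
    "\<forall>n. \<exists>B. \<forall>\<omega>\<in>Omega J. \<forall>j<Jstar. \<bar>h n \<omega> j\<bar> \<le> B"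
    "K = (\<lambda>t \<omega>. c + (\<Sum>n. \<Sum>j<Jstar. h n \<omega> j * (\<omega> j (stopt (\<tau> (Suc n)) t \<omega>) - \<omega> j (stopt (\<tau> n) t \<omega>))))"
    using simple(1) unfolding simple_capital_def by blast
  define N where "N u \<omega> = (SOME n. ennreal u \<le> \<tau> n \<omega>)" for u \<omega>
  have N: "ennreal u \<le> \<tau> (N u \<omega>) \<omega>" if "\<omega> \<in> Omega J" for \<omega> u
  proof -
    have "\<exists>n. ennreal u \<le> \<tau> n \<omega>" if "\<omega> \<in> Omega J" for \<omega> u
    proof -
      have "\<forall>\<^sub>F n in sequentially. ennreal (max u 0) < \<tau> n \<omega>"
        using h(3) that unfolding infinity_ennreal_def tendsto_top_iff_ennreal by (meson max.cobounded2)
      then obtain n where "ennreal (max u 0) < \<tau> n \<omega>" unfolding eventually_sequentially by blast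
      moreover have "ennreal u \<le> ennreal (max u 0)" by (intro ennreal_leI) simp
      ultimately show ?thesis by (meson le_less_trans less_imp_le)
    qed
    from this[OF that] show ?thesis unfolding N_def by (rule someI_ex)
  qed
  define h' where "h' n \<omega> j = e * h n \<omega> j" for n \<omega> and j :: nat
  define K' where "K' t \<omega> = e * c + (\<Sum>n. \<Sum>j<Jstar. h' n \<omega> j * (\<omega> j (stopt (\<tau> (Suc n)) t \<omega>) - \<omega> j (stopt (\<tau> n) t \<omega>)))" for t \<omega>
  have e: "K' t \<omega> = e * K t \<omega>" if "0 \<le> t" "\<omega> \<in> Omega J" for t \<omega>
  proof -
    have S: "(\<Sum>n. \<Sum>j<Jstar. f n \<omega> j * (\<omega> j (stopt (\<tau> (Suc n)) t \<omega>) - \<omega> j (stopt (\<tau> n) t \<omega>)))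
      = (\<Sum>n<N t \<omega>. \<Sum>j<Jstar. f n \<omega> j * (\<omega> j (stopt (\<tau> (Suc n)) t \<omega>) - \<omega> j (stopt (\<tau> n) t \<omega>)))" for f
      using h(2) that N[OF that(2), of t] by (intro sum_stop) auto
    show ?thesis unfolding K'_def h(6) S unfolding h'_def by (simp add: distrib_left sum_distrib_left mult.assoc)
  qed
  have "simple_capital J Jstar K'" unfolding simple_capital_def
  proof (rule exI[of _ "e * c"], rule exI[of _ \<tau>], rule exI[of _ h'], intro conjI)
    show "\<forall>n. tau_measurable J (\<tau> n) (h' n)"
      using h(4) unfolding tau_measurable_def h'_def by (metis (no_types, lifting))
    show "\<forall>n. \<exists>B. \<forall>\<omega>\<in>Omega J. \<forall>j<Jstar. \<bar>h' n \<omega> j\<bar> \<le> B"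
    proof
      fix n obtain B where "\<forall>\<omega>\<in>Omega J. \<forall>j<Jstar. \<bar>h n \<omega> j\<bar> \<le> B" using h(5) by blast
      then show "\<exists>B. \<forall>\<omega>\<in>Omega J. \<forall>j<Jstar. \<bar>h' n \<omega> j\<bar> \<le> B"
        using assms(2) unfolding h'_def by (intro exI[of _ "e * B"]) (auto simp: abs_mult intro: mult_left_mono)
    qed
    show "K' = (\<lambda>t \<omega>. e * c + (\<Sum>n. \<Sum>j<Jstar. h' n \<omega> j * (\<omega> j (stopt (\<tau> (Suc n)) t \<omega>) - \<omega> j (stopt (\<tau> n) t \<omega>))))"
      by (intro ext) (rule K'_def)
  qed (use h in auto)
  then have "(\<lambda>t \<omega>. ennreal (K' t \<omega>)) \<in> nn_supermart J Jstar"
    using e simple(2) assms(2) by (intro nn_supermart.simple) auto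
  then show ?case using e simple(2) assms(2) by (intro bexI) (auto simp: ennreal_mult)
next
  case (liminf Xs)
  then obtain Z where Z: "\<And>k. Z k \<in> nn_supermart J Jstar" "\<And>k t \<omega>. 0 \<le> t \<Longrightarrow> \<omega> \<in> Omega J \<Longrightarrow> Z k t \<omega> = ennreal e * Xs k t \<omega>"
    by metis
  have "liminf (\<lambda>k. ennreal e * Xs k t \<omega>) = ennreal e * liminf (\<lambda>k. Xs k t \<omega>)" for t \<omega>
  proof (rule Liminf_compose_continuous_mono)
    show "continuous_on UNIV (\<lambda>x. ennreal e * x)" by (intro ennreal_continuous_on_cmult continuous_on_id) simp
  qed (auto simp: mono_def mult_left_mono)
  then show ?case using Z by (intro bexI[OF _ nn_supermart.liminf[of Z]]) auto
qed

lemma inverse_Suc_pos: "0 < inverse (real (Suc l))"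
  by simp

lemma tendsto_add_inverse_Suc: "(\<lambda>l. c + C * inverse (real (Suc l))) \<longlonglongrightarrow> c" for C c :: real
  using tendsto_add[OF tendsto_const tendsto_mult[OF tendsto_const LIMSEQ_inverse_real_of_nat], of c C] by simp

text \<open>Induction on the way \<open>Y\<close> is generated. For a simple \<open>Y\<close>, the
  process cut off after \<open>N\<close> trading periods is itself the gain of a finite strategy, so
  it is discretised on the same grid as the hedge and the two are added there; afterwards the mesh
  tends to 0 and \<open>N\<close> to infinity. Lower limits are handled by
  \<open>superhedges_liminf\<close>.\<close>

lemma coordinate_superhedges:
  assumes s: "strategy J I a b k" and jj: "\<And>r. r \<in> I \<Longrightarrow> jj r < Jstar" and J: "Jstar \<le> J" and c: "0 \<le> c"
    and Y: "Y \<in> nn_supermart J Jstar"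
  shows "\<exists>Z. superhedges J Jstar c UNIV (\<lambda>t \<omega>. c + gains I (\<lambda>r t \<omega>. \<omega> (jj r) t) a b k t \<omega>) Y Z"
  using Y
proof induction
  case (simple K)
  obtain \<tau> h c' where h: "\<And>n. nonanticipating J (\<tau> n)" "\<And>n \<omega>. \<omega> \<in> Omega J \<Longrightarrow> \<tau> n \<omega> \<le> \<tau> (Suc n) \<omega>"
    "\<And>\<omega> u. \<omega> \<in> Omega J \<Longrightarrow> \<exists>N. \<forall>n\<ge>N. ennreal u \<le> \<tau> n \<omega>" "\<And>n. tau_measurable J (\<tau> n) (h n)"
    "\<And>n. \<exists>B. \<forall>\<omega>\<in>Omega J. \<forall>j<Jstar. \<bar>h n \<omega> j\<bar> \<le> B"
    "\<And>t \<omega>. K t \<omega> = c' + (\<Sum>n. \<Sum>j<Jstar. h n \<omega> j * (\<omega> j (stopt (\<tau> (Suc n)) t \<omega>) - \<omega> j (stopt (\<tau> n) t \<omega>)))"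
    "\<And>\<omega>. K 0 \<omega> = c'" by (rule simple_capital_cases[OF simple(1)]) (rule that; assumption)
  have "(\<lambda>_ _. 0) \<in> Omega J" unfolding Omega_def Cpaths_def by auto
  then have c': "0 \<le> c'" using simple(2) h(7) by (metis order_refl)
  let ?V = "gains I (\<lambda>r t \<omega>. \<omega> (jj r) t) a b k"
  \<comment> \<open>The index pair consists of a trading period and a coordinate, which puts the
    truncated process into the form required by \<open>strategy_discretise\<close>.\<close>
  define YN where "YN N t \<omega> = c' + gains ({..<N} \<times> {..<Jstar}) (\<lambda>r t \<omega>. \<omega> (snd r) t) (\<lambda>r. \<tau> (fst r)) (\<lambda>r. \<tau> (Suc (fst r))) (\<lambda>r \<omega>. h (fst r) \<omega> (snd r)) t \<omega>" for N t \<omega>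
  have YNs: "YN N t \<omega> = c' + (\<Sum>n<N. \<Sum>j<Jstar. h n \<omega> j * (\<omega> j (stopt (\<tau> (Suc n)) t \<omega>) - \<omega> j (stopt (\<tau> n) t \<omega>)))" for N t \<omega>
    unfolding YN_def gains_def sum.cartesian_product by (simp add: case_prod_beta)
  have taum: "\<tau> n \<omega> \<le> \<tau> m \<omega>" if "\<omega> \<in> Omega J" "n \<le> m" for n m \<omega>
    by (rule lift_Suc_mono_le[of "\<lambda>n. \<tau> n \<omega>", OF h(2)[OF that(1)] that(2)])
  \<comment> \<open>Truncation amounts to stopping at \<open>\<tau> N\<close>, so nonnegativity of
    \<open>K\<close> is inherited.\<close>
  have YNK: "YN N t \<omega> = K (stopt (\<tau> N) t \<omega>) \<omega>" if "0 \<le> t" "\<omega> \<in> Omega J" for N t \<omega>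
  proof -
    have "K (stopt (\<tau> N) t \<omega>) \<omega> = c' + (\<Sum>n<N. \<Sum>j<Jstar. h n \<omega> j * (\<omega> j (stopt (\<tau> (Suc n)) (stopt (\<tau> N) t \<omega>) \<omega>) - \<omega> j (stopt (\<tau> n) (stopt (\<tau> N) t \<omega>) \<omega>)))"
      unfolding h(6) using h(2)[OF that(2)] by (subst sum_stop[where N = N]) (auto simp: ennreal_stopt)
    also have "\<dots> = YN N t \<omega>" unfolding YNs using taum[OF that(2)] by (auto intro!: sum.cong simp: stopt_stopt)
    finally show ?thesis ..
  qed
  have YN0: "0 \<le> YN N t \<omega>" if "0 \<le> t" "\<omega> \<in> Omega J" for N t \<omega>
    unfolding YNK[OF that] using simple(2) that by simp
  have YNe: "\<forall>\<^sub>F N in sequentially. YN N t \<omega> = K t \<omega>" if t\<omega>: "0 \<le> t" "\<omega> \<in> Omega J" for t \<omega>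
  proof -
    obtain N where N: "\<forall>n\<ge>N. ennreal t \<le> \<tau> n \<omega>" using h(3)[OF t\<omega>(2)] by blast
    then have "YN n t \<omega> = K t \<omega>" if "n \<ge> N" for n using that YNK[OF t\<omega>, of n] t\<omega>(1) by (simp add: stopt_eq)
    then show ?thesis unfolding eventually_sequentially by blast
  qed
  have stN: "strategy J ({..<N} \<times> {..<Jstar}) (\<lambda>r. \<tau> (fst r)) (\<lambda>r. \<tau> (Suc (fst r))) (\<lambda>r \<omega>. h (fst r) \<omega> (snd r))" for N
    unfolding strategy_def
  proof (intro conjI ballI)
    fix r assume r: "r \<in> {..<N} \<times> {..<Jstar}"
    show "tau_measurable J (\<tau> (fst r)) (\<lambda>\<omega>. h (fst r) \<omega> (snd r))"
      using h(4) unfolding tau_measurable_def by (metis (no_types, lifting))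
    obtain B where "\<forall>\<omega>\<in>Omega J. \<forall>j<Jstar. \<bar>h (fst r) \<omega> j\<bar> \<le> B" using h(5) by blast
    then show "\<exists>B. \<forall>\<omega>\<in>Omega J. \<bar>h (fst r) \<omega> (snd r)\<bar> \<le> B" using r by (intro exI[of _ B]) auto
  qed (use h in auto)
  obtain C where C: "0 \<le> C" "\<forall>\<eta>>0. \<exists>K. grid_capital J Jstar \<eta> K \<and> (\<forall>t\<ge>0. \<forall>\<omega>\<in>Omega J. 0 \<le> K t \<omega>) \<and> (\<forall>\<omega>\<in>Omega J. K 0 \<omega> = c + C * \<eta>) \<and>
    (\<forall>t\<ge>0. \<forall>\<omega>\<in>Omega J. (\<forall>s\<in>{0..t}. 0 \<le> c + ?V s \<omega>) \<longrightarrow> c + ?V t \<omega> \<le> K t \<omega>)"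
    proof -
    have "\<forall>r\<in>I. jj r < Jstar" using jj by blast
    note strategy_discretise[OF s this J c]
    then show ?thesis by (elim exE conjE) (rule that; assumption)
  qed
  have N: "\<exists>Z. superhedges J Jstar c UNIV (\<lambda>t \<omega>. c + ?V t \<omega>) (\<lambda>t \<omega>. ennreal (YN N t \<omega>)) Z" for N
  proof -
    obtain C' where C': "0 \<le> C'" "\<forall>\<eta>>0. \<exists>K. grid_capital J Jstar \<eta> K \<and> (\<forall>t\<ge>0. \<forall>\<omega>\<in>Omega J. 0 \<le> K t \<omega>) \<and> (\<forall>\<omega>\<in>Omega J. K 0 \<omega> = c' + C' * \<eta>) \<and>
      (\<forall>t\<ge>0. \<forall>\<omega>\<in>Omega J. (\<forall>s\<in>{0..t}. 0 \<le> YN N s \<omega>) \<longrightarrow> YN N t \<omega> \<le> K t \<omega>)"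
    proof -
      have "\<exists>C\<ge>0. \<forall>\<eta>>0. \<exists>K. grid_capital J Jstar \<eta> K \<and> (\<forall>t\<ge>0. \<forall>\<omega>\<in>Omega J. 0 \<le> K t \<omega>) \<and> (\<forall>\<omega>\<in>Omega J. K 0 \<omega> = c' + C * \<eta>) \<and>
        (\<forall>t\<ge>0. \<forall>\<omega>\<in>Omega J. (\<forall>s\<in>{0..t}. 0 \<le> YN N s \<omega>) \<longrightarrow> YN N t \<omega> \<le> K t \<omega>)"
        unfolding YN_def by (rule strategy_discretise[OF stN _ J c']) auto
      then show ?thesis by (elim exE conjE) (rule that; assumption)
    qed
    define \<eta> where "\<eta> l = inverse (real (Suc l))" for l
    have \<eta>: "0 < \<eta> l" for l unfolding \<eta>_def by simp
    have "\<exists>Z. superhedges J Jstar (c + (C + C') * \<eta> l) UNIV (\<lambda>t \<omega>. c + ?V t \<omega>) (\<lambda>t \<omega>. ennreal (YN N t \<omega>)) Z" for l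
    proof -
      obtain K1 where K1: "grid_capital J Jstar (\<eta> l) K1" "\<forall>t\<ge>0. \<forall>\<omega>\<in>Omega J. 0 \<le> K1 t \<omega>" "\<forall>\<omega>\<in>Omega J. K1 0 \<omega> = c + C * \<eta> l"
        "\<forall>t\<ge>0. \<forall>\<omega>\<in>Omega J. (\<forall>s\<in>{0..t}. 0 \<le> c + ?V s \<omega>) \<longrightarrow> c + ?V t \<omega> \<le> K1 t \<omega>"
        using C(2)[THEN spec, THEN mp, OF \<eta>] by blast
      obtain K2 where K2: "grid_capital J Jstar (\<eta> l) K2" "\<forall>t\<ge>0. \<forall>\<omega>\<in>Omega J. 0 \<le> K2 t \<omega>" "\<forall>\<omega>\<in>Omega J. K2 0 \<omega> = c' + C' * \<eta> l"
        "\<forall>t\<ge>0. \<forall>\<omega>\<in>Omega J. YN N t \<omega> \<le> K2 t \<omega>"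
        using C'(2)[THEN spec, THEN mp, OF \<eta>[of l]] YN0 by (metis atLeastAtMost_iff)
      obtain L where L: "grid_capital J Jstar (\<eta> l) L" "\<forall>t\<ge>0. \<forall>\<omega>\<in>Omega J. L t \<omega> = K1 t \<omega> + K2 t \<omega>"
        using grid_capital_add[OF K1(1) K2(1) \<eta>] by blast
      have "superhedges J Jstar (c + (C + C') * \<eta> l) UNIV (\<lambda>t \<omega>. c + ?V t \<omega>) (\<lambda>t \<omega>. ennreal (YN N t \<omega>)) (\<lambda>t \<omega>. ennreal (L t \<omega>))"
        unfolding superhedges_def
      proof (intro conjI ballI allI impI)
        show "(\<lambda>t \<omega>. ennreal (L t \<omega>)) \<in> nn_supermart J Jstar"
          using L K1(2) K2(2) by (intro nn_supermart.simple grid_capital_simple[OF L(1) \<eta> J]) auto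
        fix \<omega> assume \<omega>: "\<omega> \<in> Omega J"
        have "YN N 0 \<omega> = c'" unfolding YNs by simp
        then show "ennreal (L 0 \<omega>) = ennreal (c + (C + C') * \<eta> l) + ennreal (YN N 0 \<omega>)"
          using L(2) K1(3) K2(3) \<omega> c c' C(1) C'(1) \<eta>[of l]
          by (subst ennreal_plus[symmetric]) (auto simp: algebra_simps)
      next
        fix t :: real and \<omega> assume t: "0 \<le> t" and \<omega>: "\<omega> \<in> Omega J"
        then have "0 \<le> K1 t \<omega>" "YN N t \<omega> \<le> K2 t \<omega>" "L t \<omega> = K1 t \<omega> + K2 t \<omega>" using K1(2) K2(4) L(2) by auto
        then show "ennreal (YN N t \<omega>) \<le> ennreal (L t \<omega>)" by (intro ennreal_leI) auto
        assume V: "\<forall>s\<in>{0..t}. 0 \<le> c + ?V s \<omega>"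
        then have "c + ?V t \<omega> \<le> K1 t \<omega>" using K1(4) t \<omega> by blast
        moreover have "0 \<le> c + ?V t \<omega>" using V t by auto
        ultimately have "ennreal (c + ?V t \<omega> + YN N t \<omega>) \<le> ennreal (L t \<omega>)" using \<open>YN N t \<omega> \<le> K2 t \<omega>\<close> \<open>L t \<omega> = K1 t \<omega> + K2 t \<omega>\<close>
          by (intro ennreal_leI) auto
        then show "ennreal (c + ?V t \<omega>) + ennreal (YN N t \<omega>) \<le> ennreal (L t \<omega>)"
          using \<open>0 \<le> c + ?V t \<omega>\<close> YN0[OF t \<omega>] by (subst ennreal_plus[symmetric]) auto
      qed
      then show ?thesis by blast
    qed
    then obtain Z where Z: "\<And>l. superhedges J Jstar (c + (C + C') * \<eta> l) UNIV (\<lambda>t \<omega>. c + ?V t \<omega>) (\<lambda>t \<omega>. ennreal (YN N t \<omega>)) (Z l)" by metis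
    have "superhedges J Jstar c UNIV (\<lambda>t \<omega>. c + ?V t \<omega>) (\<lambda>t \<omega>. ennreal (YN N t \<omega>)) (\<lambda>t \<omega>. liminf (\<lambda>l. Z l t \<omega>))"
    proof (rule superhedges_liminf[OF Z])
      fix \<omega> assume \<omega>: "\<omega> \<in> Omega J"
      have "(\<lambda>l. ennreal (c + (C + C') * \<eta> l)) \<longlonglongrightarrow> ennreal c" unfolding \<eta>_def by (intro tendsto_ennrealI tendsto_add_inverse_Suc)
      then have "(\<lambda>l. ennreal (c + (C + C') * \<eta> l) + ennreal (YN N 0 \<omega>)) \<longlonglongrightarrow> ennreal c + ennreal (YN N 0 \<omega>)" by (intro tendsto_add tendsto_const)
      then show "liminf (\<lambda>l. ennreal (c + (C + C') * \<eta> l) + ennreal (YN N 0 \<omega>)) = ennreal c + ennreal (YN N 0 \<omega>)"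
        by (intro lim_imp_Liminf) auto
    qed (auto simp: Liminf_const intro!: exI[of _ "c + ?V _ _"])
    then show ?thesis by blast
  qed
  then obtain Z where Z: "\<And>N. superhedges J Jstar c UNIV (\<lambda>t \<omega>. c + ?V t \<omega>) (\<lambda>t \<omega>. ennreal (YN N t \<omega>)) (Z N)" by metis
  have "superhedges J Jstar c UNIV (\<lambda>t \<omega>. c + ?V t \<omega>) (\<lambda>t \<omega>. ennreal (K t \<omega>)) (\<lambda>t \<omega>. liminf (\<lambda>l. Z l t \<omega>))"
  proof (rule superhedges_liminf[OF Z])
    show "liminf (\<lambda>k. ennreal c + ennreal (YN k 0 \<omega>)) = ennreal c + ennreal (K 0 \<omega>)" for \<omega>
      unfolding YNs h(7) by (simp add: Liminf_const)
    show "ennreal (K t \<omega>) \<le> liminf (\<lambda>k. ennreal (YN k t \<omega>))" if "0 \<le> t" "\<omega> \<in> Omega J" for t \<omega>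
      using YNe[OF that] by (intro Liminf_bounded) (auto elim: eventually_mono)
  qed (auto intro!: exI[of _ "c + ?V _ _"])
  then show ?case by blast
next
  case (liminf Xs)
  then obtain Z where Z: "\<And>k'. superhedges J Jstar c UNIV (\<lambda>t \<omega>. c + gains I (\<lambda>r t \<omega>. \<omega> (jj r) t) a b k t \<omega>) (Xs k') (Z k')"
    by metis
  have "superhedges J Jstar c UNIV (\<lambda>t \<omega>. c + gains I (\<lambda>r t \<omega>. \<omega> (jj r) t) a b k t \<omega>) (\<lambda>t \<omega>. liminf (\<lambda>k'. Xs k' t \<omega>)) (\<lambda>t \<omega>. liminf (\<lambda>l. Z l t \<omega>))"
  proof (rule superhedges_liminf[OF Z])
    show "liminf (\<lambda>k. ennreal c + Xs k 0 \<omega>) = ennreal c + liminf (\<lambda>k. Xs k 0 \<omega>)" for \<omega>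
    proof (rule Liminf_compose_continuous_mono)
      show "continuous_on UNIV (\<lambda>x. ennreal c + x)" by (intro continuous_on_add_ennreal continuous_on_const continuous_on_id)
    qed (auto simp: mono_def add_left_mono)
  qed (auto intro!: exI[of _ "c + gains I (\<lambda>r t \<omega>. \<omega> (jj r) t) a b k _ _"])
  then show ?case by blast
qed

text \<open>The index type is fixed since tradability is proved by induction over martingales; an index stands
  for a step of a bet, given by mesh exponent and pattern.\<close>

definition tradable where
  "tradable J Jstar E x \<longleftrightarrow> (\<forall>(I :: ((nat \<times> bool list) \<times> nat) set) a b k c Y. strategy J I a b k \<longrightarrow> 0 \<le> c \<longrightarrow> Y \<in> nn_supermart J Jstar \<longrightarrow>
     (\<exists>Z. superhedges J Jstar c E (\<lambda>t \<omega>. c + gains I (\<lambda>_. x) a b k t \<omega>) Y Z))"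

text \<open>Uniform convergence on [0,t] makes the gains of a fixed finite strategy converge
  uniformly there as well. Nonnegative limit capital does not make the approximating capitals
  nonnegative, so a surplus 1/(l+1) is granted and removed at the end.\<close>

lemma tradable_limit:
  assumes tr: "\<And>k. tradable J Jstar (E k) (x k)" and E: "\<And>k. E' \<subseteq> E k"
    and lim: "\<And>t \<omega> e. 0 \<le> t \<Longrightarrow> \<omega> \<in> Omega J \<Longrightarrow> (t, \<omega>) \<in> E' \<Longrightarrow> 0 < e \<Longrightarrow>
        \<forall>\<^sub>F k in sequentially. \<forall>s\<in>{0..t}. \<bar>x k s \<omega> - x' s \<omega>\<bar> \<le> e"
  shows "tradable J Jstar E' x'"
  unfolding tradable_def
proof (intro allI impI)
  fix I :: "((nat \<times> bool list) \<times> nat) set" and a b k c Y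
  assume s: "strategy J I a b k" and c: "0 \<le> (c::real)" and Y: "Y \<in> nn_supermart J Jstar"
  let ?V = "\<lambda>x t \<omega>. c + gains I (\<lambda>_. x) a b k t \<omega>"
  have fin: "finite I" using s unfolding strategy_def by auto
  have gl: "\<forall>\<^sub>F m in sequentially. \<forall>s\<in>{0..t}. \<bar>?V (x m) s \<omega> - ?V x' s \<omega>\<bar> \<le> e"
    if t: "0 \<le> t" "\<omega> \<in> Omega J" "(t, \<omega>) \<in> E'" and e: "0 < e" for t \<omega> e
  proof -
    \<comment> \<open>The added 1 keeps \<open>B\<close> positive when all positions vanish.\<close>
    define B where "B = (\<Sum>r\<in>I. \<bar>k r \<omega>\<bar>) + 1"
    have B: "0 < B" unfolding B_def by (simp add: add_nonneg_pos sum_nonneg)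
    have "0 < e / (2 * B)" using e B by simp
    from lim[OF t this] show ?thesis
    proof eventually_elim
      case (elim m)
      show ?case
      proof
        fix s assume s: "s \<in> {0..t}"
        have d: "\<bar>x m (stopt \<tau> s \<omega>) \<omega> - x' (stopt \<tau> s \<omega>) \<omega>\<bar> \<le> e / (2 * B)" for \<tau>
          using elim s stopt_le[of s \<tau> \<omega>] by (intro bspec[OF elim]) auto
        have "\<bar>?V (x m) s \<omega> - ?V x' s \<omega>\<bar> = \<bar>\<Sum>r\<in>I. k r \<omega> * ((x m (stopt (b r) s \<omega>) \<omega> - x' (stopt (b r) s \<omega>) \<omega>) - (x m (stopt (a r) s \<omega>) \<omega> - x' (stopt (a r) s \<omega>) \<omega>))\<bar>"
          unfolding gains_def by (simp add: sum_subtractf[symmetric] algebra_simps)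
        also have "\<dots> \<le> (\<Sum>r\<in>I. \<bar>k r \<omega>\<bar> * (e / B))"
        proof (rule order_trans[OF sum_abs], rule sum_mono)
          fix r
          have "\<bar>(x m (stopt (b r) s \<omega>) \<omega> - x' (stopt (b r) s \<omega>) \<omega>) - (x m (stopt (a r) s \<omega>) \<omega> - x' (stopt (a r) s \<omega>) \<omega>)\<bar> \<le> e / (2 * B) + e / (2 * B)"
            using d[of "b r"] d[of "a r"] by linarith
          also have "\<dots> = e / B" using B by (simp add: field_simps)
          finally show "\<bar>k r \<omega> * ((x m (stopt (b r) s \<omega>) \<omega> - x' (stopt (b r) s \<omega>) \<omega>) - (x m (stopt (a r) s \<omega>) \<omega> - x' (stopt (a r) s \<omega>) \<omega>))\<bar> \<le> \<bar>k r \<omega>\<bar> * (e / B)"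
            unfolding abs_mult by (intro mult_left_mono) auto
        qed
        also have "\<dots> = (B - 1) * (e / B)" unfolding sum_distrib_right[symmetric] B_def by simp
        also have "\<dots> \<le> e" using B e by (simp add: field_simps)
        finally show "\<bar>?V (x m) s \<omega> - ?V x' s \<omega>\<bar> \<le> e" .
      qed
    qed
  qed
  have "\<exists>Z. superhedges J Jstar (c + 1 * inverse (real (Suc l))) E' (?V x') Y Z" for l
  proof -
    let ?e = "inverse (real (Suc l))"
    \<comment> \<open>For each fixed surplus \<open>?e\<close> the approximating capital is
      eventually nonnegative on all of [0,t], so the hedges of the approximants are eventually
      effective.\<close>
    have "\<exists>Z. superhedges J Jstar (c + 1 * ?e) (E m) (\<lambda>t \<omega>. ?e + ?V (x m) t \<omega>) Y Z" for m
    proof -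
      have "0 \<le> c + 1 * ?e" using c by (simp add: add_nonneg_nonneg)
      from tr[of m, unfolded tradable_def, rule_format, OF s this Y] show ?thesis
        by (simp add: add.assoc add.left_commute)
    qed
    then obtain Z where Z: "\<And>m. superhedges J Jstar (c + 1 * ?e) (E m) (\<lambda>t \<omega>. ?e + ?V (x m) t \<omega>) Y (Z m)" by metis
    have "superhedges J Jstar (c + 1 * ?e) E' (?V x') Y (\<lambda>t \<omega>. liminf (\<lambda>m. Z m t \<omega>))"
    proof (rule superhedges_liminf[OF Z])
      fix t :: real and \<omega> assume t: "0 \<le> t" "\<omega> \<in> Omega J" "(t, \<omega>) \<in> E'" and V: "\<forall>s\<in>{0..t}. 0 \<le> ?V x' s \<omega>"
      have "\<forall>\<^sub>F m in sequentially. (t, \<omega>) \<in> E m \<and> (\<forall>s\<in>{0..t}. 0 \<le> ?e + ?V (x m) s \<omega>)"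
        using gl[OF t inverse_Suc_pos[of l]]
      proof eventually_elim
        case (elim m)
        show ?case using E[of m] t(3) elim V by force
      qed
      moreover have "(\<lambda>m. ?V (x m) t \<omega>) \<longlonglongrightarrow> ?V x' t \<omega>"
      proof (rule tendstoI)
        fix e :: real assume "0 < e"
        from gl[OF t, of "e / 2"] show "\<forall>\<^sub>F m in sequentially. dist (?V (x m) t \<omega>) (?V x' t \<omega>) < e"
        proof (rule eventually_mono)
          fix m assume "\<forall>s\<in>{0..t}. \<bar>?V (x m) s \<omega> - ?V x' s \<omega>\<bar> \<le> e / 2"
          then have "\<bar>?V (x m) t \<omega> - ?V x' t \<omega>\<bar> \<le> e / 2" using t(1) by simp
          then show "dist (?V (x m) t \<omega>) (?V x' t \<omega>) < e" using \<open>0 < e\<close> unfolding dist_real_def by simp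
        qed (use \<open>0 < e\<close> in simp)
      qed
      then have "(\<lambda>m. ?e + ?V (x m) t \<omega>) \<longlonglongrightarrow> ?e + ?V x' t \<omega>" by (rule tendsto_add[OF tendsto_const])
      moreover have "?V x' t \<omega> \<le> ?e + ?V x' t \<omega>" by simp
      ultimately show "(\<forall>\<^sub>F m in sequentially. (t, \<omega>) \<in> E m \<and> (\<forall>s\<in>{0..t}. 0 \<le> ?e + ?V (x m) s \<omega>)) \<and> (\<exists>v. (\<lambda>m. ?e + ?V (x m) t \<omega>) \<longlonglongrightarrow> v \<and> ?V x' t \<omega> \<le> v)" by blast
    qed (auto simp: Liminf_const)
    then show ?thesis by blast
  qed
  then obtain Z where Z: "\<And>l. superhedges J Jstar (c + 1 * inverse (real (Suc l))) E' (?V x') Y (Z l)" by metis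
  have "superhedges J Jstar c E' (?V x') Y (\<lambda>t \<omega>. liminf (\<lambda>m. Z m t \<omega>))"
  proof (rule superhedges_liminf[OF Z])
    fix \<omega>
    have "(\<lambda>l. ennreal (c + 1 * inverse (real (Suc l))) + Y 0 \<omega>) \<longlonglongrightarrow> ennreal c + Y 0 \<omega>"
      by (intro tendsto_add tendsto_const tendsto_ennrealI tendsto_add_inverse_Suc)
    then show "liminf (\<lambda>l. ennreal (c + 1 * inverse (real (Suc l))) + Y 0 \<omega>) = ennreal c + Y 0 \<omega>" by (intro lim_imp_Liminf) auto
  qed (auto simp: Liminf_const intro!: exI[of _ "?V x' _ _"])
  then show "\<exists>Z. superhedges J Jstar c E' (?V x') Y Z" by blast
qed

section \<open>Trading a process that is itself a trading gain\<close>

lemma nonanticipating_max: assumes "nonanticipating J a" "nonanticipating J b" shows "nonanticipating J (\<lambda>\<omega>. max (a \<omega>) (b \<omega>))"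
  unfolding nonanticipating_def
proof (intro ballI impI)
  fix \<omega> \<omega>' assume \<omega>: "\<omega> \<in> Omega J" "\<omega>' \<in> Omega J" and ag: "agree J \<omega> \<omega>' (max (a \<omega>) (b \<omega>))"
  show "max (a \<omega>) (b \<omega>) = max (a \<omega>') (b \<omega>')"
    using nonanticipating_agree(2)[OF assms(1) \<omega> ag] nonanticipating_agree(2)[OF assms(2) \<omega> ag] by simp
qed

lemma nonanticipating_min: assumes "nonanticipating J a" "nonanticipating J b" shows "nonanticipating J (\<lambda>\<omega>. min (a \<omega>) (b \<omega>))"
  unfolding nonanticipating_def
proof (intro ballI impI)
  fix \<omega> \<omega>' assume \<omega>: "\<omega> \<in> Omega J" "\<omega>' \<in> Omega J" and ag: "agree J \<omega> \<omega>' (min (a \<omega>) (b \<omega>))"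
  note A = nonanticipating_agree[OF assms(1) \<omega> ag] and B = nonanticipating_agree[OF assms(2) \<omega> ag]
  show "min (a \<omega>) (b \<omega>) = min (a \<omega>') (b \<omega>')"
  proof (cases "a \<omega> \<le> b \<omega>")
    case True
    then have m: "min (a \<omega>) (b \<omega>) = a \<omega>" by simp
    have a': "a \<omega>' = a \<omega>" using A(2) m by simp
    have "a \<omega> \<le> b \<omega>'"
    proof (rule ccontr)
      assume n: "\<not> a \<omega> \<le> b \<omega>'"
      then have "b \<omega>' \<le> min (a \<omega>) (b \<omega>)" using m by simp
      then have "b \<omega> \<le> a \<omega>" "b \<omega>' = b \<omega>" using B m by auto
      then show False using n True by simp
    qed
    then show ?thesis using m a' by simp
  next
    case False
    then have m: "min (a \<omega>) (b \<omega>) = b \<omega>" by simp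
    have b': "b \<omega>' = b \<omega>" using B(2) m by simp
    have "b \<omega> \<le> a \<omega>'"
    proof (rule ccontr)
      assume n: "\<not> b \<omega> \<le> a \<omega>'"
      then have "a \<omega>' \<le> min (a \<omega>) (b \<omega>)" using m by simp
      then have "a \<omega>' = a \<omega>" using A m by auto
      then show False using n False by simp
    qed
    then show ?thesis using m b' by (simp add: min_def)
  qed
qed

text \<open>Increments over (u,v] of increments over (a,b] are increments over the intersection of
  the two intervals. An empty intersection is represented by the degenerate interval at
  \<open>max a u\<close>.\<close>

lemma min_max_rectangle:
  fixes a b u v t :: "'b::linorder" and g :: "'b \<Rightarrow> real"
  assumes "a \<le> b" "u \<le> v"
  shows "(g (min v (min b t)) - g (min u (min b t))) - (g (min v (min a t)) - g (min u (min a t)))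
     = g (min (max (max a u) (min b v)) t) - g (min (max a u) t)"
proof -
  consider "b \<le> u" | "v \<le> a" | "u < b" "a < v" by force
  then show ?thesis
  proof cases
    case 1
    then have "a \<le> u" "b \<le> v" using assms by auto
    then show ?thesis using 1 assms by (simp add: min.absorb2 max.absorb1 max.absorb2 min.absorb1 min.coboundedI1)
  next
    case 2
    then have "u \<le> a" "v \<le> b" "u \<le> b" using assms by auto
    then show ?thesis using 2 assms by (simp add: min.absorb2 max.absorb1 max.absorb2 min.absorb1 min.assoc[symmetric])
  next
    case 3
    then have e: "max (max a u) (min b v) = min b v" using assms by (intro max.absorb2) auto
    show ?thesis unfolding e using 3 assms
      by (cases "a \<le> u"; cases "b \<le> v"; simp add: min.assoc[symmetric] max.absorb1 max.absorb2 min.absorb1 min.absorb2)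
  qed
qed

text \<open>Holding \<open>k\<close> units of a process that holds \<open>h\<close> units of a
  security means holding \<open>k * h\<close> units of the security on the intersection of the two
  holding periods. This reduces the claim to \<open>coordinate_superhedges\<close>.\<close>

lemma tradable_finite:
  fixes N :: nat
  assumes h: "\<And>n. nonanticipating J (\<tau> n)" "\<And>n \<omega>. \<omega> \<in> Omega J \<Longrightarrow> \<tau> n \<omega> \<le> \<tau> (Suc n) \<omega>"
    "\<And>n. tau_measurable J (\<tau> n) (h n)" "\<And>n. \<exists>B. \<forall>\<omega>\<in>Omega J. \<forall>j<Jstar. \<bar>h n \<omega> j\<bar> \<le> B" and J: "Jstar \<le> J"
  shows "tradable J Jstar E (\<lambda>t \<omega>. c0 + (\<Sum>n<N. \<Sum>j<Jstar. h n \<omega> j * (\<omega> j (stopt (\<tau> (Suc n)) t \<omega>) - \<omega> j (stopt (\<tau> n) t \<omega>))))"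
  unfolding tradable_def
proof (intro allI impI)
  fix I :: "((nat \<times> bool list) \<times> nat) set" and a b k c Y
  assume s: "strategy J I a b k" and c: "0 \<le> (c::real)" and Y: "Y \<in> nn_supermart J Jstar"
  let ?x = "\<lambda>t \<omega>. c0 + (\<Sum>n<N. \<Sum>j<Jstar. h n \<omega> j * (\<omega> j (stopt (\<tau> (Suc n)) t \<omega>) - \<omega> j (stopt (\<tau> n) t \<omega>)))"
  define I' where "I' = I \<times> ({..<N} \<times> {..<Jstar})"
  define a' where "a' = (\<lambda>(r :: ((nat \<times> bool list) \<times> nat) \<times> nat \<times> nat) \<omega>. max (a (fst r) \<omega>) (\<tau> (fst (snd r)) \<omega>))"
  \<comment> \<open>The maximum with \<open>a'\<close> keeps the end time at or after the start time
    when the intersection is empty.\<close>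
  define b' where "b' = (\<lambda>r \<omega>. max (a' r \<omega>) (min (b (fst r) \<omega>) (\<tau> (Suc (fst (snd r))) \<omega>)))"
  define k' where "k' = (\<lambda>r \<omega>. k (fst r) \<omega> * h (fst (snd r)) \<omega> (snd (snd r)))"
  have s': "strategy J I' a' b' k'" unfolding strategy_def
  proof (intro conjI ballI)
    show "finite I'" using s unfolding I'_def strategy_def by auto
    fix r assume r: "r \<in> I'"
    then have i: "fst r \<in> I" "snd (snd r) < Jstar" unfolding I'_def by auto
    then have S: "nonanticipating J (a (fst r))" "nonanticipating J (b (fst r))" "tau_measurable J (a (fst r)) (k (fst r))" "\<exists>B. \<forall>\<omega>\<in>Omega J. \<bar>k (fst r) \<omega>\<bar> \<le> B"
      using s unfolding strategy_def by auto
    show "nonanticipating J (a' r)" unfolding a'_def by (rule nonanticipating_max[OF S(1) h(1)])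
    then show "nonanticipating J (b' r)" unfolding b'_def by (rule nonanticipating_max[OF _ nonanticipating_min[OF S(2) h(1)]])
    show "a' r \<omega> \<le> b' r \<omega>" for \<omega> unfolding b'_def by simp
    show "tau_measurable J (a' r) (k' r)" unfolding tau_measurable_def
    proof (intro ballI impI)
      fix \<omega> \<omega>' assume \<omega>: "\<omega> \<in> Omega J" "\<omega>' \<in> Omega J" and ag: "agree J \<omega> \<omega>' (a' r \<omega>)"
      have "k (fst r) \<omega> = k (fst r) \<omega>'" using S(3) \<omega> agree_mono[OF ag, of "a (fst r) \<omega>"] unfolding tau_measurable_def a'_def by simp
      moreover have "h (fst (snd r)) \<omega> = h (fst (snd r)) \<omega>'"
        using h(3)[of "fst (snd r)"] \<omega> agree_mono[OF ag, of "\<tau> (fst (snd r)) \<omega>"] unfolding tau_measurable_def a'_def by simp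
      ultimately show "k' r \<omega> = k' r \<omega>'" unfolding k'_def by simp
    qed
    obtain B1 where B1: "\<forall>\<omega>\<in>Omega J. \<bar>k (fst r) \<omega>\<bar> \<le> B1" using S(4) by blast
    obtain B2 where B2: "\<forall>\<omega>\<in>Omega J. \<forall>j<Jstar. \<bar>h (fst (snd r)) \<omega> j\<bar> \<le> B2" using h(4) by blast
    show "\<exists>B. \<forall>\<omega>\<in>Omega J. \<bar>k' r \<omega>\<bar> \<le> B"
    proof (rule exI[of _ "B1 * B2"], rule ballI)
      fix \<omega> assume "\<omega> \<in> Omega J"
      then have "\<bar>k (fst r) \<omega>\<bar> \<le> B1" "\<bar>h (fst (snd r)) \<omega> (snd (snd r))\<bar> \<le> B2" using B1 B2 i by auto
      then show "\<bar>k' r \<omega>\<bar> \<le> B1 * B2" unfolding k'_def abs_mult by (intro mult_mono) auto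
    qed
  qed
  have eq: "gains I (\<lambda>_. ?x) a b k t \<omega> = gains I' (\<lambda>r t \<omega>. \<omega> (snd (snd r)) t) a' b' k' t \<omega>" if \<omega>: "\<omega> \<in> Omega J" for t \<omega>
  proof -
    have "?x (stopt (b r) t \<omega>) \<omega> - ?x (stopt (a r) t \<omega>) \<omega> =
       (\<Sum>n<N. \<Sum>j<Jstar. h n \<omega> j * (\<omega> j (stopt (b' (r, n, j)) t \<omega>) - \<omega> j (stopt (a' (r, n, j)) t \<omega>)))" if r: "r \<in> I" for r
    proof -
      have "\<omega> j (stopt (\<tau> (Suc n)) (stopt (b r) t \<omega>) \<omega>) - \<omega> j (stopt (\<tau> n) (stopt (b r) t \<omega>) \<omega>) - (\<omega> j (stopt (\<tau> (Suc n)) (stopt (a r) t \<omega>) \<omega>) - \<omega> j (stopt (\<tau> n) (stopt (a r) t \<omega>) \<omega>))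
        = \<omega> j (stopt (b' (r, n, j)) t \<omega>) - \<omega> j (stopt (a' (r, n, j)) t \<omega>)" for n j
      proof -
        have "a r \<omega> \<le> b r \<omega>" using s r \<omega> unfolding strategy_def by auto
        from min_max_rectangle[OF this h(2)[OF \<omega>, of n], of "\<lambda>z. \<omega> j (enn2real z)" "ennreal t"]
        show ?thesis unfolding a'_def b'_def fst_conv snd_conv stopt_def[of "\<tau> _"] ennreal_stopt
          unfolding stopt_def .
      qed
      then show ?thesis by (simp add: sum_subtractf[symmetric] right_diff_distrib[symmetric])
    qed
    then show ?thesis unfolding gains_def I'_def k'_def
      by (simp add: sum.cartesian_product' sum_distrib_left mult.assoc del: add_diff_cancel_left)
  qed
  obtain Z where Z: "superhedges J Jstar c UNIV (\<lambda>t \<omega>. c + gains I' (\<lambda>r t \<omega>. \<omega> (snd (snd r)) t) a' b' k' t \<omega>) Y Z"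
    using coordinate_superhedges[OF s' _ J c Y, of "\<lambda>r. snd (snd r)"] unfolding I'_def by auto
  have "superhedges J Jstar c E (\<lambda>t \<omega>. c + gains I (\<lambda>_. ?x) a b k t \<omega>) Y Z"
    using Z unfolding superhedges_def by (simp add: eq cong: ball_cong)
  then show "\<exists>Z. superhedges J Jstar c E (\<lambda>t \<omega>. c + gains I (\<lambda>_. ?x) a b k t \<omega>) Y Z" by blast
qed

section \<open>Path properties and tradability of continuous martingales\<close>

definition proper :: "nat \<Rightarrow> (real \<Rightarrow> (nat \<Rightarrow> real \<Rightarrow> real) \<Rightarrow> real option) \<Rightarrow> bool" where
  "proper J X \<longleftrightarrow> (\<forall>t\<ge>0. \<forall>\<omega>\<in>Omega J. \<forall>\<omega>'\<in>Omega J. agree J \<omega> \<omega>' (ennreal t) \<longrightarrow> X t \<omega> = X t \<omega>') \<and>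
     (\<forall>\<omega>\<in>Omega J. 0 \<in> {t. 0 \<le> t \<and> X t \<omega> \<noteq> None} \<and> connected {t. 0 \<le> t \<and> X t \<omega> \<noteq> None} \<and>
        continuous_on {t. 0 \<le> t \<and> X t \<omega> \<noteq> None} (\<lambda>t. the (X t \<omega>)))"

lemma proper_down:
  assumes "proper J X" "\<omega> \<in> Omega J" "X t \<omega> \<noteq> None" "0 \<le> s" "s \<le> t"
  shows "X s \<omega> \<noteq> None"
proof -
  have "0 \<in> {t. 0 \<le> t \<and> X t \<omega> \<noteq> None}" "connected {t. 0 \<le> t \<and> X t \<omega> \<noteq> None}" using assms unfolding proper_def by auto
  from connected_contains_Icc[OF this(2,1), of t] assms show ?thesis by auto
qed

lemma continuous_on_atLeastI:
  fixes f :: "real \<Rightarrow> 'b::topological_space"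
  assumes "\<And>u. 0 \<le> u \<Longrightarrow> continuous_on {0..u} f"
  shows "continuous_on {0..} f"
  unfolding continuous_on_def
proof
  fix x :: real assume x: "x \<in> {0..}"
  have "(f \<longlongrightarrow> f x) (at x within {0..x+1})" using assms[of "x + 1"] x unfolding continuous_on_def by auto
  moreover have "at x within {0..} = at x within {0..x+1}"
    using x by (intro at_within_nhd[of x "{..<x+1}"]) auto
  ultimately show "(f \<longlongrightarrow> f x) (at x within {0..})" by simp
qed

lemma continuous_on_stopt: "continuous_on {0..} (\<lambda>t. stopt \<tau> t \<omega>)"
proof (cases "\<tau> \<omega> = \<infinity>")
  case True
  then show ?thesis unfolding stopt_def by (intro continuous_on_eq[OF continuous_on_id]) (auto simp: min_def top_unique)
next
  case False
  then obtain u where u: "\<tau> \<omega> = ennreal u" "0 \<le> u" by (cases "\<tau> \<omega>") auto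
  have "stopt \<tau> t \<omega> = min u t" if "t \<in> {0..}" for t using u that unfolding stopt_def by (auto simp: min_def)
  then show ?thesis by (subst continuous_on_cong[OF refl]) (auto intro!: continuous_intros)
qed

lemma simple_capital_proper:
  assumes "simple_capital J Jstar K" "Jstar \<le> J"
  shows "proper J (\<lambda>t \<omega>. Some (K t \<omega>))" "\<exists>c. \<forall>\<omega>. K 0 \<omega> = c" "tradable J Jstar UNIV K"
proof -
  obtain \<tau> h c' where h: "\<And>n. nonanticipating J (\<tau> n)" "\<And>n \<omega>. \<omega> \<in> Omega J \<Longrightarrow> \<tau> n \<omega> \<le> \<tau> (Suc n) \<omega>"
    "\<And>\<omega> u. \<omega> \<in> Omega J \<Longrightarrow> \<exists>N. \<forall>n\<ge>N. ennreal u \<le> \<tau> n \<omega>" "\<And>n. tau_measurable J (\<tau> n) (h n)"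
    "\<And>n. \<exists>B. \<forall>\<omega>\<in>Omega J. \<forall>j<Jstar. \<bar>h n \<omega> j\<bar> \<le> B"
    "\<And>t \<omega>. K t \<omega> = c' + (\<Sum>n. \<Sum>j<Jstar. h n \<omega> j * (\<omega> j (stopt (\<tau> (Suc n)) t \<omega>) - \<omega> j (stopt (\<tau> n) t \<omega>)))"
    "\<And>\<omega>. K 0 \<omega> = c'" by (rule simple_capital_cases[OF assms(1)]) (rule that; assumption)
  show "\<exists>c. \<forall>\<omega>. K 0 \<omega> = c" using h(7) by blast
  define x where "x N t \<omega> = c' + (\<Sum>n<N. \<Sum>j<Jstar. h n \<omega> j * (\<omega> j (stopt (\<tau> (Suc n)) t \<omega>) - \<omega> j (stopt (\<tau> n) t \<omega>)))" for N t \<omega>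
  \<comment> \<open>On a bounded time interval only finitely many trading periods matter, so the
    truncations equal \<open>K\<close> from some index on and uniform convergence is
    trivial.\<close>
  have Kx: "\<exists>N. \<forall>n\<ge>N. \<forall>s\<in>{0..t}. K s \<omega> = x n s \<omega>" if \<omega>: "\<omega> \<in> Omega J" for t \<omega>
  proof -
    obtain N where N: "\<forall>n\<ge>N. ennreal t \<le> \<tau> n \<omega>" using h(3)[OF \<omega>] by blast
    have "K s \<omega> = x n s \<omega>" if "n \<ge> N" "s \<in> {0..t}" for n s
    proof -
      have "ennreal s \<le> ennreal t" using that by (intro ennreal_leI) auto
      also have "\<dots> \<le> \<tau> n \<omega>" using N that by blast
      finally show ?thesis unfolding h(6) x_def using that h(2)[OF \<omega>] by (subst sum_stop[where N = n]) auto
    qed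
    then show ?thesis by blast
  qed
  show "tradable J Jstar UNIV K"
  proof (rule tradable_limit[where E = "\<lambda>_. UNIV" and x = x])
    show "tradable J Jstar UNIV (x N)" for N
      unfolding x_def using tradable_finite[of J \<tau> h Jstar UNIV c' N] h assms(2) by blast
    fix t \<omega> and e :: real assume "\<omega> \<in> Omega J" "0 < e"
    then show "\<forall>\<^sub>F k in sequentially. \<forall>s\<in>{0..t}. \<bar>x k s \<omega> - K s \<omega>\<bar> \<le> e"
      unfolding eventually_sequentially using Kx[of \<omega> t] by fastforce
  qed simp
  have "K t \<omega> = K t \<omega>'" if t: "0 \<le> t" and \<omega>: "\<omega> \<in> Omega J" "\<omega>' \<in> Omega J" and ag: "agree J \<omega> \<omega>' (ennreal t)" for t \<omega> \<omega>'
  proof -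
    have "(\<Sum>j<Jstar. h n \<omega> j * (\<omega> j (stopt (\<tau> (Suc n)) t \<omega>) - \<omega> j (stopt (\<tau> n) t \<omega>))) =
      (\<Sum>j<Jstar. h n \<omega>' j * (\<omega>' j (stopt (\<tau> (Suc n)) t \<omega>') - \<omega>' j (stopt (\<tau> n) t \<omega>')))" for n
    proof (cases "\<tau> n \<omega> \<le> ennreal t")
      case True
      have hh: "h n \<omega> = h n \<omega>'" using h(4)[of n] \<omega> agree_mono[OF ag True] unfolding tau_measurable_def by blast
      have st: "stopt (\<tau> m) t \<omega>' = stopt (\<tau> m) t \<omega>" for m
        using nonanticipating_agree[OF h(1)[of m] \<omega> ag] t by (cases "\<tau> m \<omega> \<le> ennreal t") (auto simp: stopt_def min_def)
      have "\<omega> j (stopt (\<tau> m) t \<omega>) = \<omega>' j (stopt (\<tau> m) t \<omega>)" if "j < Jstar" for j m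
        using ag that assms(2) ennreal_stopt[of "\<tau> m" t \<omega>] unfolding agree_def by auto
      then show ?thesis unfolding hh st by simp
    next
      case False
      then have F: "\<not> \<tau> n \<omega>' \<le> ennreal t" using nonanticipating_agree(1)[OF h(1)[of n] \<omega> ag] by simp
      have "stopt (\<tau> n) t \<omega> = t" "stopt (\<tau> (Suc n)) t \<omega> = t" "stopt (\<tau> n) t \<omega>' = t" "stopt (\<tau> (Suc n)) t \<omega>' = t"
        using False F h(2)[OF \<omega>(1), of n] h(2)[OF \<omega>(2), of n] t by (auto intro!: stopt_eq simp: not_le intro: order_trans less_imp_le)
      then show ?thesis by simp
    qed
    then show ?thesis unfolding h(6) by simp
  qed
  moreover have "continuous_on {0..} (\<lambda>t. K t \<omega>)" if \<omega>: "\<omega> \<in> Omega J" for \<omega>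
  proof (rule continuous_on_atLeastI)
    fix u :: real
    obtain N where N: "\<forall>s\<in>{0..u}. K s \<omega> = x N s \<omega>" using Kx[OF \<omega>] by blast
    have "continuous_on {0..u} (\<lambda>t. \<omega> j (stopt (\<tau> n) t \<omega>))" for n j
      by (rule continuous_on_compose2[OF Omega_cont[OF \<omega>, of UNIV] continuous_on_subset[OF continuous_on_stopt]]) auto
    then have "continuous_on {0..u} (\<lambda>t. x N t \<omega>)" unfolding x_def by (intro continuous_intros)
    then show "continuous_on {0..u} (\<lambda>t. K t \<omega>)" using N by (subst continuous_on_cong[OF refl]) auto
  qed
  moreover have "{t::real. 0 \<le> t} = {0..}" by auto
  ultimately show "proper J (\<lambda>t \<omega>. Some (K t \<omega>))" unfolding proper_def
    by (auto simp: connected_iff_interval)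
qed

lemma quasi_always_all:
  assumes "\<And>t \<omega>. 0 \<le> t \<Longrightarrow> \<omega> \<in> Omega J \<Longrightarrow> (t, \<omega>) \<in> E"
  shows "quasi_always J Jstar E"
proof -
  define \<tau> :: "nat \<Rightarrow> (nat \<Rightarrow> real \<Rightarrow> real) \<Rightarrow> ennreal" where "\<tau> = (\<lambda>n _. of_nat n)"
  have "simple_capital J Jstar (\<lambda>t \<omega>. 1)" unfolding simple_capital_def
  proof (rule exI[of _ 1], rule exI[of _ \<tau>], rule exI[of _ "\<lambda>_ _ _. 0"], intro conjI)
    show "\<forall>\<omega>\<in>Omega J. (\<lambda>n. \<tau> n \<omega>) \<longlonglongrightarrow> \<infinity>" unfolding \<tau>_def using of_nat_tendsto_top_ennreal by simp
  qed (auto simp: stopping_time_def tau_measurable_def \<tau>_def)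
  then have "(\<lambda>t \<omega>. ennreal 1) \<in> nn_supermart J Jstar" by (intro nn_supermart.simple) auto
  then show ?thesis unfolding quasi_always_def using assms by (intro bexI[of _ "\<lambda>t \<omega>. ennreal 1"]) auto
qed

text \<open>The four properties are proved together because the limit step needs path continuity of
  the approximants before the suprema in the definition of convergence can be exploited.\<close>

lemma cont_martingale_props:
  assumes "X \<in> cont_martingales J Jstar" "Jstar \<le> J"
  shows "proper J X \<and> (\<exists>c. \<forall>\<omega>\<in>Omega J. X 0 \<omega> = Some c) \<and> quasi_always J Jstar (pdom J X) \<and>
     tradable J Jstar (pdom J X) (\<lambda>t \<omega>. the (X t \<omega>))"
  using assms(1)
proof induction
  case (simple K)
  have "tradable J Jstar (pdom J (\<lambda>t \<omega>. Some (K t \<omega>))) K"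
    by (rule tradable_limit[where E = "\<lambda>_. UNIV" and x = "\<lambda>_. K"]) (use simple_capital_proper[OF simple assms(2)] in auto)
  moreover have "quasi_always J Jstar (pdom J (\<lambda>t \<omega>. Some (K t \<omega>)))"
    by (rule quasi_always_all) (auto simp: pdom_def)
  ultimately show ?case using simple_capital_proper[OF simple assms(2)] by auto
next
  case (limit X Xs)
  have p: "proper J X" using limit(1) unfolding cont_process_def proper_def by blast
  have D: "X s \<omega> \<noteq> None" "Xs k s \<omega> \<noteq> None" if "(t, \<omega>) \<in> pdom J X" "s \<in> {0..t}" for t s \<omega> k
  proof -
    have "(t, \<omega>) \<in> pdom J (Xs k)" using limit(3) that by blast
    then show "X s \<omega> \<noteq> None" "Xs k s \<omega> \<noteq> None" using that proper_down[OF p, of \<omega> t s] proper_down[of J "Xs k" \<omega> t s] limit.IH[of k]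
      unfolding pdom_def by auto
  qed
  \<comment> \<open>A real \<open>Sup\<close> bounds the elements only if the set is bounded above;
    continuity of both paths on the compact interval provides this.\<close>
  have bd: "\<bar>the (Xs k s \<omega>) - the (X s \<omega>)\<bar> \<le> Sup ((\<lambda>s. \<bar>the (Xs k s \<omega>) - the (X s \<omega>)\<bar>) ` {0..t})"
    if d: "(t, \<omega>) \<in> pdom J X" and s: "s \<in> {0..t}" for t \<omega> s k
  proof (rule cSup_upper)
    have \<omega>: "\<omega> \<in> Omega J" using d unfolding pdom_def by simp
    have "continuous_on {0..t} (\<lambda>t. the (X t \<omega>))"
      by (rule continuous_on_subset[of "{t. 0 \<le> t \<and> X t \<omega> \<noteq> None}"]) (use p \<omega> D[OF d] in \<open>auto simp: proper_def\<close>)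
    moreover have "continuous_on {0..t} (\<lambda>t. the (Xs k t \<omega>))"
      by (rule continuous_on_subset[of "{t. 0 \<le> t \<and> Xs k t \<omega> \<noteq> None}"]) (use limit.IH[of k] \<omega> D(2)[OF d, of _ k] in \<open>auto simp: proper_def\<close>)
    ultimately have "continuous_on {0..t} (\<lambda>s. \<bar>the (Xs k s \<omega>) - the (X s \<omega>)\<bar>)" by (intro continuous_intros)
    then show "bdd_above ((\<lambda>s. \<bar>the (Xs k s \<omega>) - the (X s \<omega>)\<bar>) ` {0..t})"
      by (intro bounded_imp_bdd_above compact_imp_bounded compact_continuous_image) auto
  qed (use s in auto)
  have "\<exists>c. \<forall>\<omega>\<in>Omega J. X 0 \<omega> = Some c"
  proof -
    obtain c where c: "\<And>k \<omega>. \<omega> \<in> Omega J \<Longrightarrow> Xs k 0 \<omega> = Some (c k)" using limit.IH by metis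
    have "c \<longlonglongrightarrow> the (X 0 \<omega>)" if \<omega>: "\<omega> \<in> Omega J" for \<omega>
    proof -
      have "(0, \<omega>) \<in> pdom J X" using p \<omega> unfolding proper_def pdom_def by auto
      from limit(4)[OF this] have "(\<lambda>k. \<bar>c k - the (X 0 \<omega>)\<bar>) \<longlonglongrightarrow> 0" using c[OF \<omega>] by simp
      then show ?thesis by (simp add: tendsto_rabs_zero_iff LIM_zero_iff)
    qed
    then have "the (X 0 \<omega>) = lim c" if "\<omega> \<in> Omega J" for \<omega> using that limI by metis
    moreover have "X 0 \<omega> \<noteq> None" if "\<omega> \<in> Omega J" for \<omega> using p that unfolding proper_def by auto
    ultimately show ?thesis by (metis option.exhaust_sel)
  qed
  moreover have "tradable J Jstar (pdom J X) (\<lambda>t \<omega>. the (X t \<omega>))"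
  proof (rule tradable_limit)
    show "tradable J Jstar (pdom J (Xs k)) (\<lambda>t \<omega>. the (Xs k t \<omega>))" for k using limit.IH by blast
    show "pdom J X \<subseteq> pdom J (Xs k)" for k by (rule limit(3))
    fix t \<omega> and e :: real assume d: "(t, \<omega>) \<in> pdom J X" and e: "0 < e"
    from order_tendstoD(2)[OF limit(4)[OF d] e]
    show "\<forall>\<^sub>F k in sequentially. \<forall>s\<in>{0..t}. \<bar>the (Xs k s \<omega>) - the (X s \<omega>)\<bar> \<le> e"
    proof eventually_elim
      case (elim k)
      then show ?case using bd[OF d, of _ k] by (meson less_imp_le order_trans)
    qed
  qed
  moreover have "quasi_always J Jstar (pdom J X)" using limit(1) unfolding cont_process_def by blast
  ultimately show ?case using p by blast
qed

section \<open>Bets on crossing patterns\<close>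

abbreviation crossing_time :: "real set \<Rightarrow> real \<Rightarrow> (real \<Rightarrow> real) \<Rightarrow> nat \<Rightarrow> ennreal" where
  "crossing_time D \<delta> \<phi> k \<equiv> cross D \<delta> (\<lambda>r t. \<bar>\<phi> t - \<phi> r\<bar>) k"

definition crossing_before where "crossing_before D \<delta> \<phi> k t = enn2real (min (crossing_time D \<delta> \<phi> k) (ennreal t))"

definition sign_of :: "bool \<Rightarrow> real" where "sign_of b = (if b then 1 else -1)"

definition follows :: "real set \<Rightarrow> real \<Rightarrow> bool list \<Rightarrow> (real \<Rightarrow> real) \<Rightarrow> nat \<Rightarrow> bool" where
  "follows D \<delta> p \<phi> m \<longleftrightarrow> (\<forall>i<m. crossing_time D \<delta> \<phi> (Suc i) \<noteq> \<infinity> \<and>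
     \<phi> (enn2real (crossing_time D \<delta> \<phi> (Suc i))) - \<phi> (enn2real (crossing_time D \<delta> \<phi> i)) = sign_of (p ! i) * \<delta>)"

text \<open>After \<open>m\<close> correct moves the capital is 2^m / 2^length. Staking all of it on
  the next sign, divided by the step \<open>\<delta>\<close>, makes a correct move double the
  capital and a wrong one exhaust it.\<close>

definition stake :: "real set \<Rightarrow> real \<Rightarrow> bool list \<Rightarrow> (real \<Rightarrow> real) \<Rightarrow> nat \<Rightarrow> real" where
  "stake D \<delta> p \<phi> m = (if follows D \<delta> p \<phi> m then 2 ^ m / 2 ^ length p * sign_of (p ! m) / \<delta> else 0)"

definition bet_value :: "real set \<Rightarrow> real \<Rightarrow> bool list \<Rightarrow> (real \<Rightarrow> real) \<Rightarrow> real \<Rightarrow> real" where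
  "bet_value D \<delta> p \<phi> t = 1 / 2 ^ length p +
     (\<Sum>m<length p. stake D \<delta> p \<phi> m * (\<phi> (crossing_before D \<delta> \<phi> (Suc m) t) - \<phi> (crossing_before D \<delta> \<phi> m t)))"

lemma sign_of_abs [simp]: "\<bar>sign_of b\<bar> = 1" "sign_of b * sign_of b = 1" unfolding sign_of_def by auto
lemma sign_of_eq [simp]: "sign_of a = sign_of b \<longleftrightarrow> a = b" unfolding sign_of_def by auto

locale path_crossing =
  fixes D :: "real set" and \<delta> :: real and \<phi> :: "real \<Rightarrow> real"
  assumes pos': "0 < \<delta>" and D0': "0 \<in> D" and Dpos': "\<And>t. t \<in> D \<Longrightarrow> 0 \<le> t"
    and Ddown': "\<And>s t. t \<in> D \<Longrightarrow> 0 \<le> s \<Longrightarrow> s \<le> t \<Longrightarrow> s \<in> D"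
    and \<phi>cont: "continuous_on D \<phi>"
begin

sublocale crossing D \<delta> "\<lambda>r t. \<bar>\<phi> t - \<phi> r\<bar>"
proof
  show "0 < \<delta>" "0 \<in> D" by (rule pos', rule D0')
  show "0 \<le> t" if "t \<in> D" for t using that by (rule Dpos')
  show "s \<in> D" if "t \<in> D" "0 \<le> s" "s \<le> t" for s t using that by (rule Ddown')
  show "\<bar>\<phi> r - \<phi> r\<bar> = 0" for r by simp
  show "continuous_on D (\<lambda>t. \<bar>\<phi> t - \<phi> r\<bar>)" for r by (intro continuous_intros \<phi>cont)
qed

lemma crossing_before_eqs: "t \<in> D \<Longrightarrow> T m \<le> ennreal t \<Longrightarrow> crossing_before D \<delta> \<phi> m t = \<tau> m"
  "t \<in> D \<Longrightarrow> ennreal t \<le> T m \<Longrightarrow> crossing_before D \<delta> \<phi> m t = t"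
  using Dpos[of t] unfolding crossing_before_def by (auto simp: min_def)

lemma follows_Suc: "follows D \<delta> p \<phi> (Suc m) \<longleftrightarrow> follows D \<delta> p \<phi> m \<and> T (Suc m) \<noteq> \<infinity> \<and> \<phi> (\<tau> (Suc m)) - \<phi> (\<tau> m) = sign_of (p ! m) * \<delta>"
  unfolding follows_def by (auto simp: less_Suc_eq)

text \<open>Each completed crossing multiplies the capital by 1 + 1 or by 1 - 1.\<close>

lemma bet_value_partial:
  assumes t: "t \<in> D" "T M \<le> ennreal t"
  shows "1 / 2 ^ length p + (\<Sum>m<M. stake D \<delta> p \<phi> m * (\<phi> (crossing_before D \<delta> \<phi> (Suc m) t) - \<phi> (crossing_before D \<delta> \<phi> m t)))
    = (if follows D \<delta> p \<phi> M then 2 ^ M / 2 ^ length p else 0)"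
  using t(2)
proof (induction M)
  case 0 show ?case by (simp add: follows_def)
next
  case (Suc M)
  have le: "T M \<le> ennreal t" using Suc.prems mono_Suc[of M] by (rule order_trans[rotated])
  have f: "T (Suc M) \<noteq> \<infinity>" using Suc.prems le_iff[OF t(1)] by blast
  have e: "crossing_before D \<delta> \<phi> (Suc M) t = \<tau> (Suc M)" "crossing_before D \<delta> \<phi> M t = \<tau> M" using crossing_before_eqs(1)[OF t(1)] Suc.prems le by auto
  have "\<bar>\<phi> (\<tau> (Suc M)) - \<phi> (\<tau> M)\<bar> = \<delta>" using \<tau>_step(2)[OF f] .
  then have d: "\<phi> (\<tau> (Suc M)) - \<phi> (\<tau> M) = \<delta> \<or> \<phi> (\<tau> (Suc M)) - \<phi> (\<tau> M) = - \<delta>" by linarith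
  show ?case
  proof (cases "follows D \<delta> p \<phi> M")
    case False
    then show ?thesis using Suc.IH[OF le] by (simp add: follows_Suc stake_def)
  next
    case True
    have "1 / 2 ^ length p + (\<Sum>m<Suc M. stake D \<delta> p \<phi> m * (\<phi> (crossing_before D \<delta> \<phi> (Suc m) t) - \<phi> (crossing_before D \<delta> \<phi> m t)))
      = 2 ^ M / 2 ^ length p * (1 + sign_of (p ! M) * (\<phi> (\<tau> (Suc M)) - \<phi> (\<tau> M)) / \<delta>)"
    proof -
      have "1 / 2 ^ length p + (\<Sum>m<Suc M. stake D \<delta> p \<phi> m * (\<phi> (crossing_before D \<delta> \<phi> (Suc m) t) - \<phi> (crossing_before D \<delta> \<phi> m t)))
        = 2 ^ M / 2 ^ length p + stake D \<delta> p \<phi> M * (\<phi> (\<tau> (Suc M)) - \<phi> (\<tau> M))"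
        using Suc.IH[OF le] True e by simp
      also have "\<dots> = 2 ^ M / 2 ^ length p * (1 + sign_of (p ! M) * (\<phi> (\<tau> (Suc M)) - \<phi> (\<tau> M)) / \<delta>)"
        using True unfolding stake_def by (simp add: distrib_left)
      finally show ?thesis .
    qed
    also have "\<dots> = (if follows D \<delta> p \<phi> (Suc M) then 2 ^ Suc M / 2 ^ length p else 0)"
    proof -
      define x where "x = \<phi> (\<tau> (Suc M)) - \<phi> (\<tau> M)"
      have "x = \<delta> \<or> x = - \<delta>" using d unfolding x_def .
      then show ?thesis using True f pos unfolding follows_Suc x_def[symmetric] by (auto simp: sign_of_def)
    qed
    finally show ?thesis .
  qed
qed

lemma bet_value_cases:
  assumes t: "t \<in> D"
  shows "(\<exists>M<length p. T M \<le> ennreal t \<and> ennreal t < T (Suc M) \<and>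
      bet_value D \<delta> p \<phi> t = (if follows D \<delta> p \<phi> M then 2 ^ M / 2 ^ length p * (1 + sign_of (p ! M) * (\<phi> t - \<phi> (\<tau> M)) / \<delta>) else 0)) \<or>
    (T (length p) \<le> ennreal t \<and> bet_value D \<delta> p \<phi> t = (if follows D \<delta> p \<phi> (length p) then 1 else 0))"
proof (cases "T (length p) \<le> ennreal t")
  case True
  then show ?thesis using bet_value_partial[OF t True, of p] unfolding bet_value_def by simp
next
  case False
  define M where "M = (GREATEST m. m \<le> length p \<and> T m \<le> ennreal t)"
  have M: "M \<le> length p" "T M \<le> ennreal t"
    using GreatestI_nat[of "\<lambda>m. m \<le> length p \<and> T m \<le> ennreal t" 0 "length p"] unfolding M_def by auto
  have G: "m \<le> M" if "m \<le> length p" "T m \<le> ennreal t" for m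
    using Greatest_le_nat[of "\<lambda>m. m \<le> length p \<and> T m \<le> ennreal t" m "length p"] that unfolding M_def by auto
  have M': "M < length p" using M False by (metis le_neq_implies_less)
  then have lt: "ennreal t < T (Suc M)" using G[of "Suc M"] by (meson Suc_leI Suc_n_not_le_n not_le)
  have z: "\<phi> (crossing_before D \<delta> \<phi> (Suc m) t) - \<phi> (crossing_before D \<delta> \<phi> m t) = 0" if "m \<in> {Suc M..<length p}" for m
  proof -
    have "T (Suc M) \<le> T m" "T (Suc M) \<le> T (Suc m)" using that by (auto intro!: mono)
    then have "ennreal t \<le> T m" "ennreal t \<le> T (Suc m)" using lt by auto
    then show ?thesis using crossing_before_eqs(2)[OF t] by simp
  qed
  have "(\<Sum>m<length p. stake D \<delta> p \<phi> m * (\<phi> (crossing_before D \<delta> \<phi> (Suc m) t) - \<phi> (crossing_before D \<delta> \<phi> m t)))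
    = (\<Sum>m<Suc M. stake D \<delta> p \<phi> m * (\<phi> (crossing_before D \<delta> \<phi> (Suc m) t) - \<phi> (crossing_before D \<delta> \<phi> m t)))"
    using M' z by (intro sum.mono_neutral_right) auto
  then have "bet_value D \<delta> p \<phi> t = (if follows D \<delta> p \<phi> M then 2 ^ M / 2 ^ length p else 0) + stake D \<delta> p \<phi> M * (\<phi> t - \<phi> (\<tau> M))"
    using bet_value_partial[OF t M(2), of p] crossing_before_eqs(1)[OF t M(2)] crossing_before_eqs(2)[OF t less_imp_le[OF lt]] unfolding bet_value_def by simp
  then show ?thesis using M' M(2) lt by (intro disjI1 exI[of _ M]) (auto simp: stake_def distrib_left)
qed

text \<open>Before the next crossing the path is less than \<open>\<delta>\<close> away from the
  last crossing position, so the linear interpolation stays between 0 and the doubled capital, which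
  never exceeds 1.\<close>

lemma bet_value_bounds:
  assumes t: "t \<in> D"
  shows "0 \<le> bet_value D \<delta> p \<phi> t" "bet_value D \<delta> p \<phi> t \<le> 1"
proof -
  have "0 \<le> bet_value D \<delta> p \<phi> t \<and> bet_value D \<delta> p \<phi> t \<le> 1"
    using bet_value_cases[OF t, of p]
  proof
    assume "\<exists>M<length p. T M \<le> ennreal t \<and> ennreal t < T (Suc M) \<and>
      bet_value D \<delta> p \<phi> t = (if follows D \<delta> p \<phi> M then 2 ^ M / 2 ^ length p * (1 + sign_of (p ! M) * (\<phi> t - \<phi> (\<tau> M)) / \<delta>) else 0)"
    then obtain M where M: "M < length p" "T M \<le> ennreal t" "ennreal t < T (Suc M)"
      and v: "bet_value D \<delta> p \<phi> t = (if follows D \<delta> p \<phi> M then 2 ^ M / 2 ^ length p * (1 + sign_of (p ! M) * (\<phi> t - \<phi> (\<tau> M)) / \<delta>) else 0)" by blast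
    have "T M \<noteq> \<infinity>" "\<tau> M \<le> t" using le_iff[OF t] M(2) by auto
    then have "\<bar>\<phi> t - \<phi> (\<tau> M)\<bar> < \<delta>" using \<tau>_last[OF _ t _ M(3)] by simp
    then have "\<bar>sign_of (p ! M) * (\<phi> t - \<phi> (\<tau> M)) / \<delta>\<bar> \<le> 1" using pos by (simp add: abs_mult)
    then have b: "0 \<le> 1 + sign_of (p ! M) * (\<phi> t - \<phi> (\<tau> M)) / \<delta>" "1 + sign_of (p ! M) * (\<phi> t - \<phi> (\<tau> M)) / \<delta> \<le> 2" by linarith+
    have "2 ^ M / 2 ^ length p * (1 + sign_of (p ! M) * (\<phi> t - \<phi> (\<tau> M)) / \<delta>) \<le> 2 ^ M / 2 ^ length p * 2"
      using b(2) by (intro mult_left_mono) auto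
    also have "\<dots> = (2::real) ^ Suc M / 2 ^ length p" by simp
    also have "\<dots> \<le> 1" using M(1) by (simp del: power_Suc add: power_increasing)
    finally show ?thesis unfolding v using b(1) by auto
  qed auto
  then show "0 \<le> bet_value D \<delta> p \<phi> t" "bet_value D \<delta> p \<phi> t \<le> 1" by auto
qed

lemma bet_value_final:
  assumes "t \<in> D" "T (length p) \<le> ennreal t"
  shows "bet_value D \<delta> p \<phi> t = (if follows D \<delta> p \<phi> (length p) then 1 else 0)"
  using bet_value_partial[OF assms, of p] unfolding bet_value_def by simp

text \<open>The domain is compared only up to the crossing as well, because for a martingale the
  moment of explosion is not known in advance.\<close>

lemma crossing_time_local_le:
  assumes D': "\<And>t. t \<in> D' \<Longrightarrow> 0 \<le> t"
    and ag: "\<And>s. 0 \<le> s \<Longrightarrow> ennreal s \<le> T m \<Longrightarrow> (s \<in> D' \<longleftrightarrow> s \<in> D) \<and> \<phi>' s = \<phi> s"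
  shows "i \<le> m \<Longrightarrow> crossing_time D' \<delta> \<phi>' i = T i" "follows D' \<delta> p \<phi>' m \<longleftrightarrow> follows D \<delta> p \<phi> m"
proof -
  show *: "crossing_time D' \<delta> \<phi>' i = T i" if i: "i \<le> m" for i
  proof (rule cross_local)
    show "T i = \<infinity> \<longrightarrow> D' = D \<and> (\<forall>r\<in>D. \<forall>t\<in>D. \<bar>\<phi>' t - \<phi>' r\<bar> = \<bar>\<phi> t - \<phi> r\<bar>)"
    proof
      assume "T i = \<infinity>"
      then have "T m = \<infinity>" using mono[OF i] by (simp add: top_unique)
      then have a: "(s \<in> D' \<longleftrightarrow> s \<in> D) \<and> \<phi>' s = \<phi> s" if "0 \<le> s" for s using ag[OF that] by simp
      have "D' = D" using a D' Dpos by blast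
      then show "D' = D \<and> (\<forall>r\<in>D. \<forall>t\<in>D. \<bar>\<phi>' t - \<phi>' r\<bar> = \<bar>\<phi> t - \<phi> r\<bar>)" using a Dpos by simp
    qed
    fix t assume t: "0 \<le> t" "T i = ennreal t"
    have a: "(s \<in> D' \<longleftrightarrow> s \<in> D) \<and> \<phi>' s = \<phi> s" if "0 \<le> s" "s \<le> t" for s
    proof (rule ag[OF that(1)])
      have "ennreal s \<le> T i" unfolding t(2) using that(2) by (rule ennreal_leI)
      then show "ennreal s \<le> T m" using mono[OF i] by simp
    qed
    have "t \<in> D" using fin(1)[of i] t by simp
    then show "t \<in> D' \<and> (\<forall>s. 0 \<le> s \<and> s \<le> t \<longrightarrow> (s \<in> D') = (s \<in> D)) \<and> (\<forall>r s. 0 \<le> r \<and> r \<le> s \<and> s \<le> t \<longrightarrow> \<bar>\<phi>' s - \<phi>' r\<bar> = \<bar>\<phi> s - \<phi> r\<bar>)"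
      using a t by auto
  qed
  have v: "\<phi>' (\<tau> i) = \<phi> (\<tau> i)" if "i \<le> m" for i
  proof -
    have "ennreal (\<tau> i) \<le> T i" by (cases "T i") auto
    then show ?thesis using ag[of "\<tau> i"] mono[OF that] by auto
  qed
  show "follows D' \<delta> p \<phi>' m \<longleftrightarrow> follows D \<delta> p \<phi> m"
    unfolding follows_def using * v by (intro all_cong1 imp_cong refl) auto
qed

end

lemma path_crossing_Cpaths: "\<phi> \<in> Cpaths \<Longrightarrow> 0 < \<delta> \<Longrightarrow> path_crossing {0..} \<delta> \<phi>"
  by unfold_locales (auto intro: Cpaths_cont)

text \<open>Riemann sums of the position over deterministic times approximate the value of a bet, so its Brownian
  expectation needs no optional stopping.\<close>

definition position :: "real \<Rightarrow> bool list \<Rightarrow> real \<Rightarrow> (real \<Rightarrow> real) \<Rightarrow> real" where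
  "position \<delta> p u \<phi> = (\<Sum>m<length p. if crossing_time {0..} \<delta> \<phi> m \<le> ennreal u \<and> ennreal u < crossing_time {0..} \<delta> \<phi> (Suc m) then stake {0..} \<delta> p \<phi> m else 0)"

lemma position_bound:
  assumes "0 < \<delta>" shows "\<bar>position \<delta> p u \<phi>\<bar> \<le> real (length p) / \<delta>"
proof -
  have "\<bar>position \<delta> p u \<phi>\<bar> \<le> (\<Sum>m<length p. 1 / \<delta>)" unfolding position_def
  proof (rule order_trans[OF sum_abs], rule sum_mono)
    fix m assume "m \<in> {..<length p}"
    then have "(2::real) ^ m \<le> 2 ^ length p" by (intro power_increasing) auto
    then have "2 ^ m / 2 ^ length p / \<delta> \<le> 1 / \<delta>" using assms by (intro divide_right_mono) auto
    then show "\<bar>if crossing_time {0..} \<delta> \<phi> m \<le> ennreal u \<and> ennreal u < crossing_time {0..} \<delta> \<phi> (Suc m) then stake {0..} \<delta> p \<phi> m else 0\<bar> \<le> 1 / \<delta>"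
      using assms by (auto simp: stake_def abs_mult)
  qed
  then show ?thesis by simp
qed

lemma position_local:
  assumes \<phi>: "\<phi> \<in> Cpaths" "\<phi>' \<in> Cpaths" and \<delta>: "0 < \<delta>" and u: "0 \<le> u" and ag: "\<And>s. 0 \<le> s \<Longrightarrow> s \<le> u \<Longrightarrow> \<phi>' s = \<phi> s"
  shows "position \<delta> p u \<phi>' = position \<delta> p u \<phi>"
proof -
  interpret A: path_crossing "{0..}" \<delta> \<phi> using \<phi> \<delta> by (intro path_crossing_Cpaths)
  interpret B: path_crossing "{0..}" \<delta> \<phi>' using \<phi> \<delta> by (intro path_crossing_Cpaths)
  have z: "\<And>t::real. t \<in> {0..} \<Longrightarrow> 0 \<le> t" by simp
  have 1: "B.T m = A.T m \<and> (follows {0..} \<delta> p \<phi>' m \<longleftrightarrow> follows {0..} \<delta> p \<phi> m)" if le: "A.T m \<le> ennreal u" for m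
  proof -
    have su: "s \<le> u" if "0 \<le> s" "ennreal s \<le> A.T m" for s using order_trans[OF that(2) le] u by simp
    have a: "(s \<in> {0..} \<longleftrightarrow> s \<in> {0..}) \<and> \<phi>' s = \<phi> s" if "0 \<le> s" "ennreal s \<le> A.T m" for s :: real using ag[OF that(1) su[OF that]] by simp
    show ?thesis by (intro conjI A.crossing_time_local_le(1)[of "{0..}" m \<phi>' m, OF z a order_refl] A.crossing_time_local_le(2)[of "{0..}" m \<phi>' p, OF z a])
  qed
  have 2: "A.T m = B.T m" if le: "B.T m \<le> ennreal u" for m
  proof -
    have su: "s \<le> u" if "0 \<le> s" "ennreal s \<le> B.T m" for s using order_trans[OF that(2) le] u by simp
    have a: "(s \<in> {0..} \<longleftrightarrow> s \<in> {0..}) \<and> \<phi> s = \<phi>' s" if "0 \<le> s" "ennreal s \<le> B.T m" for s :: real using ag[OF that(1) su[OF that]] by simp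
    show ?thesis by (rule B.crossing_time_local_le(1)[of "{0..}" m \<phi> m, OF z a order_refl])
  qed
  have 3: "A.T m \<le> ennreal u \<longleftrightarrow> B.T m \<le> ennreal u" for m using 1 2 by metis
  show ?thesis unfolding position_def
  proof (rule sum.cong[OF refl])
    fix m
    show "(if B.T m \<le> ennreal u \<and> ennreal u < B.T (Suc m) then stake {0..} \<delta> p \<phi>' m else 0) = (if A.T m \<le> ennreal u \<and> ennreal u < A.T (Suc m) then stake {0..} \<delta> p \<phi> m else 0)"
      using 1[of m] 3[of m] 3[of "Suc m"] unfolding stake_def by (auto simp: not_le[symmetric])
  qed
qed

text \<open>The position is constant between crossings and changes finitely often, so the Riemann
  sum splits into one grid sum per step of the pattern, each with an error governed by uniform
  continuity through \<open>grid_sum\<close>.\<close>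

lemma bet_value_riemann:
  assumes \<phi>: "\<phi> \<in> Cpaths" and \<delta>: "0 < \<delta>" and t: "0 \<le> t0" "t0 < t"
  shows "(\<lambda>N. \<Sum>i<Suc N. position \<delta> p (t0 + real i * ((t - t0) / real (Suc N))) \<phi> *
      (\<phi> (t0 + real (Suc i) * ((t - t0) / real (Suc N))) - \<phi> (t0 + real i * ((t - t0) / real (Suc N)))))
    \<longlonglongrightarrow> bet_value {0..} \<delta> p \<phi> t - bet_value {0..} \<delta> p \<phi> t0"
proof (rule LIMSEQ_I)
  interpret path_crossing "{0..}" \<delta> \<phi> using \<phi> \<delta> by (intro path_crossing_Cpaths)
  define s where "s N i = t0 + real i * ((t - t0) / real (Suc N))" for N i
  define B where "B = (\<Sum>m<length p. \<bar>stake {0..} \<delta> p \<phi> m\<bar>) + 1"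
  have B: "0 < B" unfolding B_def by (simp add: add_nonneg_pos sum_nonneg)
  fix e :: real assume e: "0 < e"
  \<comment> \<open>The stakes add up to \<open>B\<close> - 1 and each of the grid sums errs by at
    most 4 \<open>\<eta>\<close>, so the total error stays below e/2.\<close>
  define \<eta> where "\<eta> = e / (8 * B)"
  have \<eta>: "0 < \<eta>" unfolding \<eta>_def using e B by simp
  have "uniformly_continuous_on {0..t} \<phi>" by (intro compact_uniformly_continuous Cpaths_cont \<phi>) simp
  then obtain d where d: "d > 0" "\<And>x y. x \<in> {0..t} \<Longrightarrow> y \<in> {0..t} \<Longrightarrow> dist y x < d \<Longrightarrow> dist (\<phi> y) (\<phi> x) < \<eta>"
    unfolding uniformly_continuous_on_def using \<eta> by metis
  obtain N0 :: nat where N0: "(t - t0) / d < real N0" using reals_Archimedean2 by blast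
  have "norm ((\<Sum>i<Suc N. position \<delta> p (s N i) \<phi> * (\<phi> (s N (Suc i)) - \<phi> (s N i))) - (bet_value {0..} \<delta> p \<phi> t - bet_value {0..} \<delta> p \<phi> t0)) < e"
    if N: "N \<ge> N0" for N
  proof -
    have "(t - t0) / d < real (Suc N)" using N0 N by (simp add: less_trans)
    then have mesh: "(t - t0) / real (Suc N) < d" "0 < (t - t0) / real (Suc N)" using d(1) t by (simp_all add: field_simps)
    have sm: "s N i \<le> s N (Suc i)" "s N (Suc i) - s N i < d" for i
    proof -
      have "s N (Suc i) = s N i + (t - t0) / real (Suc N)" unfolding s_def of_nat_Suc[of i] by (simp only: distrib_right mult_1 add.assoc add.commute add.left_commute)
      then show "s N i \<le> s N (Suc i)" "s N (Suc i) - s N i < d" using mesh by auto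
    qed
    have s0: "s N 0 = t0" "s N (Suc N) = t" unfolding s_def using t by auto
    have slt: "s N i < t" if "i < Suc N" for i
    proof -
      have "real i * ((t - t0) / real (Suc N)) < real (Suc N) * ((t - t0) / real (Suc N))" using that mesh by (intro mult_strict_right_mono) auto
      then show ?thesis unfolding s_def using t by simp
    qed
    have st0: "t0 \<le> s N i" for i unfolding s_def using t by simp
    \<comment> \<open>The crossing times clipped to [t0,t]; the holding periods within this interval
      run between consecutive clipped times.\<close>
    define c where "c m = max t0 (crossing_before {0..} \<delta> \<phi> m t)" for m
    have ctle: "crossing_before {0..} \<delta> \<phi> m t \<le> t" for m unfolding crossing_before_def using t by (auto intro!: enn2real_leI simp: min_def)
    have cond: "c m \<le> x \<longleftrightarrow> T m \<le> ennreal x" if "t0 \<le> x" "x < t" for m x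
    proof (cases "T m \<le> ennreal t")
      case True
      then have "crossing_before {0..} \<delta> \<phi> m t = \<tau> m" "T m = ennreal (\<tau> m)" using crossing_before_eqs(1)[of t m] t le_iff[of t m] fin(2)[of m] by auto
      then show ?thesis unfolding c_def using that t ennreal_le_iff[of x "\<tau> m"] by simp
    next
      case False
      then have "crossing_before {0..} \<delta> \<phi> m t = t" using crossing_before_eqs(2)[of t m] t by auto
      moreover have "\<not> T m \<le> ennreal x" using False that by (meson ennreal_leI less_imp_le order_trans)
      ultimately show ?thesis unfolding c_def using that by simp
    qed
    have cdiff: "\<phi> (crossing_before {0..} \<delta> \<phi> m t) - \<phi> (crossing_before {0..} \<delta> \<phi> m t0) = \<phi> (c m) - \<phi> t0" for m
    proof (cases "T m \<le> ennreal t0")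
      case True
      then have "T m \<le> ennreal t" using t by (meson ennreal_leI less_imp_le order_trans)
      then have "crossing_before {0..} \<delta> \<phi> m t = \<tau> m" "crossing_before {0..} \<delta> \<phi> m t0 = \<tau> m" "\<tau> m \<le> t0" using crossing_before_eqs(1)[of t m] crossing_before_eqs(1)[of t0 m] t True le_iff[of t0 m] by auto
      then show ?thesis unfolding c_def by (simp add: max_def)
    next
      case False
      then have 1: "crossing_before {0..} \<delta> \<phi> m t0 = t0" using crossing_before_eqs(2)[of t0 m] t by auto
      have "t0 \<le> crossing_before {0..} \<delta> \<phi> m t"
      proof (cases "T m \<le> ennreal t")
        case True
        then have "crossing_before {0..} \<delta> \<phi> m t = \<tau> m" "T m = ennreal (\<tau> m)" using crossing_before_eqs(1)[of t m] t le_iff[of t m] fin(2)[of m] by auto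
        then show ?thesis using False t by (metis ennreal_leI linear)
      next
        case False
        then show ?thesis using crossing_before_eqs(2)[of t m] t by auto
      qed
      then show ?thesis unfolding c_def using 1 by (simp add: max_def)
    qed
    have main: "\<bar>(\<Sum>i<Suc N. if T m \<le> ennreal (s N i) \<and> ennreal (s N i) < T (Suc m) then \<phi> (s N (Suc i)) - \<phi> (s N i) else 0) - (\<phi> (c (Suc m)) - \<phi> (c m))\<bar> \<le> 4 * \<eta>" for m
    proof -
      have "(\<Sum>i<Suc N. if T m \<le> ennreal (s N i) \<and> ennreal (s N i) < T (Suc m) then \<phi> (s N (Suc i)) - \<phi> (s N i) else 0)
        = (\<Sum>i<Suc N. if c m \<le> s N i \<and> s N i < c (Suc m) then \<phi> (s N (Suc i)) - \<phi> (s N i) else 0)"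
        using cond[OF st0 slt] by (intro sum.cong refl) (simp add: not_le[symmetric])
      also have "\<bar>\<dots> - (\<phi> (c (Suc m)) - \<phi> (c m))\<bar> \<le> 4 * \<eta>"
      proof (rule grid_sum)
        show "s N 0 \<le> c m" unfolding c_def s0 by simp
        show "c (Suc m) \<le> s N (Suc N)" unfolding c_def s0 using ctle t by simp
        have "min (T m) (ennreal t) \<le> min (T (Suc m)) (ennreal t)" by (intro min.mono mono_Suc order_refl)
        then have "crossing_before {0..} \<delta> \<phi> m t \<le> crossing_before {0..} \<delta> \<phi> (Suc m) t" unfolding crossing_before_def by (intro enn2real_mono) (auto simp: min_less_iff_disj)
        then show "c m \<le> c (Suc m)" unfolding c_def by auto
        show "0 \<le> \<eta>" using \<eta> by simp
        fix i x assume i: "i < Suc N" and x: "s N i \<le> x" "x \<le> s N (Suc i)"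
        have "s N (Suc i) \<le> t" using slt[of "Suc i"] i s0(2) by (cases "Suc i = Suc N") auto
        then have "x \<in> {0..t}" "s N i \<in> {0..t}" "dist x (s N i) < d" using x st0[of i] t sm[of i] by (auto simp: dist_real_def)
        from d(2)[OF this(2,1,3)] show "\<bar>\<phi> x - \<phi> (s N i)\<bar> \<le> \<eta>" by (simp add: dist_real_def)
      qed (rule sm(1))
      finally show ?thesis .
    qed
    have "(\<Sum>i<Suc N. position \<delta> p (s N i) \<phi> * (\<phi> (s N (Suc i)) - \<phi> (s N i)))
      = (\<Sum>m<length p. stake {0..} \<delta> p \<phi> m * (\<Sum>i<Suc N. if T m \<le> ennreal (s N i) \<and> ennreal (s N i) < T (Suc m) then \<phi> (s N (Suc i)) - \<phi> (s N i) else 0))"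
      unfolding position_def sum_distrib_right sum_distrib_left by (subst sum.swap) (intro sum.cong refl, auto)
    moreover have "bet_value {0..} \<delta> p \<phi> t - bet_value {0..} \<delta> p \<phi> t0 = (\<Sum>m<length p. stake {0..} \<delta> p \<phi> m * (\<phi> (c (Suc m)) - \<phi> (c m)))"
    proof -
      have "bet_value {0..} \<delta> p \<phi> t - bet_value {0..} \<delta> p \<phi> t0 = (\<Sum>m<length p. stake {0..} \<delta> p \<phi> m *
          ((\<phi> (crossing_before {0..} \<delta> \<phi> (Suc m) t) - \<phi> (crossing_before {0..} \<delta> \<phi> (Suc m) t0)) - (\<phi> (crossing_before {0..} \<delta> \<phi> m t) - \<phi> (crossing_before {0..} \<delta> \<phi> m t0))))"
        unfolding bet_value_def by (simp add: sum_subtractf[symmetric] algebra_simps)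
      then show ?thesis unfolding cdiff by simp
    qed
    ultimately have "\<bar>(\<Sum>i<Suc N. position \<delta> p (s N i) \<phi> * (\<phi> (s N (Suc i)) - \<phi> (s N i))) - (bet_value {0..} \<delta> p \<phi> t - bet_value {0..} \<delta> p \<phi> t0)\<bar>
      = \<bar>\<Sum>m<length p. stake {0..} \<delta> p \<phi> m * ((\<Sum>i<Suc N. if T m \<le> ennreal (s N i) \<and> ennreal (s N i) < T (Suc m) then \<phi> (s N (Suc i)) - \<phi> (s N i) else 0) - (\<phi> (c (Suc m)) - \<phi> (c m)))\<bar>"
      by (simp add: sum_subtractf[symmetric] right_diff_distrib)
    also have "\<dots> \<le> (\<Sum>m<length p. \<bar>stake {0..} \<delta> p \<phi> m\<bar> * (4 * \<eta>))"
      by (rule order_trans[OF sum_abs], rule sum_mono) (auto simp only: abs_mult intro!: mult_left_mono main abs_ge_zero)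
    also have "\<dots> = (B - 1) * (4 * \<eta>)" unfolding sum_distrib_right[symmetric] B_def by simp
    also have "\<dots> < e" using B mult_pos_pos[OF B e] e unfolding \<eta>_def by (simp add: field_simps add_pos_pos)
    finally show ?thesis by simp
  qed
  then show "\<exists>no. \<forall>n\<ge>no. norm ((\<Sum>i<Suc n. position \<delta> p (t0 + real i * ((t - t0) / real (Suc n))) \<phi> *
      (\<phi> (t0 + real (Suc i) * ((t - t0) / real (Suc n))) - \<phi> (t0 + real i * ((t - t0) / real (Suc n))))) - (bet_value {0..} \<delta> p \<phi> t - bet_value {0..} \<delta> p \<phi> t0)) < e"
    unfolding s_def by blast
qed

section \<open>Bets on Brownian paths\<close>

lemma space_Cspace: "space Cspace = Cpaths"
  unfolding Cspace_def by (intro space_measure_of) auto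

lemma Cpaths_neg: "\<psi> \<in> Cpaths \<Longrightarrow> t \<le> 0 \<Longrightarrow> \<psi> t = \<psi> 0"
  unfolding Cpaths_def by blast

lemma CpathsI: "continuous_on UNIV \<psi> \<Longrightarrow> (\<And>t. t \<le> 0 \<Longrightarrow> \<psi> t = \<psi> 0) \<Longrightarrow> \<psi> \<in> Cpaths"
  unfolding Cpaths_def by blast

lemma Cspace_eval: "(\<lambda>\<psi>. \<psi> t) \<in> borel_measurable Cspace"
proof -
  have 1: "(\<lambda>\<psi>. \<psi> t) \<in> borel_measurable Cspace" if "0 \<le> t" for t
  proof (rule measurableI)
    fix A :: "real set" assume "A \<in> sets borel"
    then have "{\<psi>\<in>Cpaths. \<psi> t \<in> A} \<in> sets Cspace"
      unfolding Cspace_def using that by (subst sets_measure_of) (auto intro!: sigma_sets.Basic)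
    then show "(\<lambda>\<psi>. \<psi> t) -` A \<inter> space Cspace \<in> sets Cspace"
      by (simp add: space_Cspace vimage_def Int_def conj_commute)
  qed simp
  show ?thesis
  proof (cases "0 \<le> t")
    case False
    have "(\<lambda>\<psi>. \<psi> t) \<in> borel_measurable Cspace \<longleftrightarrow> (\<lambda>\<psi>. \<psi> 0) \<in> borel_measurable Cspace"
    proof (rule measurable_cong)
      fix \<psi> assume "\<psi> \<in> space Cspace"
      then show "\<psi> t = \<psi> 0" using False Cpaths_neg[of \<psi> t] unfolding space_Cspace by simp
    qed
    then show ?thesis using 1[of 0] by simp
  qed (rule 1)
qed

lemma measurable_CspaceI:
  assumes "\<And>x. x \<in> space M \<Longrightarrow> f x \<in> Cpaths" "\<And>t. 0 \<le> t \<Longrightarrow> (\<lambda>x. f x t) \<in> borel_measurable M"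
  shows "f \<in> measurable M Cspace"
  unfolding Cspace_def
proof (rule measurable_measure_of)
  fix A assume "A \<in> {{\<psi>\<in>Cpaths. \<psi> t \<in> B} | t B. 0 \<le> t \<and> B \<in> sets borel}"
  then obtain t B where A: "A = {\<psi>\<in>Cpaths. \<psi> t \<in> B}" "0 \<le> t" "B \<in> sets borel" by blast
  have "f -` A \<inter> space M = (\<lambda>x. f x t) -` B \<inter> space M" using assms(1) unfolding A(1) by auto
  then show "f -` A \<inter> space M \<in> sets M" using measurable_sets[OF assms(2)[OF A(2)] A(3)] by simp
qed (use assms in auto)

section \<open>Stopped paths, joined paths and measurability\<close>

definition stop :: "real \<Rightarrow> (real \<Rightarrow> real) \<Rightarrow> real \<Rightarrow> real" where "stop s \<psi> u = \<psi> (min u s)"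

lemma stop_Cpaths: "\<psi> \<in> Cpaths \<Longrightarrow> 0 \<le> s \<Longrightarrow> stop s \<psi> \<in> Cpaths"
proof -
  assume p: "\<psi> \<in> Cpaths" and s: "0 \<le> s"
  have "continuous_on UNIV (\<lambda>u. \<psi> (min u s))"
    by (rule continuous_on_compose2[OF Cpaths_cont[OF p, of UNIV]]) (intro continuous_intros, simp)
  moreover have "stop s \<psi> t = stop s \<psi> 0" if "t \<le> 0" for t
    using that s Cpaths_neg[OF p that] unfolding stop_def by simp
  ultimately show ?thesis unfolding stop_def by (intro CpathsI)
qed

lemma stop_measurable: "0 \<le> s \<Longrightarrow> stop s \<in> measurable Cspace Cspace"
  by (intro measurable_CspaceI stop_Cpaths) (auto simp: stop_def space_Cspace intro: Cspace_eval)

text \<open>Only the increments of \<open>\<psi>\<close> are attached, so the joined path continues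
  from \<open>f T\<close> whatever the starting point of \<open>\<psi>\<close> is.\<close>

definition join :: "(real \<Rightarrow> real) \<Rightarrow> real \<Rightarrow> (real \<Rightarrow> real) \<Rightarrow> real \<Rightarrow> real" where
  "join f T \<psi> u = f (min u T) + (\<psi> (max (u - T) 0) - \<psi> 0)"

lemma join_Cpaths: "f \<in> Cpaths \<Longrightarrow> 0 \<le> T \<Longrightarrow> \<psi> \<in> Cpaths \<Longrightarrow> join f T \<psi> \<in> Cpaths"
proof -
  assume f: "f \<in> Cpaths" and T: "0 \<le> T" and p: "\<psi> \<in> Cpaths"
  have "continuous_on UNIV (\<lambda>u. f (min u T))"
    by (rule continuous_on_compose2[OF Cpaths_cont[OF f, of UNIV]]) (intro continuous_intros, simp)
  moreover have "continuous_on UNIV (\<lambda>u. \<psi> (max (u - T) 0))"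
    by (rule continuous_on_compose2[OF Cpaths_cont[OF p, of UNIV]]) (intro continuous_intros, simp)
  ultimately have "continuous_on UNIV (join f T \<psi>)" unfolding join_def by (intro continuous_intros)
  moreover have "join f T \<psi> t = join f T \<psi> 0" if "t \<le> 0" for t
    using that T Cpaths_neg[OF f that] unfolding join_def by simp
  ultimately show ?thesis by (intro CpathsI)
qed

lemma join_measurable: "f \<in> Cpaths \<Longrightarrow> 0 \<le> T \<Longrightarrow> join f T \<in> measurable Cspace Cspace"
  by (intro measurable_CspaceI join_Cpaths)
    (auto simp: join_def space_Cspace intro!: borel_measurable_add borel_measurable_diff Cspace_eval)

lemma crossing_time_measurable: assumes "0 < \<delta>" shows "(\<lambda>\<phi>. crossing_time {0..} \<delta> \<phi> k) \<in> borel_measurable Cspace"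
  using cross_measurable[of 1 "\<lambda>_ \<phi>. \<phi>" Cspace \<delta> k] assms by (simp add: Cspace_eval space_Cspace Cpaths_cont)

lemma eval_Cspace:
  assumes "r \<in> borel_measurable Cspace" "\<And>x. x \<in> Cpaths \<Longrightarrow> 0 \<le> r x"
  shows "(\<lambda>\<phi>. \<phi> (r \<phi>)) \<in> borel_measurable Cspace"
  using eval_measurable[of "\<lambda>\<phi>. \<phi>" Cspace r] assms by (simp add: Cspace_eval space_Cspace Cpaths_cont)

lemma follows_measurable: assumes \<delta>: "0 < \<delta>" shows "Measurable.pred Cspace (\<lambda>\<phi>. follows {0..} \<delta> p \<phi> m)"
proof -
  note [measurable] = crossing_time_measurable[OF \<delta>]
  have [measurable]: "(\<lambda>\<phi>. \<phi> (enn2real (crossing_time {0..} \<delta> \<phi> k))) \<in> borel_measurable Cspace" for k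
    by (rule eval_Cspace) (auto intro!: borel_measurable_enn2real crossing_time_measurable[OF \<delta>])
  show ?thesis unfolding follows_def by measurable
qed

lemma stake_measurable: assumes \<delta>: "0 < \<delta>" shows "(\<lambda>\<phi>. stake {0..} \<delta> p \<phi> m) \<in> borel_measurable Cspace"
proof -
  note [measurable] = follows_measurable[OF \<delta>]
  show ?thesis unfolding stake_def by measurable
qed

lemma position_measurable: assumes \<delta>: "0 < \<delta>" shows "position \<delta> p u \<in> borel_measurable Cspace"
proof -
  note [measurable] = stake_measurable[OF \<delta>] crossing_time_measurable[OF \<delta>]
  have "(\<lambda>\<phi>. position \<delta> p u \<phi>) \<in> borel_measurable Cspace" unfolding position_def by measurable
  then show ?thesis .
qed

lemma bet_value_measurable: assumes \<delta>: "0 < \<delta>" shows "(\<lambda>\<phi>. bet_value {0..} \<delta> p \<phi> t) \<in> borel_measurable Cspace"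
proof -
  note [measurable] = stake_measurable[OF \<delta>] crossing_time_measurable[OF \<delta>]
  have [measurable]: "(\<lambda>\<phi>. \<phi> (crossing_before {0..} \<delta> \<phi> k t)) \<in> borel_measurable Cspace" for k
    by (rule eval_Cspace) (auto simp: crossing_before_def)
  show ?thesis unfolding bet_value_def by measurable
qed

definition unbounded_path :: "(real \<Rightarrow> real) \<Rightarrow> bool" where "unbounded_path \<phi> \<longleftrightarrow> (\<forall>M. \<exists>t\<ge>0. M < \<bar>\<phi> t\<bar>)"

lemma cpath_bounded_initial:
  assumes "\<phi> \<in> Cpaths" shows "\<exists>M. \<forall>s\<in>{0..t}. \<bar>\<phi> s\<bar> \<le> M"
proof -
  have "compact (\<phi> ` {0..t})" by (intro compact_continuous_image Cpaths_cont assms) simp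
  then show ?thesis using compact_imp_bounded bounded_iff[of "\<phi> ` {0..t}"] by auto
qed

text \<open>If no further crossing occurred, the path would remain within \<open>\<delta>\<close> of
  its last crossing position after a bounded initial piece.\<close>

lemma unbounded_crosses_forever:
  assumes \<phi>: "\<phi> \<in> Cpaths" "unbounded_path \<phi>" and \<delta>: "0 < \<delta>"
  shows "crossing_time {0..} \<delta> \<phi> k \<noteq> \<infinity>"
proof (induction k)
  case (Suc k)
  interpret path_crossing "{0..}" \<delta> \<phi> using \<phi>(1) \<delta> by (rule path_crossing_Cpaths)
  show ?case
  proof
    assume inf: "T (Suc k) = \<infinity>"
    obtain M where M: "\<forall>s\<in>{0..\<tau> k}. \<bar>\<phi> s\<bar> \<le> M" using cpath_bounded_initial[OF \<phi>(1)] by blast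
    obtain t where t: "t \<ge> 0" "M + \<delta> < \<bar>\<phi> t\<bar>" using \<phi>(2) unfolding unbounded_path_def by blast
    have b: "\<bar>\<phi> (\<tau> k)\<bar> \<le> M" using M fin(3)[OF Suc] by simp
    show False
    proof (cases "t \<le> \<tau> k")
      case True then show ?thesis using M t \<delta> by force
    next
      case False
      then have "\<bar>\<phi> t - \<phi> (\<tau> k)\<bar> < \<delta>" using \<tau>_last[OF Suc, of t] t inf by simp
      then show ?thesis using t b by linarith
    qed
  qed
qed simp

lemma bet_value_local:
  assumes \<phi>: "\<phi> \<in> Cpaths" "\<phi>' \<in> Cpaths" and \<delta>: "0 < \<delta>" and u: "0 \<le> u" and ag: "\<And>s. 0 \<le> s \<Longrightarrow> s \<le> u \<Longrightarrow> \<phi>' s = \<phi> s"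
  shows "bet_value {0..} \<delta> p \<phi>' u = bet_value {0..} \<delta> p \<phi> u"
proof -
  interpret A: path_crossing "{0..}" \<delta> \<phi> using \<phi>(1) \<delta> by (rule path_crossing_Cpaths)
  interpret B: path_crossing "{0..}" \<delta> \<phi>' using \<phi>(2) \<delta> by (rule path_crossing_Cpaths)
  have z: "\<And>t::real. t \<in> {0..} \<Longrightarrow> 0 \<le> t" by simp
  have 1: "B.T m = A.T m \<and> (follows {0..} \<delta> p \<phi>' m \<longleftrightarrow> follows {0..} \<delta> p \<phi> m)" if le: "A.T m \<le> ennreal u" for m
  proof -
    have su: "s \<le> u" if "0 \<le> s" "ennreal s \<le> A.T m" for s using order_trans[OF that(2) le] u by simp
    have a: "(s \<in> {0..} \<longleftrightarrow> s \<in> {0..}) \<and> \<phi>' s = \<phi> s" if "0 \<le> s" "ennreal s \<le> A.T m" for s :: real using ag[OF that(1) su[OF that]] by simp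
    show ?thesis by (intro conjI A.crossing_time_local_le(1)[of "{0..}" m \<phi>' m, OF z a order_refl] A.crossing_time_local_le(2)[of "{0..}" m \<phi>' p, OF z a])
  qed
  have 2: "A.T m = B.T m" if le: "B.T m \<le> ennreal u" for m
  proof -
    have su: "s \<le> u" if "0 \<le> s" "ennreal s \<le> B.T m" for s using order_trans[OF that(2) le] u by simp
    have a: "(s \<in> {0..} \<longleftrightarrow> s \<in> {0..}) \<and> \<phi> s = \<phi>' s" if "0 \<le> s" "ennreal s \<le> B.T m" for s :: real using ag[OF that(1) su[OF that]] by simp
    show ?thesis by (rule B.crossing_time_local_le(1)[of "{0..}" m \<phi> m, OF z a order_refl])
  qed
  have 3: "A.T m \<le> ennreal u \<longleftrightarrow> B.T m \<le> ennreal u" for m using 1 2 by metis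
  have c: "crossing_before {0..} \<delta> \<phi>' m u = crossing_before {0..} \<delta> \<phi> m u" for m
    using 1[of m] 3[of m] A.crossing_before_eqs(2)[of u m] B.crossing_before_eqs(2)[of u m] u unfolding crossing_before_def by (cases "A.T m \<le> ennreal u") auto
  have cu: "0 \<le> crossing_before {0..} \<delta> \<phi> m u" "crossing_before {0..} \<delta> \<phi> m u \<le> u" for m
    unfolding crossing_before_def using u by (auto intro!: enn2real_leI simp: min_def)
  have b: "stake {0..} \<delta> p \<phi>' m * (\<phi> (crossing_before {0..} \<delta> \<phi> (Suc m) u) - \<phi> (crossing_before {0..} \<delta> \<phi> m u)) = stake {0..} \<delta> p \<phi> m * (\<phi> (crossing_before {0..} \<delta> \<phi> (Suc m) u) - \<phi> (crossing_before {0..} \<delta> \<phi> m u))" for m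
  proof (cases "A.T m \<le> ennreal u")
    case True then show ?thesis using 1[of m] unfolding stake_def by simp
  next
    case False
    then have "ennreal u \<le> A.T m" "ennreal u \<le> A.T (Suc m)" using A.mono_Suc[of m] by auto
    then show ?thesis using A.crossing_before_eqs(2)[of u] u by simp
  qed
  show ?thesis unfolding bet_value_def c ag[OF cu] b ..
qed

text \<open>Bounded second moments give uniform integrability. Concretely, clamping a value to
  [-R,R] changes it by at most its square over \<open>R\<close>, so the clamped means are at most
  C/R in absolute value; dominated convergence applies to the clamped functions, and
  \<open>R\<close> is arbitrary.\<close>

lemma truncated_limit:
  fixes S :: "nat \<Rightarrow> 'a \<Rightarrow> real"
  assumes "prob_space M" and m: "\<And>n. S n \<in> borel_measurable M" "X \<in> borel_measurable M"
    and lim: "\<And>x. x \<in> space M \<Longrightarrow> (\<lambda>n. S n x) \<longlonglongrightarrow> X x" and X: "\<And>x. x \<in> space M \<Longrightarrow> \<bar>X x\<bar> \<le> 1"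
    and S: "\<And>n. integrable M (S n)" "\<And>n. (\<integral>x. S n x \<partial>M) = 0" "\<And>n. integrable M (\<lambda>x. (S n x)\<^sup>2)" "\<And>n. (\<integral>x. (S n x)\<^sup>2 \<partial>M) \<le> C"
  shows "(\<integral>x. X x \<partial>M) = 0"
proof -
  interpret prob_space M by fact
  have "0 \<le> (\<integral>x. (S 0 x)\<^sup>2 \<partial>M)" by (rule integral_nonneg_AE) simp
  from order_trans[OF this S(4)] have C: "0 \<le> C" .
  have b: "\<bar>\<integral>x. X x \<partial>M\<bar> \<le> C / R" if R: "1 \<le> R" for R
  proof -
    define c where "c y = max (-R) (min R y)" for y :: real
    have cb: "\<bar>c y\<bar> \<le> R" for y unfolding c_def using R by auto
    have cm: "(\<lambda>x. c (S n x)) \<in> borel_measurable M" for n unfolding c_def using m by measurable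
    have ci: "integrable M (\<lambda>x. c (S n x))" for n
      by (rule integrable_const_bound[where B = R]) (use cm cb in auto)
    have d: "\<bar>y - c y\<bar> \<le> y\<^sup>2 / R" for y
    proof (cases "\<bar>y\<bar> \<le> R")
      case True then show ?thesis unfolding c_def using R by (auto simp: abs_le_iff)
    next
      case False
      have "\<bar>y - c y\<bar> \<le> \<bar>y\<bar>" unfolding c_def using R by auto
      also have "\<bar>y\<bar> * R \<le> \<bar>y\<bar> * \<bar>y\<bar>" using False by (intro mult_left_mono) auto
      then have "\<bar>y\<bar> \<le> y\<^sup>2 / R" using R by (simp add: field_simps power2_eq_square abs_mult_self_eq)
      finally show ?thesis .
    qed
    have "\<bar>\<integral>x. c (S n x) \<partial>M\<bar> \<le> C / R" for n
    proof -
      have "\<bar>\<integral>x. c (S n x) \<partial>M\<bar> = \<bar>(\<integral>x. S n x - c (S n x) \<partial>M)\<bar>" using S(1,2) ci by simp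
      also have "\<dots> \<le> (\<integral>x. \<bar>S n x - c (S n x)\<bar> \<partial>M)" by (rule integral_abs_bound)
      also have "\<dots> \<le> (\<integral>x. (S n x)\<^sup>2 / R \<partial>M)" using S(1,3) ci d by (intro integral_mono) auto
      also have "\<dots> \<le> C / R" using S(4) R by (simp add: divide_right_mono)
      finally show ?thesis .
    qed
    moreover have "(\<lambda>n. \<integral>x. c (S n x) \<partial>M) \<longlonglongrightarrow> (\<integral>x. X x \<partial>M)"
    proof (rule integral_dominated_convergence[where w = "\<lambda>_. R"])
      show "AE x in M. (\<lambda>n. c (S n x)) \<longlonglongrightarrow> X x"
      proof (rule AE_I2)
        fix x assume x: "x \<in> space M"
        have "(\<lambda>n. c (S n x)) \<longlonglongrightarrow> c (X x)" unfolding c_def by (intro tendsto_intros lim x)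
        moreover have "c (X x) = X x" unfolding c_def using X[OF x] R by auto
        ultimately show "(\<lambda>n. c (S n x)) \<longlonglongrightarrow> X x" by simp
      qed
    qed (use cm cb m in auto)
    ultimately show ?thesis by (intro tendsto_upperbound[OF tendsto_rabs]) auto
  qed
  have "\<bar>\<integral>x. X x \<partial>M\<bar> \<le> 0"
  proof (rule field_le_epsilon)
    fix e :: real assume e: "0 < e"
    define R where "R = max 1 (C / e)"
    have "C / R \<le> e" using e C unfolding R_def by (auto simp: field_simps max_def)
    then show "\<bar>\<integral>x. X x \<partial>M\<bar> \<le> 0 + e" using b[of R] unfolding R_def by simp
  qed
  then show ?thesis by simp
qed

section \<open>Almost sure properties of Brownian paths\<close>

locale wiener =
  fixes x :: real and W :: "(real \<Rightarrow> real) measure"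
  assumes wiener: "wiener_measure x W"
begin

sublocale prob_space W using wiener unfolding wiener_measure_def by blast

lemma sets_W: "sets W = sets Cspace" using wiener unfolding wiener_measure_def by blast
lemma space_W: "space W = Cpaths" using sets_eq_imp_space_eq[OF sets_W] space_Cspace by simp
lemma measurable_W: "measurable W N = measurable Cspace N" by (rule measurable_cong_sets[OF sets_W refl])
lemma eval_W [measurable]: "(\<lambda>\<psi>. \<psi> t) \<in> borel_measurable W" unfolding measurable_W by (rule Cspace_eval)
lemma start: "AE \<psi> in W. \<psi> 0 = x" using wiener unfolding wiener_measure_def by blast

lemma increment:
  assumes "0 \<le> s" "s < t"
  shows "distributed W lborel (\<lambda>\<psi>. \<psi> t - \<psi> s) (\<lambda>y. ennreal (normal_density 0 (sqrt (t - s)) y))"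
  using assms wiener unfolding wiener_measure_def by blast

lemma increment_moments:
  assumes st: "0 \<le> s" "s < t"
  shows "integrable W (\<lambda>\<psi>. \<psi> t - \<psi> s)" "(\<integral>\<psi>. \<psi> t - \<psi> s \<partial>W) = 0"
    "integrable W (\<lambda>\<psi>. (\<psi> t - \<psi> s)\<^sup>2)" "(\<integral>\<psi>. (\<psi> t - \<psi> s)\<^sup>2 \<partial>W) = t - s"
proof -
  note D = increment[OF st]
  have p: "0 < sqrt (t - s)" using st by simp
  have nn: "\<And>y. 0 \<le> normal_density 0 (sqrt (t - s)) y" by simp
  show "integrable W (\<lambda>\<psi>. \<psi> t - \<psi> s)"
    using distributed_integrable[OF D, of "\<lambda>x. x"] integrable_normal_moment[OF p, of 0 1] nn by simp
  show "(\<integral>\<psi>. \<psi> t - \<psi> s \<partial>W) = 0"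
    using distributed_integral[OF D, of "\<lambda>x. x"] integral_normal_moment_odd[OF p, of 0 0] nn by simp
  show "integrable W (\<lambda>\<psi>. (\<psi> t - \<psi> s)\<^sup>2)"
    using distributed_integrable[OF D, of "\<lambda>x. x\<^sup>2"] integrable_normal_moment[OF p, of 0 2] nn by simp
  show "(\<integral>\<psi>. (\<psi> t - \<psi> s)\<^sup>2 \<partial>W) = t - s"
  proof -
    have "(\<integral>y. normal_density 0 (sqrt (t - s)) y * y\<^sup>2 \<partial>lborel) = t - s"
      using integral_normal_moment_even[OF p, of 0 1] st by simp
    then show ?thesis using distributed_integral[OF D, of "\<lambda>x. x\<^sup>2"] nn by simp
  qed
qed

text \<open>The normal density is bounded by its peak value.\<close>

lemma increment_small:
  assumes st: "0 \<le> s" "s < t" and M: "0 \<le> M"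
  shows "emeasure W {\<psi>\<in>space W. \<bar>\<psi> t - \<psi> s\<bar> \<le> M} \<le> ennreal (2 * M / sqrt (2 * pi * (t - s)))"
proof -
  have "{\<psi>\<in>space W. \<bar>\<psi> t - \<psi> s\<bar> \<le> M} = (\<lambda>\<psi>. \<psi> t - \<psi> s) -` {-M..M} \<inter> space W" by (auto simp: abs_le_iff)
  then have "emeasure W {\<psi>\<in>space W. \<bar>\<psi> t - \<psi> s\<bar> \<le> M} = (\<integral>\<^sup>+y. ennreal (normal_density 0 (sqrt (t - s)) y) * indicator {-M..M} y \<partial>lborel)"
    using distributed_emeasure[OF increment[OF st], of "{-M..M}"] by simp
  also have "\<dots> \<le> (\<integral>\<^sup>+y. ennreal (1 / sqrt (2 * pi * (t - s))) * indicator {-M..M} y \<partial>lborel)"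
  proof (intro nn_integral_mono mult_right_mono ennreal_leI)
    fix y
    have "normal_density 0 (sqrt (t - s)) y = 1 / sqrt (2 * pi * (t - s)) * exp (- y\<^sup>2 / (2 * (t - s)))"
      unfolding normal_density_def using st by simp
    also have "\<dots> \<le> 1 / sqrt (2 * pi * (t - s)) * 1" using st by (intro mult_left_mono) auto
    finally show "normal_density 0 (sqrt (t - s)) y \<le> 1 / sqrt (2 * pi * (t - s))" by simp
  qed simp
  also have "\<dots> = ennreal (1 / sqrt (2 * pi * (t - s))) * ennreal (2 * M)"
    using M by (subst nn_integral_cmult) (auto simp: emeasure_lborel_Icc)
  also have "\<dots> = ennreal (2 * M / sqrt (2 * pi * (t - s)))" using M st by (subst ennreal_mult[symmetric]) auto
  finally show ?thesis .
qed

text \<open>Constancy on an interval would force equal values at two rational times, which has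
  probability 0 for each of countably many pairs.\<close>

lemma AE_not_constant: "AE \<psi> in W. \<forall>a b. 0 \<le> a \<longrightarrow> a < b \<longrightarrow> (\<exists>t\<in>{a..b}. \<psi> t \<noteq> \<psi> a)"
proof -
  have "AE \<psi> in W. \<psi> (of_rat q) \<noteq> \<psi> (of_rat r)" if "0 \<le> q" "q < r" for q r :: rat
  proof (rule AE_I)
    show "{\<psi>\<in>space W. \<not> \<psi> (of_rat q) \<noteq> \<psi> (of_rat r)} \<subseteq> {\<psi>\<in>space W. \<bar>\<psi> (of_rat r) - \<psi> (of_rat q)\<bar> \<le> 0}" by auto
    have "(0::real) \<le> of_rat q" "(of_rat q::real) < of_rat r" using that by (auto simp: of_rat_less)
    from increment_small[OF this order_refl]
    show "emeasure W {\<psi>\<in>space W. \<bar>\<psi> (of_rat r) - \<psi> (of_rat q)\<bar> \<le> 0} = 0" by simp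
    show "{\<psi>\<in>space W. \<bar>\<psi> (of_rat r) - \<psi> (of_rat q)\<bar> \<le> 0} \<in> sets W" by measurable
  qed
  then have "AE \<psi> in W. \<forall>q r :: rat. 0 \<le> q \<longrightarrow> q < r \<longrightarrow> \<psi> (of_rat q) \<noteq> \<psi> (of_rat r)"
    unfolding AE_all_countable by (auto intro!: AE_impI)
  then show ?thesis
  proof (rule AE_mp, intro AE_I2 impI allI)
    fix \<psi> :: "real \<Rightarrow> real" and a b :: real
    assume *: "\<forall>q r :: rat. 0 \<le> q \<longrightarrow> q < r \<longrightarrow> \<psi> (of_rat q) \<noteq> \<psi> (of_rat r)" and ab: "0 \<le> a" "a < b"
    obtain q where q: "a < of_rat q" "of_rat q < b" using of_rat_dense[OF ab(2)] by blast
    obtain r where r: "of_rat q < (of_rat r :: real)" "of_rat r < b" using of_rat_dense[OF q(2)] by blast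
    have "0 \<le> q" "q < r" using q r ab by (simp_all add: of_rat_less) (metis less_eq_real_def not_less of_rat_less_0_iff order_less_trans)
    then have "\<psi> (of_rat q) \<noteq> \<psi> (of_rat r)" using * by blast
    then have "\<psi> (of_rat q) \<noteq> \<psi> a \<or> \<psi> (of_rat r) \<noteq> \<psi> a" by auto
    then show "\<exists>t\<in>{a..b}. \<psi> t \<noteq> \<psi> a" using q r by (auto intro: bexI[of _ "of_rat q"] bexI[of _ "of_rat r"])
  qed
qed

text \<open>Staying within \<open>M\<close> of the start at time n has probability of order 1/sqrt
  n, so staying there at all integer times has probability 0; the Markov property is not
  involved.\<close>

lemma AE_unbounded: "AE \<psi> in W. \<forall>M. \<exists>t\<ge>0. M < \<bar>\<psi> t - \<psi> 0\<bar>"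
proof -
  have "AE \<psi> in W. \<exists>n::nat. real M < \<bar>\<psi> (real n) - \<psi> 0\<bar>" for M :: nat
  proof (rule AE_I)
    let ?N = "{\<psi>\<in>space W. \<forall>n::nat. \<bar>\<psi> (real n) - \<psi> 0\<bar> \<le> real M}"
    show "{\<psi>\<in>space W. \<not> (\<exists>n::nat. real M < \<bar>\<psi> (real n) - \<psi> 0\<bar>)} \<subseteq> ?N" by (auto simp: not_less)
    show N: "?N \<in> sets W" by measurable
    have "emeasure W ?N \<le> ennreal (2 * real M / sqrt (2 * pi * real (Suc n)))" for n
    proof -
      have "emeasure W ?N \<le> emeasure W {\<psi>\<in>space W. \<bar>\<psi> (real (Suc n)) - \<psi> 0\<bar> \<le> real M}"
        by (intro emeasure_mono) (blast, measurable)
      also have "\<dots> \<le> ennreal (2 * real M / sqrt (2 * pi * (real (Suc n) - 0)))" by (rule increment_small) auto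
      finally show ?thesis by simp
    qed
    moreover have "(\<lambda>n. ennreal (2 * real M / sqrt (2 * pi * real (Suc n)))) \<longlonglongrightarrow> ennreal 0"
    proof (rule tendsto_ennrealI)
      have "filterlim (\<lambda>n. sqrt (2 * pi * real (Suc n))) at_top sequentially"
        by (intro filterlim_compose[OF sqrt_at_top] filterlim_tendsto_pos_mult_at_top[OF tendsto_const]
             filterlim_compose[OF filterlim_real_sequentially filterlim_Suc]) auto
      then show "(\<lambda>n. 2 * real M / sqrt (2 * pi * real (Suc n))) \<longlonglongrightarrow> 0"
        by (intro tendsto_divide_0[OF tendsto_const] filterlim_at_top_imp_at_infinity)
    qed
    ultimately have "emeasure W ?N \<le> ennreal 0" by (intro LIMSEQ_le_const) auto
    then show "emeasure W ?N = 0" by simp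
  qed
  then have "AE \<psi> in W. \<forall>M::nat. \<exists>n::nat. real M < \<bar>\<psi> (real n) - \<psi> 0\<bar>" unfolding AE_all_countable by blast
  then show ?thesis
  proof (rule AE_mp, intro AE_I2 impI allI)
    fix \<psi> :: "real \<Rightarrow> real" and M :: real assume *: "\<forall>M::nat. \<exists>n::nat. real M < \<bar>\<psi> (real n) - \<psi> 0\<bar>"
    obtain m :: nat where "M < real m" using reals_Archimedean2 by blast
    moreover obtain n :: nat where "real m < \<bar>\<psi> (real n) - \<psi> 0\<bar>" using * by blast
    ultimately show "\<exists>t\<ge>0. M < \<bar>\<psi> t - \<psi> 0\<bar>" by (intro exI[of _ "real n"]) auto
  qed
qed

end

section \<open>Brownian expectations of bets\<close>

context wiener
begin

text \<open>Independence is given for increments over finitely many times only. It is extended to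
  arbitrary functions of the stopped path through the cylinder events, which are stable under
  intersection and generate the sigma-algebra.\<close>

lemma indep_stop:
  fixes Q :: "(real \<Rightarrow> real) \<Rightarrow> real" and g :: "real \<Rightarrow> real"
  assumes s: "0 \<le> s" and t': "s < t'" and Q: "Q \<in> borel_measurable Cspace" and g: "g \<in> borel_measurable borel"
  shows "indep_var borel (\<lambda>\<psi>. Q (stop s \<psi>)) borel (\<lambda>\<psi>. g (\<psi> t' - \<psi> s))"
proof -
  define G where "G = {{\<psi>\<in>Cpaths. \<forall>u\<in>U. \<psi> u \<in> B u} | U (B :: real \<Rightarrow> real set). finite U \<and> U \<subseteq> {0..} \<and> (\<forall>u\<in>U. B u \<in> sets borel)}"
  define D where "D = (\<lambda>\<psi> :: real \<Rightarrow> real. \<psi> t' - \<psi> s)"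
  have Dm [measurable]: "D \<in> borel_measurable W" unfolding D_def by measurable
  have sm [measurable]: "stop s \<in> measurable W Cspace" unfolding measurable_W by (rule stop_measurable[OF s])
  have GI: "Int_stable {stop s -` A \<inter> space W | A. A \<in> G}"
  proof (rule Int_stableI)
    fix a b assume "a \<in> {stop s -` A \<inter> space W | A. A \<in> G}" "b \<in> {stop s -` A \<inter> space W | A. A \<in> G}"
    then obtain U B U' B' where
      a: "a = stop s -` {\<psi>\<in>Cpaths. \<forall>u\<in>U. \<psi> u \<in> B u} \<inter> space W" "finite U" "U \<subseteq> {0..}" "\<forall>u\<in>U. B u \<in> sets borel" and
      b: "b = stop s -` {\<psi>\<in>Cpaths. \<forall>u\<in>U'. \<psi> u \<in> B' u} \<inter> space W" "finite U'" "U' \<subseteq> {0..}" "\<forall>u\<in>U'. B' u \<in> sets borel"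
      unfolding G_def by auto
    define C where "C u = (if u \<in> U then B u else UNIV) \<inter> (if u \<in> U' then B' u else UNIV)" for u
    have "{\<psi>\<in>Cpaths. \<forall>u\<in>U \<union> U'. \<psi> u \<in> C u} \<in> G" unfolding G_def
      by (rule CollectI, rule exI[of _ "U \<union> U'"], rule exI[of _ C]) (use a b in \<open>auto simp: C_def\<close>)
    moreover have "a \<inter> b = stop s -` {\<psi>\<in>Cpaths. \<forall>u\<in>U \<union> U'. \<psi> u \<in> C u} \<inter> space W"
      unfolding a(1) b(1) C_def by auto
    ultimately show "a \<inter> b \<in> {stop s -` A \<inter> space W | A. A \<in> G}" by blast
  qed
  have DI: "Int_stable {D -` A \<inter> space W | A. A \<in> sets borel}"
  proof (rule Int_stableI)
    fix a b assume "a \<in> {D -` A \<inter> space W | A. A \<in> sets borel}" "b \<in> {D -` A \<inter> space W | A. A \<in> sets borel}"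
    then obtain A B where "a = D -` A \<inter> space W" "b = D -` B \<inter> space W" "A \<in> sets borel" "B \<in> sets borel" by blast
    then show "a \<inter> b \<in> {D -` A \<inter> space W | A. A \<in> sets borel}" by (intro CollectI exI[of _ "A \<inter> B"]) auto
  qed
  have base: "prob ((stop s -` {\<psi>\<in>Cpaths. \<forall>u\<in>U. \<psi> u \<in> B u} \<inter> space W) \<inter> (D -` C \<inter> space W)) =
     prob (stop s -` {\<psi>\<in>Cpaths. \<forall>u\<in>U. \<psi> u \<in> B u} \<inter> space W) * prob (D -` C \<inter> space W)"
    if U: "finite U" "U \<subseteq> {0..}" "\<forall>u\<in>U. B u \<in> sets borel" and C: "C \<in> sets borel" for U and B :: "real \<Rightarrow> real set" and C
  proof -
    \<comment> \<open>The stopped path at \<open>u\<close> is the path at \<open>min u s\<close>.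
      The times 0 and \<open>s\<close> are added so that the sorted list starts at the origin and
      ends at \<open>s\<close>; the increment up to \<open>t'\<close> is then the next one in the
      list.\<close>
    define T where "T = insert 0 (insert s ((\<lambda>u. min u s) ` U))"
    have T: "finite T" "\<And>v. v \<in> T \<Longrightarrow> 0 \<le> v \<and> v \<le> s" using U s unfolding T_def by auto
    define L where "L = sorted_list_of_set T"
    define n where "n = card T - 1"
    have cT: "card T > 0" using T(1) unfolding T_def by (simp add: card_gt_0_iff)
    have L: "length L = Suc n" "set L = T" "sorted_wrt (<) L"
      using T(1) cT unfolding L_def n_def by auto
    define tt where "tt i = (if i \<le> n then L ! i else t')" for i
    have lt: "L ! i < L ! j" if "i < j" "j \<le> n" for i j using L(1,3) that by (simp add: sorted_wrt_nth_less)
    have inT: "L ! i \<in> T" if "i \<le> n" for i using L that by (metis nth_mem le_imp_less_Suc)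
    have ex: "\<exists>k\<le>n. L ! k = v" if "v \<in> T" for v using that L by (metis in_set_conv_nth less_Suc_eq_le)
    have Ln: "L ! n = s"
    proof -
      obtain k where k: "k \<le> n" "L ! k = s" using ex[of s] unfolding T_def by auto
      show ?thesis using k lt[of k n] T(2)[OF inT[of n]] by (cases "k = n") auto
    qed
    have L0: "L ! 0 = 0"
    proof -
      obtain k where k: "k \<le> n" "L ! k = 0" using ex[of 0] unfolding T_def by auto
      show ?thesis using k lt[of 0 k] T(2)[OF inT[of 0]] by (cases "k = 0") auto
    qed
    have tts: "0 \<le> tt 0 \<and> (\<forall>i<Suc n. tt i < tt (Suc i))"
      unfolding tt_def using L0 Ln t' lt by (auto simp: less_Suc_eq)
    define inc where "inc i \<psi> = \<psi> (tt (Suc i)) - \<psi> (tt i)" for i and \<psi> :: "real \<Rightarrow> real"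
    have "indep_vars (\<lambda>_. borel) inc {..<Suc n}"
      using wiener tts unfolding wiener_measure_def inc_def by blast
    then have iv: "indep_var (PiM {..<n} (\<lambda>_. borel)) (\<lambda>\<psi>. restrict (\<lambda>i. inc i \<psi>) {..<n}) (PiM {n} (\<lambda>_. borel)) (\<lambda>\<psi>. restrict (\<lambda>i. inc i \<psi>) {n})"
      by (rule indep_var_restrict) auto
    obtain k where k: "\<And>u. u \<in> U \<Longrightarrow> k u \<le> n" "\<And>u. u \<in> U \<Longrightarrow> L ! (k u) = min u s"
    proof -
      have "\<exists>k\<le>n. L ! k = min u s" if "u \<in> U" for u using that by (intro ex) (auto simp: T_def)
      then show ?thesis using that by metis
    qed
    \<comment> \<open>The values of the stopped path are rebuilt as \<open>x\<close> plus partial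
      sums of increments, which expresses the cylinder event by the increments before
      \<open>s\<close>.\<close>
    define Xa where "Xa = {f\<in>space (PiM {..<n} (\<lambda>_. borel :: real measure)). \<forall>u\<in>U. x + (\<Sum>i<k u. f i) \<in> B u}"
    define Xb where "Xb = {f\<in>space (PiM {n} (\<lambda>_. borel :: real measure)). f n \<in> C}"
    have Xa: "Xa \<in> sets (PiM {..<n} (\<lambda>_. borel))"
    proof -
      have "(\<lambda>f. x + (\<Sum>i<k u. f i)) \<in> borel_measurable (PiM {..<n} (\<lambda>_. borel))" if "u \<in> U" for u
        using k(1)[OF that] by (intro borel_measurable_add borel_measurable_const borel_measurable_sum measurable_component_singleton) auto
      note xm = this
      have "{f\<in>space (PiM {..<n} (\<lambda>_. borel :: real measure)). x + (\<Sum>i<k u. f i) \<in> B u} \<in> sets (PiM {..<n} (\<lambda>_. borel))" if "u \<in> U" for u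
        using measurable_sets[OF xm[OF that] U(3)[rule_format, OF that]] by (simp add: vimage_def Int_def conj_commute)
      then show ?thesis unfolding Xa_def using U(1) by (intro sets.sets_Collect_finite_All) auto
    qed
    have Xb: "Xb \<in> sets (PiM {n} (\<lambda>_. borel))"
      unfolding Xb_def using C by measurable
    have Dinc: "D = inc n" unfolding D_def inc_def tt_def using Ln by auto
    have eb: "(\<lambda>\<psi>. restrict (\<lambda>i. inc i \<psi>) {n}) -` Xb \<inter> space W = D -` C \<inter> space W"
      unfolding Xb_def Dinc by (auto simp: space_PiM)
    let ?A = "(\<lambda>\<psi>. restrict (\<lambda>i. inc i \<psi>) {..<n}) -` Xa \<inter> space W"
    let ?S = "stop s -` {\<psi>\<in>Cpaths. \<forall>u\<in>U. \<psi> u \<in> B u} \<inter> space W"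
    \<comment> \<open>The path starts at \<open>x\<close> only almost surely, so the two
      descriptions of the event are compared where it does, and only their probabilities are
      identified.\<close>
    have ea: "\<psi> \<in> ?A \<longleftrightarrow> \<psi> \<in> ?S" if \<psi>: "\<psi> \<in> space W" and x0: "\<psi> 0 = x" for \<psi>
    proof -
      have "x + (\<Sum>i<k u. restrict (\<lambda>i. inc i \<psi>) {..<n} i) = stop s \<psi> u" if u: "u \<in> U" for u
      proof -
        have "(\<Sum>i<k u. restrict (\<lambda>i. inc i \<psi>) {..<n} i) = (\<Sum>i<k u. \<psi> (tt (Suc i)) - \<psi> (tt i))"
          using k(1)[OF u] by (intro sum.cong refl) (auto simp: inc_def)
        also have "\<dots> = \<psi> (tt (k u)) - \<psi> (tt 0)" by (rule sum_lessThan_telescope)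
        finally show ?thesis using k[OF u] L0 x0 unfolding tt_def stop_def by simp
      qed
      then show ?thesis unfolding Xa_def using \<psi> stop_Cpaths[OF _ s] by (auto simp: space_PiM space_W)
    qed
    have rm: "(\<lambda>\<psi>. restrict (\<lambda>i. inc i \<psi>) {..<n}) \<in> measurable W (PiM {..<n} (\<lambda>_. borel))"
      unfolding inc_def by measurable
    have Am: "?A \<in> sets W" using measurable_sets[OF rm Xa] .
    have cyl: "{\<psi>\<in>Cpaths. \<forall>u\<in>U. \<psi> u \<in> B u} \<in> sets Cspace"
    proof -
      have "{\<psi>\<in>space Cspace. \<psi> u \<in> B u} \<in> sets Cspace" if "u \<in> U" for u
        using measurable_sets[OF Cspace_eval[of u], of "B u"] U(3) that by (simp add: vimage_def Int_def conj_commute)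
      then have "{\<psi>\<in>space Cspace. \<forall>u\<in>U. \<psi> u \<in> B u} \<in> sets Cspace" using U(1) by (intro sets.sets_Collect_finite_All) auto
      then show ?thesis by (simp add: space_Cspace)
    qed
    have Sm: "?S \<in> sets W" by (rule measurable_sets[OF sm cyl])
    have Dc: "D -` C \<inter> space W \<in> sets W" using C by measurable
    have "AE \<psi> in W. \<psi> \<in> ?A \<longleftrightarrow> \<psi> \<in> ?S" using start AE_space by eventually_elim (rule ea)
    then have p1: "prob ?A = prob ?S" by (intro finite_measure_eq_AE Am Sm)
    have "AE \<psi> in W. \<psi> \<in> ?A \<inter> (D -` C \<inter> space W) \<longleftrightarrow> \<psi> \<in> ?S \<inter> (D -` C \<inter> space W)" using start AE_space
      by eventually_elim (use ea in blast)
    then have p2: "prob (?A \<inter> (D -` C \<inter> space W)) = prob (?S \<inter> (D -` C \<inter> space W))"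
      by (intro finite_measure_eq_AE sets.Int Am Sm Dc)
    have "prob (?A \<inter> (D -` C \<inter> space W)) = prob ?A * prob (D -` C \<inter> space W)"
    proof -
      have "(\<lambda>\<psi>. (restrict (\<lambda>i. inc i \<psi>) {..<n}, restrict (\<lambda>i. inc i \<psi>) {n})) -` (Xa \<times> Xb) \<inter> space W = ?A \<inter> (D -` C \<inter> space W)"
        using eb by auto
      then show ?thesis using indep_varD[OF iv Xa Xb] eb by simp
    qed
    then show ?thesis using p1 p2 by simp
  qed
  have cyl: "A \<in> sets Cspace" if AG: "A \<in> G" for A
  proof -
    obtain U B where U: "A = {\<psi>\<in>Cpaths. \<forall>u\<in>U. \<psi> u \<in> B u}" "finite U" "\<forall>u\<in>U. B u \<in> sets borel" using AG unfolding G_def by auto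
    have "{\<psi>\<in>space Cspace. \<psi> u \<in> B u} \<in> sets Cspace" if "u \<in> U" for u
      using measurable_sets[OF Cspace_eval[of u], of "B u"] U(3) that by (simp add: vimage_def Int_def conj_commute)
    then have "{\<psi>\<in>space Cspace. \<forall>u\<in>U. \<psi> u \<in> B u} \<in> sets Cspace" using U(2) by (intro sets.sets_Collect_finite_All) auto
    then show ?thesis by (simp add: space_Cspace U(1))
  qed
  have "indep_set {stop s -` A \<inter> space W | A. A \<in> G} {D -` A \<inter> space W | A. A \<in> sets borel}"
  proof (rule indep_setI)
    show "{stop s -` A \<inter> space W | A. A \<in> G} \<subseteq> events" using measurable_sets[OF sm cyl] by blast
    show "{D -` A \<inter> space W | A. A \<in> sets borel} \<subseteq> events" using measurable_sets[OF Dm] by blast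
    fix a b assume "a \<in> {stop s -` A \<inter> space W | A. A \<in> G}" "b \<in> {D -` A \<inter> space W | A. A \<in> sets borel}"
    then obtain U B C where "a = stop s -` {\<psi>\<in>Cpaths. \<forall>u\<in>U. \<psi> u \<in> B u} \<inter> space W" "finite U" "U \<subseteq> {0..}" "\<forall>u\<in>U. B u \<in> sets borel"
       "b = D -` C \<inter> space W" "C \<in> sets borel" unfolding G_def by auto
    then show "prob (a \<inter> b) = prob a * prob b" using base[of U B C] by simp
  qed
  from indep_set_sigma_sets[OF this GI DI]
  have iset: "indep_set (sigma_sets (space W) {stop s -` A \<inter> space W | A. A \<in> G}) (sigma_sets (space W) {D -` A \<inter> space W | A. A \<in> sets borel})" .
  \<comment> \<open>Cylinders generate the sigma-algebra of path space, and generating commutes with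
    taking preimages under \<open>stop s\<close>.\<close>
  have sub: "{stop s -` A \<inter> space W | A. A \<in> sets Cspace} \<subseteq> sigma_sets (space W) {stop s -` A \<inter> space W | A. A \<in> G}"
  proof -
    have X: "stop s \<in> space W \<rightarrow> Cpaths" using stop_Cpaths[OF _ s] by (auto simp: space_W)
    have "sets Cspace = sigma_sets Cpaths {{\<psi>\<in>Cpaths. \<psi> t \<in> B} | t B. 0 \<le> t \<and> B \<in> sets borel}"
      unfolding Cspace_def by (rule sets_measure_of) auto
    also have "\<dots> \<subseteq> sigma_sets Cpaths G"
    proof (rule sigma_sets_subseteq, rule subsetI)
      fix A assume "A \<in> {{\<psi>\<in>Cpaths. \<psi> t \<in> B} | t B. 0 \<le> t \<and> B \<in> sets borel}"
      then obtain t B where "A = {\<psi>\<in>Cpaths. \<psi> t \<in> B}" "0 \<le> t" "B \<in> sets borel" by blast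
      then show "A \<in> G" unfolding G_def by (intro CollectI exI[of _ "{t}"] exI[of _ "\<lambda>_. B"]) auto
    qed
    finally have "{stop s -` A \<inter> space W | A. A \<in> sets Cspace} \<subseteq> {stop s -` A \<inter> space W | A. A \<in> sigma_sets Cpaths G}" by blast
    then show ?thesis using sigma_sets_vimage_commute[OF X, of G] by simp
  qed
  have QS: "{(\<lambda>\<psi>. Q (stop s \<psi>)) -` A \<inter> space W | A. A \<in> sets borel} \<subseteq> {stop s -` A \<inter> space W | A. A \<in> sets Cspace}"
  proof clarsimp
    fix A :: "real set" assume "A \<in> sets borel"
    then have "Q -` A \<inter> space Cspace \<in> sets Cspace" by (rule measurable_sets[OF Q])
    moreover have "(\<lambda>\<psi>. Q (stop s \<psi>)) -` A \<inter> space W = stop s -` (Q -` A \<inter> space Cspace) \<inter> space W"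
      using stop_Cpaths[OF _ s] by (auto simp: space_W space_Cspace)
    ultimately show "\<exists>B. (\<lambda>\<psi>. Q (stop s \<psi>)) -` A \<inter> space W = stop s -` B \<inter> space W \<and> B \<in> sets Cspace" by blast
  qed
  have gS: "{(\<lambda>\<psi>. g (\<psi> t' - \<psi> s)) -` A \<inter> space W | A. A \<in> sets borel} \<subseteq> {D -` A \<inter> space W | A. A \<in> sets borel}"
  proof clarsimp
    fix A :: "real set" assume "A \<in> sets borel"
    then have "g -` A \<in> sets borel" using measurable_sets[OF g, of A] by simp
    then show "\<exists>B. (\<lambda>\<psi>. g (\<psi> t' - \<psi> s)) -` A \<inter> space W = D -` B \<inter> space W \<and> B \<in> sets borel"
      by (intro exI[of _ "g -` A"]) (auto simp: D_def)
  qed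
  have sub1: "sigma_sets (space W) {(\<lambda>\<psi>. Q (stop s \<psi>)) -` A \<inter> space W | A. A \<in> sets borel} \<subseteq> sigma_sets (space W) {stop s -` A \<inter> space W | A. A \<in> G}"
    by (rule sigma_sets_mono[OF subset_trans[OF QS sub]])
  have sub2: "sigma_sets (space W) {(\<lambda>\<psi>. g (\<psi> t' - \<psi> s)) -` A \<inter> space W | A. A \<in> sets borel} \<subseteq> sigma_sets (space W) {D -` A \<inter> space W | A. A \<in> sets borel}"
    by (rule sigma_sets_subseteq[OF gS])
  have Qm: "(\<lambda>\<psi>. Q (stop s \<psi>)) \<in> borel_measurable W" by (rule measurable_compose[OF sm Q])
  have gm: "(\<lambda>\<psi>. g (\<psi> t' - \<psi> s)) \<in> borel_measurable W" using measurable_compose[OF Dm g] unfolding D_def .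
  show ?thesis unfolding indep_var_eq
  proof (intro conjI Qm gm indep_setI)
    fix a b
    assume "a \<in> sigma_sets (space W) {(\<lambda>\<psi>. Q (stop s \<psi>)) -` A \<inter> space W | A. A \<in> sets borel}"
      "b \<in> sigma_sets (space W) {(\<lambda>\<psi>. g (\<psi> t' - \<psi> s)) -` A \<inter> space W | A. A \<in> sets borel}"
    then show "prob (a \<inter> b) = prob a * prob b" by (intro indep_setD[OF iset] subsetD[OF sub1] subsetD[OF sub2])
  qed (rule order_trans[OF sub1 indep_setD_ev1[OF iset]], rule order_trans[OF sub2 indep_setD_ev2[OF iset]])
qed

lemma expectation_stop:
  assumes s: "0 \<le> s" "s < t" and Q: "Q \<in> borel_measurable Cspace" "integrable W (\<lambda>\<psi>. Q (stop s \<psi>))"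
  shows "integrable W (\<lambda>\<psi>. Q (stop s \<psi>) * (\<psi> t - \<psi> s))" "(\<integral>\<psi>. Q (stop s \<psi>) * (\<psi> t - \<psi> s) \<partial>W) = 0"
    "integrable W (\<lambda>\<psi>. Q (stop s \<psi>) * (\<psi> t - \<psi> s)\<^sup>2)"
    "(\<integral>\<psi>. Q (stop s \<psi>) * (\<psi> t - \<psi> s)\<^sup>2 \<partial>W) = (\<integral>\<psi>. Q (stop s \<psi>) \<partial>W) * (t - s)"
proof -
  note m = increment_moments[OF s]
  have i1: "indep_var borel (\<lambda>\<psi>. Q (stop s \<psi>)) borel (\<lambda>\<psi>. \<psi> t - \<psi> s)"
    using indep_stop[OF s Q(1), of "\<lambda>y. y"] by simp
  have i2: "indep_var borel (\<lambda>\<psi>. Q (stop s \<psi>)) borel (\<lambda>\<psi>. (\<psi> t - \<psi> s)\<^sup>2)"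
    using indep_stop[OF s Q(1), of "\<lambda>y. y\<^sup>2"] by simp
  show "integrable W (\<lambda>\<psi>. Q (stop s \<psi>) * (\<psi> t - \<psi> s))" by (rule indep_var_integrable[OF i1 Q(2) m(1)])
  show "(\<integral>\<psi>. Q (stop s \<psi>) * (\<psi> t - \<psi> s) \<partial>W) = 0" using indep_var_lebesgue_integral[OF i1 Q(2) m(1)] m(2) by simp
  show "integrable W (\<lambda>\<psi>. Q (stop s \<psi>) * (\<psi> t - \<psi> s)\<^sup>2)" by (rule indep_var_integrable[OF i2 Q(2) m(3)])
  show "(\<integral>\<psi>. Q (stop s \<psi>) * (\<psi> t - \<psi> s)\<^sup>2 \<partial>W) = (\<integral>\<psi>. Q (stop s \<psi>) \<partial>W) * (t - s)"
    using indep_var_lebesgue_integral[OF i2 Q(2) m(3)] m(4) by simp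
qed

text \<open>Each increment is independent of the path stopped at the beginning of its step. Hence
  cross terms have mean 0, the second moments add up, and a step contributes at most
  \<open>h * B^2\<close>.\<close>

lemma riemann_moments:
  fixes Q :: "nat \<Rightarrow> (real \<Rightarrow> real) \<Rightarrow> real" and h B :: real
  assumes h: "0 < h" and Q: "\<And>i. Q i \<in> borel_measurable Cspace" "\<And>i \<psi>. \<bar>Q i \<psi>\<bar> \<le> B"
  defines "S \<equiv> \<lambda>n \<psi>. \<Sum>i<n. Q i (stop (real i * h) \<psi>) * (\<psi> (real (Suc i) * h) - \<psi> (real i * h))"
  shows "S n \<in> borel_measurable Cspace \<and> integrable W (S n) \<and> (\<integral>\<psi>. S n \<psi> \<partial>W) = 0 \<and> integrable W (\<lambda>\<psi>. (S n \<psi>)\<^sup>2) \<and> (\<integral>\<psi>. (S n \<psi>)\<^sup>2 \<partial>W) \<le> real n * h * B\<^sup>2"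
proof (induction n)
  case 0 show ?case unfolding S_def by simp
next
  case (Suc n)
  let ?s = "real n * h" and ?t = "real (Suc n) * h"
  have st: "0 \<le> ?s" "?s < ?t" using h by auto
  have B0: "0 \<le> B" using Q(2)[of 0 "\<lambda>_. 0"] by linarith
  define q where "q \<psi> = Q n (stop ?s \<psi>)" for \<psi>
  define d where "d \<psi> = \<psi> ?t - \<psi> ?s" for \<psi> :: "real \<Rightarrow> real"
  have SS: "S (Suc n) \<psi> = S n \<psi> + q \<psi> * d \<psi>" for \<psi> unfolding S_def q_def d_def by simp
  have ss: "stop ?s (stop ?s \<psi>) = stop ?s \<psi>" for \<psi> unfolding stop_def by auto
  \<comment> \<open>The partial sum reads the path no further than \<open>?s\<close>, so it may be
    treated as part of the integrand in \<open>expectation_stop\<close>.\<close>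
  have Sst: "S n (stop ?s \<psi>) = S n \<psi>" for \<psi> unfolding S_def
  proof (rule sum.cong[OF refl])
    fix i assume "i \<in> {..<n}"
    then have le: "real (Suc i) * h \<le> ?s" "real i * h \<le> ?s" using h by (auto intro: mult_right_mono simp del: of_nat_Suc)
    have "stop (real i * h) (stop ?s \<psi>) = stop (real i * h) \<psi>" using le(2) unfolding stop_def by (auto simp: min_def fun_eq_iff)
    then show "Q i (stop (real i * h) (stop ?s \<psi>)) * (stop ?s \<psi> (real (Suc i) * h) - stop ?s \<psi> (real i * h)) = Q i (stop (real i * h) \<psi>) * (\<psi> (real (Suc i) * h) - \<psi> (real i * h))"
      using le unfolding stop_def[of ?s] by (simp add: min_def)
  qed
  have qm: "q \<in> borel_measurable Cspace" unfolding q_def by (rule measurable_compose[OF stop_measurable[OF st(1)] Q(1)])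
  have qs: "q (stop ?s \<psi>) = q \<psi>" for \<psi> unfolding q_def ss ..
  have qb: "\<bar>q \<psi>\<bar> \<le> B" for \<psi> unfolding q_def by (rule Q(2))
  have dm: "d \<in> borel_measurable Cspace" unfolding d_def by (intro borel_measurable_diff Cspace_eval)
  have Sm: "S n \<in> borel_measurable Cspace" using Suc by blast
  have qi: "integrable W q" using qb qm by (intro integrable_const_bound[where B = B]) (auto simp: measurable_W)
  have q2i: "integrable W (\<lambda>\<psi>. (q \<psi>)\<^sup>2)" using qb qm by (intro integrable_const_bound[where B = "B\<^sup>2"]) (auto simp: measurable_W abs_le_square_iff[symmetric] B0 intro: order_trans[OF qb])
  have q2b: "(\<integral>\<psi>. (q \<psi>)\<^sup>2 \<partial>W) \<le> B\<^sup>2"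
  proof -
    have "(\<integral>\<psi>. (q \<psi>)\<^sup>2 \<partial>W) \<le> (\<integral>\<psi>. B\<^sup>2 \<partial>W)" using q2i qb B0 by (intro integral_mono) (auto simp: abs_le_square_iff[symmetric])
    then show ?thesis by (simp add: prob_space)
  qed
  have Sqi: "integrable W (\<lambda>\<psi>. S n \<psi> * q \<psi>)"
  proof (rule Bochner_Integration.integrable_bound)
    show "integrable W (\<lambda>\<psi>. B * S n \<psi>)" using Suc by simp
    show "AE \<psi> in W. norm (S n \<psi> * q \<psi>) \<le> norm (B * S n \<psi>)" 
    proof (rule AE_I2)
      fix \<psi>
      have "\<bar>q \<psi>\<bar> * \<bar>S n \<psi>\<bar> \<le> B * \<bar>S n \<psi>\<bar>" by (intro mult_right_mono qb) simp
      then show "norm (S n \<psi> * q \<psi>) \<le> norm (B * S n \<psi>)" using B0 by (simp add: abs_mult mult.commute)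
    qed
    show "(\<lambda>\<psi>. S n \<psi> * q \<psi>) \<in> borel_measurable W" unfolding measurable_W by (intro borel_measurable_times Sm qm)
  qed
  have e1: "integrable W (\<lambda>\<psi>. q \<psi> * d \<psi>)" "(\<integral>\<psi>. q \<psi> * d \<psi> \<partial>W) = 0"
    using expectation_stop(1,2)[OF st qm] qi unfolding qs d_def by auto
  have e2: "integrable W (\<lambda>\<psi>. S n \<psi> * q \<psi> * d \<psi>)" "(\<integral>\<psi>. S n \<psi> * q \<psi> * d \<psi> \<partial>W) = 0"
    using expectation_stop(1,2)[OF st, of "\<lambda>\<psi>. S n \<psi> * q \<psi>"] Sqi Sm qm unfolding qs Sst d_def by auto
  have e3: "integrable W (\<lambda>\<psi>. (q \<psi>)\<^sup>2 * (d \<psi>)\<^sup>2)" "(\<integral>\<psi>. (q \<psi>)\<^sup>2 * (d \<psi>)\<^sup>2 \<partial>W) = (\<integral>\<psi>. (q \<psi>)\<^sup>2 \<partial>W) * h"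
    using expectation_stop(3,4)[OF st, of "\<lambda>\<psi>. (q \<psi>)\<^sup>2"] q2i qm unfolding qs d_def by (auto simp: algebra_simps)
  have sq: "(S (Suc n) \<psi>)\<^sup>2 = (S n \<psi>)\<^sup>2 + 2 * (S n \<psi> * q \<psi> * d \<psi>) + (q \<psi>)\<^sup>2 * (d \<psi>)\<^sup>2" for \<psi>
    unfolding SS by (simp add: power2_eq_square algebra_simps)
  have "S (Suc n) = (\<lambda>\<psi>. S n \<psi> + q \<psi> * d \<psi>)" using SS by blast
  then have "S (Suc n) \<in> borel_measurable Cspace" using Sm qm dm by simp
  moreover have "integrable W (S (Suc n))" "(\<integral>\<psi>. S (Suc n) \<psi> \<partial>W) = 0" unfolding SS using Suc e1 by auto
  moreover have "integrable W (\<lambda>\<psi>. (S (Suc n) \<psi>)\<^sup>2)" unfolding sq using Suc e2 e3 by auto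
  moreover have "(\<integral>\<psi>. (S (Suc n) \<psi>)\<^sup>2 \<partial>W) \<le> real (Suc n) * h * B\<^sup>2"
  proof -
    have "(\<integral>\<psi>. (S (Suc n) \<psi>)\<^sup>2 \<partial>W) = (\<integral>\<psi>. (S n \<psi>)\<^sup>2 \<partial>W) + (\<integral>\<psi>. (q \<psi>)\<^sup>2 \<partial>W) * h" unfolding sq using Suc e2 e3 by simp
    also have "\<dots> \<le> real n * h * B\<^sup>2 + B\<^sup>2 * h" using Suc q2b h by (intro add_mono mult_right_mono) auto
    finally show ?thesis by (simp add: algebra_simps)
  qed
  ultimately show ?case by blast
qed

text \<open>The increment of the bet after \<open>T\<close> is a pointwise limit of Riemann sums
  with mean 0 and second moments at most \<open>(t - T) * B^2\<close>, and it is bounded by 1 in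
  absolute value, so \<open>truncated_limit\<close> applies.\<close>

lemma expectation_bet_value:
  assumes f: "f \<in> Cpaths" and \<delta>: "0 < \<delta>" and T: "0 \<le> T" "T < t"
  shows "(\<integral>\<psi>. bet_value {0..} \<delta> p (join f T \<psi>) t \<partial>W) = bet_value {0..} \<delta> p f T"
proof -
  have jC: "join f T \<psi> \<in> Cpaths" if "\<psi> \<in> space W" for \<psi> using join_Cpaths[OF f T(1)] that by (simp add: space_W)
  have jf: "join f T \<psi> s = f s" if "s \<le> T" for \<psi> s unfolding join_def using that by simp
  have v0: "bet_value {0..} \<delta> p (join f T \<psi>) T = bet_value {0..} \<delta> p f T" if "\<psi> \<in> space W" for \<psi>
    using bet_value_local[OF f jC[OF that] \<delta> T(1)] jf by simp
  define X where "X \<psi> = bet_value {0..} \<delta> p (join f T \<psi>) t - bet_value {0..} \<delta> p f T" for \<psi>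
  define h where "h N = (t - T) / real (Suc N)" for N
  define Q where "Q N i \<psi> = position \<delta> p (T + real i * h N) (join f T \<psi>)" for N i \<psi>
  define S where "S N \<psi> = (\<Sum>i<Suc N. Q N i (stop (real i * h N) \<psi>) * (\<psi> (real (Suc i) * h N) - \<psi> (real i * h N)))" for N \<psi>
  define B where "B = real (length p) / \<delta>"
  have h: "0 < h N" for N unfolding h_def using T by simp
  have Qm: "Q N i \<in> borel_measurable Cspace" for N i
    unfolding Q_def by (rule measurable_compose[OF join_measurable[OF f T(1)] position_measurable[OF \<delta>]])
  have Qb: "\<bar>Q N i \<psi>\<bar> \<le> B" for N i \<psi> unfolding Q_def B_def by (rule position_bound[OF \<delta>])
  have RS: "S N \<in> borel_measurable Cspace" "integrable W (S N)" "(\<integral>\<psi>. S N \<psi> \<partial>W) = 0" "integrable W (\<lambda>\<psi>. (S N \<psi>)\<^sup>2)"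
     "(\<integral>\<psi>. (S N \<psi>)\<^sup>2 \<partial>W) \<le> real (Suc N) * h N * B\<^sup>2" for N
  proof -
    have "S N = (\<lambda>\<psi>. \<Sum>i<Suc N. Q N i (stop (real i * h N) \<psi>) * (\<psi> (real (Suc i) * h N) - \<psi> (real i * h N)))"
      unfolding S_def by (rule ext) (rule refl)
    note this[symmetric]
    note R = riemann_moments[OF h[of N] Qm[of N] Qb[of N], where n = "Suc N", unfolded this]
    show "S N \<in> borel_measurable Cspace" "integrable W (S N)" "(\<integral>\<psi>. S N \<psi> \<partial>W) = 0" "integrable W (\<lambda>\<psi>. (S N \<psi>)\<^sup>2)"
      "(\<integral>\<psi>. (S N \<psi>)\<^sup>2 \<partial>W) \<le> real (Suc N) * h N * B\<^sup>2" using R unfolding S_def by (simp_all only: simp_thms)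
  qed
  have vm: "(\<lambda>\<psi>. bet_value {0..} \<delta> p (join f T \<psi>) t) \<in> borel_measurable W"
    unfolding measurable_W by (rule measurable_compose[OF join_measurable[OF f T(1)] bet_value_measurable[OF \<delta>]])
  have vb: "0 \<le> bet_value {0..} \<delta> p \<phi> u \<and> bet_value {0..} \<delta> p \<phi> u \<le> 1" if "\<phi> \<in> Cpaths" "0 \<le> u" for \<phi> u
    using path_crossing.bet_value_bounds[OF path_crossing_Cpaths[OF that(1) \<delta>], of u p] that by auto
  have "(\<integral>\<psi>. X \<psi> \<partial>W) = 0"
  proof (rule truncated_limit[where S = S and C = "(t - T) * B\<^sup>2"])
    show "prob_space W" by (rule prob_space_axioms)
    show "S N \<in> borel_measurable W" for N unfolding measurable_W by (rule RS)
    show "X \<in> borel_measurable W" unfolding X_def using vm by simp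
    show "\<bar>X \<psi>\<bar> \<le> 1" if "\<psi> \<in> space W" for \<psi>
      using vb[OF jC[OF that], of t] vb[OF f T(1)] T unfolding X_def by (auto simp: abs_le_iff)
    show "(\<lambda>N. S N \<psi>) \<longlonglongrightarrow> X \<psi>" if \<psi>: "\<psi> \<in> space W" for \<psi>
    proof -
      have "S N \<psi> = (\<Sum>i<Suc N. position \<delta> p (T + real i * h N) (join f T \<psi>) * (join f T \<psi> (T + real (Suc i) * h N) - join f T \<psi> (T + real i * h N)))" for N
        unfolding S_def
      proof (rule sum.cong[OF refl])
        fix i
        have i: "0 \<le> real i * h N" "0 \<le> real (Suc i) * h N" using h[of N] by auto
        \<comment> \<open>The position at a time reads the joined path up to that time, where
          stopping the Brownian part makes no difference.\<close>
        have "Q N i (stop (real i * h N) \<psi>) = position \<delta> p (T + real i * h N) (join f T \<psi>)"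
          unfolding Q_def
        proof (rule position_local)
          show "join f T \<psi> \<in> Cpaths" by (rule jC[OF \<psi>])
          show "join f T (stop (real i * h N) \<psi>) \<in> Cpaths" using stop_Cpaths[OF _ i(1)] \<psi> by (intro join_Cpaths f T(1)) (simp add: space_W)
          show "0 \<le> T + real i * h N" using T i by simp
          show "join f T (stop (real i * h N) \<psi>) s = join f T \<psi> s" if "s \<le> T + real i * h N" for s
            using that i unfolding join_def stop_def by (auto simp: min_def max_def)
        qed (rule \<delta>)
        then show "Q N i (stop (real i * h N) \<psi>) * (\<psi> (real (Suc i) * h N) - \<psi> (real i * h N)) =
          position \<delta> p (T + real i * h N) (join f T \<psi>) * (join f T \<psi> (T + real (Suc i) * h N) - join f T \<psi> (T + real i * h N))"
          using i unfolding join_def by (simp del: of_nat_Suc)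
      qed
      then show ?thesis using bet_value_riemann[OF jC[OF \<psi>] \<delta> T, of p] v0[OF \<psi>] unfolding X_def h_def by simp
    qed
    show "integrable W (S N)" "(\<integral>\<psi>. S N \<psi> \<partial>W) = 0" "integrable W (\<lambda>\<psi>. (S N \<psi>)\<^sup>2)" for N by (rule RS)+
    show "(\<integral>\<psi>. (S N \<psi>)\<^sup>2 \<partial>W) \<le> (t - T) * B\<^sup>2" for N using RS(5)[of N] unfolding h_def by simp
  qed
  moreover have "integrable W (\<lambda>\<psi>. bet_value {0..} \<delta> p (join f T \<psi>) t)"
    using vm vb jC T by (intro integrable_const_bound[where B = 1]) auto
  ultimately show ?thesis unfolding X_def by (simp add: prob_space)
qed

lemma AE_join_unbounded_path:
  assumes f: "f \<in> Cpaths" and T: "0 \<le> T"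
  shows "AE \<psi> in W. unbounded_path (join f T \<psi>)"
  using AE_unbounded
proof (rule AE_mp, intro AE_I2 impI)
  fix \<psi> :: "real \<Rightarrow> real" assume *: "\<forall>M. \<exists>t\<ge>0. M < \<bar>\<psi> t - \<psi> 0\<bar>"
  show "unbounded_path (join f T \<psi>)" unfolding unbounded_path_def
  proof
    fix M
    obtain t where t: "t \<ge> 0" "M + \<bar>f T\<bar> < \<bar>\<psi> t - \<psi> 0\<bar>" using * by blast
    have "join f T \<psi> (T + t) = f T + (\<psi> t - \<psi> 0)" unfolding join_def using t T by (simp add: min_def max_def)
    then show "\<exists>t\<ge>0. M < \<bar>join f T \<psi> t\<bar>" using t T by (intro exI[of _ "T + t"]) auto
  qed
qed

text \<open>The joined path is almost surely unbounded, so the bet is eventually decided and its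
  value converges to the indicator of winning; the mean stays constant in time and dominated
  convergence applies.\<close>

lemma prob_follows:
  assumes f: "f \<in> Cpaths" and \<delta>: "0 < \<delta>" and T: "0 \<le> T"
  shows "prob {\<psi>\<in>space W. follows {0..} \<delta> p (join f T \<psi>) (length p)} = bet_value {0..} \<delta> p f T"
proof -
  let ?A = "{\<psi>\<in>space W. follows {0..} \<delta> p (join f T \<psi>) (length p)}"
  have vm: "(\<lambda>\<psi>. bet_value {0..} \<delta> p (join f T \<psi>) t) \<in> borel_measurable W" for t
    unfolding measurable_W by (rule measurable_compose[OF join_measurable[OF f T(1)] bet_value_measurable[OF \<delta>]])
  have pm: "Measurable.pred W (\<lambda>\<psi>. follows {0..} \<delta> p (join f T \<psi>) (length p))"
    unfolding measurable_W using measurable_compose[OF join_measurable[OF f T(1)] follows_measurable[OF \<delta>]] .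
  have jC: "join f T \<psi> \<in> Cpaths" if "\<psi> \<in> space W" for \<psi> using join_Cpaths[OF f T(1)] that by (simp add: space_W)
  have "(\<lambda>n. \<integral>\<psi>. bet_value {0..} \<delta> p (join f T \<psi>) (T + real (Suc n)) \<partial>W) \<longlonglongrightarrow> (\<integral>\<psi>. indicator ?A \<psi> \<partial>W)"
  proof (rule integral_dominated_convergence[where w = "\<lambda>_. 1"])
    show "AE \<psi> in W. (\<lambda>n. bet_value {0..} \<delta> p (join f T \<psi>) (T + real (Suc n))) \<longlonglongrightarrow> indicator ?A \<psi>"
      using AE_join_unbounded_path[OF f T] AE_space
    proof eventually_elim
      case (elim \<psi>)
      interpret path_crossing "{0..}" \<delta> "join f T \<psi>" using jC[OF elim(2)] \<delta> by (rule path_crossing_Cpaths)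
      have fi: "crossing_time {0..} \<delta> (join f T \<psi>) (length p) \<noteq> \<infinity>" using unbounded_crosses_forever[OF jC[OF elim(2)] elim(1) \<delta>] .
      obtain n0 :: nat where n0: "enn2real (crossing_time {0..} \<delta> (join f T \<psi>) (length p)) \<le> real n0" using real_arch_simple by blast
      have "bet_value {0..} \<delta> p (join f T \<psi>) (T + real (Suc n)) = indicator ?A \<psi>" if "n \<ge> n0" for n
      proof -
        have t: "T + real (Suc n) \<in> {0..}" "enn2real (crossing_time {0..} \<delta> (join f T \<psi>) (length p)) \<le> T + real (Suc n)" using n0 that T by auto
        then have "crossing_time {0..} \<delta> (join f T \<psi>) (length p) \<le> ennreal (T + real (Suc n))" using le_iff[OF t(1)] fi by blast
        from bet_value_final[OF t(1) this] show ?thesis using elim(2) by (simp add: indicator_def)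
      qed
      then show ?case by (intro tendsto_eventually) (auto simp: eventually_sequentially)
    qed
    show "AE \<psi> in W. norm (bet_value {0..} \<delta> p (join f T \<psi>) (T + real (Suc n))) \<le> 1" for n
    proof (rule AE_I2)
      fix \<psi> assume "\<psi> \<in> space W"
      from path_crossing.bet_value_bounds[OF path_crossing_Cpaths[OF jC[OF this] \<delta>], of "T + real (Suc n)" p] T
      show "norm (bet_value {0..} \<delta> p (join f T \<psi>) (T + real (Suc n))) \<le> 1" by simp
    qed
    show "(indicator ?A :: _ \<Rightarrow> real) \<in> borel_measurable W" using pm by simp
  qed (use vm in auto)
  moreover have "(\<integral>\<psi>. bet_value {0..} \<delta> p (join f T \<psi>) (T + real (Suc n)) \<partial>W) = bet_value {0..} \<delta> p f T" for n
    using expectation_bet_value[OF f \<delta> T, of "T + real (Suc n)" p] by simp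
  ultimately have "(\<integral>\<psi>. indicator ?A \<psi> \<partial>W) = bet_value {0..} \<delta> p f T" by (simp add: LIMSEQ_const_iff)
  then show ?thesis using pm by (simp add: Int_absorb2 subset_iff)
qed

end

section \<open>Morse's clock\<close>

text \<open>Morse's \<open>\<mu>\<close>-length weighs the largest gaps \<open>r\<close> by which \<open>Suc k\<close> successive increments can be bounded below; unlike
  arc length it is finite for every continuous path.\<close>

definition chains :: "(real \<Rightarrow> real) \<Rightarrow> nat \<Rightarrow> real \<Rightarrow> real set" where
  "chains \<phi> k t = {r. 0 \<le> r \<and> (\<exists>c. 0 \<le> c 0 \<and> (\<forall>i\<le>k. c i \<le> c (Suc i) \<and> r \<le> \<bar>\<phi> (c (Suc i)) - \<phi> (c i)\<bar>) \<and> c (Suc k) \<le> t)}"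

definition max_gap :: "(real \<Rightarrow> real) \<Rightarrow> nat \<Rightarrow> real \<Rightarrow> real" where "max_gap \<phi> k t = Sup (chains \<phi> k t)"

text \<open>The weights add up to 1, so that a uniform error in all gaps becomes the same error of
  the clock.\<close>

definition clock :: "(real \<Rightarrow> real) \<Rightarrow> real \<Rightarrow> real" where "clock \<phi> t = (\<Sum>k. (1/2) ^ Suc k * max_gap \<phi> k t)"

lemma chain_range:
  fixes c :: "nat \<Rightarrow> real"
  assumes "0 \<le> c 0" "\<forall>i\<le>k. c i \<le> c (Suc i)" "c (Suc k) \<le> t" "i \<le> Suc k"
  shows "0 \<le> c i \<and> c i \<le> t"
proof -
  have m: "c i \<le> c j" if "i \<le> j" "j \<le> Suc k" for i j
    using that(1)
  proof (rule dec_induct[where P = "\<lambda>j. j \<le> Suc k \<longrightarrow> c i \<le> c j", rule_format])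
    show "j \<le> Suc k" by fact
    fix n assume "n \<le> Suc k \<Longrightarrow> c i \<le> c n" "Suc n \<le> Suc k"
    then show "c i \<le> c (Suc n)" using assms(2) by (meson Suc_leD Suc_le_mono order_trans)
  qed simp
  show ?thesis using m[of 0 i] m[of i "Suc k"] assms by auto
qed

lemma zero_chain: "0 \<le> t \<Longrightarrow> 0 \<in> chains \<phi> k t"
  unfolding chains_def by (auto intro!: exI[of _ "\<lambda>_. 0"])

lemma chains_bdd:
  assumes "\<phi> \<in> Cpaths" shows "bdd_above (chains \<phi> k t)"
proof -
  obtain M where M: "\<forall>s\<in>{0..t}. \<bar>\<phi> s\<bar> \<le> M" using cpath_bounded_initial[OF assms] by blast
  have "r \<le> 2 * M" if rc: "r \<in> chains \<phi> k t" for r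
  proof -
    obtain c where c: "0 \<le> c 0" "\<forall>i\<le>k. c i \<le> c (Suc i) \<and> r \<le> \<bar>\<phi> (c (Suc i)) - \<phi> (c i)\<bar>" "c (Suc k) \<le> t"
      using rc unfolding chains_def by blast
    have m: "\<forall>i\<le>k. c i \<le> c (Suc i)" using c(2) by blast
    have "\<bar>\<phi> (c 0)\<bar> \<le> M" "\<bar>\<phi> (c (Suc 0))\<bar> \<le> M" using chain_range[OF c(1) m c(3), of 0] chain_range[OF c(1) m c(3), of "Suc 0"] M by auto
    moreover have "r \<le> \<bar>\<phi> (c (Suc 0)) - \<phi> (c 0)\<bar>" using c(2) by simp
    ultimately show ?thesis by linarith
  qed
  then show ?thesis by (intro bdd_aboveI)
qed

lemma max_gap_upper: "\<phi> \<in> Cpaths \<Longrightarrow> r \<in> chains \<phi> k t \<Longrightarrow> r \<le> max_gap \<phi> k t"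
  unfolding max_gap_def by (intro cSup_upper chains_bdd)

lemma max_gap_least: "0 \<le> t \<Longrightarrow> (\<And>r. r \<in> chains \<phi> k t \<Longrightarrow> r \<le> b) \<Longrightarrow> max_gap \<phi> k t \<le> b"
  unfolding max_gap_def using zero_chain by (intro cSup_least) blast+

lemma max_gap_nonneg: "\<phi> \<in> Cpaths \<Longrightarrow> 0 \<le> t \<Longrightarrow> 0 \<le> max_gap \<phi> k t"
  by (rule max_gap_upper[OF _ zero_chain])

lemma max_gap_compare:
  assumes \<phi>: "\<phi>' \<in> Cpaths" and t: "0 \<le> t" "0 \<le> t'"
    and \<kappa>: "\<And>s. 0 \<le> s \<Longrightarrow> s \<le> t \<Longrightarrow> 0 \<le> \<kappa> s \<and> \<kappa> s \<le> t' \<and> \<bar>\<phi> s - \<phi>' (\<kappa> s)\<bar> \<le> e"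
    and mono: "\<And>s s'. 0 \<le> s \<Longrightarrow> s \<le> s' \<Longrightarrow> s' \<le> t \<Longrightarrow> \<kappa> s \<le> \<kappa> s'"
  shows "max_gap \<phi> k t \<le> max_gap \<phi>' k t' + 2 * e"
proof (rule max_gap_least[OF t(1)])
  have e: "0 \<le> e" using \<kappa>[of 0] t(1) by force
  fix r assume "r \<in> chains \<phi> k t"
  then obtain c where c: "0 \<le> c 0" "\<forall>i\<le>k. c i \<le> c (Suc i) \<and> r \<le> \<bar>\<phi> (c (Suc i)) - \<phi> (c i)\<bar>" "c (Suc k) \<le> t"
    unfolding chains_def by blast
  have crossing_time: "0 \<le> c i \<and> c i \<le> t" if "i \<le> Suc k" for i using chain_range[of c k t i] c that by blast
  have "max 0 (r - 2 * e) \<in> chains \<phi>' k t'" unfolding chains_def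
  proof (intro CollectI conjI exI[of _ "\<lambda>i. \<kappa> (c i)"] allI impI)
    show "0 \<le> \<kappa> (c 0)" "\<kappa> (c (Suc k)) \<le> t'" using \<kappa> crossing_time by auto
    fix i assume i: "i \<le> k"
    show "\<kappa> (c i) \<le> \<kappa> (c (Suc i))" using mono crossing_time[of i] crossing_time[of "Suc i"] c(2) i by auto
    have "\<bar>\<phi> (c i) - \<phi>' (\<kappa> (c i))\<bar> \<le> e" "\<bar>\<phi> (c (Suc i)) - \<phi>' (\<kappa> (c (Suc i)))\<bar> \<le> e" using \<kappa> crossing_time[of i] crossing_time[of "Suc i"] i by auto
    moreover have "r \<le> \<bar>\<phi> (c (Suc i)) - \<phi> (c i)\<bar>" using c(2) i by blast
    ultimately show "max 0 (r - 2 * e) \<le> \<bar>\<phi>' (\<kappa> (c (Suc i))) - \<phi>' (\<kappa> (c i))\<bar>" by linarith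
  qed simp
  from max_gap_upper[OF \<phi> this] show "r \<le> max_gap \<phi>' k t' + 2 * e" by simp
qed

lemma max_gap_mono: "\<phi> \<in> Cpaths \<Longrightarrow> 0 \<le> t \<Longrightarrow> t \<le> t' \<Longrightarrow> max_gap \<phi> k t \<le> max_gap \<phi> k t'"
  using max_gap_compare[of \<phi> t t' "\<lambda>s. s" \<phi> 0 k] by simp

lemma max_gap_le_0:
  assumes "\<phi> \<in> Cpaths" "0 \<le> t" shows "max_gap \<phi> k t \<le> max_gap \<phi> 0 t"
proof (rule max_gap_least[OF assms(2)])
  fix r assume "r \<in> chains \<phi> k t"
  then obtain c where c: "0 \<le> r" "0 \<le> c 0" "\<forall>i\<le>k. c i \<le> c (Suc i) \<and> r \<le> \<bar>\<phi> (c (Suc i)) - \<phi> (c i)\<bar>" "c (Suc k) \<le> t"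
    unfolding chains_def by blast
  have "c (Suc 0) \<le> t" using chain_range[of c k t "Suc 0"] c by auto
  then have "r \<in> chains \<phi> 0 t" unfolding chains_def using c by auto
  then show "r \<le> max_gap \<phi> 0 t" by (rule max_gap_upper[OF assms(1)])
qed

lemma half_sums: "(\<lambda>k. (1/2::real) ^ Suc k * b) sums b"
  using sums_mult2[OF power_half_series, of b] by simp

lemma clock_summable:
  assumes "\<phi> \<in> Cpaths" "0 \<le> t" shows "summable (\<lambda>k. (1/2) ^ Suc k * max_gap \<phi> k t)"
proof (rule summable_comparison_test')
  show "summable (\<lambda>k. (1/2) ^ Suc k * max_gap \<phi> 0 t)" using half_sums by (rule sums_summable)
  show "norm ((1/2) ^ Suc k * max_gap \<phi> k t) \<le> (1/2) ^ Suc k * max_gap \<phi> 0 t" for k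
    using max_gap_le_0[OF assms, of k] max_gap_nonneg[OF assms, of k] by (auto simp: abs_mult intro: mult_left_mono)
qed

lemma clock_compare:
  assumes \<phi>: "\<phi> \<in> Cpaths" "\<phi>' \<in> Cpaths" and t: "0 \<le> t" "0 \<le> t'"
    and \<kappa>: "\<And>s. 0 \<le> s \<Longrightarrow> s \<le> t \<Longrightarrow> 0 \<le> \<kappa> s \<and> \<kappa> s \<le> t' \<and> \<bar>\<phi> s - \<phi>' (\<kappa> s)\<bar> \<le> e"
    and mono: "\<And>s s'. 0 \<le> s \<Longrightarrow> s \<le> s' \<Longrightarrow> s' \<le> t \<Longrightarrow> \<kappa> s \<le> \<kappa> s'"
  shows "clock \<phi> t \<le> clock \<phi>' t' + 2 * e"
proof -
  have s: "(\<lambda>k. (1/2) ^ Suc k * max_gap \<phi>' k t' + (1/2) ^ Suc k * (2 * e)) sums (clock \<phi>' t' + 2 * e)"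
    unfolding clock_def by (intro sums_add half_sums summable_sums clock_summable \<phi> t)
  have "clock \<phi> t \<le> (\<Sum>k. (1/2) ^ Suc k * max_gap \<phi>' k t' + (1/2) ^ Suc k * (2 * e))"
    unfolding clock_def
  proof (rule suminf_le[OF _ clock_summable[OF \<phi>(1) t(1)] sums_summable[OF s]])
    fix k
    have "max_gap \<phi> k t \<le> max_gap \<phi>' k t' + 2 * e" by (rule max_gap_compare[OF \<phi>(2) t \<kappa> mono])
    then have "(1/2) ^ Suc k * max_gap \<phi> k t \<le> (1/2) ^ Suc k * (max_gap \<phi>' k t' + 2 * e)" by (intro mult_left_mono) auto
    then show "(1/2) ^ Suc k * max_gap \<phi> k t \<le> (1/2) ^ Suc k * max_gap \<phi>' k t' + (1/2) ^ Suc k * (2 * e)" by (simp add: distrib_left)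
  qed
  then show ?thesis using sums_unique[OF s] by simp
qed

lemma clock_mono: "\<phi> \<in> Cpaths \<Longrightarrow> 0 \<le> t \<Longrightarrow> t \<le> t' \<Longrightarrow> clock \<phi> t \<le> clock \<phi> t'"
  using clock_compare[of \<phi> \<phi> t t' "\<lambda>s. s" 0] by simp

lemma clock_0: "\<phi> \<in> Cpaths \<Longrightarrow> clock \<phi> 0 = 0"
proof -
  assume \<phi>: "\<phi> \<in> Cpaths"
  have "max_gap \<phi> k 0 = 0" for k
  proof (rule antisym)
    show "max_gap \<phi> k 0 \<le> 0"
    proof (rule max_gap_least[OF order_refl])
      fix r assume "r \<in> chains \<phi> k 0"
      then obtain c where c: "0 \<le> c 0" "\<forall>i\<le>k. c i \<le> c (Suc i) \<and> r \<le> \<bar>\<phi> (c (Suc i)) - \<phi> (c i)\<bar>" "c (Suc k) \<le> 0"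
        unfolding chains_def by blast
      have "c 0 = 0" "c (Suc 0) = 0" using chain_range[of c k 0 0] chain_range[of c k 0 "Suc 0"] c by auto
      moreover have "r \<le> \<bar>\<phi> (c (Suc 0)) - \<phi> (c 0)\<bar>" using c(2) by blast
      ultimately show "r \<le> 0" by simp
    qed
  qed (rule max_gap_nonneg[OF \<phi> order_refl])
  then show ?thesis unfolding clock_def by simp
qed

lemma clock_nonneg: "\<phi> \<in> Cpaths \<Longrightarrow> 0 \<le> t \<Longrightarrow> 0 \<le> clock \<phi> t"
  using clock_mono[of \<phi> 0 t] clock_0 by simp

lemma clock_cont:
  assumes \<phi>: "\<phi> \<in> Cpaths" shows "continuous_on {0..} (clock \<phi>)"
proof (rule continuous_on_atLeastI)
  fix u :: real
  have uc: "uniformly_continuous_on {0..u} \<phi>" by (intro compact_uniformly_continuous Cpaths_cont \<phi>) simp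
  show "continuous_on {0..u} (clock \<phi>)" unfolding continuous_on_iff
  proof (intro ballI allI impI)
    fix t e :: real assume t: "t \<in> {0..u}" and e: "0 < e"
    obtain d where d: "d > 0" "\<And>x y. x \<in> {0..u} \<Longrightarrow> y \<in> {0..u} \<Longrightarrow> dist y x < d \<Longrightarrow> dist (\<phi> y) (\<phi> x) < e / 4"
      using uc e unfolding uniformly_continuous_on_def by (metis divide_pos_pos zero_less_numeral)
    have half: "\<bar>clock \<phi> t2 - clock \<phi> t1\<bar> < e" if t: "t1 \<in> {0..u}" "t2 \<in> {0..u}" "t1 \<le> t2" "t2 - t1 < d" for t1 t2
    proof -
      have "clock \<phi> t2 \<le> clock \<phi> t1 + 2 * (e / 4)"
      \<comment> \<open>Stopping at \<open>t1\<close> moves the path on [0,t2] by little if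
        \<open>t2 - t1\<close> is small.\<close>
      proof (rule clock_compare[where \<kappa> = "\<lambda>s. min s t1"])
        fix s assume s: "0 \<le> s" "s \<le> t2"
        have "dist (min s t1) s < d" using s t d(1) by (auto simp: dist_real_def min_def)
        then have "dist (\<phi> (min s t1)) (\<phi> s) < e / 4" using d(2)[of s "min s t1"] s t by auto
        then show "0 \<le> min s t1 \<and> min s t1 \<le> t1 \<and> \<bar>\<phi> s - \<phi> (min s t1)\<bar> \<le> e / 4" using s t
          by (auto simp: dist_real_def abs_minus_commute)
      qed (use t \<phi> in auto)
      moreover have "clock \<phi> t1 \<le> clock \<phi> t2" using t by (intro clock_mono \<phi>) auto
      ultimately show ?thesis using e by simp
    qed
    show "\<exists>d>0. \<forall>x'\<in>{0..u}. dist x' t < d \<longrightarrow> dist (clock \<phi> x') (clock \<phi> t) < e"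
    proof (intro exI[of _ d] conjI ballI impI d(1))
      fix x' assume x': "x' \<in> {0..u}" "dist x' t < d"
      then show "dist (clock \<phi> x') (clock \<phi> t) < e"
        using half[of t x'] half[of x' t] t unfolding dist_real_def by (cases "t \<le> x'") (auto simp: abs_minus_commute)
    qed
  qed
qed

text \<open>Many consecutive intervals inside [0,t] cannot all be long, and on a short one the path
  hardly moves.\<close>

lemma max_gap_small:
  assumes \<phi>: "\<phi> \<in> Cpaths" and t: "0 \<le> t" and d: "0 < d" shows "\<exists>k. max_gap \<phi> k t < d"
proof -
  have "uniformly_continuous_on {0..t} \<phi>" by (intro compact_uniformly_continuous Cpaths_cont \<phi>) simp
  then obtain e where e: "e > 0" "\<And>x y. x \<in> {0..t} \<Longrightarrow> y \<in> {0..t} \<Longrightarrow> dist y x < e \<Longrightarrow> dist (\<phi> y) (\<phi> x) < d / 2"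
    unfolding uniformly_continuous_on_def using d by (metis half_gt_zero)
  obtain k :: nat where k: "t < real k * e" using e(1) reals_Archimedean3 by blast
  have "max_gap \<phi> k t \<le> d / 2"
  proof (rule max_gap_least[OF t])
    fix r assume "r \<in> chains \<phi> k t"
    then obtain c where c: "0 \<le> c 0" "\<forall>i\<le>k. c i \<le> c (Suc i) \<and> r \<le> \<bar>\<phi> (c (Suc i)) - \<phi> (c i)\<bar>" "c (Suc k) \<le> t"
      unfolding chains_def by blast
    have crossing_time: "0 \<le> c i \<and> c i \<le> t" if "i \<le> Suc k" for i using chain_range[of c k t i] c that by blast
    have "\<exists>i\<le>k. c (Suc i) - c i < e"
    proof (rule ccontr)
      assume "\<not> ?thesis"
      then have n: "\<And>i. i \<le> k \<Longrightarrow> e \<le> c (Suc i) - c i" by force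
      have "real i * e \<le> c i" if "i \<le> Suc k" for i using that
      proof (induction i)
        case (Suc i) then show ?case using n[of i] by (simp add: algebra_simps)
      qed (use c in simp)
      from this[of k] k crossing_time[of k] show False by simp
    qed
    then obtain i where i: "i \<le> k" "c (Suc i) - c i < e" by blast
    have "dist (\<phi> (c (Suc i))) (\<phi> (c i)) < d / 2" using e(2)[of "c i" "c (Suc i)"] crossing_time[of i] crossing_time[of "Suc i"] i c(2) by (auto simp: dist_real_def)
    moreover have "r \<le> \<bar>\<phi> (c (Suc i)) - \<phi> (c i)\<bar>" using c(2) i by blast
    ultimately show "r \<le> d / 2" by (simp add: dist_real_def)
  qed
  then show ?thesis using d by (intro exI[of _ k]) simp
qed

text \<open>Let \<open>d\<close> be half the distance between the two later values and
  \<open>k\<close> the first level whose gap at time \<open>t\<close> is below \<open>d\<close>. A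
  nearly optimal chain of the previous level fits into [0,t] with gaps close to \<open>d\<close>,
  and it can be prolonged beyond \<open>t\<close> by a further move of size at least
  \<open>d\<close>; so the gap at level \<open>k\<close> has grown to at least \<open>d\<close>. For
  \<open>k\<close> = 0 the two later times form the chain.\<close>

lemma clock_strict:
  assumes \<phi>: "\<phi> \<in> Cpaths" and t: "0 \<le> t" "t \<le> u" "u \<le> v" "v \<le> t'" and ne: "\<phi> u \<noteq> \<phi> v"
  shows "clock \<phi> t < clock \<phi> t'"
proof -
  define d where "d = \<bar>\<phi> u - \<phi> v\<bar> / 2"
  have d: "0 < d" using ne unfolding d_def by simp
  define k where "k = (LEAST k. max_gap \<phi> k t < d)"
  have k: "max_gap \<phi> k t < d" unfolding k_def using max_gap_small[OF \<phi> t(1) d] by (rule LeastI_ex)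
  have "d \<le> max_gap \<phi> k t'"
  proof (cases k)
    case 0
    have "d \<in> chains \<phi> 0 t'" unfolding chains_def
      by (intro CollectI conjI exI[of _ "\<lambda>i. if i = 0 then u else v"]) (use t d in \<open>auto simp: d_def abs_minus_commute\<close>)
    then show ?thesis unfolding 0 by (rule max_gap_upper[OF \<phi>])
  next
    case (Suc j)
    have j: "d \<le> max_gap \<phi> j t" using not_less_Least[of j "\<lambda>k. max_gap \<phi> k t < d"] Suc unfolding k_def by simp
    show ?thesis
    proof (rule field_le_epsilon)
      fix e :: real assume e: "0 < e"
      have "\<exists>r\<in>chains \<phi> j t. d - e < r"
      proof (rule ccontr)
        assume "\<not> ?thesis"
        then have "max_gap \<phi> j t \<le> d - e" by (intro max_gap_least t) force
        with j e show False by simp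
      qed
      then obtain r c where r: "d - e < r" "0 \<le> r" and c: "0 \<le> c 0" "\<forall>i\<le>j. c i \<le> c (Suc i) \<and> r \<le> \<bar>\<phi> (c (Suc i)) - \<phi> (c i)\<bar>" "c (Suc j) \<le> t"
        unfolding chains_def by blast
      \<comment> \<open>The two values are \<open>2 * d\<close> apart, so at least one of them lies
        at distance \<open>d\<close> or more from the end of the chain.\<close>
      define w where "w = (if d \<le> \<bar>\<phi> u - \<phi> (c (Suc j))\<bar> then u else v)"
      have w: "d \<le> \<bar>\<phi> w - \<phi> (c (Suc j))\<bar>" "t \<le> w" "w \<le> t'"
      proof -
        have "\<bar>\<phi> u - \<phi> v\<bar> \<le> \<bar>\<phi> u - \<phi> (c (Suc j))\<bar> + \<bar>\<phi> v - \<phi> (c (Suc j))\<bar>" by linarith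
        then show "d \<le> \<bar>\<phi> w - \<phi> (c (Suc j))\<bar>" unfolding w_def d_def by (simp split: if_splits)
        show "t \<le> w" "w \<le> t'" using t unfolding w_def by auto
      qed
      have "min r d \<in> chains \<phi> k t'" unfolding Suc chains_def
      proof (intro CollectI conjI exI[of _ "\<lambda>i. if i \<le> Suc j then c i else w"] allI impI)
        show "0 \<le> min r d" using r d by simp
        fix i assume i: "i \<le> Suc j"
        show "(if i \<le> Suc j then c i else w) \<le> (if Suc i \<le> Suc j then c (Suc i) else w)" using c w(2) i by (auto simp: le_Suc_eq)
        show "min r d \<le> \<bar>\<phi> (if Suc i \<le> Suc j then c (Suc i) else w) - \<phi> (if i \<le> Suc j then c i else w)\<bar>"
          using c w(1) i by (cases "i \<le> j") (auto simp: le_Suc_eq min_le_iff_disj)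
      qed (use c w in auto)
      then have "min r d \<le> max_gap \<phi> k t'" by (rule max_gap_upper[OF \<phi>])
      then show "d \<le> max_gap \<phi> k t' + e" using r e by auto
    qed
  qed
  then have lt: "max_gap \<phi> k t < max_gap \<phi> k t'" using k by simp
  have t'0: "0 \<le> t'" using t by simp
  let ?d = "\<lambda>j. (1/2) ^ Suc j * max_gap \<phi> j t' - (1/2) ^ Suc j * max_gap \<phi> j t"
  have "0 < (\<Sum>j. ?d j)"
  proof (rule suminf_pos2[where i = k])
    show "summable ?d" by (intro summable_diff clock_summable \<phi> t(1) t'0)
    show "0 \<le> ?d j" for j
      using max_gap_mono[OF \<phi> t(1), of t' j] t by (simp add: mult_left_mono)
    show "0 < ?d k" using lt by simp
  qed
  moreover have "(\<Sum>j. ?d j) = clock \<phi> t' - clock \<phi> t"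
    unfolding clock_def by (intro suminf_diff[symmetric] clock_summable \<phi> t(1) t'0)
  ultimately show ?thesis by simp
qed

lemma clock_ge:
  assumes \<phi>: "\<phi> \<in> Cpaths" and t: "0 \<le> t" shows "\<bar>\<phi> t - \<phi> 0\<bar> / 2 \<le> clock \<phi> t"
proof -
  have "\<bar>\<phi> t - \<phi> 0\<bar> \<in> chains \<phi> 0 t" unfolding chains_def
    by (intro CollectI conjI exI[of _ "\<lambda>i. if i = 0 then 0 else t"]) (use t in auto)
  then have "\<bar>\<phi> t - \<phi> 0\<bar> \<le> max_gap \<phi> 0 t" by (rule max_gap_upper[OF \<phi>])
  moreover have "(\<Sum>k<1. (1/2) ^ Suc k * max_gap \<phi> k t) \<le> clock \<phi> t" unfolding clock_def
    by (intro sum_le_suminf clock_summable \<phi> t) (use max_gap_nonneg[OF \<phi> t] in auto)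
  ultimately show ?thesis by simp
qed

section \<open>Normal form of unbounded paths\<close>

definition unclock :: "(real \<Rightarrow> real) \<Rightarrow> real \<Rightarrow> real" where
  "unclock \<phi> u = (SOME t. 0 \<le> t \<and> clock \<phi> t = max u 0)"

text \<open>The choice made in \<open>unclock\<close> is immaterial here, since
  \<open>\<phi>\<close> takes the same value at all times with the same clock reading
  (\<open>clock_eq_imp\<close>).\<close>

definition normal :: "(real \<Rightarrow> real) \<Rightarrow> real \<Rightarrow> real" where "normal \<phi> u = \<phi> (unclock \<phi> u)"

lemma clock_surj:
  assumes \<phi>: "\<phi> \<in> Cpaths" "unbounded_path \<phi>" and u: "0 \<le> u" shows "\<exists>t\<ge>0. clock \<phi> t = u"
proof -
  obtain t where t: "t \<ge> 0" "2 * u + \<bar>\<phi> 0\<bar> < \<bar>\<phi> t\<bar>" using \<phi>(2) unfolding unbounded_path_def by blast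
  have "\<bar>\<phi> t\<bar> - \<bar>\<phi> 0\<bar> \<le> \<bar>\<phi> t - \<phi> 0\<bar>" by (rule abs_triangle_ineq2)
  moreover have "u \<le> K" if "A - B \<le> C" "C / 2 \<le> K" "2 * u + B < A" for A B C K :: real using that by linarith
  ultimately have "u \<le> clock \<phi> t" using clock_ge[OF \<phi>(1) t(1)] t(2) by blast
  then show ?thesis using IVT'[of "clock \<phi>" 0 u t] clock_0[OF \<phi>(1)] u t(1) continuous_on_subset[OF clock_cont[OF \<phi>(1)], of "{0..t}"] by auto
qed

lemma unclock:
  assumes "\<phi> \<in> Cpaths" "unbounded_path \<phi>" shows "0 \<le> unclock \<phi> u" "clock \<phi> (unclock \<phi> u) = max u 0"
  using someI_ex[of "\<lambda>t. 0 \<le> t \<and> clock \<phi> t = max u 0"] clock_surj[OF assms, of "max u 0"] unfolding unclock_def by auto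

lemma clock_eq_imp:
  assumes \<phi>: "\<phi> \<in> Cpaths" and t: "0 \<le> t" "0 \<le> t'" and e: "clock \<phi> t = clock \<phi> t'" shows "\<phi> t = \<phi> t'"
proof (rule ccontr)
  assume n: "\<phi> t \<noteq> \<phi> t'"
  show False
  proof (cases "t \<le> t'")
    case True
    from clock_strict[OF \<phi> t(1) order_refl True order_refl n] e show False by simp
  next
    case False
    then have "t' \<le> t" by simp
    from clock_strict[OF \<phi> t(2) order_refl this order_refl n[symmetric]] e show False by simp
  qed
qed

text \<open>On compact intervals the clock is a continuous surjection, hence a closed map; a
  function whose composition with it is continuous must therefore be continuous. This gives
  continuity of both \<open>normal\<close> and, for paths without flat pieces,
  \<open>unclock\<close>.\<close>

lemma clock_quotient:
  assumes \<phi>: "\<phi> \<in> Cpaths" "unbounded_path \<phi>" and h: "continuous_on {0..} h" and H: "\<And>t. 0 \<le> t \<Longrightarrow> H (clock \<phi> t) = h t"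
  shows "continuous_on {0..} (H :: real \<Rightarrow> real)"
proof (rule continuous_on_atLeastI)
  fix u :: real assume u: "0 \<le> u"
  obtain T where T: "T \<ge> 0" "clock \<phi> T = u" using clock_surj[OF \<phi> u] by blast
  have cc: "continuous_on {0..T} (clock \<phi>)" by (rule continuous_on_subset[OF clock_cont[OF \<phi>(1)]]) auto
  show "continuous_on {0..u} H"
  proof (subst continuous_on_closed_vimage, simp, intro allI impI)
    fix B :: "real set" assume B: "closed B"
    have "H -` B \<inter> {0..u} = clock \<phi> ` (h -` B \<inter> {0..T})"
    proof (intro equalityI subsetI)
      fix v assume v: "v \<in> H -` B \<inter> {0..u}"
      then obtain t where t: "t \<in> {0..T}" "clock \<phi> t = v"
        using IVT'[of "clock \<phi>" 0 v T] clock_0[OF \<phi>(1)] T cc by auto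
      then show "v \<in> clock \<phi> ` (h -` B \<inter> {0..T})" using v H[of t] by auto
    next
      fix v assume "v \<in> clock \<phi> ` (h -` B \<inter> {0..T})"
      then obtain t where t: "t \<in> {0..T}" "h t \<in> B" "v = clock \<phi> t" by auto
      then show "v \<in> H -` B \<inter> {0..u}" using H[of t] clock_mono[OF \<phi>(1), of t T] clock_nonneg[OF \<phi>(1), of t] T by auto
    qed
    moreover have "compact (h -` B \<inter> {0..T})"
    proof -
      have "continuous_on {0..T} h" by (rule continuous_on_subset[OF h]) auto
      then have "closed (h -` B \<inter> {0..T})" using B continuous_on_closed_vimage[of "{0..T}" h] by auto
      then show ?thesis by (metis Int_commute bounded_closed_interval bounded_subset compact_eq_bounded_closed inf_le1 inf_le2)
    qed
    then have "compact (clock \<phi> ` (h -` B \<inter> {0..T}))"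
      by (intro compact_continuous_image continuous_on_subset[OF cc]) auto
    ultimately show "closed (H -` B \<inter> {0..u})" using compact_imp_closed by simp
  qed
qed

lemma normal_clock:
  assumes \<phi>: "\<phi> \<in> Cpaths" "unbounded_path \<phi>" and t: "0 \<le> t" shows "normal \<phi> (clock \<phi> t) = \<phi> t"
  unfolding normal_def using unclock[OF \<phi>, of "clock \<phi> t"] clock_nonneg[OF \<phi>(1) t] t
  by (intro clock_eq_imp[OF \<phi>(1)]) auto

lemma Cpaths_extend:
  assumes "continuous_on {0..} f" "\<And>t. f t = f (max t 0)" shows "(f :: real \<Rightarrow> real) \<in> Cpaths"
proof (rule CpathsI)
  have "continuous_on UNIV (\<lambda>t. f (max t 0))"
    by (rule continuous_on_compose2[OF assms(1)]) (auto intro!: continuous_intros)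
  moreover have "(\<lambda>t. f (max t 0)) = f" using assms(2) by (intro ext) (rule sym)
  ultimately show "continuous_on UNIV f" by (simp only:)
  show "f t = f 0" if "t \<le> 0" for t using assms(2)[of t] that by (simp add: max_def)
qed

lemma normal_Cpaths:
  assumes \<phi>: "\<phi> \<in> Cpaths" "unbounded_path \<phi>" shows "normal \<phi> \<in> Cpaths"
proof (rule Cpaths_extend)
  show "continuous_on {0..} (normal \<phi>)"
    by (rule clock_quotient[OF \<phi> Cpaths_cont[OF \<phi>(1)] normal_clock[OF \<phi>]])
  show "normal \<phi> t = normal \<phi> (max t 0)" for t unfolding normal_def unclock_def by simp
qed

text \<open>The path is its normal form run by the clock, which is a time transformation although it
  may be flat.\<close>

lemma F_le_normal:
  assumes F: "time_superinvariant F" and \<phi>: "\<phi> \<in> Cpaths" "unbounded_path \<phi>" shows "F \<phi> \<le> F (normal \<phi>)"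
proof -
  have "time_transformation (clock \<phi>)" unfolding time_transformation_def
    using clock_cont clock_0 clock_nonneg clock_mono \<phi>(1) by (auto intro!: mono_onI)
  then have "F (time_change (normal \<phi>) (clock \<phi>)) \<le> F (normal \<phi>)"
    using F normal_Cpaths[OF \<phi>] unfolding time_superinvariant_def by blast
  moreover have "time_change (normal \<phi>) (clock \<phi>) = \<phi>"
  proof
    fix t
    show "time_change (normal \<phi>) (clock \<phi>) t = \<phi> t" unfolding time_change_def
      using normal_clock[OF \<phi>, of "max t 0"] Cpaths_neg[OF \<phi>(1), of t] by (auto simp: max_def)
  qed
  ultimately show ?thesis by simp
qed

text \<open>Without flat pieces the clock is strictly increasing, so its inverse is a time
  transformation as well and superinvariance also works in the other direction.\<close>

lemma F_normal_le:
  assumes F: "time_superinvariant F" and \<phi>: "\<phi> \<in> Cpaths" "unbounded_path \<phi>"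
    and nc: "\<forall>a b. 0 \<le> a \<longrightarrow> a < b \<longrightarrow> (\<exists>t\<in>{a..b}. \<phi> t \<noteq> \<phi> a)"
  shows "F (normal \<phi>) \<le> F \<phi>"
proof -
  have strict: "clock \<phi> a < clock \<phi> b" if ab: "0 \<le> a" "a < b" for a b
  proof -
    obtain t where t: "t \<in> {a..b}" "\<phi> t \<noteq> \<phi> a" using nc ab by blast
    show ?thesis by (rule clock_strict[OF \<phi>(1), of a a t b]) (use t ab in auto)
  qed
  have uc: "unclock \<phi> (clock \<phi> t) = t" if t: "0 \<le> t" for t
  proof -
    have "clock \<phi> (unclock \<phi> (clock \<phi> t)) = clock \<phi> t" using unclock(2)[OF \<phi>, of "clock \<phi> t"] clock_nonneg[OF \<phi>(1) t] by simp
    then show ?thesis using strict[of t "unclock \<phi> (clock \<phi> t)"] strict[of "unclock \<phi> (clock \<phi> t)" t] t unclock(1)[OF \<phi>, of "clock \<phi> t"]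
      by (metis less_irrefl linorder_neqE_linordered_idom)
  qed
  have "time_transformation (unclock \<phi>)" unfolding time_transformation_def
  proof (intro conjI allI impI)
    show "continuous_on {0..} (unclock \<phi>)" by (rule clock_quotient[OF \<phi> continuous_on_id uc])
    show "mono_on {0..} (unclock \<phi>)"
    proof (rule mono_onI, rule ccontr)
      fix u v :: real assume uv: "u \<in> {0..}" "v \<in> {0..}" "u \<le> v" "\<not> unclock \<phi> u \<le> unclock \<phi> v"
      then have "clock \<phi> (unclock \<phi> v) < clock \<phi> (unclock \<phi> u)" using strict[of "unclock \<phi> v" "unclock \<phi> u"] unclock(1)[OF \<phi>, of v] by simp
      then show False using unclock(2)[OF \<phi>] uv by simp
    qed
    show "unclock \<phi> 0 = 0" using uc[of 0] clock_0[OF \<phi>(1)] by simp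
  qed (rule unclock(1)[OF \<phi>])
  then have "F (time_change \<phi> (unclock \<phi>)) \<le> F \<phi>" using F \<phi>(1) unfolding time_superinvariant_def by blast
  moreover have "time_change \<phi> (unclock \<phi>) = normal \<phi>" unfolding time_change_def normal_def unclock_def by simp
  ultimately show ?thesis by simp
qed

section \<open>Crossing codes\<close>

definition crossing_point :: "real \<Rightarrow> (real \<Rightarrow> real) \<Rightarrow> nat \<Rightarrow> real" where "crossing_point \<delta> \<phi> k = enn2real (crossing_time {0..} \<delta> \<phi> k)"

definition crosses_forever :: "real \<Rightarrow> (real \<Rightarrow> real) \<Rightarrow> bool" where "crosses_forever \<delta> \<phi> \<longleftrightarrow> (\<forall>k. crossing_time {0..} \<delta> \<phi> k \<noteq> \<infinity>)"

lemma crossing_point_props: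
  assumes "\<phi> \<in> Cpaths" "0 < \<delta>" "crosses_forever \<delta> \<phi>"
  shows "crossing_point \<delta> \<phi> 0 = 0" "crossing_time {0..} \<delta> \<phi> k = ennreal (crossing_point \<delta> \<phi> k)" "0 \<le> crossing_point \<delta> \<phi> k" "crossing_point \<delta> \<phi> k < crossing_point \<delta> \<phi> (Suc k)"
    "\<bar>\<phi> (crossing_point \<delta> \<phi> (Suc k)) - \<phi> (crossing_point \<delta> \<phi> k)\<bar> = \<delta>"
    "crossing_point \<delta> \<phi> k \<le> s \<Longrightarrow> s < crossing_point \<delta> \<phi> (Suc k) \<Longrightarrow> \<bar>\<phi> s - \<phi> (crossing_point \<delta> \<phi> k)\<bar> < \<delta>"
proof -
  interpret path_crossing "{0..}" \<delta> \<phi> using assms by (intro path_crossing_Cpaths)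
  have f: "T k \<noteq> \<infinity>" for k using assms(3) unfolding crosses_forever_def by blast
  show "crossing_point \<delta> \<phi> 0 = 0" unfolding crossing_point_def by simp
  show "T k = ennreal (crossing_point \<delta> \<phi> k)" "0 \<le> crossing_point \<delta> \<phi> k" unfolding crossing_point_def using fin[OF f, of k] by auto
  show "crossing_point \<delta> \<phi> k < crossing_point \<delta> \<phi> (Suc k)" "\<bar>\<phi> (crossing_point \<delta> \<phi> (Suc k)) - \<phi> (crossing_point \<delta> \<phi> k)\<bar> = \<delta>"
    unfolding crossing_point_def using \<tau>_step(1,2)[OF f, of k] by auto
  show "\<bar>\<phi> s - \<phi> (crossing_point \<delta> \<phi> k)\<bar> < \<delta>" if "crossing_point \<delta> \<phi> k \<le> s" "s < crossing_point \<delta> \<phi> (Suc k)"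
    using \<tau>_step(3)[OF f, of k s] that unfolding crossing_point_def by auto
qed

lemma crossing_point_strict_mono: "\<phi> \<in> Cpaths \<Longrightarrow> 0 < \<delta> \<Longrightarrow> crosses_forever \<delta> \<phi> \<Longrightarrow> strict_mono (crossing_point \<delta> \<phi>)"
  by (intro strict_monoI_Suc crossing_point_props(4))

lemma crossing_point_index:
  assumes "\<phi> \<in> Cpaths" "0 < \<delta>" "crosses_forever \<delta> \<phi>" "0 \<le> s"
  shows "\<exists>m. crossing_point \<delta> \<phi> m \<le> s \<and> s < crossing_point \<delta> \<phi> (Suc m)"
proof -
  interpret path_crossing "{0..}" \<delta> \<phi> using assms by (intro path_crossing_Cpaths)
  have "\<exists>e>0. \<forall>r t. 0 \<le> r \<and> r \<le> t \<and> t \<le> s \<and> t - r < e \<longrightarrow> \<bar>\<phi> t - \<phi> r\<bar> < \<delta>"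
    using sumdist_uniform[of \<delta> 1 "\<lambda>_. \<phi>" s] assms(2) Cpaths_cont[OF assms(1)] by simp
  then obtain k where "ennreal s < T k" using unbounded by blast
  then have k: "s < crossing_point \<delta> \<phi> k" unfolding crossing_point_props(2)[OF assms(1-3)] using assms(4) by (simp add: ennreal_less_iff)
  define m where "m = (LEAST k. s < crossing_point \<delta> \<phi> (Suc k))"
  have "k \<noteq> 0" using k assms(4) crossing_point_props(1)[OF assms(1-3)] by (cases k) auto
  then obtain k' where k': "k = Suc k'" by (cases k) auto
  have 1: "s < crossing_point \<delta> \<phi> (Suc m)" unfolding m_def using k unfolding k' by (rule LeastI)
  have 2: "crossing_point \<delta> \<phi> m \<le> s"
  proof (cases m)
    case 0 then show ?thesis using assms(4) crossing_point_props(1)[OF assms(1-3)] by simp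
  next
    case (Suc j) then show ?thesis using not_less_Least[of j "\<lambda>k. s < crossing_point \<delta> \<phi> (Suc k)"] unfolding m_def by simp
  qed
  show ?thesis using 1 2 by blast
qed

text \<open>Crossings have exact size, so displacements between crossing points are integer
  multiples of \<open>\<delta>\<close>; a displacement below 2 \<open>\<delta>\<close> is therefore
  at most \<open>\<delta>\<close>.\<close>

lemma lattice_position:
  assumes "\<phi> \<in> Cpaths" "0 < \<delta>" "crosses_forever \<delta> \<phi>" "l \<le> m"
  shows "\<exists>j::int. \<phi> (crossing_point \<delta> \<phi> m) - \<phi> (crossing_point \<delta> \<phi> l) = of_int j * \<delta>"
  using assms(4)
proof (induction m rule: dec_induct)
  case base show ?case by (intro exI[of _ 0]) simp
next
  case (step m)
  then obtain j :: int where j: "\<phi> (crossing_point \<delta> \<phi> m) - \<phi> (crossing_point \<delta> \<phi> l) = of_int j * \<delta>" by blast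
  have "\<phi> (crossing_point \<delta> \<phi> (Suc m)) - \<phi> (crossing_point \<delta> \<phi> m) = \<delta> \<or> \<phi> (crossing_point \<delta> \<phi> (Suc m)) - \<phi> (crossing_point \<delta> \<phi> m) = - \<delta>"
    using crossing_point_props(5)[OF assms(1-3), of m] by linarith
  then show ?case
  proof
    assume "\<phi> (crossing_point \<delta> \<phi> (Suc m)) - \<phi> (crossing_point \<delta> \<phi> m) = \<delta>"
    then show ?thesis using j by (intro exI[of _ "j + 1"]) (simp add: algebra_simps)
  next
    assume "\<phi> (crossing_point \<delta> \<phi> (Suc m)) - \<phi> (crossing_point \<delta> \<phi> m) = - \<delta>"
    then show ?thesis using j by (intro exI[of _ "j - 1"]) (simp add: algebra_simps)
  qed
qed

text \<open>The coarse crossings are read off from the fine ones: a path with fine crossings stays within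
  half a coarse step of its last fine position.\<close>

lemma coarse_step:
  assumes \<phi>: "\<phi> \<in> Cpaths" and \<delta>: "0 < \<delta>" and i: "crosses_forever (2 * \<delta>) \<phi>" "crosses_forever \<delta> \<phi>" and kl: "crossing_point (2 * \<delta>) \<phi> k = crossing_point \<delta> \<phi> l"
    and l': "l \<le> l'" "2 * \<delta> \<le> \<bar>\<phi> (crossing_point \<delta> \<phi> l') - \<phi> (crossing_point \<delta> \<phi> l)\<bar>"
       "\<And>m. l \<le> m \<Longrightarrow> m < l' \<Longrightarrow> \<bar>\<phi> (crossing_point \<delta> \<phi> m) - \<phi> (crossing_point \<delta> \<phi> l)\<bar> < 2 * \<delta>"
  shows "crossing_point (2 * \<delta>) \<phi> (Suc k) = crossing_point \<delta> \<phi> l'"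
proof -
  note P = crossing_point_props[OF \<phi> \<delta> i(2)]
  have \<delta>2: "0 < 2 * \<delta>" using \<delta> by simp
  note P2 = crossing_point_props[OF \<phi> \<delta>2 i(1)]
  have sm: "crossing_point \<delta> \<phi> a \<le> crossing_point \<delta> \<phi> b" if "a \<le> b" for a b
    using crossing_point_strict_mono[OF \<phi> \<delta> i(2)] that by (simp add: strict_mono_less_eq)
  have lt: "crossing_point \<delta> \<phi> a < crossing_point \<delta> \<phi> b \<longleftrightarrow> a < b" for a b
    using crossing_point_strict_mono[OF \<phi> \<delta> i(2)] by (simp add: strict_mono_less)
  have "crossing_time {0..} (2 * \<delta>) \<phi> (Suc k) = ennreal (crossing_point \<delta> \<phi> l')"
  proof (rule cross_SucI)
    show "crossing_time {0..} (2 * \<delta>) \<phi> k = ennreal (crossing_point \<delta> \<phi> l)" using P2(2)[of k] kl by simp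
    show "0 \<le> crossing_point \<delta> \<phi> l" "crossing_point \<delta> \<phi> l' \<in> {0..}" "crossing_point \<delta> \<phi> l \<le> crossing_point \<delta> \<phi> l'" using P(3) sm[OF l'(1)] by auto
    show "2 * \<delta> \<le> \<bar>\<phi> (crossing_point \<delta> \<phi> l') - \<phi> (crossing_point \<delta> \<phi> l)\<bar>" by fact
    fix s assume s: "crossing_point \<delta> \<phi> l \<le> s" "s < crossing_point \<delta> \<phi> l'"
    obtain m where m: "crossing_point \<delta> \<phi> m \<le> s" "s < crossing_point \<delta> \<phi> (Suc m)" using crossing_point_index[OF \<phi> \<delta> i(2), of s] s P(3)[of l] by auto
    have "l < Suc m" "m < l'" using lt[of l "Suc m"] lt[of m l'] s m by auto
    then have lm: "l \<le> m" "m < l'" by auto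
    obtain j :: int where j: "\<phi> (crossing_point \<delta> \<phi> m) - \<phi> (crossing_point \<delta> \<phi> l) = of_int j * \<delta>" using lattice_position[OF \<phi> \<delta> i(2) lm(1)] by blast
    have "\<bar>of_int j * \<delta>\<bar> < 2 * \<delta>" using l'(3)[OF lm] j by simp
    then have "\<bar>real_of_int j\<bar> < 2" using \<delta> by (simp add: abs_mult)
    then have "\<bar>j\<bar> \<le> 1" by linarith
    then have "\<bar>real_of_int j\<bar> \<le> 1" by linarith
    then have "\<bar>\<phi> (crossing_point \<delta> \<phi> m) - \<phi> (crossing_point \<delta> \<phi> l)\<bar> \<le> \<delta>" using \<delta> unfolding j by (simp add: abs_mult)
    then show "\<bar>\<phi> s - \<phi> (crossing_point \<delta> \<phi> l)\<bar> < 2 * \<delta>" using P(6)[OF m] by linarith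
  qed
  then show ?thesis unfolding crossing_point_def by (simp add: P(3)[unfolded crossing_point_def])
qed

section \<open>Dyadic codes of unbounded paths\<close>

definition dyadic :: "nat \<Rightarrow> real" where "dyadic n = (1/2) ^ n"

lemma dyadic_pos [simp]: "0 < dyadic n" unfolding dyadic_def by simp
lemma dyadic_Suc: "dyadic n = 2 * dyadic (Suc n)" unfolding dyadic_def by simp
lemma dyadic_le1: "dyadic n \<le> 1" unfolding dyadic_def by (simp add: power_le_one)

definition unbounded_from :: "real \<Rightarrow> (real \<Rightarrow> real) set" where "unbounded_from x = {\<phi>\<in>Cpaths. unbounded_path \<phi> \<and> \<phi> 0 = x}"

lemma unbounded_fromD: "\<phi> \<in> unbounded_from x \<Longrightarrow> \<phi> \<in> Cpaths" "\<phi> \<in> unbounded_from x \<Longrightarrow> unbounded_path \<phi>" "\<phi> \<in> unbounded_from x \<Longrightarrow> \<phi> 0 = x"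
  "\<phi> \<in> unbounded_from x \<Longrightarrow> 0 < \<delta> \<Longrightarrow> crosses_forever \<delta> \<phi>"
  unfolding unbounded_from_def crosses_forever_def using unbounded_crosses_forever by auto

text \<open>The level \<open>n\<close> fixes both the mesh and the distance at which recording ends.
  Ending at a distance rather than at a time makes the code independent of the speed of the
  path.\<close>

definition exit_index :: "nat \<Rightarrow> (real \<Rightarrow> real) \<Rightarrow> nat" where
  "exit_index n \<phi> = (LEAST k. real n \<le> \<bar>\<phi> (crossing_point (dyadic n) \<phi> k) - \<phi> 0\<bar>)"

definition code :: "nat \<Rightarrow> (real \<Rightarrow> real) \<Rightarrow> bool list" where
  "code n \<phi> = map (\<lambda>k. \<phi> (crossing_point (dyadic n) \<phi> k) < \<phi> (crossing_point (dyadic n) \<phi> (Suc k))) [0..<exit_index n \<phi>]"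

lemma exit_index:
  assumes \<phi>: "\<phi> \<in> unbounded_from x"
  shows "real n \<le> \<bar>\<phi> (crossing_point (dyadic n) \<phi> (exit_index n \<phi>)) - x\<bar>" "\<And>k. k < exit_index n \<phi> \<Longrightarrow> \<bar>\<phi> (crossing_point (dyadic n) \<phi> k) - x\<bar> < real n"
proof -
  note G = unbounded_fromD[OF \<phi>]
  have i: "crosses_forever (dyadic n) \<phi>" using G(4) by simp
  have "\<exists>k. real n \<le> \<bar>\<phi> (crossing_point (dyadic n) \<phi> k) - \<phi> 0\<bar>"
  proof -
    obtain t where t: "t \<ge> 0" "real n + \<bar>x\<bar> + 1 < \<bar>\<phi> t\<bar>" using G(2) unfolding unbounded_path_def by blast
    obtain m where m: "crossing_point (dyadic n) \<phi> m \<le> t" "t < crossing_point (dyadic n) \<phi> (Suc m)" using crossing_point_index[OF G(1) dyadic_pos i t(1)] by blast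
    have "\<bar>\<phi> t - \<phi> (crossing_point (dyadic n) \<phi> m)\<bar> < dyadic n" by (rule crossing_point_props(6)[OF G(1) dyadic_pos i m])
    then have "real n \<le> \<bar>\<phi> (crossing_point (dyadic n) \<phi> m) - x\<bar>" using t(2) dyadic_le1[of n] by linarith
    then show ?thesis using G(3) by blast
  qed
  then have "real n \<le> \<bar>\<phi> (crossing_point (dyadic n) \<phi> (exit_index n \<phi>)) - \<phi> 0\<bar>" unfolding exit_index_def by (rule LeastI_ex)
  then show "real n \<le> \<bar>\<phi> (crossing_point (dyadic n) \<phi> (exit_index n \<phi>)) - x\<bar>" using G(3) by simp
  show "\<bar>\<phi> (crossing_point (dyadic n) \<phi> k) - x\<bar> < real n" if "k < exit_index n \<phi>" for k
    using not_less_Least[of k "\<lambda>k. real n \<le> \<bar>\<phi> (crossing_point (dyadic n) \<phi> k) - \<phi> 0\<bar>"] that G(3) unfolding exit_index_def by simp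
qed

lemma step_sign:
  assumes \<phi>: "\<phi> \<in> Cpaths" "0 < \<delta>" "crosses_forever \<delta> \<phi>"
  shows "\<phi> (crossing_point \<delta> \<phi> (Suc k)) - \<phi> (crossing_point \<delta> \<phi> k) = sign_of (\<phi> (crossing_point \<delta> \<phi> k) < \<phi> (crossing_point \<delta> \<phi> (Suc k))) * \<delta>"
  using crossing_point_props(5)[OF \<phi>, of k] \<phi>(2) unfolding sign_of_def by auto

lemma follows_iff:
  assumes \<phi>: "\<phi> \<in> Cpaths" "0 < \<delta>" "crosses_forever \<delta> \<phi>"
  shows "follows {0..} \<delta> p \<phi> m \<longleftrightarrow> (\<forall>i<m. p ! i \<longleftrightarrow> \<phi> (crossing_point \<delta> \<phi> i) < \<phi> (crossing_point \<delta> \<phi> (Suc i)))"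
proof -
  have "\<phi> (crossing_point \<delta> \<phi> (Suc i)) - \<phi> (crossing_point \<delta> \<phi> i) = sign_of (p ! i) * \<delta> \<longleftrightarrow> (p ! i \<longleftrightarrow> \<phi> (crossing_point \<delta> \<phi> i) < \<phi> (crossing_point \<delta> \<phi> (Suc i)))" for i
    unfolding step_sign[OF \<phi>, of i] using \<phi>(2) by auto
  then show ?thesis unfolding follows_def crossing_point_def using \<phi>(3) unfolding crosses_forever_def by auto
qed

lemma same_positions:
  assumes \<phi>: "\<phi> \<in> Cpaths" "0 < \<delta>" "crosses_forever \<delta> \<phi>" and \<phi>': "\<phi>' \<in> Cpaths" "crosses_forever \<delta> \<phi>'" and 0: "\<phi>' 0 = \<phi> 0"
    and s: "\<And>i. i < m \<Longrightarrow> (\<phi>' (crossing_point \<delta> \<phi>' i) < \<phi>' (crossing_point \<delta> \<phi>' (Suc i))) = (\<phi> (crossing_point \<delta> \<phi> i) < \<phi> (crossing_point \<delta> \<phi> (Suc i)))"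
  shows "i \<le> m \<Longrightarrow> \<phi>' (crossing_point \<delta> \<phi>' i) = \<phi> (crossing_point \<delta> \<phi> i)"
proof (induction i)
  case 0 then show ?case using crossing_point_props(1)[OF \<phi>] crossing_point_props(1)[OF \<phi>'(1) \<phi>(2) \<phi>'(2)] assms(6) by simp
next
  case (Suc i)
  then show ?case using step_sign[OF \<phi>, of i] step_sign[OF \<phi>'(1) \<phi>(2) \<phi>'(2), of i] s[of i] by simp
qed

text \<open>The exit index is determined by the positions recorded so far, so a path that repeats
  the recorded moves also exits at the same index. Therefore a cell of paths with equal code is,
  among unbounded paths, the event that one bet is won.\<close>

lemma code_follows:
  assumes \<phi>: "\<phi> \<in> unbounded_from x" and \<phi>': "\<phi>' \<in> unbounded_from x"
  shows "follows {0..} (dyadic n) (code n \<phi>) \<phi>' (length (code n \<phi>)) \<longleftrightarrow> code n \<phi>' = code n \<phi>"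
    "code n \<phi>' = code n \<phi> \<Longrightarrow> exit_index n \<phi>' = exit_index n \<phi> \<and> (\<forall>i\<le>exit_index n \<phi>. \<phi>' (crossing_point (dyadic n) \<phi>' i) = \<phi> (crossing_point (dyadic n) \<phi> i))"
proof -
  note G = unbounded_fromD[OF \<phi>] and G' = unbounded_fromD[OF \<phi>']
  have i: "crosses_forever (dyadic n) \<phi>" "crosses_forever (dyadic n) \<phi>'" using G(4) G'(4) by auto
  let ?s = "\<lambda>\<phi> i. \<phi> (crossing_point (dyadic n) \<phi> i) < \<phi> (crossing_point (dyadic n) \<phi> (Suc i))"
  have pos: "\<phi>' (crossing_point (dyadic n) \<phi>' i) = \<phi> (crossing_point (dyadic n) \<phi> i)" if "\<And>i. i < exit_index n \<phi> \<Longrightarrow> ?s \<phi>' i = ?s \<phi> i" "i \<le> exit_index n \<phi>" for i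
    using same_positions[OF G(1) dyadic_pos i(1) G'(1) i(2), of "exit_index n \<phi>" i] that G(3) G'(3) by simp
  have ex: "exit_index n \<phi>' = exit_index n \<phi>" if "\<And>i. i < exit_index n \<phi> \<Longrightarrow> ?s \<phi>' i = ?s \<phi> i"
    unfolding exit_index_def[of n \<phi>']
  proof (rule Least_equality)
    show "real n \<le> \<bar>\<phi>' (crossing_point (dyadic n) \<phi>' (exit_index n \<phi>)) - \<phi>' 0\<bar>" using pos[OF that order_refl] exit_index(1)[OF \<phi>] G'(3) by simp
    show "exit_index n \<phi> \<le> y" if y: "real n \<le> \<bar>\<phi>' (crossing_point (dyadic n) \<phi>' y) - \<phi>' 0\<bar>" for y
    proof (rule ccontr)
      assume "\<not> exit_index n \<phi> \<le> y"
      then have "y < exit_index n \<phi>" by simp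
      then show False using exit_index(2)[OF \<phi>, of y n] y pos[OF \<open>\<And>i. i < exit_index n \<phi> \<Longrightarrow> ?s \<phi>' i = ?s \<phi> i\<close>, of y] G'(3) by simp
    qed
  qed
  have p: "follows {0..} (dyadic n) (code n \<phi>) \<phi>' (length (code n \<phi>)) \<longleftrightarrow> (\<forall>i<exit_index n \<phi>. ?s \<phi>' i = ?s \<phi> i)"
    unfolding follows_iff[OF G'(1) dyadic_pos i(2)] unfolding code_def by auto
  have c: "(\<forall>i<exit_index n \<phi>. ?s \<phi>' i = ?s \<phi> i)" if "code n \<phi>' = code n \<phi>"
  proof -
    have l: "exit_index n \<phi>' = exit_index n \<phi>" using arg_cong[OF that, of length] unfolding code_def by simp
    show ?thesis
    proof (intro allI impI)
      fix i assume "i < exit_index n \<phi>"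
      then show "?s \<phi>' i = ?s \<phi> i" using arg_cong[OF that, of "\<lambda>l. l ! i"] l unfolding code_def by simp
    qed
  qed
  show "follows {0..} (dyadic n) (code n \<phi>) \<phi>' (length (code n \<phi>)) \<longleftrightarrow> code n \<phi>' = code n \<phi>"
  proof
    assume "follows {0..} (dyadic n) (code n \<phi>) \<phi>' (length (code n \<phi>))"
    then have a: "\<forall>i<exit_index n \<phi>. ?s \<phi>' i = ?s \<phi> i" using p by blast
    then show "code n \<phi>' = code n \<phi>" unfolding code_def using ex by (intro map_cong) auto
  qed (use p c in blast)
  show "exit_index n \<phi>' = exit_index n \<phi> \<and> (\<forall>i\<le>exit_index n \<phi>. \<phi>' (crossing_point (dyadic n) \<phi>' i) = \<phi> (crossing_point (dyadic n) \<phi> i))" if "code n \<phi>' = code n \<phi>"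
    using ex pos c[OF that] by blast
qed

text \<open>Coarse crossings up to the coarse exit happen at fine crossings before the fine exit,
  with indices that depend only on fine positions (\<open>coarse_step\<close>); equal fine codes
  thus yield equal coarse moves.\<close>

lemma code_refine:
  assumes \<phi>: "\<phi> \<in> unbounded_from x" and \<phi>': "\<phi>' \<in> unbounded_from x" and c: "code (Suc n) \<phi>' = code (Suc n) \<phi>"
  shows "code n \<phi>' = code n \<phi>"
proof -
  note G = unbounded_fromD[OF \<phi>] and G' = unbounded_fromD[OF \<phi>']
  define \<delta> where "\<delta> = dyadic (Suc n)"
  have \<delta>: "0 < \<delta>" "dyadic n = 2 * \<delta>" "0 < 2 * \<delta>" unfolding \<delta>_def using dyadic_Suc[of n] by simp_all
  define L where "L = exit_index (Suc n) \<phi>"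
  have i: "crosses_forever \<delta> \<phi>" "crosses_forever (2 * \<delta>) \<phi>" "crosses_forever \<delta> \<phi>'" "crosses_forever (2 * \<delta>) \<phi>'" using G(4) G'(4) \<delta> by auto
  have pos: "\<phi>' (crossing_point \<delta> \<phi>' m) = \<phi> (crossing_point \<delta> \<phi> m)" if "m \<le> L" for m
    using code_follows(2)[OF \<phi> \<phi>' c] that unfolding L_def \<delta>_def by blast
  note P = crossing_point_props[OF G(1) \<delta>(1) i(1)] and P2 = crossing_point_props[OF G(1) \<delta>(3) i(2)]
  have lt: "crossing_point \<delta> \<phi> a < crossing_point \<delta> \<phi> b \<longleftrightarrow> a < b" for a b
    using crossing_point_strict_mono[OF G(1) \<delta>(1) i(1)] by (simp add: strict_mono_less)
  \<comment> \<open>Before the coarse exit the distance at coarse crossings is below n, and until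
    the next coarse crossing the path moves by less than 2 \<open>\<delta>\<close>, which is at most
    1. So the distance n+1 of the fine exit cannot yet have been reached.\<close>
  have exit_le: "crossing_point (2 * \<delta>) \<phi> (exit_index n \<phi>) \<le> crossing_point \<delta> \<phi> L"
  proof (rule ccontr)
    assume n: "\<not> ?thesis"
    obtain m where m: "crossing_point (2 * \<delta>) \<phi> m \<le> crossing_point \<delta> \<phi> L" "crossing_point \<delta> \<phi> L < crossing_point (2 * \<delta>) \<phi> (Suc m)"
      using crossing_point_index[OF G(1) \<delta>(3) i(2) P(3)] by blast
    have "crossing_point (2 * \<delta>) \<phi> m < crossing_point (2 * \<delta>) \<phi> (exit_index n \<phi>)" using n m(1) by simp
    then have "m < exit_index n \<phi>" using crossing_point_strict_mono[OF G(1) \<delta>(3) i(2)] by (simp add: strict_mono_less)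
    then have "\<bar>\<phi> (crossing_point (2 * \<delta>) \<phi> m) - x\<bar> < real n" using exit_index(2)[OF \<phi>, of m n] \<delta>(2) by simp
    moreover have "\<bar>\<phi> (crossing_point \<delta> \<phi> L) - \<phi> (crossing_point (2 * \<delta>) \<phi> m)\<bar> < 2 * \<delta>" by (rule P2(6)[OF m])
    moreover have "real (Suc n) \<le> \<bar>\<phi> (crossing_point \<delta> \<phi> L) - x\<bar>" unfolding L_def \<delta>_def by (rule exit_index(1)[OF \<phi>])
    moreover have "2 * \<delta> \<le> 1" using dyadic_le1[of n] \<delta>(2) by simp
    ultimately show False by simp
  qed
  have main: "\<exists>l\<le>L. crossing_point (2 * \<delta>) \<phi> k = crossing_point \<delta> \<phi> l \<and> crossing_point (2 * \<delta>) \<phi>' k = crossing_point \<delta> \<phi>' l" if "k \<le> exit_index n \<phi>" for k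
    using that
  proof (induction k)
    case 0
    show ?case using crossing_point_props(1)[OF G(1) \<delta>(3) i(2)] crossing_point_props(1)[OF G(1) \<delta>(1) i(1)] crossing_point_props(1)[OF G'(1) \<delta>(3) i(4)] crossing_point_props(1)[OF G'(1) \<delta>(1) i(3)]
      by (intro exI[of _ 0]) simp
  next
    case (Suc k)
    then obtain l where l: "l \<le> L" "crossing_point (2 * \<delta>) \<phi> k = crossing_point \<delta> \<phi> l" "crossing_point (2 * \<delta>) \<phi>' k = crossing_point \<delta> \<phi>' l" by auto
    define Pr where "Pr m \<longleftrightarrow> l \<le> m \<and> 2 * \<delta> \<le> \<bar>\<phi> (crossing_point \<delta> \<phi> m) - \<phi> (crossing_point \<delta> \<phi> l)\<bar>" for m
    have "\<exists>m. Pr m"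
    proof -
      \<comment> \<open>The bound includes the maximum of the path up to the current crossing, so
        that the far away time \<open>t\<close> lies after it.\<close>
      obtain t where t: "t \<ge> 0" "(\<bar>\<phi> (crossing_point \<delta> \<phi> l)\<bar> + 3 * \<delta>) + (SOME M. \<forall>s\<in>{0..crossing_point \<delta> \<phi> l}. \<bar>\<phi> s\<bar> \<le> M) < \<bar>\<phi> t\<bar>" using G(2) unfolding unbounded_path_def by blast
      have M: "\<forall>s\<in>{0..crossing_point \<delta> \<phi> l}. \<bar>\<phi> s\<bar> \<le> (SOME M. \<forall>s\<in>{0..crossing_point \<delta> \<phi> l}. \<bar>\<phi> s\<bar> \<le> M)"
        using cpath_bounded_initial[OF G(1)] by (rule someI_ex)
      have M0: "0 \<le> (SOME M. \<forall>s\<in>{0..crossing_point \<delta> \<phi> l}. \<bar>\<phi> s\<bar> \<le> M)" using M P(3)[of l] by force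
      have tl: "crossing_point \<delta> \<phi> l < t" using M t \<delta>(1) by force
      obtain m where m: "crossing_point \<delta> \<phi> m \<le> t" "t < crossing_point \<delta> \<phi> (Suc m)" using crossing_point_index[OF G(1) \<delta>(1) i(1) t(1)] by blast
      have "l < Suc m" using lt[of l "Suc m"] tl m by simp
      moreover have "\<bar>\<phi> t - \<phi> (crossing_point \<delta> \<phi> m)\<bar> < \<delta>" by (rule P(6)[OF m])
      ultimately have "Pr m" unfolding Pr_def using t(2) M0 by linarith
      then show ?thesis by blast
    qed
    define l' where "l' = (LEAST m. Pr m)"
    have l': "Pr l'" "\<And>m. m < l' \<Longrightarrow> \<not> Pr m" unfolding l'_def using LeastI_ex[OF \<open>\<exists>m. Pr m\<close>] not_less_Least by auto
    have e: "crossing_point (2 * \<delta>) \<phi> (Suc k) = crossing_point \<delta> \<phi> l'"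
      by (rule coarse_step[OF G(1) \<delta>(1) i(2,1) l(2)]) (use l' in \<open>force simp: Pr_def\<close>)+
    have "crossing_point (2 * \<delta>) \<phi> (Suc k) \<le> crossing_point (2 * \<delta>) \<phi> (exit_index n \<phi>)" using Suc.prems crossing_point_strict_mono[OF G(1) \<delta>(3) i(2)] by (simp add: strict_mono_less_eq)
    then have "crossing_point \<delta> \<phi> l' \<le> crossing_point \<delta> \<phi> L" using exit_le e by simp
    then have l'L: "l' \<le> L" using lt[of L l'] by (simp add: not_less[symmetric])
    have "crossing_point (2 * \<delta>) \<phi>' (Suc k) = crossing_point \<delta> \<phi>' l'"
    proof (rule coarse_step[OF G'(1) \<delta>(1) i(4,3) l(3)])
      show "l \<le> l'" "2 * \<delta> \<le> \<bar>\<phi>' (crossing_point \<delta> \<phi>' l') - \<phi>' (crossing_point \<delta> \<phi>' l)\<bar>" using l'(1) pos[OF l'L] pos[OF l(1)] unfolding Pr_def by auto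
      show "\<bar>\<phi>' (crossing_point \<delta> \<phi>' m) - \<phi>' (crossing_point \<delta> \<phi>' l)\<bar> < 2 * \<delta>" if "l \<le> m" "m < l'" for m
        using l'(2)[OF that(2)] that pos[of m] pos[OF l(1)] l'L unfolding Pr_def by auto
    qed
    then show ?case using e l'L by blast
  qed
  have pp: "\<phi>' (crossing_point (dyadic n) \<phi>' k) = \<phi> (crossing_point (dyadic n) \<phi> k)" if "k \<le> exit_index n \<phi>" for k
    using main[OF that] pos unfolding \<delta>(2) by metis
  have "follows {0..} (dyadic n) (code n \<phi>) \<phi>' (length (code n \<phi>))"
    unfolding follows_iff[OF G'(1) dyadic_pos G'(4)[OF dyadic_pos]] using pp unfolding code_def by auto
  then show ?thesis using code_follows(1)[OF \<phi> \<phi>'] by blast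
qed

text \<open>Sending each time to the crossing point of the other path with the same index is
  monotone and moves values by at most one mesh, as positions at equal indices coincide.
  \<open>clock_compare\<close> is applied in both directions.\<close>

lemma clock_code_compare:
  assumes \<phi>: "\<phi> \<in> unbounded_from x" and \<phi>': "\<phi>' \<in> unbounded_from x" and c: "code n \<phi>' = code n \<phi>" and k: "k < exit_index n \<phi>"
    and s: "crossing_point (dyadic n) \<phi>' k \<le> s'" "s' < crossing_point (dyadic n) \<phi>' (Suc k)"
  shows "\<bar>clock \<phi> (crossing_point (dyadic n) \<phi> k) - clock \<phi>' s'\<bar> \<le> 2 * dyadic n" "\<bar>\<phi> (crossing_point (dyadic n) \<phi> k) - \<phi>' s'\<bar> \<le> dyadic n"
proof -
  note G = unbounded_fromD[OF \<phi>] and G' = unbounded_fromD[OF \<phi>']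
  let ?t = "crossing_point (dyadic n) \<phi>" and ?t' = "crossing_point (dyadic n) \<phi>'"
  have i: "crosses_forever (dyadic n) \<phi>" "crosses_forever (dyadic n) \<phi>'" using G(4) G'(4) by auto
  have pos: "\<phi>' (?t' m) = \<phi> (?t m)" if "m \<le> exit_index n \<phi>" for m using code_follows(2)[OF \<phi> \<phi>' c] that by blast
  have idx: "\<exists>\<kappa>. \<forall>s\<ge>0. crossing_point (dyadic n) \<psi> (\<kappa> s) \<le> s \<and> s < crossing_point (dyadic n) \<psi> (Suc (\<kappa> s))" if "\<psi> \<in> unbounded_from x" for \<psi>
  proof -
    have "\<forall>s\<ge>0. \<exists>m. crossing_point (dyadic n) \<psi> m \<le> s \<and> s < crossing_point (dyadic n) \<psi> (Suc m)"
      using crossing_point_index[OF unbounded_fromD(1)[OF that] dyadic_pos unbounded_fromD(4)[OF that dyadic_pos]] by blast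
    then show ?thesis by metis
  qed
  obtain \<kappa> where \<kappa>: "\<forall>s\<ge>0. ?t (\<kappa> s) \<le> s \<and> s < ?t (Suc (\<kappa> s))" using idx[OF \<phi>] by blast
  obtain \<kappa>' where \<kappa>': "\<forall>s\<ge>0. ?t' (\<kappa>' s) \<le> s \<and> s < ?t' (Suc (\<kappa>' s))" using idx[OF \<phi>'] by blast
  have sm: "?t a < ?t b \<longleftrightarrow> a < b" "?t' a < ?t' b \<longleftrightarrow> a < b" "?t a \<le> ?t b \<longleftrightarrow> a \<le> b" "?t' a \<le> ?t' b \<longleftrightarrow> a \<le> b" for a b
    using crossing_point_strict_mono[OF G(1) dyadic_pos i(1)] crossing_point_strict_mono[OF G'(1) dyadic_pos i(2)] by (simp_all add: strict_mono_less strict_mono_less_eq)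
  have \<kappa>m: "\<kappa> s \<le> \<kappa> u" if "0 \<le> s" "s \<le> u" for s u
  proof -
    have "?t (\<kappa> s) < ?t (Suc (\<kappa> u))" using \<kappa> that by (meson le_less_trans order_trans)
    then show ?thesis using sm(1) by simp
  qed
  have \<kappa>'m: "\<kappa>' s \<le> \<kappa>' u" if "0 \<le> s" "s \<le> u" for s u
  proof -
    have "?t' (\<kappa>' s) < ?t' (Suc (\<kappa>' u))" using \<kappa>' that by (meson le_less_trans order_trans)
    then show ?thesis using sm(2) by simp
  qed
  have \<kappa>k: "\<kappa> s \<le> k" if "0 \<le> s" "s \<le> ?t k" for s
  proof -
    have "?t (\<kappa> s) \<le> ?t k" using \<kappa> that by (meson order_trans)
    then show ?thesis using sm(3) by simp
  qed
  have \<kappa>'k: "\<kappa>' u \<le> k" if "0 \<le> u" "u \<le> s'" for u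
  proof -
    have "?t' (\<kappa>' u) < ?t' (Suc k)" using \<kappa>' that s(2) by (meson le_less_trans order_trans)
    then show ?thesis using sm(2) by simp
  qed
  have s0: "0 \<le> s'" using s(1) crossing_point_props(3)[OF G'(1) dyadic_pos i(2), of k] by simp
  have near: "\<bar>\<phi> u - \<phi> (?t (\<kappa> u))\<bar> < dyadic n" if "0 \<le> u" for u using crossing_point_props(6)[OF G(1) dyadic_pos i(1)] \<kappa> that by blast
  have near': "\<bar>\<phi>' u - \<phi>' (?t' (\<kappa>' u))\<bar> < dyadic n" if "0 \<le> u" for u using crossing_point_props(6)[OF G'(1) dyadic_pos i(2)] \<kappa>' that by blast
  have 1: "clock \<phi> (?t k) \<le> clock \<phi>' s' + 2 * dyadic n"
  proof (rule clock_compare[where \<kappa> = "\<lambda>u. ?t' (\<kappa> u)"])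
    show "\<phi> \<in> Cpaths" "\<phi>' \<in> Cpaths" "0 \<le> ?t k" "0 \<le> s'" using G(1) G'(1) s0 crossing_point_props(3)[OF G(1) dyadic_pos i(1)] by auto
    show "0 \<le> ?t' (\<kappa> u) \<and> ?t' (\<kappa> u) \<le> s' \<and> \<bar>\<phi> u - \<phi>' (?t' (\<kappa> u))\<bar> \<le> dyadic n" if u: "0 \<le> u" "u \<le> ?t k" for u
      using crossing_point_props(3)[OF G'(1) dyadic_pos i(2)] \<kappa>k[OF u] sm(4)[of "\<kappa> u" k] s(1) near[OF u(1)] pos[of "\<kappa> u"] k by auto
    show "?t' (\<kappa> u) \<le> ?t' (\<kappa> v)" if "0 \<le> u" "u \<le> v" for u v using \<kappa>m[OF that] sm(4) by simp
  qed
  have 2: "clock \<phi>' s' \<le> clock \<phi> (?t k) + 2 * dyadic n"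
  proof (rule clock_compare[where \<kappa> = "\<lambda>u. ?t (\<kappa>' u)"])
    show "\<phi> \<in> Cpaths" "\<phi>' \<in> Cpaths" "0 \<le> ?t k" "0 \<le> s'" using G(1) G'(1) s0 crossing_point_props(3)[OF G(1) dyadic_pos i(1)] by auto
    show "0 \<le> ?t (\<kappa>' u) \<and> ?t (\<kappa>' u) \<le> ?t k \<and> \<bar>\<phi>' u - \<phi> (?t (\<kappa>' u))\<bar> \<le> dyadic n" if u: "0 \<le> u" "u \<le> s'" for u
      using crossing_point_props(3)[OF G(1) dyadic_pos i(1)] \<kappa>'k[OF u] sm(3)[of "\<kappa>' u" k] near'[OF u(1)] pos[of "\<kappa>' u"] k by auto
    show "?t (\<kappa>' u) \<le> ?t (\<kappa>' v)" if "0 \<le> u" "u \<le> v" for u v using \<kappa>'m[OF that] sm(3) by simp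
  qed
  show "\<bar>clock \<phi> (?t k) - clock \<phi>' s'\<bar> \<le> 2 * dyadic n" using 1 2 by linarith
  show "\<bar>\<phi> (?t k) - \<phi>' s'\<bar> \<le> dyadic n" using crossing_point_props(6)[OF G'(1) dyadic_pos i(2) s] pos[of k] k by (simp add: abs_minus_commute)
qed

text \<open>A clock time of \<open>\<phi>'\<close> is matched with the clock time of a crossing
  point of \<open>\<phi>\<close> that is two meshes away at most, and there continuity of
  \<open>normal \<phi>\<close> takes over.\<close>

lemma normal_code_continuous:
  assumes \<phi>: "\<phi> \<in> unbounded_from x" and u: "0 \<le> u" and e: "0 < e"
  shows "\<exists>n. \<forall>\<phi>'\<in>unbounded_from x. code n \<phi>' = code n \<phi> \<longrightarrow> \<bar>normal \<phi>' u - normal \<phi> u\<bar> < e"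
proof -
  note G = unbounded_fromD[OF \<phi>]
  have "continuous_on {0..} (normal \<phi>)" by (rule Cpaths_cont[OF normal_Cpaths[OF G(1,2)]])
  then obtain d where d: "d > 0" "\<And>v. 0 \<le> v \<Longrightarrow> \<bar>v - u\<bar> < d \<Longrightarrow> \<bar>normal \<phi> v - normal \<phi> u\<bar> < e / 2"
    unfolding continuous_on_iff using u e by (metis atLeast_iff dist_real_def half_gt_zero)
  have "(\<lambda>n. (1/2::real) ^ n) \<longlonglongrightarrow> 0" by (rule LIMSEQ_power_zero) simp
  then have "\<forall>\<^sub>F n in sequentially. (1/2::real) ^ n < min (d / 2) (e / 2)" using d(1) e by (intro order_tendstoD(2)) auto
  moreover have "\<forall>\<^sub>F n in sequentially. 2 * u + 1 < real n" by real_asymp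
  ultimately have "\<forall>\<^sub>F n in sequentially. (1/2::real) ^ n < min (d / 2) (e / 2) \<and> 2 * u + 1 < real n" by eventually_elim auto
  then obtain n where n: "dyadic n < d / 2" "dyadic n < e / 2" "2 * u + 1 < real n" unfolding eventually_sequentially dyadic_def by auto
  have "\<bar>normal \<phi>' u - normal \<phi> u\<bar> < e" if \<phi>': "\<phi>' \<in> unbounded_from x" and c: "code n \<phi>' = code n \<phi>" for \<phi>'
  proof -
    note G' = unbounded_fromD[OF \<phi>']
    have i: "crosses_forever (dyadic n) \<phi>" "crosses_forever (dyadic n) \<phi>'" using G(4) G'(4) by auto
    define s' where "s' = unclock \<phi>' u"
    have s': "0 \<le> s'" "clock \<phi>' s' = u" unfolding s'_def using unclock[OF G'(1,2), of u] u by auto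
    obtain k where k: "crossing_point (dyadic n) \<phi>' k \<le> s'" "s' < crossing_point (dyadic n) \<phi>' (Suc k)" using crossing_point_index[OF G'(1) dyadic_pos i(2) s'(1)] by blast
    \<comment> \<open>At the exit the path is at distance at least n from its start, so by
      \<open>clock_ge\<close> the clock shows at least n/2, which exceeds \<open>u\<close>; clock
      time \<open>u\<close> thus comes before the exit.\<close>
    have ke: "k < exit_index n \<phi>'"
    proof (rule ccontr)
      assume "\<not> k < exit_index n \<phi>'"
      then have "crossing_point (dyadic n) \<phi>' (exit_index n \<phi>') \<le> s'" using k(1) crossing_point_strict_mono[OF G'(1) dyadic_pos i(2)] by (meson not_less order_trans strict_mono_less_eq)
      then have "clock \<phi>' (crossing_point (dyadic n) \<phi>' (exit_index n \<phi>')) \<le> u" using clock_mono[OF G'(1) crossing_point_props(3)[OF G'(1) dyadic_pos i(2)]] s'(2) by metis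
      moreover have "real n / 2 \<le> clock \<phi>' (crossing_point (dyadic n) \<phi>' (exit_index n \<phi>'))"
        using clock_ge[OF G'(1) crossing_point_props(3)[OF G'(1) dyadic_pos i(2)], of "exit_index n \<phi>'"] exit_index(1)[OF \<phi>', of n] G'(3) by simp
      ultimately show False using n(3) by simp
    qed
    have "exit_index n \<phi>' = exit_index n \<phi>" using code_follows(2)[OF \<phi> \<phi>' c] by blast
    then have k': "k < exit_index n \<phi>" using ke by simp
    let ?s = "crossing_point (dyadic n) \<phi> k"
    have s0: "0 \<le> ?s" by (rule crossing_point_props(3)[OF G(1) dyadic_pos i(1)])
    have 1: "\<bar>clock \<phi> ?s - u\<bar> \<le> 2 * dyadic n" "\<bar>\<phi> ?s - \<phi>' s'\<bar> \<le> dyadic n" using clock_code_compare[OF \<phi> \<phi>' c k' k] s'(2) by auto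
    have "\<bar>normal \<phi> (clock \<phi> ?s) - normal \<phi> u\<bar> < e / 2" using d(2)[OF clock_nonneg[OF G(1) s0]] 1(1) n(1) by simp
    then have "\<bar>\<phi> ?s - normal \<phi> u\<bar> < e / 2" using normal_clock[OF G(1,2) s0] by simp
    moreover have "normal \<phi>' u = \<phi>' s'" unfolding normal_def s'_def ..
    ultimately show ?thesis using 1(2) n(2) by linarith
  qed
  then show ?thesis by blast
qed

text \<open>Unions of cells play the role of open sets. Outer approximation alone does not survive
  complements, so the property \<open>reg\<close> approximates a set and its complement
  simultaneously by open sets with small overlap; this is symmetric, and it holds for cells because
  they are open and closed.\<close>

lemma refining_outer_regular:
  fixes code :: "nat \<Rightarrow> 'a \<Rightarrow> 'c::countable"
  assumes fm: "finite_measure M" and cell: "\<And>n c. {x\<in>space M. code n x = c} \<in> sets M"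
    and refine: "\<And>n x y. x \<in> space M \<Longrightarrow> y \<in> space M \<Longrightarrow> code (Suc n) x = code (Suc n) y \<Longrightarrow> code n x = code n y"
    and A: "A \<in> sigma_sets (space M) {{x\<in>space M. code n x = c} | n c. True}" and e: "0 < (e::real)"
  shows "\<exists>I. I \<subseteq> {(n, code n x) | n x. x \<in> space M} \<and> (\<forall>x\<in>A. \<exists>n. (n, code n x) \<in> I) \<and>
     (\<integral>\<^sup>+z. emeasure M {x\<in>space M. code (fst z) x = snd z} \<partial>count_space I) \<le> emeasure M A + ennreal e"
proof -
  interpret finite_measure M by fact
  define cl where "cl n x = {y\<in>space M. code n y = code n x}" for n x
  define opn where "opn U \<longleftrightarrow> U \<subseteq> space M \<and> (\<forall>x\<in>U. \<exists>n. cl n x \<subseteq> U)" for U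
  have refine': "code m x = code m y" if "x \<in> space M" "y \<in> space M" "m \<le> n" "code n x = code n y" for m n x y
    using that(3,4) by (induction n rule: dec_induct) (auto intro: refine[OF that(1,2)])
  have clm: "cl n x \<subseteq> cl m x" if "x \<in> space M" "m \<le> n" for m n x
    unfolding cl_def using refine'[OF _ that] by auto
  have opn_cell: "opn {x\<in>space M. code n x = c}" for n c
    unfolding opn_def cl_def by auto
  have opn_Un: "opn (\<Union>i\<in>J. U i)" if o: "\<And>i. i \<in> J \<Longrightarrow> opn (U i)" for J :: "'i set" and U
    unfolding opn_def
  proof (intro conjI ballI)
    show "(\<Union>i\<in>J. U i) \<subseteq> space M" using that unfolding opn_def by blast
    fix x assume "x \<in> (\<Union>i\<in>J. U i)"
    then obtain i where i: "i \<in> J" "x \<in> U i" by blast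
    then obtain n where "cl n x \<subseteq> U i" using o unfolding opn_def by blast
    then show "\<exists>n. cl n x \<subseteq> (\<Union>i\<in>J. U i)" using i by blast
  qed
  have opn_Int: "opn (U \<inter> V)" if o: "opn U" "opn V" for U V
    unfolding opn_def
  proof (intro conjI ballI)
    fix x assume x: "x \<in> U \<inter> V"
    then obtain n m where nm: "cl n x \<subseteq> U" "cl m x \<subseteq> V" using o unfolding opn_def by blast
    have "x \<in> space M" using x that unfolding opn_def by blast
    then have "cl (max n m) x \<subseteq> U \<inter> V" using nm clm[of x n "max n m"] clm[of x m "max n m"] by auto
    then show "\<exists>n. cl n x \<subseteq> U \<inter> V" by blast
  qed (use that opn_def in auto)
  have opn_space: "opn (space M)" unfolding opn_def cl_def by auto
  have opn_sets: "U \<in> sets M" if o: "opn U" for U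
  proof -
    have "U = (\<Union>z\<in>{z. {x\<in>space M. code (fst z) x = snd z} \<subseteq> U}. {x\<in>space M. code (fst z) x = snd z})"
    proof (intro equalityI subsetI)
      fix x assume x: "x \<in> U"
      then obtain n where n: "cl n x \<subseteq> U" using o unfolding opn_def by blast
      have "x \<in> space M" using x that unfolding opn_def by blast
      then show "x \<in> (\<Union>z\<in>{z. {x\<in>space M. code (fst z) x = snd z} \<subseteq> U}. {x\<in>space M. code (fst z) x = snd z})"
        using n unfolding cl_def by (intro UN_I[of "(n, code n x)"]) auto
    qed auto
    also have "\<dots> \<in> sets M" by (rule sets.countable_UN') (auto intro!: cell)
    finally show ?thesis .
  qed
  define reg where "reg B \<longleftrightarrow> B \<in> sets M \<and> (\<forall>e>0. \<exists>U V. opn U \<and> opn V \<and> B \<subseteq> U \<and> space M - B \<subseteq> V \<and> measure M (U \<inter> V) < e)" for B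
  have regA: "reg A" using A
  proof induction
    case (Basic a)
    then obtain n c where a: "a = {x\<in>space M. code n x = c}" by blast
    have "\<exists>m. cl m y \<subseteq> space M - a" if "y \<in> space M - a" for y
      using that unfolding a cl_def by (intro exI[of _ n]) auto
    then have "opn (space M - a)" unfolding opn_def by blast
    then show ?case unfolding reg_def using opn_cell[of n c] cell[of n c] unfolding a[symmetric]
      by (intro conjI allI impI exI[of _ a] exI[of _ "space M - a"]) auto
  next
    case Empty
    have "opn {}" unfolding opn_def by simp
    then show ?case unfolding reg_def using opn_space by (intro conjI allI impI exI[of _ "{}"] exI[of _ "space M"]) auto
  next
    case (Compl a)
    show ?case unfolding reg_def
    proof (intro conjI allI impI)
      show "space M - a \<in> sets M" using Compl unfolding reg_def by auto
      fix e :: real assume "0 < e"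
      then obtain U V where "opn U" "opn V" "a \<subseteq> U" "space M - a \<subseteq> V" "measure M (U \<inter> V) < e" using Compl unfolding reg_def by blast
      then show "\<exists>U V. opn U \<and> opn V \<and> space M - a \<subseteq> U \<and> space M - (space M - a) \<subseteq> V \<and> measure M (U \<inter> V) < e"
        by (intro exI[of _ V] exI[of _ U]) (auto simp: Int_commute)
    qed
  next
    case (Union a)
    show ?case unfolding reg_def
    proof (intro conjI allI impI)
      show "(\<Union>i. a i) \<in> sets M" using Union unfolding reg_def by auto
      fix e :: real assume e: "0 < e"
      have "\<exists>U V. opn U \<and> opn V \<and> a i \<subseteq> U \<and> space M - a i \<subseteq> V \<and> measure M (U \<inter> V) < e / 2 * (1/2) ^ Suc i" for i
      proof -
        have "0 < e / 2 * (1/2) ^ Suc i" using e by simp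
        then show ?thesis using Union(2)[of i] unfolding reg_def by blast
      qed
      then obtain U V where UV: "\<And>i. opn (U i)" "\<And>i. opn (V i)" "\<And>i. a i \<subseteq> U i" "\<And>i. space M - a i \<subseteq> V i"
        "\<And>i. measure M (U i \<inter> V i) < e / 2 * (1/2) ^ Suc i" by metis
      define UU where "UU = (\<Union>i. U i)"
      \<comment> \<open>An infinite intersection of open sets need not be open, so finitely many are
        intersected. The overlap with \<open>UU\<close> decreases to a set inside the union of the
        single overlaps, whose measures sum to at most e/2, so it falls below \<open>e\<close> at
        some finite stage.\<close>
      define VV where "VV m = (\<Inter>i\<in>{..m}. V i)" for m
      have oV: "opn (VV m)" for m
      proof (induction m)
        case (Suc m)
        have "VV (Suc m) = VV m \<inter> V (Suc m)" unfolding VV_def by (auto simp: atMost_Suc)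
        then show ?case using opn_Int[OF Suc UV(2)] by simp
      qed (simp add: VV_def UV)
      have oU: "opn UU" unfolding UU_def by (rule opn_Un) (rule UV)
      have dec: "decseq (\<lambda>m. UU \<inter> VV m)" unfolding decseq_def VV_def by auto
      have "(\<lambda>m. measure M (UU \<inter> VV m)) \<longlonglongrightarrow> measure M (\<Inter>m. UU \<inter> VV m)"
        using opn_sets[OF opn_Int[OF oU oV]] dec by (intro finite_Lim_measure_decseq) auto
      moreover have "measure M (\<Inter>m. UU \<inter> VV m) < e"
      proof -
        have "(\<Inter>m. UU \<inter> VV m) \<subseteq> (\<Union>i. U i \<inter> V i)" unfolding UU_def VV_def by blast
        then have "measure M (\<Inter>m. UU \<inter> VV m) \<le> measure M (\<Union>i. U i \<inter> V i)"
          using opn_sets opn_Int UV(1,2) by (intro finite_measure_mono) auto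
        also have "\<dots> \<le> (\<Sum>i. measure M (U i \<inter> V i))"
        proof (rule finite_measure_subadditive_countably)
          show "range (\<lambda>i. U i \<inter> V i) \<subseteq> sets M" using opn_sets opn_Int UV(1,2) by auto
          show "summable (\<lambda>i. measure M (U i \<inter> V i))"
            by (rule summable_comparison_test'[OF sums_summable[OF half_sums[of "e / 2"]]]) (use UV(5) in \<open>auto simp: mult.commute intro: less_imp_le\<close>)
        qed
        also have "\<dots> \<le> (\<Sum>i. (1/2) ^ Suc i * (e / 2))"
        proof (rule suminf_le)
          show "measure M (U i \<inter> V i) \<le> (1/2) ^ Suc i * (e / 2)" for i using UV(5)[of i] by (simp add: mult.commute)
          then show "summable (\<lambda>i. measure M (U i \<inter> V i))"
            by (intro summable_comparison_test'[OF sums_summable[OF half_sums[of "e / 2"]]]) auto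
        qed (rule sums_summable[OF half_sums])
        also have "\<dots> = e / 2" by (rule sums_unique[OF half_sums, symmetric])
        finally show ?thesis using e by simp
      qed
      ultimately have "\<forall>\<^sub>F m in sequentially. measure M (UU \<inter> VV m) < e" by (rule order_tendstoD(2))
      then obtain m where m: "measure M (UU \<inter> VV m) < e" unfolding eventually_sequentially by blast
      show "\<exists>U V. opn U \<and> opn V \<and> (\<Union>i. a i) \<subseteq> U \<and> space M - (\<Union>i. a i) \<subseteq> V \<and> measure M (U \<inter> V) < e"
      proof (intro exI conjI)
        show "(\<Union>i. a i) \<subseteq> UU" "space M - (\<Union>i. a i) \<subseteq> VV m" unfolding UU_def VV_def using UV(3,4) by blast+
      qed (use oU oV m in auto)
    qed
  qed
  then obtain U V where UV: "opn U" "opn V" "A \<subseteq> U" "space M - A \<subseteq> V" "measure M (U \<inter> V) < e" using e unfolding reg_def by blast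
  have As: "A \<in> sets M" using regA unfolding reg_def by blast
  have "emeasure M U \<le> emeasure M (A \<union> (U \<inter> V))"
    using UV opn_sets[OF UV(1)] opn_sets[OF UV(2)] As sets.sets_into_space[OF opn_sets[OF UV(1)]] by (intro emeasure_mono) auto
  also have "\<dots> \<le> emeasure M A + emeasure M (U \<inter> V)" using opn_sets UV As by (intro emeasure_subadditive) auto
  also have "emeasure M (U \<inter> V) \<le> ennreal e" using UV(5) by (simp add: emeasure_eq_measure ennreal_leI)
  finally have MU: "emeasure M U \<le> emeasure M A + ennreal e" by (simp add: add_left_mono)
  \<comment> \<open>The coarsest level at which the cell of \<open>x\<close> fits into
    \<open>U\<close>. It is constant on that cell, so the selected cells are pairwise disjoint and
    their measures add up to that of \<open>U\<close>.\<close>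
  define nx where "nx x = (LEAST n. cl n x \<subseteq> U)" for x
  have nx: "cl (nx x) x \<subseteq> U" "\<And>m. m < nx x \<Longrightarrow> \<not> cl m x \<subseteq> U" if "x \<in> U" for x
  proof -
    have "\<exists>n. cl n x \<subseteq> U" using that UV(1) unfolding opn_def by blast
    then show "cl (nx x) x \<subseteq> U" unfolding nx_def by (rule LeastI_ex)
    show "\<not> cl m x \<subseteq> U" if "m < nx x" for m using that not_less_Least unfolding nx_def by blast
  qed
  have Us: "x \<in> space M" if "x \<in> U" for x using that UV(1) unfolding opn_def by blast
  define I where "I = {(nx x, code (nx x) x) | x. x \<in> U}"
  have same: "nx y = nx x" if x: "x \<in> U" and y: "y \<in> space M" "code (nx x) y = code (nx x) x" for x y
  proof -
    have cle: "cl m y = cl m x" if "m \<le> nx x" for m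
      unfolding cl_def using refine'[OF y(1) Us[OF x] that y(2)] by simp
    have yU: "y \<in> U" using nx(1)[OF x] y unfolding cl_def by blast
    show ?thesis
    proof (rule antisym)
      show "nx y \<le> nx x"
      proof (rule ccontr)
        assume "\<not> nx y \<le> nx x"
        then show False using nx(2)[OF yU, of "nx x"] nx(1)[OF x] cle[of "nx x"] by simp
      qed
      show "nx x \<le> nx y"
      proof (rule ccontr)
        assume "\<not> nx x \<le> nx y"
        then show False using nx(2)[OF x, of "nx y"] nx(1)[OF yU] cle[of "nx y"] by simp
      qed
    qed
  qed
  have "U = (\<Union>z\<in>I. {x\<in>space M. code (fst z) x = snd z})"
  proof (intro equalityI subsetI)
    fix x assume "x \<in> U" then show "x \<in> (\<Union>z\<in>I. {x\<in>space M. code (fst z) x = snd z})"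
      using Us unfolding I_def by (intro UN_I[of "(nx x, code (nx x) x)"]) auto
  next
    fix x assume "x \<in> (\<Union>z\<in>I. {x\<in>space M. code (fst z) x = snd z})"
    then show "x \<in> U" using nx(1) unfolding I_def cl_def by force
  qed
  moreover have "disjoint_family_on (\<lambda>z. {x\<in>space M. code (fst z) x = snd z}) I"
    unfolding disjoint_family_on_def
  proof (intro ballI impI)
    fix z z' assume z: "z \<in> I" "z' \<in> I" "z \<noteq> z'"
    then obtain x x' where x: "z = (nx x, code (nx x) x)" "x \<in> U" and x': "z' = (nx x', code (nx x') x')" "x' \<in> U" unfolding I_def by blast
    show "{x\<in>space M. code (fst z) x = snd z} \<inter> {x\<in>space M. code (fst z') x = snd z'} = {}"
    proof (rule ccontr)
      assume "\<not> ?thesis"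
      then obtain y where y: "y \<in> space M" "code (nx x) y = code (nx x) x" "code (nx x') y = code (nx x') x'" using x x' by auto
      then show False using same[OF x(2) y(1,2)] same[OF x'(2) y(1,3)] z(3) x(1) x'(1) by auto
    qed
  qed
  ultimately have "(\<integral>\<^sup>+z. emeasure M {x\<in>space M. code (fst z) x = snd z} \<partial>count_space I) = emeasure M U"
    using cell by (subst emeasure_UN_countable[symmetric]) auto
  moreover have "I \<subseteq> {(n, code n x) | n x. x \<in> space M}" unfolding I_def using Us by blast
  moreover have "\<forall>x\<in>A. \<exists>n. (n, code n x) \<in> I" unfolding I_def using UV(3) by blast
  ultimately show ?thesis using MU by (intro exI[of _ I]) simp
qed

text \<open>The sum counts the multiples of \<open>\<eta>\<close> strictly below \<open>y\<close>,
  which rounds \<open>y\<close> up to the next multiple.\<close>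

lemma layer_sum:
  fixes y :: ennreal and \<eta> :: real
  assumes \<eta>: "0 < \<eta>"
  defines "f \<equiv> \<lambda>k::nat. ennreal \<eta> * (if ennreal (real k * \<eta>) < y then 1 else 0)"
  shows "y \<le> suminf f" "suminf f \<le> y + ennreal \<eta>"
proof -
  have "y \<le> suminf f \<and> suminf f \<le> y + ennreal \<eta>"
  proof (cases y)
    case top
    have "of_nat n * ennreal \<eta> \<le> suminf f" for n
    proof -
      have "of_nat n * ennreal \<eta> = (\<Sum>k<n. f k)" unfolding f_def using top by (simp add: ennreal_less_top)
      also have "\<dots> \<le> suminf f" by (intro sum_le_suminf) auto
      finally show ?thesis .
    qed
    then have "ennreal (real n * \<eta>) \<le> suminf f" for n using \<eta> by (simp add: ennreal_mult ennreal_of_nat_eq_real_of_nat)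
    moreover have "(\<lambda>n. ennreal (real n * \<eta>)) \<longlonglongrightarrow> top"
    proof -
      have "filterlim (\<lambda>n. real n * \<eta>) at_top sequentially"
        using \<eta> by (intro filterlim_at_top_mult_tendsto_pos[OF tendsto_const _ filterlim_real_sequentially])
      then show ?thesis by (rule ennreal_tendsto_top_eq_at_top[THEN iffD2])
    qed
    ultimately have "top \<le> suminf f" by (intro LIMSEQ_le_const2) auto
    then show ?thesis using top by simp
  next
    case (real r)
    define K where "K = nat \<lceil>r / \<eta>\<rceil>"
    have kK: "real k * \<eta> < r \<longleftrightarrow> k < K" for k
    proof -
      have "real k * \<eta> < r \<longleftrightarrow> real k < r / \<eta>" using \<eta> by (simp add: pos_less_divide_eq)
      also have "\<dots> \<longleftrightarrow> k < K" unfolding K_def by linarith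
      finally show ?thesis .
    qed
    have fk: "f k = (if k < K then ennreal \<eta> else 0)" for k
      unfolding f_def using real kK[of k] \<eta> by (simp add: ennreal_less_iff)
    have "suminf f = (\<Sum>k<K. f k)" by (rule suminf_finite) (auto simp: fk)
    also have "\<dots> = of_nat K * ennreal \<eta>" by (simp add: fk)
    also have "\<dots> = ennreal (real K * \<eta>)" using \<eta> by (simp add: ennreal_mult ennreal_of_nat_eq_real_of_nat)
    finally have s: "suminf f = ennreal (real K * \<eta>)" .
    have r0: "0 \<le> r / \<eta>" using real \<eta> by simp
    have "r / \<eta> \<le> real K" "real K \<le> r / \<eta> + 1" unfolding K_def using r0 by linarith+
    then have "r \<le> real K * \<eta>" "real K * \<eta> \<le> r + \<eta>" using \<eta> by (simp_all add: field_simps)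
    then show ?thesis unfolding s using real \<eta> by (auto simp: ennreal_plus[symmetric] simp del: ennreal_plus intro: ennreal_leI)
  qed
  then show "y \<le> suminf f" "suminf f \<le> y + ennreal \<eta>" by auto
qed

section \<open>Covering functionals by bets\<close>

definition won :: "(real \<Rightarrow> real) \<Rightarrow> nat \<times> bool list \<Rightarrow> bool" where
  "won \<phi> z \<longleftrightarrow> follows {0..} (dyadic (fst z)) (snd z) \<phi> (length (snd z))"

text \<open>A portfolio assigns a weight to every pair of mesh exponent and pattern. Integration
  over the counting measure admits infinite weights and infinite payoffs, which are needed for the
  limits below.\<close>

definition pay :: "(nat \<times> bool list \<Rightarrow> ennreal) \<Rightarrow> (real \<Rightarrow> real) \<Rightarrow> ennreal" where
  "pay w \<phi> = (\<integral>\<^sup>+z. w z * indicator {z. won \<phi> z} z \<partial>count_space UNIV)"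

definition cost :: "(nat \<times> bool list \<Rightarrow> ennreal) \<Rightarrow> ennreal" where
  "cost w = (\<integral>\<^sup>+z. w z * ennreal (1 / 2 ^ length (snd z)) \<partial>count_space UNIV)"

lemma pay_suminf: "pay (\<lambda>z. \<Sum>j. v j z) \<phi> = (\<Sum>j. pay (v j) \<phi>)"
  unfolding pay_def by (subst nn_integral_suminf[symmetric]) (auto simp: ennreal_suminf_multc)

lemma cost_suminf: "cost (\<lambda>z. \<Sum>j. v j z) = (\<Sum>j. cost (v j))"
  unfolding cost_def by (subst nn_integral_suminf[symmetric]) (auto simp: ennreal_suminf_multc)

lemma pay_add: "pay (\<lambda>z. v z + w z) \<phi> = pay v \<phi> + pay w \<phi>"
  unfolding pay_def by (subst nn_integral_add[symmetric]) (auto simp: distrib_right)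

lemma cost_add: "cost (\<lambda>z. v z + w z) = cost v + cost w"
  unfolding cost_def by (subst nn_integral_add[symmetric]) (auto simp: distrib_right)

lemma pay_ge: "won \<phi> z \<Longrightarrow> v z \<le> pay v \<phi>"
  unfolding pay_def using nn_integral_ge_point[of z UNIV "\<lambda>z. v z * indicator {z. won \<phi> z} z"] by simp

text \<open>Joined at time 0 to the constant path at \<open>x\<close>, a path started at
  \<open>x\<close> is unchanged, so this is \<open>prob_follows\<close> before any move has been
  made.\<close>

lemma (in wiener) stake_cost: "prob {\<psi>\<in>space W. won \<psi> z} = 1 / 2 ^ length (snd z)"
proof -
  let ?f = "\<lambda>_::real. x" let ?\<delta> = "dyadic (fst z)"
  have f: "?f \<in> Cpaths" by (rule CpathsI) auto
  have "bet_value {0..} ?\<delta> (snd z) ?f 0 = 1 / 2 ^ length (snd z)" unfolding bet_value_def by simp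
  then have 1: "prob {\<psi>\<in>space W. follows {0..} ?\<delta> (snd z) (join ?f 0 \<psi>) (length (snd z))} = 1 / 2 ^ length (snd z)"
    using prob_follows[OF f dyadic_pos order_refl, of "fst z" "snd z"] by simp
  have pm: "{\<psi>\<in>space W. won \<psi> z} \<in> sets W"
    unfolding won_def using follows_measurable[OF dyadic_pos] unfolding measurable_W[symmetric] by (rule predE)
  have pj: "{\<psi>\<in>space W. follows {0..} ?\<delta> (snd z) (join ?f 0 \<psi>) (length (snd z))} \<in> sets W"
    by (rule predE) (use measurable_compose[OF join_measurable[OF f order_refl] follows_measurable[OF dyadic_pos]] in \<open>simp add: measurable_W\<close>)
  have "AE \<psi> in W. \<psi> \<in> {\<psi>\<in>space W. won \<psi> z} \<longleftrightarrow> \<psi> \<in> {\<psi>\<in>space W. follows {0..} ?\<delta> (snd z) (join ?f 0 \<psi>) (length (snd z))}"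
    using start AE_space
  proof eventually_elim
    case (elim \<psi>)
    then have "\<psi> \<in> Cpaths" by (simp add: space_W)
    then have "join ?f 0 \<psi> u = \<psi> u" for u
      unfolding join_def using elim(1) Cpaths_neg[of \<psi> u] by (cases "u \<le> 0") simp_all
    then have "join ?f 0 \<psi> = \<psi>" by (rule ext)
    then show ?case by (simp add: won_def)
  qed
  from finite_measure_eq_AE[OF this pm pj] 1 show ?thesis by simp
qed

lemma unbounded_from_sets: "unbounded_from x \<in> sets Cspace"
proof -
  have "unbounded_path \<phi> \<longleftrightarrow> (\<forall>M::nat. \<exists>q::rat. 0 \<le> q \<and> real M < \<bar>\<phi> (of_rat q)\<bar>)" if \<phi>: "\<phi> \<in> Cpaths" for \<phi>
  proof
    assume u: "unbounded_path \<phi>"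
    show "\<forall>M::nat. \<exists>q::rat. 0 \<le> q \<and> real M < \<bar>\<phi> (of_rat q)\<bar>"
    proof
      fix M :: nat
      obtain t where t: "t \<ge> 0" "real M < \<bar>\<phi> t\<bar>" using u unfolding unbounded_path_def by blast
      have "open ((\<lambda>t. \<bar>\<phi> t\<bar>) -` {real M<..})"
        using continuous_on_open_vimage[OF open_UNIV, of "\<lambda>t. \<bar>\<phi> t\<bar>"] Cpaths_cont[OF \<phi>, of UNIV] by (auto intro: continuous_intros)
      then obtain e where e: "e > 0" "ball t e \<subseteq> (\<lambda>t. \<bar>\<phi> t\<bar>) -` {real M<..}"
        using t(2) by (metis greaterThan_iff open_contains_ball vimageI)
      obtain q where q: "t < of_rat q" "of_rat q < t + e" using of_rat_dense[of t "t + e"] e(1) by auto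
      then have "of_rat q \<in> ball t e" by (simp add: dist_real_def)
      moreover have "0 \<le> q" using q(1) t(1) by (metis less_imp_le order_le_less_trans zero_less_of_rat_iff)
      ultimately show "\<exists>q::rat. 0 \<le> q \<and> real M < \<bar>\<phi> (of_rat q)\<bar>" using e(2) by auto
    qed
  next
    assume *: "\<forall>M::nat. \<exists>q::rat. 0 \<le> q \<and> real M < \<bar>\<phi> (of_rat q)\<bar>"
    show "unbounded_path \<phi>" unfolding unbounded_path_def
    proof
      fix M :: real
      obtain m :: nat where "M < real m" using reals_Archimedean2 by blast
      moreover obtain q :: rat where "0 \<le> q" "real m < \<bar>\<phi> (of_rat q)\<bar>" using * by blast
      ultimately show "\<exists>t\<ge>0. M < \<bar>\<phi> t\<bar>" by (intro exI[of _ "of_rat q"]) auto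
    qed
  qed
  then have "unbounded_from x = {\<phi>\<in>space Cspace. (\<forall>M::nat. \<exists>q::rat. 0 \<le> q \<and> real M < \<bar>\<phi> (of_rat q)\<bar>) \<and> \<phi> 0 = x}"
    unfolding unbounded_from_def space_Cspace by auto
  also have "\<dots> \<in> sets Cspace"
  proof -
    note [measurable] = Cspace_eval
    show ?thesis by measurable
  qed
  finally show ?thesis .
qed

section \<open>Covering level sets and bounded paths by portfolios\<close>

context wiener
begin

lemma AE_unbounded_from: "AE \<psi> in W. \<psi> \<in> unbounded_from x"
  using AE_unbounded start AE_space
proof eventually_elim
  case (elim \<psi>)
  have "unbounded_path \<psi>" unfolding unbounded_path_def
  proof
    fix M
    obtain t where "t \<ge> 0" "M + \<bar>\<psi> 0\<bar> < \<bar>\<psi> t - \<psi> 0\<bar>" using elim(1) by blast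
    then show "\<exists>t\<ge>0. M < \<bar>\<psi> t\<bar>" by (intro exI[of _ t]) auto
  qed
  then show ?case unfolding unbounded_from_def using elim by (simp add: space_W)
qed

text \<open>Codes are meaningful on unbounded paths from \<open>x\<close> only; this set has full
  Wiener measure, so the restriction loses no mass.\<close>

definition WG :: "(real \<Rightarrow> real) measure" where "WG = restrict_space W (unbounded_from x)"

lemma unbounded_from_W: "unbounded_from x \<in> sets W" using unbounded_from_sets sets_W by simp

lemma space_WG: "space WG = unbounded_from x"
  unfolding WG_def space_restrict_space using sets.sets_into_space[OF unbounded_from_W] by auto

lemma emeasure_WG: "A \<subseteq> unbounded_from x \<Longrightarrow> emeasure WG A = emeasure W A"
  unfolding WG_def by (rule emeasure_restrict_space) (auto simp: unbounded_from_W)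

lemma sets_WG: "A \<in> sets WG \<longleftrightarrow> A \<subseteq> unbounded_from x \<and> A \<in> sets W"
  unfolding WG_def by (rule sets_restrict_space_iff) (auto simp: unbounded_from_W)

lemma won_sets: "{\<psi>\<in>space W. won \<psi> z} \<in> sets W"
  unfolding won_def using follows_measurable[OF dyadic_pos] unfolding measurable_W[symmetric] by (rule predE)

lemma cell_eq: "\<phi> \<in> unbounded_from x \<Longrightarrow> {\<psi>\<in>unbounded_from x. code n \<psi> = code n \<phi>} = {\<psi>\<in>space W. won \<psi> (n, code n \<phi>)} \<inter> unbounded_from x"
  unfolding won_def using code_follows(1) sets.sets_into_space[OF unbounded_from_W] by auto

lemma cell_sets: "{\<psi>\<in>unbounded_from x. code n \<psi> = c} \<in> sets WG"
proof (cases "\<exists>\<phi>\<in>unbounded_from x. code n \<phi> = c")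
  case True
  then obtain \<phi> where "\<phi> \<in> unbounded_from x" "code n \<phi> = c" by blast
  then have "{\<psi>\<in>unbounded_from x. code n \<psi> = c} = {\<psi>\<in>space W. won \<psi> (n, c)} \<inter> unbounded_from x" using cell_eq by blast
  then show ?thesis unfolding sets_WG using won_sets unbounded_from_W by auto
next
  case False
  then have "{\<psi>\<in>unbounded_from x. code n \<psi> = c} = {}" by auto
  then show ?thesis by (simp only: sets.empty_sets)
qed

lemma cell_emeasure:
  assumes "\<phi> \<in> unbounded_from x"
  shows "emeasure WG {\<psi>\<in>unbounded_from x. code n \<psi> = code n \<phi>} = ennreal (1 / 2 ^ length (code n \<phi>))"
proof -
  have "emeasure WG {\<psi>\<in>unbounded_from x. code n \<psi> = code n \<phi>} = emeasure W ({\<psi>\<in>space W. won \<psi> (n, code n \<phi>)} \<inter> unbounded_from x)"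
    by (subst emeasure_WG) (auto simp: cell_eq[OF assms])
  also have "\<dots> = emeasure W {\<psi>\<in>space W. won \<psi> (n, code n \<phi>)}"
    using AE_unbounded_from won_sets unbounded_from_W by (intro emeasure_eq_AE) auto
  finally show ?thesis using stake_cost[of "(n, code n \<phi>)"] by (simp add: emeasure_eq_measure)
qed

text \<open>Every covering cell is the event of winning the bet on its code up to a null set, so its
  measure equals the price of that bet and the measure bound becomes a bound on the cost.\<close>

lemma cover_set:
  assumes A: "A \<in> sigma_sets (unbounded_from x) {{\<phi>\<in>unbounded_from x. code n \<phi> = c} | n c. True}" and e: "0 < (e::real)"
  shows "\<exists>I. (\<forall>\<phi>\<in>A. \<exists>z\<in>I. won \<phi> z) \<and> cost (indicator I) \<le> emeasure WG A + ennreal e"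
proof -
  have fm: "finite_measure WG"
  proof (rule finite_measureI)
    show "emeasure WG (space WG) \<noteq> \<infinity>" unfolding space_WG emeasure_WG[OF order_refl] by simp
  qed
  obtain I where I: "I \<subseteq> {(n, code n \<phi>) | n \<phi>. \<phi> \<in> unbounded_from x}" "\<forall>\<phi>\<in>A. \<exists>n. (n, code n \<phi>) \<in> I"
     "(\<integral>\<^sup>+z. emeasure WG {\<phi>\<in>unbounded_from x. code (fst z) \<phi> = snd z} \<partial>count_space I) \<le> emeasure WG A + ennreal e"
  proof -
    have c1: "{\<phi>\<in>space WG. code n \<phi> = c} \<in> sets WG" for n c unfolding space_WG by (rule cell_sets)
    have r1: "code n \<phi> = code n \<psi>" if "\<phi> \<in> space WG" "\<psi> \<in> space WG" "code (Suc n) \<phi> = code (Suc n) \<psi>" for n \<phi> \<psi>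
      using code_refine[of \<psi> x \<phi> n] that unfolding space_WG by blast
    have a1: "A \<in> sigma_sets (space WG) {{\<phi>\<in>space WG. code n \<phi> = c} | n c. True}" unfolding space_WG by (rule A)
    note refining_outer_regular[where M = WG and code = code and A = A and e = e, OF fm c1 r1 a1 e]
    then obtain I where "I \<subseteq> {(n, code n x') | n x'. x' \<in> space WG}" "\<forall>\<phi>\<in>A. \<exists>n. (n, code n \<phi>) \<in> I"
      "(\<integral>\<^sup>+z. emeasure WG {\<phi>\<in>space WG. code (fst z) \<phi> = snd z} \<partial>count_space I) \<le> emeasure WG A + ennreal e" by blast
    then show thesis unfolding space_WG by (rule that)
  qed
  have "cost (indicator I) = (\<integral>\<^sup>+z. ennreal (1 / 2 ^ length (snd z)) \<partial>count_space I)"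
    unfolding cost_def by (subst nn_integral_count_space_indicator) (auto simp: mult.commute)
  also have "\<dots> = (\<integral>\<^sup>+z. emeasure WG {\<phi>\<in>unbounded_from x. code (fst z) \<phi> = snd z} \<partial>count_space I)"
  proof (rule nn_integral_cong)
    fix z assume "z \<in> space (count_space I)"
    then obtain n \<phi> where "z = (n, code n \<phi>)" "\<phi> \<in> unbounded_from x" using I(1) by auto
    then show "ennreal (1 / 2 ^ length (snd z)) = emeasure WG {\<phi>\<in>unbounded_from x. code (fst z) \<phi> = snd z}" using cell_emeasure by simp
  qed
  finally have "cost (indicator I) \<le> emeasure WG A + ennreal e" using I(3) by simp
  moreover have "\<exists>z\<in>I. won \<phi> z" if \<phi>A: "\<phi> \<in> A" for \<phi>
  proof -
    have "A \<subseteq> unbounded_from x" using A by (rule sigma_sets_into_sp[rotated]) auto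
    then have "\<phi> \<in> unbounded_from x" using \<phi>A by blast
    moreover obtain n where "(n, code n \<phi>) \<in> I" using bspec[OF I(2) \<phi>A] by (rule exE)
    ultimately show ?thesis unfolding won_def using code_follows(1)[of \<phi> x \<phi> n] by (intro bexI[of _ "(n, code n \<phi>)"]) auto
  qed
  ultimately show ?thesis by blast
qed

text \<open>By continuity in the codes, each set of paths with \<open>normal \<phi> u\<close> above
  a given level is a union of cells, and there are only countably many cells.\<close>

lemma normal_measurable: "normal \<in> measurable (sigma (unbounded_from x) {{\<phi>\<in>unbounded_from x. code n \<phi> = c} | n c. True}) Cspace"
proof (rule measurable_CspaceI)
  let ?S = "sigma (unbounded_from x) {{\<phi>\<in>unbounded_from x. code n \<phi> = c} | n c. True}"
  have sp: "space ?S = unbounded_from x" by (rule space_measure_of) auto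
  have cell: "{\<phi>\<in>unbounded_from x. code n \<phi> = c} \<in> sets ?S" for n c by (subst sets_measure_of) auto
  show "normal \<phi> \<in> Cpaths" if "\<phi> \<in> space ?S" for \<phi> using that normal_Cpaths unbounded_fromD unfolding sp by blast
  fix u :: real assume u: "0 \<le> u"
  show "(\<lambda>\<phi>. normal \<phi> u) \<in> borel_measurable ?S"
  proof (rule borel_measurableI_greater, unfold sp)
    fix a :: real
    let ?O = "{\<phi>\<in>unbounded_from x. a < normal \<phi> u}"
    let ?J = "{z. {\<phi>\<in>unbounded_from x. code (fst z) \<phi> = snd z} \<subseteq> ?O}"
    have "?O = (\<Union>z\<in>?J. {\<phi>\<in>unbounded_from x. code (fst z) \<phi> = snd z})"
    proof (intro equalityI subsetI)
      fix \<phi> assume \<phi>: "\<phi> \<in> ?O"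
      then have "0 < normal \<phi> u - a" "\<phi> \<in> unbounded_from x" by auto
      from normal_code_continuous[OF this(2) u this(1)] obtain n where n: "\<forall>\<phi>'\<in>unbounded_from x. code n \<phi>' = code n \<phi> \<longrightarrow> \<bar>normal \<phi>' u - normal \<phi> u\<bar> < normal \<phi> u - a" by blast
      have "(n, code n \<phi>) \<in> ?J" using n by fastforce
      then show "\<phi> \<in> (\<Union>z\<in>?J. {\<phi>\<in>unbounded_from x. code (fst z) \<phi> = snd z})" using \<phi> by (intro UN_I[of "(n, code n \<phi>)"]) auto
    qed auto
    also have "\<dots> \<in> sets ?S" by (rule sets.countable_UN') (auto intro!: cell)
    finally show "?O \<in> sets ?S" .
  qed
qed

text \<open>Layer by layer: each level set of the functional on normal forms is covered by cells,
  and each layer contributes weight \<open>\<eta>\<close>. With \<open>\<eta>\<close> = e/2, half of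
  the allowance pays for rounding in \<open>layer_sum\<close>, and the other half for the covering
  errors, whose geometric weights add up to 1.\<close>

lemma cover_unbounded:
  assumes Fm: "F \<in> borel_measurable Cspace" and F: "time_superinvariant F" and e: "0 < (e::real)"
  shows "\<exists>w. cost w \<le> (\<integral>\<^sup>+\<psi>. F \<psi> \<partial>W) + ennreal e \<and> (\<forall>\<phi>\<in>unbounded_from x. F \<phi> \<le> pay w \<phi>)"
proof -
  define \<eta> where "\<eta> = e / 2"
  have \<eta>: "0 < \<eta>" using e unfolding \<eta>_def by simp
  let ?S = "sigma (unbounded_from x) {{\<phi>\<in>unbounded_from x. code n \<phi> = c} | n c. True}"
  define A where "A k = {\<phi>\<in>unbounded_from x. ennreal (real k * \<eta>) < F (normal \<phi>)}" for k
  have FN: "(\<lambda>\<phi>. F (normal \<phi>)) \<in> borel_measurable ?S" by (rule measurable_compose[OF normal_measurable Fm])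
  have sp: "space ?S = unbounded_from x" by (rule space_measure_of) auto
  have sS: "sets ?S = sigma_sets (unbounded_from x) {{\<phi>\<in>unbounded_from x. code n \<phi> = c} | n c. True}" by (rule sets_measure_of) auto
  have "{\<phi>\<in>space ?S. ennreal (real k * \<eta>) < F (normal \<phi>)} \<in> sets ?S" for k using FN by (rule borel_measurable_less[OF borel_measurable_const])
  then have As: "A k \<in> sigma_sets (unbounded_from x) {{\<phi>\<in>unbounded_from x. code n \<phi> = c} | n c. True}" for k
    unfolding A_def sp sS .
  have sub: "sigma_sets (unbounded_from x) {{\<phi>\<in>unbounded_from x. code n \<phi> = c} | n c. True} \<subseteq> sets WG"
    using sets.sigma_sets_subset[of "{{\<phi>\<in>unbounded_from x. code n \<phi> = c} | n c. True}" WG] cell_sets unfolding space_WG by blast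
  have AW: "A k \<in> sets WG" for k using As sub by blast
  have "\<exists>I. (\<forall>\<phi>\<in>A k. \<exists>z\<in>I. won \<phi> z) \<and> cost (indicator I) \<le> emeasure WG (A k) + ennreal ((1/2) ^ Suc k * 1)" for k
    by (rule cover_set[OF As]) simp
  then obtain I where I: "\<And>k \<phi>. \<phi> \<in> A k \<Longrightarrow> \<exists>z\<in>I k. won \<phi> z" "\<And>k. cost (indicator (I k)) \<le> emeasure WG (A k) + ennreal ((1/2) ^ Suc k * 1)" by metis
  define w where "w z = (\<Sum>k. ennreal \<eta> * indicator (I k) z)" for z
  have "F \<phi> \<le> pay w \<phi>" if \<phi>: "\<phi> \<in> unbounded_from x" for \<phi>
  proof -
    have "F \<phi> \<le> F (normal \<phi>)" using F_le_normal[OF F] unbounded_fromD \<phi> by blast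
    also have "\<dots> \<le> (\<Sum>k. ennreal \<eta> * (if ennreal (real k * \<eta>) < F (normal \<phi>) then 1 else 0))" by (rule layer_sum(1)[OF \<eta>])
    also have "\<dots> \<le> (\<Sum>k. pay (\<lambda>z. ennreal \<eta> * indicator (I k) z) \<phi>)"
    proof (rule suminf_le)
      fix k
      show "ennreal \<eta> * (if ennreal (real k * \<eta>) < F (normal \<phi>) then 1 else 0) \<le> pay (\<lambda>z. ennreal \<eta> * indicator (I k) z) \<phi>"
      proof (cases "\<phi> \<in> A k")
        case True
        then obtain z where z: "z \<in> I k" "won \<phi> z" using I(1) by blast
        then show ?thesis using pay_ge[OF z(2), of "\<lambda>z. ennreal \<eta> * indicator (I k) z"] by auto
      next
        case False then show ?thesis using \<phi> unfolding A_def by auto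
      qed
    qed auto
    also have "\<dots> = pay w \<phi>" unfolding w_def by (rule pay_suminf[symmetric])
    finally show ?thesis .
  qed
  moreover have "cost w \<le> (\<integral>\<^sup>+\<psi>. F \<psi> \<partial>W) + ennreal e"
  proof -
    have FNm: "(\<lambda>\<phi>. F (normal \<phi>)) \<in> borel_measurable WG"
    proof (rule measurableI)
      fix B :: "ennreal set" assume "B \<in> sets borel"
      from measurable_sets[OF FN this] have "(\<lambda>\<phi>. F (normal \<phi>)) -` B \<inter> unbounded_from x \<in> sigma_sets (unbounded_from x) {{\<phi>\<in>unbounded_from x. code n \<phi> = c} | n c. True}"
        unfolding sp sS .
      then show "(\<lambda>\<phi>. F (normal \<phi>)) -` B \<inter> space WG \<in> sets WG" using sub unfolding space_WG by blast
    qed simp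
    have "cost w = (\<Sum>k. cost (\<lambda>z. ennreal \<eta> * indicator (I k) z))" unfolding w_def by (rule cost_suminf)
    also have "\<dots> = (\<Sum>k. ennreal \<eta> * cost (indicator (I k)))"
      unfolding cost_def by (simp add: nn_integral_cmult mult.assoc)
    also have "\<dots> \<le> (\<Sum>k. ennreal \<eta> * emeasure WG (A k) + ennreal \<eta> * ennreal ((1/2) ^ Suc k * 1))"
      using I(2) by (intro suminf_le) (auto simp: distrib_left[symmetric] intro: mult_left_mono)
    also have "\<dots> = (\<Sum>k. ennreal \<eta> * emeasure WG (A k)) + (\<Sum>k. ennreal \<eta> * ennreal ((1/2) ^ Suc k * 1))" by (rule suminf_add[symmetric]) auto
    also have "(\<Sum>k. ennreal \<eta> * ennreal ((1/2) ^ Suc k * 1)) = ennreal \<eta>"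
    proof -
      have "(\<Sum>k. ennreal \<eta> * ennreal ((1/2) ^ Suc k * 1)) = (\<Sum>k. ennreal ((1/2) ^ Suc k * \<eta>))"
        using \<eta> by (intro suminf_cong) (simp add: ennreal_mult[symmetric] mult.commute)
      also have "\<dots> = ennreal \<eta>" using half_sums[of \<eta>] \<eta> by (intro suminf_ennreal_eq) auto
      finally show ?thesis .
    qed
    also have "(\<Sum>k. ennreal \<eta> * emeasure WG (A k)) = (\<Sum>k. \<integral>\<^sup>+\<phi>. ennreal \<eta> * indicator (A k) \<phi> \<partial>WG)"
      using AW by (simp add: nn_integral_cmult)
    also have "\<dots> = (\<integral>\<^sup>+\<phi>. (\<Sum>k. ennreal \<eta> * indicator (A k) \<phi>) \<partial>WG)" using AW by (intro nn_integral_suminf[symmetric]) auto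
    also have "\<dots> \<le> (\<integral>\<^sup>+\<phi>. F (normal \<phi>) + ennreal \<eta> \<partial>WG)"
    proof (rule nn_integral_mono)
      fix \<phi> assume "\<phi> \<in> space WG"
      then have "indicator (A k) \<phi> = (if ennreal (real k * \<eta>) < F (normal \<phi>) then 1 else 0 :: ennreal)" for k unfolding A_def space_WG by (auto simp: indicator_def)
      then show "(\<Sum>k. ennreal \<eta> * indicator (A k) \<phi>) \<le> F (normal \<phi>) + ennreal \<eta>" using layer_sum(2)[OF \<eta>, of "F (normal \<phi>)"] by simp
    qed
    also have "\<dots> = (\<integral>\<^sup>+\<phi>. F (normal \<phi>) \<partial>WG) + (\<integral>\<^sup>+\<phi>. ennreal \<eta> \<partial>WG)" using FNm by (intro nn_integral_add) auto
    also have "(\<integral>\<^sup>+\<phi>. ennreal \<eta> \<partial>WG) \<le> ennreal \<eta>"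
    proof -
      have "emeasure WG (unbounded_from x) \<le> 1" using emeasure_WG[OF order_refl] emeasure_le_1 by simp
      then have "ennreal \<eta> * emeasure WG (unbounded_from x) \<le> ennreal \<eta> * 1" by (intro mult_left_mono) auto
      then show ?thesis by (simp add: space_WG)
    qed
    also have "(\<integral>\<^sup>+\<phi>. F (normal \<phi>) \<partial>WG) \<le> (\<integral>\<^sup>+\<psi>. F \<psi> \<partial>W)"
    proof -
      have "(\<integral>\<^sup>+\<phi>. F (normal \<phi>) \<partial>WG) \<le> (\<integral>\<^sup>+\<psi>. F \<psi> \<partial>WG)"
      proof (rule nn_integral_mono_AE)
        have "AE \<psi> in W. \<psi> \<in> unbounded_from x \<longrightarrow> F (normal \<psi>) \<le> F \<psi>" using AE_not_constant
          by eventually_elim (use F_normal_le[OF F] unbounded_fromD in blast)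
        then show "AE \<psi> in WG. F (normal \<psi>) \<le> F \<psi>" unfolding WG_def using unbounded_from_W by (subst AE_restrict_space_iff) auto
      qed
      also have "\<dots> = (\<integral>\<^sup>+\<psi>. F \<psi> * indicator (unbounded_from x) \<psi> \<partial>W)" unfolding WG_def using unbounded_from_W by (subst nn_integral_restrict_space) auto
      also have "\<dots> \<le> (\<integral>\<^sup>+\<psi>. F \<psi> \<partial>W)" by (intro nn_integral_mono) (auto simp: indicator_def)
      finally show ?thesis .
    qed
    finally have "cost w \<le> (\<integral>\<^sup>+\<psi>. F \<psi> \<partial>W) + ennreal \<eta> + ennreal \<eta>" by (simp add: add_mono add.assoc)
    also have "\<dots> = (\<integral>\<^sup>+\<psi>. F \<psi> \<partial>W) + ennreal e" using \<eta> unfolding \<eta>_def by (simp add: add.assoc ennreal_plus[symmetric] del: ennreal_plus)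
    finally show ?thesis .
  qed
  ultimately show ?thesis by blast
qed

text \<open>All patterns of a fixed length K whose positions stay within \<open>M\<close> are bet
  on. Their total price is the Brownian probability of staying within \<open>M\<close> for K
  crossings, which tends to 0, while a path with bounded crossing positions follows one of these
  patterns for every K.\<close>

lemma cover_bounded:
  assumes e: "0 < (e::real)"
  shows "\<exists>P. finite P \<and> (\<Sum>p\<in>P. 1 / 2 ^ length p) \<le> e \<and>
    (\<forall>\<phi>\<in>Cpaths. crosses_forever (dyadic n) \<phi> \<longrightarrow> (\<forall>k. \<bar>\<phi> (crossing_point (dyadic n) \<phi> k) - \<phi> 0\<bar> \<le> M) \<longrightarrow> (\<exists>p\<in>P. won \<phi> (n, p)))"
proof -
  define P where "P K = {p :: bool list. length p = K \<and> (\<forall>m\<le>K. \<bar>\<Sum>i<m. sign_of (p ! i) * dyadic n\<bar> \<le> M)}" for K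
  have fP: "finite (P K)" for K unfolding P_def by (rule finite_subset[OF _ finite_lists_length_eq[of UNIV K]]) auto
  define E where "E K = (\<Union>p\<in>P K. {\<psi>\<in>space W. won \<psi> (n, p)})" for K
  have Es: "E K \<in> sets W" for K unfolding E_def using fP won_sets by auto
  have sumpos: "\<phi> (enn2real (crossing_time {0..} (dyadic n) \<phi> m)) - \<phi> 0 = (\<Sum>i<m. sign_of (p ! i) * dyadic n)" if "follows {0..} (dyadic n) p \<phi> k" "m \<le> k" for \<phi> m k p
    using that(2)
  proof (induction m)
    case (Suc m)
    have "\<phi> (enn2real (crossing_time {0..} (dyadic n) \<phi> (Suc m))) - \<phi> (enn2real (crossing_time {0..} (dyadic n) \<phi> m)) = sign_of (p ! m) * dyadic n"
      using that(1) Suc.prems unfolding follows_def by auto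
    moreover have "\<phi> (enn2real (crossing_time {0..} (dyadic n) \<phi> m)) - \<phi> 0 = (\<Sum>i<m. sign_of (p ! i) * dyadic n)" using Suc by simp
    ultimately show ?case by simp
  qed simp
  have disj: "disjoint_family_on (\<lambda>p. {\<psi>\<in>space W. won \<psi> (n, p)}) (P K)" for K
    unfolding disjoint_family_on_def
  proof (intro ballI impI)
    fix p p' assume p: "p \<in> P K" "p' \<in> P K" "p \<noteq> p'"
    have False if "won \<psi> (n, p)" "won \<psi> (n, p')" for \<psi>
    proof -
      have l: "length p = length p'" using p unfolding P_def by auto
      have "p ! i = p' ! i" if i: "i < length p" for i
      proof -
        have "sign_of (p ! i) * dyadic n = sign_of (p' ! i) * dyadic n" using \<open>won \<psi> (n, p)\<close> \<open>won \<psi> (n, p')\<close> i l unfolding won_def follows_def by auto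
        then show ?thesis by (simp add: less_imp_neq[OF dyadic_pos, symmetric])
      qed
      then have "p = p'" using l by (intro nth_equalityI) auto
      then show False using p(3) by simp
    qed
    then show "{\<psi>\<in>space W. won \<psi> (n, p)} \<inter> {\<psi>\<in>space W. won \<psi> (n, p')} = {}" by blast
  qed
  have probE: "prob (E K) = (\<Sum>p\<in>P K. 1 / 2 ^ length p)" for K
  proof -
    have "prob (E K) = (\<Sum>p\<in>P K. prob {\<psi>\<in>space W. won \<psi> (n, p)})" unfolding E_def
      using fP disj won_sets by (intro finite_measure_finite_Union) auto
    then show ?thesis using stake_cost by simp
  qed
  \<comment> \<open>A prefix of an admissible pattern is admissible, and whoever follows the pattern
    follows its prefix.\<close>
  have "E (Suc K) \<subseteq> E K" for K
  proof
    fix \<psi> assume "\<psi> \<in> E (Suc K)"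
    then obtain p where p: "p \<in> P (Suc K)" "won \<psi> (n, p)" "\<psi> \<in> space W" unfolding E_def by blast
    have "take K p \<in> P K" using p(1) unfolding P_def by auto
    moreover have "won \<psi> (n, take K p)" using p(1,2) unfolding won_def follows_def P_def by auto
    ultimately show "\<psi> \<in> E K" using p(3) unfolding E_def by blast
  qed
  then have dec: "decseq E" by (rule decseq_SucI)
  have "emeasure W (\<Inter>K. E K) = 0"
  proof (rule AE_iff_measurable[THEN iffD1, rotated 2])
    show "AE \<psi> in W. \<psi> \<notin> (\<Inter>K. E K)" using AE_unbounded_from
    proof eventually_elim
      case (elim \<psi>)
      note G = unbounded_fromD[OF elim]
      have i: "crosses_forever (dyadic n) \<psi>" using G(4) by simp
      show ?case
      proof
        assume a: "\<psi> \<in> (\<Inter>K. E K)"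
        have b: "\<bar>\<psi> (crossing_point (dyadic n) \<psi> k) - \<psi> 0\<bar> \<le> M" for k
        proof -
          obtain p where p: "p \<in> P k" "won \<psi> (n, p)" using a unfolding E_def by blast
          then have "\<psi> (crossing_point (dyadic n) \<psi> k) - \<psi> 0 = (\<Sum>i<k. sign_of (p ! i) * dyadic n)"
            using sumpos[of p \<psi> k k] unfolding won_def crossing_point_def P_def by auto
          then show ?thesis using p(1) unfolding P_def by auto
        qed
        obtain t where t: "t \<ge> 0" "M + \<bar>\<psi> 0\<bar> + 1 < \<bar>\<psi> t\<bar>" using G(2) unfolding unbounded_path_def by blast
        obtain m where "crossing_point (dyadic n) \<psi> m \<le> t" "t < crossing_point (dyadic n) \<psi> (Suc m)" using crossing_point_index[OF G(1) dyadic_pos i t(1)] by blast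
        from crossing_point_props(6)[OF G(1) dyadic_pos i this] show False using b[of m] t(2) dyadic_le1[of n] by linarith
      qed
    qed
    show "{\<psi>\<in>space W. \<not> \<psi> \<notin> (\<Inter>K. E K)} = (\<Inter>K. E K)"
      using sets.sets_into_space[OF Es[of 0]] by auto
    show "(\<Inter>K. E K) \<in> sets W" using Es by auto
  qed
  then have "(\<lambda>K. prob (E K)) \<longlonglongrightarrow> 0"
    using finite_Lim_measure_decseq[OF _ dec] Es by (simp add: measure_def image_subset_iff)
  then have "\<forall>\<^sub>F K in sequentially. prob (E K) < e" using e by (rule order_tendstoD(2))
  then obtain K where K: "prob (E K) < e" unfolding eventually_sequentially by blast
  have "\<exists>p\<in>P K. won \<phi> (n, p)" if \<phi>: "\<phi> \<in> Cpaths" "crosses_forever (dyadic n) \<phi>" "\<forall>k. \<bar>\<phi> (crossing_point (dyadic n) \<phi> k) - \<phi> 0\<bar> \<le> M" for \<phi>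
  proof -
    define p where "p = map (\<lambda>k. \<phi> (crossing_point (dyadic n) \<phi> k) < \<phi> (crossing_point (dyadic n) \<phi> (Suc k))) [0..<K]"
    have pr: "follows {0..} (dyadic n) p \<phi> K" unfolding follows_iff[OF \<phi>(1) dyadic_pos \<phi>(2)] p_def by simp
    have l: "length p = K" unfolding p_def by simp
    have "\<bar>\<Sum>i<m. sign_of (p ! i) * dyadic n\<bar> \<le> M" if "m \<le> K" for m
      using \<phi>(3)[rule_format, of m] unfolding crossing_point_def sumpos[OF pr that] .
    then have "p \<in> P K" unfolding P_def using l by simp
    then show ?thesis using pr l unfolding won_def by (intro bexI[of _ p]) auto
  qed
  then show ?thesis using fP[of K] probE[of K] K by (intro exI[of _ "P K"]) auto
qed

text \<open>To the portfolio for unbounded paths another one of cost at most e/2 is added, whose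
  payoff is infinite on every bounded path that keeps crossing some mesh; there nothing needs to be
  known about \<open>F\<close>.\<close>

lemma cover:
  assumes Fm: "F \<in> borel_measurable Cspace" and F: "time_superinvariant F" and e: "0 < (e::real)"
  shows "\<exists>w. cost w \<le> (\<integral>\<^sup>+\<psi>. F \<psi> \<partial>W) + ennreal e \<and>
     (\<forall>\<phi>\<in>Cpaths. \<phi> 0 = x \<longrightarrow> (\<exists>n. crosses_forever (dyadic n) \<phi>) \<longrightarrow> F \<phi> \<le> pay w \<phi>)"
proof -
  have e2: "0 < e / 2" using e by simp
  obtain w1 where w1: "cost w1 \<le> (\<integral>\<^sup>+\<psi>. F \<psi> \<partial>W) + ennreal (e / 2)" "\<And>\<phi>. \<phi> \<in> unbounded_from x \<Longrightarrow> F \<phi> \<le> pay w1 \<phi>"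
    using cover_unbounded[OF Fm F e2] by blast
  define nn where "nn j = fst (prod_decode j)" for j
  define MM where "MM j = fst (prod_decode (snd (prod_decode j)))" for j
  have "\<exists>P. finite P \<and> (\<Sum>p\<in>P. 1 / 2 ^ length p) \<le> (1/2) ^ Suc j * (e / 2) \<and>
    (\<forall>\<phi>\<in>Cpaths. crosses_forever (dyadic (nn j)) \<phi> \<longrightarrow> (\<forall>k. \<bar>\<phi> (crossing_point (dyadic (nn j)) \<phi> k) - \<phi> 0\<bar> \<le> real (MM j)) \<longrightarrow> (\<exists>p\<in>P. won \<phi> (nn j, p)))" for j
    by (rule cover_bounded) (use e in simp)
  then obtain P where P: "\<And>j. finite (P j)" "\<And>j. (\<Sum>p\<in>P j. 1 / 2 ^ length p) \<le> (1/2) ^ Suc j * (e / 2)"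
    "\<And>j \<phi>. \<phi> \<in> Cpaths \<Longrightarrow> crosses_forever (dyadic (nn j)) \<phi> \<Longrightarrow> (\<And>k. \<bar>\<phi> (crossing_point (dyadic (nn j)) \<phi> k) - \<phi> 0\<bar> \<le> real (MM j)) \<Longrightarrow> \<exists>p\<in>P j. won \<phi> (nn j, p)"
    by metis
  define w2 where "w2 z = (\<Sum>j. indicator ({nn j} \<times> P j) z :: ennreal)" for z
  have "cost (indicator ({nn j} \<times> P j)) \<le> ennreal ((1/2) ^ Suc j * (e / 2))" for j
  proof -
    have "cost (indicator ({nn j} \<times> P j)) = (\<Sum>z\<in>{nn j} \<times> P j. indicator ({nn j} \<times> P j) z * ennreal (1 / 2 ^ length (snd z)))"
      unfolding cost_def using P(1)[of j] by (intro nn_integral_count_space') auto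
    also have "\<dots> = (\<Sum>z\<in>{nn j} \<times> P j. ennreal (1 / 2 ^ length (snd z)))" by (intro sum.cong) auto
    also have "\<dots> = (\<Sum>p\<in>P j. ennreal (1 / 2 ^ length p))" by (subst sum.cartesian_product') simp
    also have "\<dots> = ennreal (\<Sum>p\<in>P j. 1 / 2 ^ length p)" by (rule sum_ennreal) simp
    also have "\<dots> \<le> ennreal ((1/2) ^ Suc j * (e / 2))" using P(2) by (rule ennreal_leI)
    finally show ?thesis .
  qed
  then have "cost w2 \<le> (\<Sum>j. ennreal ((1/2) ^ Suc j * (e / 2)))" unfolding w2_def cost_suminf by (intro suminf_le) auto
  also have "\<dots> = ennreal (e / 2)" using half_sums[of "e / 2"] e by (intro suminf_ennreal_eq) auto
  finally have c2: "cost w2 \<le> ennreal (e / 2)" .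
  define w where "w z = w1 z + w2 z" for z
  have "cost w \<le> ((\<integral>\<^sup>+\<psi>. F \<psi> \<partial>W) + ennreal (e / 2)) + ennreal (e / 2)" unfolding w_def cost_add using w1(1) c2 by (rule add_mono)
  also have "\<dots> = (\<integral>\<^sup>+\<psi>. F \<psi> \<partial>W) + ennreal e" using e by (simp add: add.assoc ennreal_plus[symmetric] del: ennreal_plus)
  finally have "cost w \<le> (\<integral>\<^sup>+\<psi>. F \<psi> \<partial>W) + ennreal e" .
  moreover have "F \<phi> \<le> pay w \<phi>" if \<phi>: "\<phi> \<in> Cpaths" "\<phi> 0 = x" "crosses_forever (dyadic n) \<phi>" for \<phi> n
  proof (cases "unbounded_path \<phi>")
    case True
    then have "F \<phi> \<le> pay w1 \<phi>" using \<phi> by (intro w1(2)) (simp add: unbounded_from_def)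
    also have "\<dots> \<le> pay w \<phi>" unfolding w_def pay_add by simp
    finally show ?thesis .
  next
    case False
    then obtain B where B: "\<And>t. t \<ge> 0 \<Longrightarrow> \<bar>\<phi> t\<bar> \<le> B" unfolding unbounded_path_def by (meson not_less)
    obtain m :: nat where m: "B + \<bar>x\<bar> \<le> real m" using real_arch_simple by blast
    \<comment> \<open>The indices that belong to one fixed mesh and bound; each contributes a payoff
      of at least 1, so the total is infinite.\<close>
    define f where "f l = prod_encode (n, prod_encode (m, l))" for l
    have fl: "nn (f l) = n" "MM (f l) = m" for l unfolding nn_def MM_def f_def by auto
    have inj: "inj f" unfolding f_def by (intro injI) simp
    have one: "1 \<le> pay (indicator ({nn (f l)} \<times> P (f l))) \<phi>" for l
    proof -
      have "\<bar>\<phi> (crossing_point (dyadic (nn (f l))) \<phi> k) - \<phi> 0\<bar> \<le> real (MM (f l))" for k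
        using B[OF crossing_point_props(3)[OF \<phi>(1) dyadic_pos \<phi>(3)], of k] m \<phi>(2) unfolding fl by linarith
      then obtain p where "p \<in> P (f l)" "won \<phi> (nn (f l), p)" using P(3)[OF \<phi>(1), of "f l"] \<phi>(3) fl by auto
      then show ?thesis using pay_ge[of \<phi> "(nn (f l), p)" "indicator ({nn (f l)} \<times> P (f l))"] by simp
    qed
    have "of_nat N \<le> pay w2 \<phi>" for N
    proof -
      have "of_nat N = (\<Sum>l<N. 1::ennreal)" by simp
      also have "\<dots> \<le> (\<Sum>l<N. pay (indicator ({nn (f l)} \<times> P (f l))) \<phi>)" using one by (intro sum_mono)
      also have "\<dots> = (\<Sum>j\<in>f ` {..<N}. pay (indicator ({nn j} \<times> P j)) \<phi>)" using inj by (subst sum.reindex) (auto simp: inj_on_def)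
      also have "\<dots> \<le> (\<Sum>j. pay (indicator ({nn j} \<times> P j)) \<phi>)" by (intro sum_le_suminf) auto
      also have "\<dots> = pay w2 \<phi>" unfolding w2_def by (rule pay_suminf[symmetric])
      finally show ?thesis .
    qed
    then have "\<not> pay w2 \<phi> < top" using ennreal_Ex_less_of_nat[of "pay w2 \<phi>"] by (meson leD)
    then have "pay w2 \<phi> = top" by (metis top.not_eq_extremum)
    then show ?thesis unfolding w_def pay_add by simp
  qed
  ultimately show ?thesis by blast
qed

end

section \<open>Convergent paths\<close>

lemma squeeze_range: "0 \<le> t \<Longrightarrow> 0 \<le> t / (1 + t) \<and> t / (1 + t) < (1::real)" by auto

lemma squeeze_inverse: "0 \<le> u \<Longrightarrow> u < 1 \<Longrightarrow> 0 \<le> u / (1 - u) \<and> (u / (1 - u)) / (1 + u / (1 - u)) = (u::real)"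
  by (simp add: field_simps)

lemma squeeze_less: "0 \<le> s \<Longrightarrow> 0 \<le> t \<Longrightarrow> s / (1 + s) < t / (1 + t) \<longleftrightarrow> s < (t::real)"
  by (simp add: field_simps)

text \<open>The time change t/(1+t) is an increasing bijection onto [0,1), so finite crossing times
  are carried over by \<open>cross_eqI\<close> in both directions, and a crossing that never happens
  cannot show up before time 1.\<close>

lemma squeeze_crossing:
  assumes \<phi>: "\<phi> \<in> Cpaths" and \<psi>: "\<psi> \<in> Cpaths" and \<delta>: "0 < \<delta>" and eq: "\<And>t. 0 \<le> t \<Longrightarrow> \<psi> (t / (1 + t)) = \<phi> t"
  shows "crossing_time {0..} \<delta> \<phi> k = ennreal s \<Longrightarrow> 0 \<le> s \<Longrightarrow> crossing_time {0..} \<delta> \<psi> k = ennreal (s / (1 + s))"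
    "crossing_time {0..} \<delta> \<phi> k = \<infinity> \<Longrightarrow> 1 \<le> crossing_time {0..} \<delta> \<psi> k"
proof -
  interpret A: path_crossing "{0..}" \<delta> \<phi> using \<phi> \<delta> by (rule path_crossing_Cpaths)
  interpret B: path_crossing "{0..}" \<delta> \<psi> using \<psi> \<delta> by (rule path_crossing_Cpaths)
  define f where "f t = t / (1 + t)" for t :: real
  define g where "g u = u / (1 - u)" for u :: real
  have fr: "0 \<le> f t" "f t < 1" if "0 \<le> t" for t using squeeze_range[OF that] unfolding f_def by auto
  have fg: "0 \<le> g u" "f (g u) = u" if "0 \<le> u" "u < 1" for u using squeeze_inverse[OF that] unfolding f_def g_def by auto
  have fl: "f s < f t \<longleftrightarrow> s < t" if "0 \<le> s" "0 \<le> t" for s t using squeeze_less[OF that] unfolding f_def .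
  have fe: "\<psi> (f t) = \<phi> t" if "0 \<le> t" for t using eq[OF that] unfolding f_def .
  have 1: "B.T k = ennreal (f (A.\<tau> k)) \<and> 0 \<le> f (A.\<tau> k)" if fin: "A.T k \<noteq> \<infinity>"
  proof (rule cross_eqI[where k = k and t = "\<lambda>i. f (A.\<tau> i)", OF _ _ _ order_refl])
    show "f (A.\<tau> 0) = 0" unfolding f_def by simp
    fix i assume "i < k"
    then have Fi: "A.T (Suc i) \<noteq> \<infinity>" using A.fin_le[OF fin, of "Suc i"] by simp
    note S = A.\<tau>_step[OF Fi]
    have n: "0 \<le> A.\<tau> i" "0 \<le> A.\<tau> (Suc i)" by auto
    show "f (A.\<tau> (Suc i)) \<in> {0..} \<and> f (A.\<tau> i) \<le> f (A.\<tau> (Suc i)) \<and> \<delta> \<le> \<bar>\<psi> (f (A.\<tau> (Suc i))) - \<psi> (f (A.\<tau> i))\<bar>"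
      using S(1,2) fr(1)[OF n(2)] fl[OF n] fe[OF n(1)] fe[OF n(2)] by simp
    fix s assume s: "f (A.\<tau> i) \<le> s" "s < f (A.\<tau> (Suc i))"
    have s01: "0 \<le> s" "s < 1" using s fr[OF n(1)] fr[OF n(2)] by auto
    note G = fg[OF s01]
    have "A.\<tau> i \<le> g s" "g s < A.\<tau> (Suc i)" using s fl[OF G(1) n(1)] fl[OF G(1) n(2)] G(2) by auto
    from S(3)[OF this] show "\<bar>\<psi> s - \<psi> (f (A.\<tau> i))\<bar> < \<delta>" using fe[OF G(1)] fe[OF n(1)] G(2) by simp
  qed
  show "B.T k = ennreal (s / (1 + s))" if "A.T k = ennreal s" "0 \<le> s"
    using 1 that unfolding f_def by simp
  show "1 \<le> B.T k" if inf: "A.T k = \<infinity>"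
  proof (rule ccontr)
    assume "\<not> 1 \<le> B.T k"
    then have lt: "B.T k < 1" by simp
    then have fin: "B.T k \<noteq> \<infinity>" by auto
    have t1: "B.\<tau> i < 1" if "i \<le> k" for i
    proof -
      have "B.T i < 1" using B.mono[OF that] lt by simp
      then have "ennreal (B.\<tau> i) < ennreal 1" using B.fin(2)[OF B.fin_le[OF fin that]] by simp
      then show ?thesis by (simp add: ennreal_less_iff)
    qed
    have "A.T k = ennreal (g (B.\<tau> k)) \<and> 0 \<le> g (B.\<tau> k)"
    proof (rule cross_eqI[where k = k and t = "\<lambda>i. g (B.\<tau> i)", OF _ _ _ order_refl])
      show "g (B.\<tau> 0) = 0" unfolding g_def by simp
      fix i assume i: "i < k"
      then have Fi: "B.T (Suc i) \<noteq> \<infinity>" using B.fin_le[OF fin, of "Suc i"] by simp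
      note S = B.\<tau>_step[OF Fi]
      have n: "0 \<le> B.\<tau> i" "0 \<le> B.\<tau> (Suc i)" by auto
      have l1: "B.\<tau> i < 1" "B.\<tau> (Suc i) < 1" using t1[of i] t1[of "Suc i"] i by auto
      note G = fg[OF n(1) l1(1)] and G' = fg[OF n(2) l1(2)]
      have e: "\<phi> (g (B.\<tau> i)) = \<psi> (B.\<tau> i)" "\<phi> (g (B.\<tau> (Suc i))) = \<psi> (B.\<tau> (Suc i))"
        using fe[OF G(1)] fe[OF G'(1)] G(2) G'(2) by auto
      show "g (B.\<tau> (Suc i)) \<in> {0..} \<and> g (B.\<tau> i) \<le> g (B.\<tau> (Suc i)) \<and> \<delta> \<le> \<bar>\<phi> (g (B.\<tau> (Suc i))) - \<phi> (g (B.\<tau> i))\<bar>"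
        using S(1,2) fl[OF G(1) G'(1)] G G' e by simp
      fix s assume s: "g (B.\<tau> i) \<le> s" "s < g (B.\<tau> (Suc i))"
      have s0: "0 \<le> s" using s(1) G(1) by simp
      have "B.\<tau> i \<le> f s" "f s < B.\<tau> (Suc i)" using s fl[OF s0 G(1)] fl[OF s0 G'(1)] G(2) G'(2) by auto
      from S(3)[OF this] show "\<bar>\<phi> s - \<phi> (g (B.\<tau> i))\<bar> < \<delta>" using fe[OF s0] e(1) by simp
    qed
    with inf show False by simp
  qed
qed

text \<open>Crossings not reached by time \<open>t\<close> do not matter, as the increments of the
  bet after them are 0 on both time scales; for the others the stopped positions and the moves
  coincide.\<close>

lemma squeeze_bet_value:
  assumes \<phi>: "\<phi> \<in> Cpaths" and \<psi>: "\<psi> \<in> Cpaths" and \<delta>: "0 < \<delta>" and eq: "\<And>t. 0 \<le> t \<Longrightarrow> \<psi> (t / (1 + t)) = \<phi> t" and t: "0 \<le> t"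
  shows "bet_value {0..} \<delta> p \<psi> (t / (1 + t)) = bet_value {0..} \<delta> p \<phi> t"
proof -
  interpret A: path_crossing "{0..}" \<delta> \<phi> using \<phi> \<delta> by (rule path_crossing_Cpaths)
  interpret B: path_crossing "{0..}" \<delta> \<psi> using \<psi> \<delta> by (rule path_crossing_Cpaths)
  have SC: "A.T k = ennreal s \<Longrightarrow> 0 \<le> s \<Longrightarrow> B.T k = ennreal (s / (1 + s))" "A.T k = \<infinity> \<Longrightarrow> 1 \<le> B.T k" for k s
    by (rule squeeze_crossing[OF \<phi> \<psi> \<delta> eq], assumption+)+
  define f where "f t = t / (1 + t)" for t :: real
  have ft: "0 \<le> f t" "f t < 1" using squeeze_range[OF t] unfolding f_def by auto
  have fin: "B.T k = ennreal (f (A.\<tau> k)) \<and> A.T k = ennreal (A.\<tau> k)" if "A.T k \<noteq> \<infinity>" for k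
    using SC(1)[OF A.fin(2,3)[OF that]] A.fin(2)[OF that] unfolding f_def by simp
  have crossing_before: "\<psi> (crossing_before {0..} \<delta> \<psi> k (f t)) = \<phi> (crossing_before {0..} \<delta> \<phi> k t)" for k
  proof (cases "A.T k \<le> ennreal t")
    case True
    then have f: "A.T k \<noteq> \<infinity>" "A.\<tau> k \<le> t" using A.le_iff[of t k] t by auto
    have l: "f (A.\<tau> k) \<le> f t" using squeeze_less[OF t A.fin(3)[OF f(1)]] f(2) unfolding f_def by (simp add: not_less[symmetric])
    have fp: "0 \<le> f (A.\<tau> k)" unfolding f_def by simp
    have "B.T k \<le> ennreal (f t)" using fin[OF f(1)] l by (simp add: ennreal_leI)
    then have "crossing_before {0..} \<delta> \<psi> k (f t) = f (A.\<tau> k)" using B.crossing_before_eqs(1)[of "f t" k] ft fin[OF f(1)] fp by simp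
    then show ?thesis using A.crossing_before_eqs(1)[of t k] t True eq[of "A.\<tau> k"] unfolding f_def by simp
  next
    case False
    have "ennreal (f t) \<le> B.T k"
    proof (cases "A.T k = \<infinity>")
      case True
      have "ennreal (f t) \<le> ennreal 1" using ft by (intro ennreal_leI) simp
      also have "\<dots> \<le> B.T k" using SC(2)[OF True] by simp
      finally show ?thesis .
    next
      case F: False
      have "t < A.\<tau> k" using False A.le_iff[of t k] t F by auto
      then have "f t < f (A.\<tau> k)" using squeeze_less[OF t A.fin(3)[OF F]] unfolding f_def by simp
      then show ?thesis using fin[OF F] by (simp add: ennreal_leI)
    qed
    then have "crossing_before {0..} \<delta> \<psi> k (f t) = f t" using B.crossing_before_eqs(2)[of "f t" k] ft by simp
    moreover have "crossing_before {0..} \<delta> \<phi> k t = t" using A.crossing_before_eqs(2)[of t k] False t by simp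
    ultimately show ?thesis using eq[OF t] unfolding f_def by simp
  qed
  have pr: "follows {0..} \<delta> p \<psi> m \<longleftrightarrow> follows {0..} \<delta> p \<phi> m" if "A.T m \<noteq> \<infinity>" for m
  proof -
    have a: "A.T i \<noteq> \<infinity>" "B.T i \<noteq> \<infinity>" "\<psi> (B.\<tau> i) = \<phi> (A.\<tau> i)" if "i \<le> m" for i
    proof -
      show F: "A.T i \<noteq> \<infinity>" using A.fin_le[OF \<open>A.T m \<noteq> \<infinity>\<close> that] .
      show "B.T i \<noteq> \<infinity>" using fin[OF F] by simp
      have "B.\<tau> i = f (A.\<tau> i)" using fin[OF F] unfolding f_def by simp
      then show "\<psi> (B.\<tau> i) = \<phi> (A.\<tau> i)" using eq[of "A.\<tau> i"] unfolding f_def by simp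
    qed
    show ?thesis unfolding follows_def using a by (intro all_cong1 imp_cong refl) simp
  qed
  have "stake {0..} \<delta> p \<psi> m * (\<phi> (crossing_before {0..} \<delta> \<phi> (Suc m) t) - \<phi> (crossing_before {0..} \<delta> \<phi> m t)) = stake {0..} \<delta> p \<phi> m * (\<phi> (crossing_before {0..} \<delta> \<phi> (Suc m) t) - \<phi> (crossing_before {0..} \<delta> \<phi> m t))" for m
  proof (cases "A.T m \<le> ennreal t")
    case True
    then have "A.T m \<noteq> \<infinity>" using A.le_iff[of t m] t by auto
    then show ?thesis using pr unfolding stake_def by simp
  next
    case False
    then have "ennreal t \<le> A.T m" "ennreal t \<le> A.T (Suc m)" using A.mono_Suc[of m] by auto
    then show ?thesis using A.crossing_before_eqs(2)[of t] t by simp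
  qed
  then have "bet_value {0..} \<delta> p \<psi> (f t) = bet_value {0..} \<delta> p \<phi> t" unfolding bet_value_def crossing_before by (simp only:)
  then show ?thesis unfolding f_def .
qed

lemma bet_value_continuous:
  assumes "\<psi> \<in> Cpaths" shows "continuous_on {0..} (\<lambda>t. bet_value {0..} \<delta> p \<psi> t)"
proof -
  \<comment> \<open>A crossing time capped at \<open>t\<close> is a stopped time; the sample point
    is a dummy, since the time is a constant function of it.\<close>
  have "crossing_before {0..} \<delta> \<psi> k t = stopt (\<lambda>_. crossing_time {0..} \<delta> \<psi> k) t undefined" for k t unfolding crossing_before_def stopt_def ..
  then have c: "continuous_on {0..} (crossing_before {0..} \<delta> \<psi> k)" for k
    using continuous_on_stopt[of "\<lambda>_. crossing_time {0..} \<delta> \<psi> k" undefined] by (simp cong: continuous_on_cong)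
  have "continuous_on {0..} (\<lambda>t. \<psi> (crossing_before {0..} \<delta> \<psi> k t))" for k
    by (rule continuous_on_compose2[OF Cpaths_cont[OF assms, of UNIV] c]) simp
  then show ?thesis unfolding bet_value_def by (intro continuous_intros)
qed

text \<open>After the last crossing of a mesh the path stays within that mesh of one value; since
  this holds for every mesh, the Cauchy criterion is met.\<close>

lemma limit_exists:
  assumes \<phi>: "\<phi> \<in> Cpaths" and n: "\<And>n. \<not> crosses_forever (dyadic n) \<phi>"
  shows "\<exists>L. (\<phi> \<longlongrightarrow> L) at_top"
proof -
  have osc: "\<exists>T\<ge>0. \<forall>s\<ge>T. \<forall>t\<ge>T. \<bar>\<phi> s - \<phi> t\<bar> < e" if e: "0 < e" for e
  proof -
    have "(\<lambda>n. (1/2::real) ^ n) \<longlonglongrightarrow> 0" by (rule LIMSEQ_power_zero) simp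
    then have "\<forall>\<^sub>F n in sequentially. (1/2::real) ^ n < e / 2" using e by (intro order_tendstoD(2)) auto
    then obtain n where d: "dyadic n < e / 2" unfolding eventually_sequentially dyadic_def by auto
    interpret path_crossing "{0..}" "dyadic n" \<phi> using \<phi> by (rule path_crossing_Cpaths) simp
    define k where "k = (LEAST k. T k = \<infinity>)"
    have k: "T k = \<infinity>" unfolding k_def using n[of n] unfolding crosses_forever_def by (metis (mono_tags) LeastI)
    then obtain k' where k': "k = Suc k'" by (cases k) auto
    have fi: "T k' \<noteq> \<infinity>" using not_less_Least[of k' "\<lambda>k. T k = \<infinity>"] k' unfolding k_def by simp
    have "\<bar>\<phi> s - \<phi> (\<tau> k')\<bar> < dyadic n" if "s \<ge> \<tau> k'" for s
    proof (rule \<tau>_last[OF fi])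
      show "s \<in> {0..}" using order_trans[OF fin(3)[OF fi] that] by simp
      show "ennreal s < T (Suc k')" using k unfolding k' by simp
    qed fact
    then have "\<bar>\<phi> s - \<phi> t\<bar> < e" if "s \<ge> \<tau> k'" "t \<ge> \<tau> k'" for s t using that d by (smt (verit) field_sum_of_halves)
    then show ?thesis using fin(3)[OF fi] by blast
  qed
  have "Cauchy (\<lambda>n. \<phi> (real n))" unfolding Cauchy_altdef2
  proof (intro allI impI)
    fix e :: real assume "0 < e"
    then obtain T where T: "T \<ge> 0" "\<forall>s\<ge>T. \<forall>t\<ge>T. \<bar>\<phi> s - \<phi> t\<bar> < e" using osc by blast
    obtain N :: nat where "T \<le> real N" using real_arch_simple by blast
    then show "\<exists>N. \<forall>n\<ge>N. dist (\<phi> (real n)) (\<phi> (real N)) < e" using T(2)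
      by (intro exI[of _ N]) (auto simp: dist_real_def intro: order_trans)
  qed
  then obtain L where L: "(\<lambda>n. \<phi> (real n)) \<longlonglongrightarrow> L" using Cauchy_convergent convergent_def by blast
  have "(\<phi> \<longlongrightarrow> L) at_top"
  proof (rule tendstoI)
    fix e :: real assume e: "0 < e"
    then have "0 < e / 2" by simp
    then obtain T where T: "T \<ge> 0" "\<forall>s\<ge>T. \<forall>t\<ge>T. \<bar>\<phi> s - \<phi> t\<bar> < e / 2" using osc by blast
    have "\<bar>\<phi> t - L\<bar> \<le> e / 2" if t: "t \<ge> T" for t
    proof (rule tendsto_upperbound[where F = sequentially and f = "\<lambda>n. \<bar>\<phi> t - \<phi> (real n)\<bar>"])
      show "(\<lambda>n. \<bar>\<phi> t - \<phi> (real n)\<bar>) \<longlonglongrightarrow> \<bar>\<phi> t - L\<bar>" by (intro tendsto_intros L)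
      obtain N :: nat where "T \<le> real N" using real_arch_simple by blast
      then show "\<forall>\<^sub>F n in sequentially. \<bar>\<phi> t - \<phi> (real n)\<bar> \<le> e / 2" unfolding eventually_sequentially
        using T(2) t by (intro exI[of _ N]) (auto intro: less_imp_le order_trans)
    qed simp
    then have "\<forall>t\<ge>T. dist (\<phi> t) L < e" using e unfolding dist_real_def by fastforce
    then show "\<forall>\<^sub>F t in at_top. dist (\<phi> t) L < e" unfolding eventually_at_top_linorder by blast
  qed
  then show ?thesis by blast
qed

text \<open>Existence of the limit is exactly what keeps the squeezed path continuous at time 1,
  after which it is constant.\<close>

lemma squeeze_path:
  assumes \<phi>: "\<phi> \<in> Cpaths" and L: "(\<phi> \<longlongrightarrow> L) at_top"
  shows "\<exists>\<psi>\<in>Cpaths. \<forall>t\<ge>0. \<psi> (t / (1 + t)) = \<phi> t"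
proof -
  define g where "g u = (max u 0) / (1 - max u 0)" for u :: real
  define \<psi> where "\<psi> u = (if u < 1 then \<phi> (g u) else L)" for u
  have "\<psi> \<in> Cpaths"
  proof (rule CpathsI)
    show "\<psi> t = \<psi> 0" if "t \<le> 0" for t using that unfolding \<psi>_def g_def by (simp add: max_def)
    have "isCont \<psi> a" for a
    proof -
      consider "a < 1" | "a = 1" | "1 < a" by linarith
      then show ?thesis
      proof cases
        case 1
        have "isCont g a" unfolding g_def using 1 by (intro continuous_intros) (auto simp: max_def)
        moreover have "isCont \<phi> (g a)" using Cpaths_cont[OF \<phi>, of UNIV] by (simp add: continuous_on_eq_continuous_at)
        ultimately have "isCont (\<lambda>u. \<phi> (g u)) a" by (rule isCont_o2)
        moreover have "\<forall>\<^sub>F u in nhds a. \<psi> u = \<phi> (g u)" using eventually_nhds_in_open[of "{..<1}" a] 1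
          by (auto elim!: eventually_mono simp: \<psi>_def)
        ultimately show ?thesis by (simp add: isCont_cong)
      next
        case 3
        have "\<forall>\<^sub>F u in nhds a. \<psi> u = L" using eventually_nhds_in_open[of "{1<..}" a] 3
          by (auto elim!: eventually_mono simp: \<psi>_def)
        then show ?thesis by (simp add: isCont_cong)
      next
        case 2
        show ?thesis unfolding continuous_at_eps_delta
        proof (intro allI impI)
          fix e :: real assume e: "0 < e"
          obtain T where T: "\<And>t. t \<ge> T \<Longrightarrow> dist (\<phi> t) L < e" using tendstoD[OF L e] unfolding eventually_at_top_linorder by blast
          define T' where "T' = max T 0"
          have T': "0 \<le> T'" "T \<le> T'" unfolding T'_def by auto
          show "\<exists>d>0. \<forall>x'. dist x' a < d \<longrightarrow> dist (\<psi> x') (\<psi> a) < e"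
          proof (intro exI[of _ "1 / (1 + T')"] conjI allI impI)
            fix u assume u: "dist u a < 1 / (1 + T')"
            show "dist (\<psi> u) (\<psi> a) < e"
            proof (cases "u < 1")
              case True
              have "1 - u < 1 / (1 + T')" using u True 2 by (simp add: dist_real_def)
              then have b: "(1 - u) * (1 + T') < 1" using T' by (simp add: field_simps)
              have "1 / (1 + T') \<le> 1" using T' by simp
              then have "0 < u" using \<open>1 - u < 1 / (1 + T')\<close> by linarith
              then have "T' \<le> g u" unfolding g_def using True b by (simp add: field_simps)
              then show ?thesis using T[of "g u"] T' True 2 unfolding \<psi>_def by simp
            qed (use 2 e in \<open>simp add: \<psi>_def\<close>)
          qed (use T' in simp)
        qed
      qed
    qed
    then show "continuous_on UNIV \<psi>" by (simp add: continuous_on_eq_continuous_at)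
  qed
  moreover have "\<psi> (t / (1 + t)) = \<phi> t" if t: "0 \<le> t" for t
  proof -
    have "max (t / (1 + t)) 0 = t / (1 + t)" "1 - t / (1 + t) = 1 / (1 + t)" using t by (auto simp: field_simps)
    then have "g (t / (1 + t)) = t" unfolding g_def using t by simp
    then show ?thesis unfolding \<psi>_def using squeeze_range[OF t] by simp
  qed
  ultimately show ?thesis by blast
qed

section \<open>Exhaustion by finite portfolios and random continuation\<close>

definition first_bets :: "nat \<Rightarrow> (nat \<times> bool list) set" where "first_bets n = {z. to_nat z < n}"

lemma first_bets_finite: "finite (first_bets n)"
proof -
  have "inj_on (to_nat :: nat \<times> bool list \<Rightarrow> nat) (first_bets n)" by (rule inj_on_subset[OF inj_to_nat]) auto
  moreover have "to_nat ` first_bets n \<subseteq> {..<n}" unfolding first_bets_def by auto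
  ultimately show ?thesis using finite_imageD finite_subset by blast
qed

lemma first_bets_mono: "m \<le> n \<Longrightarrow> first_bets m \<subseteq> first_bets n" unfolding first_bets_def by auto

text \<open>Only finite portfolios can be traded, since a strategy has a finite index set; the
  payoff and the cost of an infinite portfolio are recovered as suprema along the enumeration of the
  bets.\<close>

lemma count_space_SUP:
  fixes f :: "nat \<times> bool list \<Rightarrow> ennreal"
  shows "(\<integral>\<^sup>+z. f z \<partial>count_space UNIV) = (SUP n. \<Sum>z\<in>first_bets n. f z)"
proof -
  have "(SUP n. f z * indicator (first_bets n) z) = f z" for z
  proof (rule antisym)
    show "(SUP n. f z * indicator (first_bets n) z) \<le> f z" by (rule SUP_least) (auto simp: indicator_def)
    show "f z \<le> (SUP n. f z * indicator (first_bets n) z)" by (rule SUP_upper2[of "Suc (to_nat z)"]) (auto simp: first_bets_def)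
  qed
  then have "(\<integral>\<^sup>+z. f z \<partial>count_space UNIV) = (\<integral>\<^sup>+z. (SUP n. f z * indicator (first_bets n) z) \<partial>count_space UNIV)" by simp
  also have "\<dots> = (SUP n. \<integral>\<^sup>+z. f z * indicator (first_bets n) z \<partial>count_space UNIV)"
  proof (rule nn_integral_monotone_convergence_SUP)
    show "incseq (\<lambda>n z. f z * indicator (first_bets n) z)" using first_bets_mono by (force simp: incseq_def le_fun_def indicator_def)
  qed simp
  also have "\<dots> = (SUP n. \<Sum>z\<in>first_bets n. f z)"
  proof (rule SUP_cong[OF refl])
    fix n
    have "(\<integral>\<^sup>+z. f z * indicator (first_bets n) z \<partial>count_space UNIV) = (\<Sum>z\<in>first_bets n. f z * indicator (first_bets n) z)"
      by (intro nn_integral_count_space' first_bets_finite) auto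
    then show "(\<integral>\<^sup>+z. f z * indicator (first_bets n) z \<partial>count_space UNIV) = (\<Sum>z\<in>first_bets n. f z)" by simp
  qed
  finally show ?thesis .
qed

text \<open>Every continuation of the squeezed path beyond time 1 yields \<open>\<phi>\<close> after
  the time change t/(1+t), so by superinvariance \<open>F \<phi>\<close> is at most \<open>F\<close>
  of the continued path. A Brownian continuation is almost surely unbounded, hence covered by
  \<open>w\<close>, and by \<open>prob_follows\<close> the mean payoff of each bet is its value on
  the squeezed path at time 1.\<close>

lemma (in wiener) continuation_bound:
  assumes w: "\<And>\<phi>. \<phi> \<in> Cpaths \<Longrightarrow> \<phi> 0 = x \<Longrightarrow> \<exists>n. crosses_forever (dyadic n) \<phi> \<Longrightarrow> F \<phi> \<le> pay w \<phi>"
    and F: "time_superinvariant F" and \<phi>: "\<phi> \<in> Cpaths" and \<psi>: "\<psi> \<in> Cpaths" "\<psi> 0 = x"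
    and eq: "\<And>t. 0 \<le> t \<Longrightarrow> \<psi> (t / (1 + t)) = \<phi> t"
  shows "F \<phi> \<le> (SUP n. \<Sum>z\<in>first_bets n. w z * ennreal (bet_value {0..} (dyadic (fst z)) (snd z) \<psi> 1))"
proof -
  let ?j = "join \<psi> 1"
  have won_m: "{\<beta>\<in>space W. won (?j \<beta>) z} \<in> sets W" for z
    unfolding won_def by (rule predE) (use measurable_compose[OF join_measurable[OF \<psi>(1), of 1] follows_measurable[OF dyadic_pos]] in \<open>simp add: measurable_W\<close>)
  have P: "emeasure W {\<beta>\<in>space W. won (?j \<beta>) z} = ennreal (bet_value {0..} (dyadic (fst z)) (snd z) \<psi> 1)" for z
    using prob_follows[OF \<psi>(1) dyadic_pos, of 1 "fst z" "snd z"] unfolding won_def by (simp add: emeasure_eq_measure)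
  have le: "F \<phi> \<le> pay w (?j \<beta>)" if \<beta>: "\<beta> \<in> Cpaths" "unbounded_path (?j \<beta>)" for \<beta>
  proof -
    have jC: "?j \<beta> \<in> Cpaths" using join_Cpaths[OF \<psi>(1) _ \<beta>(1)] by simp
    have tt: "time_transformation (\<lambda>t. t / (1 + t))" unfolding time_transformation_def
    proof (intro conjI allI impI)
      show "continuous_on {0..} (\<lambda>t::real. t / (1 + t))" by (intro continuous_intros) auto
      show "mono_on {0..} (\<lambda>t::real. t / (1 + t))"
      proof (rule mono_onI)
        fix s t :: real assume "s \<in> {0..}" "t \<in> {0..}" "s \<le> t"
        then show "s / (1 + s) \<le> t / (1 + t)" using squeeze_less[of t s] by (simp add: not_less[symmetric])
      qed
    qed auto
    have "time_change (?j \<beta>) (\<lambda>t. t / (1 + t)) = \<phi>"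
    proof
      fix t
      have "?j \<beta> (max t 0 / (1 + max t 0)) = \<psi> (max t 0 / (1 + max t 0))"
        using squeeze_range[of "max t 0"] unfolding join_def by simp
      then show "time_change (?j \<beta>) (\<lambda>t. t / (1 + t)) t = \<phi> t" unfolding time_change_def
        using eq[of "max t 0"] Cpaths_neg[OF \<phi>, of t] by (cases "t \<le> 0") simp_all
    qed
    then have "F \<phi> \<le> F (?j \<beta>)" using F jC tt unfolding time_superinvariant_def by metis
    also have "\<dots> \<le> pay w (?j \<beta>)"
    proof (rule w[OF jC])
      show "?j \<beta> 0 = x" unfolding join_def using \<psi>(2) by simp
      show "\<exists>n. crosses_forever (dyadic n) (?j \<beta>)" using unbounded_crosses_forever[OF jC \<beta>(2)] unfolding crosses_forever_def by auto
    qed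
    finally show ?thesis .
  qed
  have "F \<phi> = (\<integral>\<^sup>+\<beta>. F \<phi> \<partial>W)" by (simp add: emeasure_space_1)
  also have "\<dots> \<le> (\<integral>\<^sup>+\<beta>. pay w (?j \<beta>) \<partial>W)"
  proof (rule nn_integral_mono_AE)
    have "AE \<beta> in W. unbounded_path (?j \<beta>)" by (rule AE_join_unbounded_path[OF \<psi>(1)]) simp
    then show "AE \<beta> in W. F \<phi> \<le> pay w (?j \<beta>)" using AE_space by eventually_elim (rule le, simp_all add: space_W)
  qed
  also have "\<dots> = (\<integral>\<^sup>+\<beta>. (SUP n. \<Sum>z\<in>first_bets n. w z * indicator {\<beta>\<in>space W. won (?j \<beta>) z} \<beta>) \<partial>W)"
    unfolding pay_def count_space_SUP by (intro nn_integral_cong SUP_cong sum.cong refl) (auto simp: indicator_def)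
  also have "\<dots> = (SUP n. \<integral>\<^sup>+\<beta>. (\<Sum>z\<in>first_bets n. w z * indicator {\<beta>\<in>space W. won (?j \<beta>) z} \<beta>) \<partial>W)"
  proof (rule nn_integral_monotone_convergence_SUP)
    show "incseq (\<lambda>n \<beta>. \<Sum>z\<in>first_bets n. w z * indicator {\<beta>\<in>space W. won (?j \<beta>) z} \<beta>)"
      unfolding incseq_def le_fun_def using first_bets_mono first_bets_finite by (auto intro!: sum_mono2)
  qed (use won_m in auto)
  also have "\<dots> = (SUP n. \<Sum>z\<in>first_bets n. w z * ennreal (bet_value {0..} (dyadic (fst z)) (snd z) \<psi> 1))"
    using won_m P by (intro SUP_cong refl, subst nn_integral_sum) (auto simp: nn_integral_cmult)
  finally show ?thesis .
qed

text \<open>Adaptedness includes the cemetery value, so agreement of two sample points up to a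
  crossing time fixes both the values of the process and the shape of its domain up to that
  time.\<close>

lemma adapted_crossing:
  assumes X: "proper J X" and \<omega>: "\<omega> \<in> Omega J" "\<omega>' \<in> Omega J" and \<delta>: "0 < \<delta>"
  defines "D \<equiv> \<lambda>\<omega>. {t. 0 \<le> t \<and> X t \<omega> \<noteq> None}"
  shows "path_crossing (D \<omega>) \<delta> (path_of X \<omega>)"
    "agree J \<omega> \<omega>' (crossing_time (D \<omega>) \<delta> (path_of X \<omega>) m) \<Longrightarrow>
      crossing_time (D \<omega>') \<delta> (path_of X \<omega>') m = crossing_time (D \<omega>) \<delta> (path_of X \<omega>) m \<and> (follows (D \<omega>') \<delta> p (path_of X \<omega>') m \<longleftrightarrow> follows (D \<omega>) \<delta> p (path_of X \<omega>) m)"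
proof -
  show pc: "path_crossing (D \<omega>) \<delta> (path_of X \<omega>)"
  proof
    show "0 < \<delta>" "0 \<in> D \<omega>" using \<delta> X \<omega>(1) unfolding proper_def D_def by auto
    show "0 \<le> t" if "t \<in> D \<omega>" for t using that unfolding D_def by simp
    show "s \<in> D \<omega>" if "t \<in> D \<omega>" "0 \<le> s" "s \<le> t" for s t
      using that proper_down[OF X \<omega>(1), of t s] unfolding D_def by simp
    have "continuous_on (D \<omega>) (\<lambda>t. the (X t \<omega>))" using X \<omega>(1) unfolding proper_def D_def by blast
    moreover have "path_of X \<omega> t = the (X t \<omega>)" if "t \<in> D \<omega>" for t using that unfolding path_of_def D_def by (simp add: max.absorb1)
    ultimately show "continuous_on (D \<omega>) (path_of X \<omega>)" by (simp cong: continuous_on_cong)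
  qed
  interpret path_crossing "D \<omega>" \<delta> "path_of X \<omega>" by (rule pc)
  assume ag: "agree J \<omega> \<omega>' (T m)"
  have z: "0 \<le> t" if "t \<in> D \<omega>'" for t using that unfolding D_def by simp
  have a: "(s \<in> D \<omega>' \<longleftrightarrow> s \<in> D \<omega>) \<and> path_of X \<omega>' s = path_of X \<omega> s" if s: "0 \<le> s" "ennreal s \<le> T m" for s
  proof -
    have "X s \<omega> = X s \<omega>'" using X \<omega> s agree_mono[OF ag s(2)] unfolding proper_def by blast
    then show ?thesis using s(1) unfolding D_def path_of_def by (simp add: max_def)
  qed
  show "crossing_time (D \<omega>') \<delta> (path_of X \<omega>') m = T m \<and> (follows (D \<omega>') \<delta> p (path_of X \<omega>') m \<longleftrightarrow> follows (D \<omega>) \<delta> p (path_of X \<omega>) m)"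
    by (intro conjI crossing_time_local_le(1)[of "D \<omega>'" m "path_of X \<omega>'" m, OF z a order_refl] crossing_time_local_le(2)[of "D \<omega>'" m "path_of X \<omega>'" p, OF z a])
qed

section \<open>The hedge of the functional\<close>

lemma Omega_nonempty: "(\<lambda>_ _. 0) \<in> Omega J"
  unfolding Omega_def Cpaths_def by simp

theorem theorem10:
  fixes J Jstar :: nat
    and F :: "(real \<Rightarrow> real) \<Rightarrow> ennreal"
    and X :: "real \<Rightarrow> (nat \<Rightarrow> real \<Rightarrow> real) \<Rightarrow> real option"
    and W :: "(real \<Rightarrow> real) measure"
  assumes "1 \<le> Jstar" and "Jstar \<le> J"
    and "F \<in> borel_measurable Cspace"
    and "time_superinvariant F"
    and "X \<in> cont_martingales J Jstar"
    and "wiener_measure (init_value J X) W"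
  shows "upper_expectation J Jstar (apply_functional F X) \<le> (\<integral>\<^sup>+ \<psi>. F \<psi> \<partial>W)"
proof (cases "(\<integral>\<^sup>+ \<psi>. F \<psi> \<partial>W) = top")
  case True then show ?thesis by simp
next
  case Ifin: False
  define x where "x = init_value J X"
  interpret wiener x W by unfold_locales (use assms(6) in \<open>simp add: x_def\<close>)
  have props: "proper J X" "\<exists>c. \<forall>\<omega>\<in>Omega J. X 0 \<omega> = Some c" "quasi_always J Jstar (pdom J X)"
    "tradable J Jstar (pdom J X) (\<lambda>t \<omega>. the (X t \<omega>))"
    using cont_martingale_props[OF assms(5,2)] by auto
  have X0: "X 0 \<omega> = Some x" if "\<omega> \<in> Omega J" for \<omega>
  proof -
    obtain c where c: "\<forall>\<omega>\<in>Omega J. X 0 \<omega> = Some c" using props(2) by blast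
    have "(SOME \<omega>. \<omega> \<in> Omega J) \<in> Omega J" by (rule someI[of "\<lambda>\<omega>. \<omega> \<in> Omega J", OF Omega_nonempty])
    then show ?thesis using c that unfolding x_def init_value_def by simp
  qed
  obtain N where N: "N \<in> nn_supermart J Jstar" "\<forall>\<omega>\<in>Omega J. N 0 \<omega> = 1"
    "\<forall>t\<ge>0. \<forall>\<omega>\<in>Omega J. (t, \<omega>) \<notin> pdom J X \<longrightarrow> N t \<omega> = \<infinity>" using props(3) unfolding quasi_always_def by blast
  define D where "D \<omega> = {t. 0 \<le> t \<and> X t \<omega> \<noteq> None}" for \<omega>
  show ?thesis
  proof (rule ennreal_le_epsilon)
    fix \<epsilon> :: real assume \<epsilon>: "0 < \<epsilon>"
    define e where "e = \<epsilon> / 2"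
    have e: "0 < e" using \<epsilon> unfolding e_def by simp
    obtain w where w: "cost w \<le> (\<integral>\<^sup>+\<psi>. F \<psi> \<partial>W) + ennreal e"
      "\<And>\<phi>. \<phi> \<in> Cpaths \<Longrightarrow> \<phi> 0 = x \<Longrightarrow> \<exists>n. crosses_forever (dyadic n) \<phi> \<Longrightarrow> F \<phi> \<le> pay w \<phi>"
      using cover[OF assms(3,4) e] by blast
    \<comment> \<open>Finiteness of the integral enters here: every bet has a positive price, so a
      finite total cost forces every weight to be finite, as is required of a position.\<close>
    have cfin: "cost w < top" using w(1) Ifin by (simp add: le_less_trans less_top top.not_eq_extremum)
    have wfin: "w z < top" for z
    proof (rule ccontr)
      assume "\<not> w z < top"
      then have "w z = top" by (metis top.not_eq_extremum)
      then have "w z * ennreal (1 / 2 ^ length (snd z)) = top" by (simp add: ennreal_top_mult not_le)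
      then have "top \<le> cost w" unfolding cost_def using nn_integral_ge_point[of z UNIV "\<lambda>z. w z * ennreal (1 / 2 ^ length (snd z))"] by simp
      then show False using cfin by simp
    qed
    define q where "q z = enn2real (w z)" for z
    have q: "0 \<le> q z" "ennreal (q z) = w z" for z unfolding q_def using wfin[of z] by auto
    have qs: "ennreal (\<Sum>z\<in>A. q z * f z) = (\<Sum>z\<in>A. w z * ennreal (f z))" if "\<And>z. 0 \<le> f z" for A f
    proof -
      have "(\<Sum>z\<in>A. w z * ennreal (f z)) = (\<Sum>z\<in>A. ennreal (q z * f z))"
        using that q by (intro sum.cong refl) (simp add: ennreal_mult)
      also have "\<dots> = ennreal (\<Sum>z\<in>A. q z * f z)" using that q(1) by (intro sum_ennreal) simp
      finally show ?thesis by simp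
    qed
    \<comment> \<open>The witness of quasi-always finiteness, scaled to initial value
      \<open>e\<close>; this is the second half of the tolerance, the first being the excess cost of
      \<open>w\<close>.\<close>
    obtain Y where Y: "Y \<in> nn_supermart J Jstar" "\<And>t \<omega>. 0 \<le> t \<Longrightarrow> \<omega> \<in> Omega J \<Longrightarrow> Y t \<omega> = ennreal e * N t \<omega>"
      using nn_supermart_scale[OF N(1), of e] e by auto
    define V where "V n t \<omega> = (\<Sum>z\<in>first_bets n. q z * bet_value (D \<omega>) (dyadic (fst z)) (snd z) (path_of X \<omega>) t)" for n t \<omega>
    define c where "c n = (\<Sum>z\<in>first_bets n. q z * (1 / 2 ^ length (snd z)))" for n
    have pc: "path_crossing (D \<omega>) \<delta> (path_of X \<omega>)" if "\<omega> \<in> Omega J" "0 < \<delta>" for \<omega> \<delta>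
      using adapted_crossing(1)[OF props(1) that(1,1,2)] unfolding D_def .
    have AC: "crossing_time (D \<omega>) \<delta> (path_of X \<omega>) m = crossing_time (D \<omega>') \<delta> (path_of X \<omega>') m"
      "follows (D \<omega>) \<delta> p (path_of X \<omega>) m \<longleftrightarrow> follows (D \<omega>') \<delta> p (path_of X \<omega>') m"
      if "\<omega> \<in> Omega J" "\<omega>' \<in> Omega J" "0 < \<delta>" "agree J \<omega> \<omega>' (crossing_time (D \<omega>) \<delta> (path_of X \<omega>) m)" for \<omega> \<omega>' \<delta> m p
      using adapted_crossing(2)[OF props(1) that(1-3), of m p] that(4) unfolding D_def by simp_all
    have "\<exists>Z. superhedges J Jstar (c n) (pdom J X) (V n) Y Z" for n
    proof -
      \<comment> \<open>One index for each bet of the finite portfolio and each step of its pattern,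
        in the index type of \<open>tradable\<close>.\<close>
      define I where "I = Sigma (first_bets n) (\<lambda>z. {..<length (snd z)})"
      define a where "a = (\<lambda>(r :: (nat \<times> bool list) \<times> nat) \<omega>. crossing_time (D \<omega>) (dyadic (fst (fst r))) (path_of X \<omega>) (snd r))"
      define b where "b = (\<lambda>(r :: (nat \<times> bool list) \<times> nat) \<omega>. crossing_time (D \<omega>) (dyadic (fst (fst r))) (path_of X \<omega>) (Suc (snd r)))"
      define k where "k = (\<lambda>(r :: (nat \<times> bool list) \<times> nat) \<omega>. q (fst r) * stake (D \<omega>) (dyadic (fst (fst r))) (snd (fst r)) (path_of X \<omega>) (snd r))"
      have st: "strategy J I a b k" unfolding strategy_def
      proof (intro conjI ballI)
        show "finite I" unfolding I_def using first_bets_finite by auto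
        fix r assume r: "r \<in> I"
        show "nonanticipating J (a r)" "nonanticipating J (b r)" unfolding nonanticipating_def a_def b_def
          by (intro ballI impI AC(1) dyadic_pos; assumption)+
        show "a r \<omega> \<le> b r \<omega>" if "\<omega> \<in> Omega J" for \<omega>
        proof -
          interpret path_crossing "D \<omega>" "dyadic (fst (fst r))" "path_of X \<omega>" using that by (intro pc) simp_all
          show ?thesis unfolding a_def b_def by (rule mono_Suc)
        qed
        show "tau_measurable J (a r) (k r)" unfolding tau_measurable_def a_def
        proof (intro ballI impI)
          fix \<omega> \<omega>' assume "\<omega> \<in> Omega J" "\<omega>' \<in> Omega J" "agree J \<omega> \<omega>' (crossing_time (D \<omega>) (dyadic (fst (fst r))) (path_of X \<omega>) (snd r))"
          from AC(2)[OF this(1,2) dyadic_pos this(3), of "snd (fst r)"]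
          show "k r \<omega> = k r \<omega>'" unfolding k_def stake_def by simp
        qed
        have "\<bar>k r \<omega>\<bar> \<le> q (fst r) * (2 ^ snd r / 2 ^ length (snd (fst r)) / dyadic (fst (fst r)))" for \<omega>
          unfolding k_def stake_def using q(1)[of "fst r"] by (auto simp: abs_mult mult_nonneg_nonneg less_imp_le[OF dyadic_pos])
        then show "\<exists>B. \<forall>\<omega>\<in>Omega J. \<bar>k r \<omega>\<bar> \<le> B" by blast
      qed
      have c0: "0 \<le> c n" unfolding c_def using q(1) by (intro sum_nonneg) auto
      have "c n + gains I (\<lambda>_ t \<omega>. the (X t \<omega>)) a b k t \<omega> = V n t \<omega>" for t \<omega>
      proof -
        have st: "stopt (a r) t \<omega> = crossing_before (D \<omega>) (dyadic (fst (fst r))) (path_of X \<omega>) (snd r) t" "stopt (b r) t \<omega> = crossing_before (D \<omega>) (dyadic (fst (fst r))) (path_of X \<omega>) (Suc (snd r)) t" for r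
          unfolding stopt_def crossing_before_def a_def b_def by auto
        have pX: "the (X (crossing_before D' \<delta> \<phi> m t) \<omega>) = path_of X \<omega> (crossing_before D' \<delta> \<phi> m t)" for D' \<delta> \<phi> m
          unfolding path_of_def crossing_before_def by (simp add: max.absorb1)
        show ?thesis unfolding gains_def st pX k_def I_def V_def bet_value_def c_def distrib_left sum.distrib sum_distrib_left
          by (simp add: sum.Sigma first_bets_finite mult.assoc split_def)
      qed
      then show ?thesis using props(4)[unfolded tradable_def, rule_format, OF st c0 Y(1)] by simp
    qed
    then obtain Zn where Zn: "\<And>n. superhedges J Jstar (c n) (pdom J X) (V n) Y (Zn n)" by metis
    define Z where "Z t \<omega> = liminf (\<lambda>n. Zn n t \<omega>)" for t \<omega>
    have Znn: "(\<lambda>t \<omega>. Z t \<omega>) \<in> nn_supermart J Jstar" unfolding Z_def using Zn unfolding superhedges_def by (intro nn_supermart.liminf) blast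
    \<comment> \<open>The initial value of \<open>Z\<close> at every sample point, as neither
      \<open>c n\<close> nor \<open>Y 0\<close> depends on it.\<close>
    define C where "C = liminf (\<lambda>n. ennreal (c n) + ennreal e)"
    have Z0: "Z 0 \<omega> = C" if \<omega>: "\<omega> \<in> Omega J" for \<omega>
    proof -
      have "Zn n 0 \<omega> = ennreal (c n) + ennreal e" for n using Zn[of n] \<omega> Y(2)[of 0 \<omega>] N(2) unfolding superhedges_def by simp
      then show ?thesis unfolding Z_def C_def by simp
    qed
    have C: "C \<le> (\<integral>\<^sup>+\<psi>. F \<psi> \<partial>W) + ennreal \<epsilon>"
    proof -
      have "ennreal (c n) \<le> cost w" for n
      proof -
        have "ennreal (c n) = (\<Sum>z\<in>first_bets n. w z * ennreal (1 / 2 ^ length (snd z)))"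
          unfolding c_def by (rule qs) simp
        also have "\<dots> \<le> cost w" unfolding cost_def count_space_SUP by (rule SUP_upper) simp
        finally show ?thesis .
      qed
      then have "ennreal (c n) + ennreal e \<le> cost w + ennreal e" for n by (intro add_right_mono)
      then have "C \<le> cost w + ennreal e" unfolding C_def by (intro Liminf_le always_eventually allI) auto
      also have "\<dots> \<le> ((\<integral>\<^sup>+\<psi>. F \<psi> \<partial>W) + ennreal e) + ennreal e" using w(1) by (rule add_right_mono)
      also have "\<dots> = (\<integral>\<^sup>+\<psi>. F \<psi> \<partial>W) + ennreal \<epsilon>" using e unfolding e_def by (simp add: add.assoc ennreal_plus[symmetric] del: ennreal_plus)
      finally show ?thesis .
    qed
    have "apply_functional F X \<omega> \<le> Liminf at_top (\<lambda>t. Z t \<omega>)" if \<omega>: "\<omega> \<in> Omega J" for \<omega>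
    proof (cases "\<forall>t\<ge>0. X t \<omega> \<noteq> None")
      case False
      then obtain t0 where t0: "t0 \<ge> 0" "X t0 \<omega> = None" by blast
      \<comment> \<open>Once the process has reached the cemetery it stays there, so the carried
        process is infinite from then on and every hedge with it.\<close>
      have "Z t \<omega> = top" if t: "t \<ge> t0" for t
      proof -
        have "X t \<omega> = None" using proper_down[OF props(1) \<omega>, of t t0] t t0 by blast
        then have "N t \<omega> = \<infinity>" using N(3) t t0 \<omega> unfolding pdom_def by auto
        then have "Y t \<omega> = top" using Y(2)[of t \<omega>] t t0 \<omega> e by (simp add: ennreal_mult_top)
        moreover have "Y t \<omega> \<le> Zn n t \<omega>" for n using Zn[of n] t t0 \<omega> unfolding superhedges_def by auto
        ultimately have "Zn n t \<omega> = top" for n by (metis top_unique)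
        then show ?thesis unfolding Z_def by (simp add: Liminf_const)
      qed
      then have "top \<le> Liminf at_top (\<lambda>t. Z t \<omega>)"
        by (intro Liminf_bounded) (auto simp: eventually_at_top_linorder intro!: exI[of _ t0])
      then show ?thesis by (simp add: top_unique)
    next
      case total: True
      define \<phi> where "\<phi> = path_of X \<omega>"
      have Dt: "D \<omega> = {0..}" unfolding D_def using total by auto
      have \<phi>: "\<phi> \<in> Cpaths" unfolding \<phi>_def
      proof (rule Cpaths_extend)
        show "continuous_on {0..} (path_of X \<omega>)" using path_crossing.\<phi>cont[OF pc[OF \<omega>, of 1]] unfolding Dt by simp
        show "path_of X \<omega> t = path_of X \<omega> (max t 0)" for t unfolding path_of_def by simp
      qed
      have \<phi>0: "\<phi> 0 = x" unfolding \<phi>_def path_of_def using X0[OF \<omega>] by simp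
      have AF: "apply_functional F X \<omega> = F \<phi>" unfolding apply_functional_def \<phi>_def using total by simp
      have vb: "0 \<le> bet_value {0..} (dyadic (fst z)) (snd z) \<phi> t \<and> bet_value {0..} (dyadic (fst z)) (snd z) \<phi> t \<le> 1" if "0 \<le> t" for z t
        using path_crossing.bet_value_bounds[OF path_crossing_Cpaths[OF \<phi> dyadic_pos], of t] that by auto
      have Vphi: "V n t \<omega> = (\<Sum>z\<in>first_bets n. q z * bet_value {0..} (dyadic (fst z)) (snd z) \<phi> t)" for n t unfolding V_def \<phi>_def Dt ..
      have V0: "0 \<le> V n t \<omega>" if "0 \<le> t" for n t unfolding Vphi using q(1) vb[OF that] by (intro sum_nonneg mult_nonneg_nonneg) auto
      \<comment> \<open>All bets have nonnegative value, so larger portfolios are worth at least as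
        much and the lower limit dominates each finite portfolio.\<close>
      have ZV: "ennreal (V n t \<omega>) \<le> Z t \<omega>" if t: "0 \<le> t" for n t
      proof -
        have "ennreal (V n t \<omega>) \<le> Zn m t \<omega>" if m: "m \<ge> n" for m
        proof -
          have "V n t \<omega> \<le> V m t \<omega>" unfolding Vphi using first_bets_mono[OF m] first_bets_finite q(1) vb[OF t]
            by (intro sum_mono2) (auto intro: mult_nonneg_nonneg)
          then have "ennreal (V n t \<omega>) \<le> ennreal (V m t \<omega>)" by (rule ennreal_leI)
          also have "\<dots> \<le> ennreal (V m t \<omega>) + Y t \<omega>" by simp
          also have "ennreal (V m t \<omega>) + Y t \<omega> \<le> Zn m t \<omega>" 
            using Zn[of m] t \<omega> V0 total unfolding superhedges_def pdom_def by auto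
          finally show ?thesis .
        qed
        then show ?thesis unfolding Z_def by (intro Liminf_bounded) (auto simp: eventually_sequentially)
      qed
      have LV: "ennreal v \<le> Liminf at_top (\<lambda>t. Z t \<omega>)" if v: "((\<lambda>t. V n t \<omega>) \<longlongrightarrow> v) at_top" for n v
      proof -
        have "ennreal v = Liminf at_top (\<lambda>t. ennreal (V n t \<omega>))" using v by (intro lim_imp_Liminf[symmetric] tendsto_ennrealI) auto
        also have "\<dots> \<le> Liminf at_top (\<lambda>t. Z t \<omega>)"
          by (rule Liminf_mono) (use ZV in \<open>auto simp: eventually_at_top_linorder intro: exI[of _ 0]\<close>)
        finally show ?thesis .
      qed
      show ?thesis
      proof (cases "\<exists>n. crosses_forever (dyadic n) \<phi>")
        case True
        have "F \<phi> \<le> pay w \<phi>" by (rule w(2)[OF \<phi> \<phi>0 True])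
        also have "\<dots> = (SUP n. \<Sum>z\<in>first_bets n. w z * indicator {z. won \<phi> z} z)" unfolding pay_def count_space_SUP ..
        also have "\<dots> \<le> Liminf at_top (\<lambda>t. Z t \<omega>)"
        proof (rule SUP_least)
          fix n
          \<comment> \<open>A winning bet has value 1 from its last crossing on, and a bet that is
            not won has nonnegative value; with finitely many bets this holds simultaneously for all
            large times.\<close>
          have ev: "\<forall>\<^sub>F t in at_top. q z * indicator {z. won \<phi> z} z \<le> q z * bet_value {0..} (dyadic (fst z)) (snd z) \<phi> t" for z
          proof (cases "won \<phi> z")
            case True
            interpret path_crossing "{0..}" "dyadic (fst z)" \<phi> using \<phi> by (rule path_crossing_Cpaths) simp
            have fi: "T (length (snd z)) \<noteq> \<infinity>"
            proof (cases "length (snd z)")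
              case (Suc m) then show ?thesis using True unfolding won_def follows_def by auto
            qed simp
            have "bet_value {0..} (dyadic (fst z)) (snd z) \<phi> t = 1" if t: "t \<ge> \<tau> (length (snd z))" for t
            proof -
              have t0: "t \<in> {0..}" using order_trans[OF fin(3)[OF fi] t] by simp
              have "T (length (snd z)) \<le> ennreal t" using le_iff[OF t0] fi t by blast
              from bet_value_final[OF t0 this] True show ?thesis unfolding won_def by simp
            qed
            then show ?thesis unfolding eventually_at_top_linorder using True by (intro exI[of _ "\<tau> (length (snd z))"]) simp
          next
            case False
            then show ?thesis unfolding eventually_at_top_linorder using vb q(1) by (intro exI[of _ 0]) simp
          qed
          have "\<forall>\<^sub>F t in at_top. \<forall>z\<in>first_bets n. q z * indicator {z. won \<phi> z} z \<le> q z * bet_value {0..} (dyadic (fst z)) (snd z) \<phi> t"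
            using ev by (intro eventually_ball_finite first_bets_finite) auto
          then have "\<forall>\<^sub>F t in at_top. ennreal (\<Sum>z\<in>first_bets n. q z * indicator {z. won \<phi> z} z) \<le> Z t \<omega>"
            using eventually_ge_at_top[of 0]
          proof eventually_elim
            case (elim t)
            then have "(\<Sum>z\<in>first_bets n. q z * indicator {z. won \<phi> z} z) \<le> V n t \<omega>" unfolding Vphi by (intro sum_mono) auto
            then show ?case using ZV[OF elim(2), of n] by (meson ennreal_leI order_trans)
          qed
          then have "ennreal (\<Sum>z\<in>first_bets n. q z * indicator {z. won \<phi> z} z) \<le> Liminf at_top (\<lambda>t. Z t \<omega>)" by (rule Liminf_bounded)
          moreover have "ennreal (\<Sum>z\<in>first_bets n. q z * indicator {z. won \<phi> z} z) = (\<Sum>z\<in>first_bets n. w z * indicator {z. won \<phi> z} z)"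
            by (subst qs) (simp_all add: ennreal_indicator)
          ultimately show "(\<Sum>z\<in>first_bets n. w z * indicator {z. won \<phi> z} z) \<le> Liminf at_top (\<lambda>t. Z t \<omega>)" by simp
        qed
        finally show ?thesis unfolding AF .
      next
        \<comment> \<open>No mesh is crossed forever, so the path converges. The bets may remain
          undecided, and their values tend to those of the squeezed path at time 1.\<close>
        case False
        then obtain L where "(\<phi> \<longlongrightarrow> L) at_top" using limit_exists[OF \<phi>] by blast
        then obtain \<psi> where \<psi>: "\<psi> \<in> Cpaths" "\<And>t. 0 \<le> t \<Longrightarrow> \<psi> (t / (1 + t)) = \<phi> t" using squeeze_path[OF \<phi>] by blast
        have \<psi>0: "\<psi> 0 = x" using \<psi>(2)[of 0] \<phi>0 by simp
        have "F \<phi> \<le> (SUP n. \<Sum>z\<in>first_bets n. w z * ennreal (bet_value {0..} (dyadic (fst z)) (snd z) \<psi> 1))"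
          by (rule continuation_bound[OF w(2) assms(4) \<phi> \<psi>(1) \<psi>0 \<psi>(2)])
        also have "\<dots> \<le> Liminf at_top (\<lambda>t. Z t \<omega>)"
        proof (rule SUP_least)
          fix n
          have "((\<lambda>t::real. t / (1 + t)) \<longlongrightarrow> 1) at_top" by real_asymp
          then have lim1: "((\<lambda>t. bet_value {0..} \<delta> p \<psi> (t / (1 + t))) \<longlongrightarrow> bet_value {0..} \<delta> p \<psi> 1) at_top" for \<delta> p
            by (rule continuous_on_tendsto_compose[OF bet_value_continuous[OF \<psi>(1)]])
               (auto simp: eventually_at_top_linorder intro: exI[of _ 0])
          have "((\<lambda>t. bet_value {0..} (dyadic (fst z)) (snd z) \<phi> t) \<longlongrightarrow> bet_value {0..} (dyadic (fst z)) (snd z) \<psi> 1) at_top" for z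
          proof (rule Lim_transform_eventually[OF lim1])
            show "\<forall>\<^sub>F t in at_top. bet_value {0..} (dyadic (fst z)) (snd z) \<psi> (t / (1 + t)) = bet_value {0..} (dyadic (fst z)) (snd z) \<phi> t"
              unfolding eventually_at_top_linorder using squeeze_bet_value[OF \<phi> \<psi>(1) dyadic_pos \<psi>(2)] by blast
          qed
          then have "((\<lambda>t. V n t \<omega>) \<longlongrightarrow> (\<Sum>z\<in>first_bets n. q z * bet_value {0..} (dyadic (fst z)) (snd z) \<psi> 1)) at_top"
            unfolding Vphi by (intro tendsto_sum tendsto_mult tendsto_const)
          from LV[OF this] have "ennreal (\<Sum>z\<in>first_bets n. q z * bet_value {0..} (dyadic (fst z)) (snd z) \<psi> 1) \<le> Liminf at_top (\<lambda>t. Z t \<omega>)" .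
          moreover have "0 \<le> bet_value {0..} (dyadic (fst z)) (snd z) \<psi> 1" for z
            using path_crossing.bet_value_bounds(1)[OF path_crossing_Cpaths[OF \<psi>(1) dyadic_pos], of 1] by simp
          then have "ennreal (\<Sum>z\<in>first_bets n. q z * bet_value {0..} (dyadic (fst z)) (snd z) \<psi> 1) = (\<Sum>z\<in>first_bets n. w z * ennreal (bet_value {0..} (dyadic (fst z)) (snd z) \<psi> 1))"
            by (rule qs)
          ultimately show "(\<Sum>z\<in>first_bets n. w z * ennreal (bet_value {0..} (dyadic (fst z)) (snd z) \<psi> 1)) \<le> Liminf at_top (\<lambda>t. Z t \<omega>)" by simp
        qed
        finally show ?thesis unfolding AF .
      qed
    qed
    then have "upper_expectation J Jstar (apply_functional F X) \<le> C"
      unfolding upper_expectation_def using Znn Z0 by (intro Inf_lower CollectI bexI[of _ Z]) auto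
    then show "upper_expectation J Jstar (apply_functional F X) \<le> (\<integral>\<^sup>+ \<psi>. F \<psi> \<partial>W) + ennreal \<epsilon>" using C by simp
  qed
qed

end
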